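(* Let $\Omega=(0,\pi)$, $\beta\in\mathbb{R}$, $\gamma(u)=(u(0),u(\pi))\in\mathbb{C}^2$ for $u\in H^1((0,\pi))$, and $B=\begin{bmatrix}0&\beta\\0&0\end{bmatrix}$. Let $A$ be the operator on $L^2((0,\pi))$ associated with the form $a(u,v)=\int_0^\pi u'\overline{v'}\,dx+\langle B\gamma(u),\gamma(v)\rangle_{\mathbb{C}^2}$, $u,v\in H^1((0,\pi))$. Then the semigroup $(e^{-tA})_{t\ge0}$ is individually eventually strongly positive with respect to $\mathbf{1}$ but not positive if and only if $\beta\in(0,1/2)$.
   Context: The operator associated with $a$: $u\in D(A)$ iff $u\in H^1((0,\pi))$ and there is $f\in L^2$ with $a(u,v)=\langle f,v\rangle_{L^2}$ for all $v\in H^1$, and then $Au=f$; $-A$ generates an analytic semigroup on $L^2((0,\pi))$. $\mathbf{1}$ is the constant function one. The semigroup is individually eventually strongly positive with respect to $\mathbf{1}$ if for each $f\ge0$, $f\ne0$, there is $t_0>0$ such that for each $t\ge t_0$ there is $c>0$ with $e^{-tA}f\ge c\mathbf{1}$ a.e. *)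

theory Defs
  imports "HOL-Analysis.Analysis"
begin

text \<open>Complex-valued functions on the real line; only their values on
  \<open>\<Omega> = (0,pi)\<close> matter, and everything is understood modulo equality a.e.\<close>

type_synonym fn = "real \<Rightarrow> complex"

definition Mpi :: "real measure" where
  "Mpi = restrict_space lborel {0<..<pi}"

definition eqae :: "fn \<Rightarrow> fn \<Rightarrow> bool" where
  "eqae f g \<longleftrightarrow> (AE x in Mpi. f x = g x)"

definition L2 :: "fn \<Rightarrow> bool" where
  "L2 f \<longleftrightarrow> f \<in> borel_measurable Mpi \<and> integrable Mpi (\<lambda>x. (cmod (f x))\<^sup>2)"

definition inner_L2 :: "fn \<Rightarrow> fn \<Rightarrow> complex" where
  "inner_L2 f g = (LINT x|Mpi. f x * cnj (g x))"

definition norm_L2 :: "fn \<Rightarrow> real" where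
  "norm_L2 f = sqrt (LINT x|Mpi. (cmod (f x))\<^sup>2)"

definition test_fn :: "(real \<Rightarrow> real) \<Rightarrow> bool" where
  "test_fn \<phi> \<longleftrightarrow>
     (\<forall>k x. ((deriv ^^ k) \<phi> has_real_derivative (deriv ^^ Suc k) \<phi> x) (at x)) \<and>
     (\<exists>K. compact K \<and> K \<subseteq> {0<..<pi} \<and> (\<forall>x. x \<notin> K \<longrightarrow> \<phi> x = 0))"

definition is_weak_deriv :: "fn \<Rightarrow> fn \<Rightarrow> bool" where
  "is_weak_deriv u g \<longleftrightarrow>
     (\<forall>\<phi>. test_fn \<phi> \<longrightarrow>
        (LINT x|Mpi. u x * complex_of_real (deriv \<phi> x)) =
        - (LINT x|Mpi. g x * complex_of_real (\<phi> x)))"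

definition H1 :: "fn \<Rightarrow> bool" where
  "H1 u \<longleftrightarrow> L2 u \<and> (\<exists>g. L2 g \<and> is_weak_deriv u g)"

definition wderiv :: "fn \<Rightarrow> fn" where
  "wderiv u = (SOME g. L2 g \<and> is_weak_deriv u g)"

text \<open>Continuous representative on \<open>[0,pi]\<close> (exists and is unique for \<open>u \<in> H\<^sup>1\<close>);
  the trace is \<open>\<gamma>(u) = (cont_rep u 0, cont_rep u pi)\<close>.\<close>
definition cont_rep :: "fn \<Rightarrow> fn" where
  "cont_rep u = (SOME w. continuous_on {0..pi} w \<and> (AE x in Mpi. w x = u x))"

text \<open>The form \<open>a(u,v) = \<integral> u' conj(v') + \<langle>B \<gamma>(u), \<gamma>(v)\<rangle>\<close> with \<open>B = [[0,\<beta>],[0,0]]\<close>,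
  so \<open>\<langle>B \<gamma>(u), \<gamma>(v)\<rangle> = \<beta> u(pi) conj(v(0))\<close>.\<close>
definition aform :: "real \<Rightarrow> fn \<Rightarrow> fn \<Rightarrow> complex" where
  "aform \<beta> u v = inner_L2 (wderiv u) (wderiv v)
     + (\<Sum>i\<in>{0::nat,1}. (\<Sum>j\<in>{0::nat,1}.
          (if i = 0 \<and> j = 1 then complex_of_real \<beta> else 0) *
          cont_rep u (if j = 0 then 0 else pi)) * cnj (cont_rep v (if i = 0 then 0 else pi)))"

text \<open>Graph of the associated operator: \<open>opA \<beta> u f\<close> iff \<open>u \<in> D(A)\<close> and \<open>Au = f\<close>.\<close>
definition opA :: "real \<Rightarrow> fn \<Rightarrow> fn \<Rightarrow> bool" where
  "opA \<beta> u f \<longleftrightarrow> H1 u \<and> L2 f \<and> (\<forall>v. H1 v \<longrightarrow> aform \<beta> u v = inner_L2 f v)"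

definition C0_semigroup :: "(real \<Rightarrow> fn \<Rightarrow> fn) \<Rightarrow> bool" where
  "C0_semigroup T \<longleftrightarrow>
     (\<forall>t\<ge>0. \<forall>f. L2 f \<longrightarrow> L2 (T t f)) \<and>
     (\<forall>t\<ge>0. \<forall>f g c. L2 f \<and> L2 g \<longrightarrow>
         eqae (T t (\<lambda>x. f x + c * g x)) (\<lambda>x. T t f x + c * T t g x)) \<and>
     (\<forall>t\<ge>0. \<exists>C. \<forall>f. L2 f \<longrightarrow> norm_L2 (T t f) \<le> C * norm_L2 f) \<and>
     (\<forall>f. L2 f \<longrightarrow> eqae (T 0 f) f) \<and>
     (\<forall>s\<ge>0. \<forall>t\<ge>0. \<forall>f. L2 f \<longrightarrow> eqae (T (s + t) f) (T s (T t f))) \<and>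
     (\<forall>f. L2 f \<longrightarrow> ((\<lambda>t. norm_L2 (\<lambda>x. T t f x - f x)) \<longlongrightarrow> 0) (at_right 0))"

definition sg_generator :: "(real \<Rightarrow> fn \<Rightarrow> fn) \<Rightarrow> fn \<Rightarrow> fn \<Rightarrow> bool" where
  "sg_generator T f g \<longleftrightarrow> L2 f \<and> L2 g \<and>
     ((\<lambda>t. norm_L2 (\<lambda>x. (T t f x - f x) / complex_of_real t - g x)) \<longlongrightarrow> 0) (at_right 0)"

definition generated_by_minus_A :: "real \<Rightarrow> (real \<Rightarrow> fn \<Rightarrow> fn) \<Rightarrow> bool" where
  "generated_by_minus_A \<beta> T \<longleftrightarrow> C0_semigroup T \<and>
     (\<forall>f g. sg_generator T f g \<longleftrightarrow> opA \<beta> f (\<lambda>x. - g x))"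

text \<open>The semigroup \<open>(e^{-tA})_{t\<ge>0}\<close> (unique up to a.e. equality).\<close>
definition expA :: "real \<Rightarrow> real \<Rightarrow> fn \<Rightarrow> fn" where
  "expA \<beta> = (SOME T. generated_by_minus_A \<beta> T)"

definition nonneg_fn :: "fn \<Rightarrow> bool" where
  "nonneg_fn f \<longleftrightarrow> (AE x in Mpi. Im (f x) = 0 \<and> Re (f x) \<ge> 0)"

definition positive_sg :: "(real \<Rightarrow> fn \<Rightarrow> fn) \<Rightarrow> bool" where
  "positive_sg T \<longleftrightarrow> (\<forall>t\<ge>0. \<forall>f. L2 f \<and> nonneg_fn f \<longrightarrow> nonneg_fn (T t f))"

definition ind_ev_strongly_pos :: "(real \<Rightarrow> fn \<Rightarrow> fn) \<Rightarrow> bool" where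
  "ind_ev_strongly_pos T \<longleftrightarrow>
     (\<forall>f. L2 f \<and> nonneg_fn f \<and> \<not> eqae f (\<lambda>x. 0) \<longrightarrow>
        (\<exists>t0>0. \<forall>t\<ge>t0. \<exists>c>0. AE x in Mpi. Im (T t f x) = 0 \<and> Re (T t f x) \<ge> c))"

end

theory Submission
  imports Defs "HOL-Probability.Distributions"
begin

text \<open>\<open>e\<^sup>-\<^sup>t\<^sup>A\<close> is constructed explicitly: a function on \<open>(0,pi)\<close> is extended to the line, evenly about \<open>pi\<close>
  and so that \<open>f(z + pi) - f(z - pi) = - 2 \<beta> \<integral>\<^sub>0\<^sup>z f\<close> in coordinates centred at \<open>pi\<close> (which encodes
  \<open>u'(0) = \<beta> u(pi)\<close>), and convolved with the heat kernel, which preserves both relations.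

  For \<open>\<beta> \<le> 0\<close> the extension of a nonnegative function is nonnegative, so the semigroup is positive. For
  \<open>\<beta> > 0\<close> there are functions in the domain with \<open>m\<^sup>2 g - g'' \<ge> 0\<close> and \<open>g(0) < 0\<close>, so it is not.
  For \<open>0 < \<beta> < 1/2\<close> write \<open>\<beta> = \<mu> sin (\<mu> pi)\<close> with \<open>0 < \<mu> < 1/2\<close>: the eigenvalue \<open>\<mu>\<^sup>2\<close> has the positive
  eigenfunction \<open>cos (\<mu> (pi - x))\<close>, the adjoint has \<open>cos (\<mu> x)\<close>, and on the orthogonal complement
  of the latter the form is bounded below by a constant above \<open>\<mu>\<^sup>2\<close>, so the eigenfunction dominates every orbit
  of a nonzero nonnegative function. For \<open>\<beta> = 1/2\<close> the eigenfunction \<open>sin (x / 2)\<close> vanishes at \<open>0\<close>, and for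
  \<open>\<beta> > 1/2\<close> no orbit of the constant function remains positive.\<close>

section \<open>Strongly continuous semigroups\<close>

text \<open>\<open>expA\<close> is merely some semigroup generated by -A, so existence and
  uniqueness of such a semigroup must be proved before anything can be said about it. The explicit
  formula yields existence together with smoothing, the boundary conditions and a bound from L2 to
  the supremum norm. Evenness about pi encodes u'(pi) = 0; differentiating the second relation at z
  = 0 and using evenness gives G'(-pi) = \<beta> G(0), which is the condition at x = 0 since x = z +
  pi. Both relations survive because convolution with an even kernel commutes with shifts and, up to
  a constant that parity kills, with primitives. The form is not symmetric, so the spectral theorem
  is not at hand; one coercivity estimate on the complement of the adjoint eigenfunction takes the
  place of a spectral gap. The equation \<beta> = \<mu> sin (\<mu> pi) is the boundary condition at
  0 for cos (\<mu> (pi - x)). The value of this eigenfunction at 0 is cos (\<mu> pi), which reaches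
  zero at \<mu> = 1/2, that is at \<beta> = 1/2; this is the origin of the threshold.\<close>

lemma vector_derivative_zero_imp_const:
  fixes f :: "real \<Rightarrow> 'a::real_normed_vector"
  assumes "a \<le> b" "continuous_on {a..b} f"
    and "\<And>x. a < x \<Longrightarrow> x < b \<Longrightarrow> (f has_vector_derivative 0) (at x)"
  shows "f b = f a"
proof (cases "a = b")
  case False
  have "norm (f b - f a) \<le> (\<lambda>_. 0::real) b - (\<lambda>_. 0) a"
    using assms False
    by (intro differentiable_bound_general[where f'="\<lambda>_. 0" and \<phi>'="\<lambda>_. 0"]) auto
  then show ?thesis by simp
qed simp

lemma has_vector_derivative_iff_tendsto:
  "(f has_vector_derivative y) (at t) \<longleftrightarrow> ((\<lambda>s. (f s - f t) /\<^sub>R (s - t)) \<longlongrightarrow> y) (at t)"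
proof -
  have "norm ((f s - f t) /\<^sub>R (s - t) - y) = norm (((f s - f t) - (s - t) *\<^sub>R y) /\<^sub>R norm (s - t))"
    if "s \<noteq> t" for s
  proof -
    have "(f s - f t) /\<^sub>R (s - t) - y = ((f s - f t) - (s - t) *\<^sub>R y) /\<^sub>R (s - t)"
      using that by (simp add: scaleR_diff_right)
    then show ?thesis by simp
  qed
  then have "((\<lambda>s. norm ((f s - f t) /\<^sub>R (s - t) - y)) \<longlongrightarrow> 0) (at t) \<longleftrightarrow>
      ((\<lambda>s. norm (((f s - f t) - (s - t) *\<^sub>R y) /\<^sub>R norm (s - t))) \<longlongrightarrow> 0) (at t)"
    by (intro filterlim_cong refl) (auto simp: eventually_at_filter)
  then have "((\<lambda>s. (f s - f t) /\<^sub>R (s - t) - y) \<longlongrightarrow> 0) (at t) \<longleftrightarrow>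
      ((\<lambda>s. ((f s - f t) - (s - t) *\<^sub>R y) /\<^sub>R norm (s - t)) \<longlongrightarrow> 0) (at t)"
    unfolding tendsto_norm_zero_iff .
  then show ?thesis
    unfolding has_vector_derivative_def has_derivative_at_within LIM_zero_iff
    by (simp add: bounded_linear_scaleR_left)
qed

text \<open>Local boundedness \<open>bdd\<close> is part of the locale, so that this theory lives in
  an arbitrary normed space; for Banach spaces \<open>C0_sgI\<close> derives it from the other
  conditions by uniform boundedness.\<close>

locale C0_sg =
  fixes T :: "real \<Rightarrow> 'a::real_normed_vector \<Rightarrow> 'a"
  assumes lin: "t \<ge> 0 \<Longrightarrow> bounded_linear (T t)"
    and zero: "T 0 x = x"
    and add: "s \<ge> 0 \<Longrightarrow> t \<ge> 0 \<Longrightarrow> T (s + t) x = T s (T t x)"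
    and cont0: "((\<lambda>t. T t x) \<longlongrightarrow> x) (at_right 0)"
    and bdd: "\<exists>M. \<forall>t\<in>{0..1}. \<forall>x. norm (T t x) \<le> M * norm x"
begin

definition gen :: "'a \<Rightarrow> 'a \<Rightarrow> bool" where
  "gen x y \<longleftrightarrow> ((\<lambda>t. (T t x - x) /\<^sub>R t) \<longlongrightarrow> y) (at_right 0)"

lemma growth: "\<exists>M\<ge>1. \<exists>w\<ge>0. \<forall>t\<ge>0. \<forall>x. norm (T t x) \<le> M * exp (w * t) * norm x"
proof -
  from bdd obtain M0 where M0: "\<And>t x. t \<in> {0..1} \<Longrightarrow> norm (T t x) \<le> M0 * norm x" by blast
  define M where "M = max 1 M0"
  have M1: "M \<ge> 1" by (simp add: M_def)
  have M: "norm (T t x) \<le> M * norm x" if "t \<in> {0..1}" for t x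
    using M0[OF that, of x] by (smt (verit) M_def mult_right_mono norm_ge_zero)
  have step: "norm (T t x) \<le> M ^ Suc n * norm x" if "0 \<le> t" "t \<le> real (Suc n)" for n t x
    using that
  proof (induction n arbitrary: t x)
    case 0
    then show ?case using M[of t x] by simp
  next
    case (Suc n)
    show ?case
    proof (cases "t \<le> 1")
      case True
      have "norm (T t x) \<le> M * norm x" using M True Suc.prems by auto
      also have "\<dots> \<le> M ^ Suc (Suc n) * norm x"
        using power_increasing[of 1 "Suc (Suc n)" M] M1 by (intro mult_right_mono) auto
      finally show ?thesis .
    next
      case False
      have "T t x = T (t - 1) (T 1 x)" using add[of "t-1" 1 x] False by simp
      then have "norm (T t x) \<le> M ^ Suc n * norm (T 1 x)"
        using Suc.IH[of "t-1" "T 1 x"] Suc.prems False by simp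
      also have "\<dots> \<le> M ^ Suc n * (M * norm x)" using M[of 1 x] M1 by (intro mult_left_mono) auto
      finally show ?thesis by (simp add: mult_ac)
    qed
  qed
  have "norm (T t x) \<le> M * exp (ln M * t) * norm x" if "t \<ge> 0" for t x
  proof -
    define n where "n = nat \<lfloor>t\<rfloor>"
    have n: "real n \<le> t" "t \<le> real (Suc n)" using that unfolding n_def by linarith+
    have "norm (T t x) \<le> M ^ Suc n * norm x" using step[OF that n(2)] .
    also have "M ^ Suc n = M * exp (ln M * real n)"
      using M1 by (simp add: mult.commute[of "ln M"] exp_of_nat_mult)
    also have "\<dots> * norm x \<le> M * exp (ln M * t) * norm x"
      using M1 n by (intro mult_right_mono mult_left_mono) (auto intro: mult_left_mono)
    finally show ?thesis .
  qed
  moreover have "ln M \<ge> 0" using M1 by simp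
  ultimately show ?thesis using M1 by blast
qed

lemma diff: "t \<ge> 0 \<Longrightarrow> T t (x - y) = T t x - T t y"
  using lin[of t] by (simp add: linear_simps)

lemma scale: "t \<ge> 0 \<Longrightarrow> T t (c *\<^sub>R x) = c *\<^sub>R T t x"
  using lin[of t] by (simp add: linear_simps)

lemma orbit_tendsto:
  assumes t: "t \<ge> 0"
  shows "((\<lambda>s. T s x) \<longlongrightarrow> T t x) (at t within {0..})"
proof -
  obtain M w where M: "M \<ge> 1" "w \<ge> 0" "\<And>t x. t \<ge> 0 \<Longrightarrow> norm (T t x) \<le> M * exp (w * t) * norm x"
    using growth by auto
  have lim: "((\<lambda>s. T \<bar>s - t\<bar> x) \<longlongrightarrow> x) (at t within {0..})"
  proof (rule filterlim_compose[OF cont0])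
    show "filterlim (\<lambda>s. \<bar>s - t\<bar>) (at_right 0) (at t within {0..})"
      unfolding filterlim_at by (auto intro!: tendsto_eq_intros simp: eventually_at_filter)
  qed
  have "((\<lambda>s. norm (T s x - T t x)) \<longlongrightarrow> 0) (at t within {0..})"
  proof (rule tendsto_sandwich[where f="\<lambda>_. 0" and h="\<lambda>s. M * exp (w * (t + 1)) * norm (T \<bar>s - t\<bar> x - x)"])
    show "((\<lambda>s. M * exp (w * (t + 1)) * norm (T \<bar>s - t\<bar> x - x)) \<longlongrightarrow> 0) (at t within {0..})"
      by (rule tendsto_eq_intros lim refl | simp)+
    have "norm (T s x - T t x) \<le> M * exp (w * (t + 1)) * norm (T \<bar>s - t\<bar> x - x)" if "s \<ge> 0" "s \<le> t + 1" for s
    proof -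
      \<comment> \<open>For either order of s and t the difference of the orbit values is, up to
        sign, T m applied to T |s - t| x - x with m the smaller time. This turns right continuity at
        0 into two-sided continuity.\<close>
      define m where "m = min s t"
      have m: "m \<ge> 0" "m \<le> t + 1" using that t by (auto simp: m_def)
      have "norm (T s x - T t x) = norm (T m (T \<bar>s - t\<bar> x - x))"
      proof (cases "s \<le> t")
        case True
        then show ?thesis using add[of s "t - s" x] that m
          by (simp add: m_def diff min_def norm_minus_commute)
      next
        case False
        then show ?thesis using add[of t "s - t" x] t m by (simp add: m_def diff min_def)
      qed
      also have "\<dots> \<le> M * exp (w * m) * norm (T \<bar>s - t\<bar> x - x)" using M m by blast
      also have "\<dots> \<le> M * exp (w * (t+1)) * norm (T \<bar>s - t\<bar> x - x)"
        using M m by (intro mult_right_mono mult_left_mono) (auto intro: mult_left_mono)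
      finally show ?thesis .
    qed
    moreover have "eventually (\<lambda>s. s \<ge> 0 \<and> s \<le> t + 1) (at t within {0..})"
      unfolding eventually_at by (intro exI[of _ 1]) (auto simp: dist_real_def)
    ultimately show "eventually (\<lambda>s. norm (T s x - T t x) \<le> M * exp (w * (t + 1)) * norm (T \<bar>s - t\<bar> x - x)) (at t within {0..})"
      by (auto elim!: eventually_mono)
  qed auto
  then show ?thesis by (simp add: LIM_zero_iff tendsto_norm_zero_iff)
qed

lemma continuous_orbit: "continuous_on {0..} (\<lambda>t. T t x)"
  using orbit_tendsto by (auto simp: continuous_on_def)

text \<open>Time and vector vary together in left difference quotients and in the product rule of
  \<open>C0_sg_unique\<close>; the bound \<open>growth\<close>, uniform over bounded times, makes
  such limits possible.\<close>

lemma joint_tendsto: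
  assumes s: "s \<ge> 0" and "(\<sigma> \<longlongrightarrow> s) F" and ev: "eventually (\<lambda>i. \<sigma> i \<ge> 0) F" and "(\<xi> \<longlongrightarrow> x) F"
  shows "((\<lambda>i. T (\<sigma> i) (\<xi> i)) \<longlongrightarrow> T s x) F"
proof -
  obtain M w where M: "M \<ge> 1" "w \<ge> 0" "\<And>t x. t \<ge> 0 \<Longrightarrow> norm (T t x) \<le> M * exp (w * t) * norm x"
    using growth by auto
  have 1: "((\<lambda>i. T (\<sigma> i) x) \<longlongrightarrow> T s x) F"
    using continuous_on_tendsto_compose[OF continuous_orbit assms(2)] s ev by simp
  have 2: "((\<lambda>i. T (\<sigma> i) (\<xi> i) - T (\<sigma> i) x) \<longlongrightarrow> 0) F"
  proof (rule Lim_null_comparison)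
    show "((\<lambda>i. M * exp (w * \<sigma> i) * norm (\<xi> i - x)) \<longlongrightarrow> 0) F"
      using assms by (auto intro!: tendsto_eq_intros)
    show "eventually (\<lambda>i. norm (T (\<sigma> i) (\<xi> i) - T (\<sigma> i) x) \<le> M * exp (w * \<sigma> i) * norm (\<xi> i - x)) F"
      using ev by eventually_elim (metis M(3) diff)
  qed
  from tendsto_add[OF 1 2] show ?thesis by simp
qed

lemma gen_orbit:
  assumes "gen x y" "s \<ge> 0" shows "gen (T s x) (T s y)"
proof -
  have "((\<lambda>t. T s ((T t x - x) /\<^sub>R t)) \<longlongrightarrow> T s y) (at_right 0)"
    using bounded_linear.tendsto[OF lin[OF assms(2)]] assms(1) by (auto simp: gen_def)
  moreover have "eventually (\<lambda>t. T s ((T t x - x) /\<^sub>R t) = (T t (T s x) - T s x) /\<^sub>R t) (at_right 0)"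
    using add[of s _ x] add[of _ s x] assms(2)
    by (auto simp: eventually_at_filter diff scale intro!: always_eventually) (metis add.commute less_le)
  ultimately show ?thesis unfolding gen_def by (rule Lim_transform_eventually)
qed

lemma orbit_has_derivative:
  assumes g: "gen x y" and t: "t > 0"
  shows "((\<lambda>t. T t x) has_vector_derivative T t y) (at t)"
proof -
  have q: "((\<lambda>h. (T h x - x) /\<^sub>R h) \<longlongrightarrow> y) (at_right 0)" using g by (simp add: gen_def)
  have R: "((\<lambda>h. (T (t + h) x - T t x) /\<^sub>R h) \<longlongrightarrow> T t y) (at_right 0)"
  proof (rule Lim_transform_eventually)
    show "((\<lambda>h. T t ((T h x - x) /\<^sub>R h)) \<longlongrightarrow> T t y) (at_right 0)"
      using t by (intro joint_tendsto q) auto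
    show "eventually (\<lambda>h. T t ((T h x - x) /\<^sub>R h) = (T (t + h) x - T t x) /\<^sub>R h) (at_right 0)"
      using t add[of t _ x] by (auto simp: eventually_at_filter diff scale intro!: always_eventually)
  qed
  \<comment> \<open>From the left the quotient is T (t - h) applied to (T h x - x) / h. The time
    moves with h, hence \<open>joint_tendsto\<close>.\<close>
  have L: "((\<lambda>h. (T (t + h) x - T t x) /\<^sub>R h) \<longlongrightarrow> T t y) (at_left 0)"
  proof -
    have "((\<lambda>h. (T (t - h) x - T t x) /\<^sub>R (-h)) \<longlongrightarrow> T t y) (at_right 0)"
    proof (rule Lim_transform_eventually)
      show "((\<lambda>h. T (t - h) ((T h x - x) /\<^sub>R h)) \<longlongrightarrow> T t y) (at_right 0)"
      proof (intro joint_tendsto q)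
        show "((\<lambda>h. t - h) \<longlongrightarrow> t) (at_right 0)" by (auto intro!: tendsto_eq_intros)
        show "eventually (\<lambda>h. 0 \<le> t - h) (at_right 0)"
          using t unfolding eventually_at_right_field by (intro exI[of _ t]) auto
      qed (use t in auto)
      have "T (t - h) ((T h x - x) /\<^sub>R h) = (T (t - h) x - T t x) /\<^sub>R (-h)" if "h > 0" "h < t" for h
        using that add[of "t-h" h x] by (simp add: diff scale) (simp add: scaleR_diff_right)
      then show "eventually (\<lambda>h. T (t - h) ((T h x - x) /\<^sub>R h) = (T (t - h) x - T t x) /\<^sub>R (-h)) (at_right 0)"
        using t unfolding eventually_at_right_field by (intro exI[of _ t]) auto
    qed
    then show ?thesis unfolding filterlim_at_left_to_right[where a="0::real"] by simp
  qed
  have "((\<lambda>h. (T (t + h) x - T t x) /\<^sub>R h) \<longlongrightarrow> T t y) (at 0)"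
    using L R by (simp add: filterlim_split_at)
  then have "((\<lambda>s. (T s x - T t x) /\<^sub>R (s - t)) \<longlongrightarrow> T t y) (at t)"
    by (subst LIM_offset_zero_iff) (auto simp: add.commute)
  then show ?thesis by (simp add: has_vector_derivative_iff_tendsto)
qed

text \<open>The usual proof passes to the limit in T t x - x = \<integral> T s y ds. Here the mean
  value inequality for T s (X n) - s Y n replaces the integral: in the limit it bounds the norm of T
  t x - x - t y by t times any bound for T s y - y on (0, t], which is small for small t.\<close>

lemma gen_closed:
  assumes g: "\<And>n::nat. gen (X n) (Y n)" and X: "X \<longlonglongrightarrow> x" and Y: "Y \<longlonglongrightarrow> y"
  shows "gen x y"
proof -
  obtain M w where M: "M \<ge> 1" "w \<ge> 0" "\<And>t x. t \<ge> 0 \<Longrightarrow> norm (T t x) \<le> M * exp (w * t) * norm x"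
    using growth by auto
  have est: "norm (T t x - x - t *\<^sub>R y) \<le> e * t"
    if t: "t > 0" and e: "\<And>s. 0 < s \<Longrightarrow> s \<le> t \<Longrightarrow> norm (T s y - y) \<le> e" for t e
  proof (rule tendsto_le[OF sequentially_bot])
    have ct: "(\<lambda>n. T t (X n)) \<longlonglongrightarrow> T t x" using t by (intro joint_tendsto X) auto
    show "(\<lambda>n. norm (T t (X n) - X n - t *\<^sub>R Y n)) \<longlonglongrightarrow> norm (T t x - x - t *\<^sub>R y)"
      by (intro tendsto_intros ct X Y)
    show "(\<lambda>n. (e + (M * exp (w * t) + 1) * norm (Y n - y)) * t) \<longlonglongrightarrow> e * t"
      using Y by (auto intro!: tendsto_eq_intros)
    have "norm (T t (X n) - X n - t *\<^sub>R Y n) \<le> (e + (M * exp (w * t) + 1) * norm (Y n - y)) * t" for n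
    proof -
      define B where "B = e + (M * exp (w * t) + 1) * norm (Y n - y)"
      define f where "f s = T s (X n) - s *\<^sub>R Y n" for s
      have "norm (f t - f 0) \<le> B * t - B * 0"
      proof (rule differentiable_bound_general[where f'="\<lambda>s. T s (Y n) - Y n" and \<phi>'="\<lambda>_. B"])
        show "continuous_on {0..t} f"
          unfolding f_def by (intro continuous_intros continuous_on_subset[OF continuous_orbit]) auto
        show "(f has_vector_derivative T s (Y n) - Y n) (at s)" if "0 < s" for s
          unfolding f_def using that by (auto intro!: derivative_eq_intros orbit_has_derivative[OF g])
        show "norm (T s (Y n) - Y n) \<le> B" if s: "0 < s" "s < t" for s
        proof -
          have "T s (Y n) - Y n = (T s y - y) + T s (Y n - y) - (Y n - y)" using s by (simp add: diff)
          then have "norm (T s (Y n) - Y n) \<le> norm (T s y - y) + norm (T s (Y n - y)) + norm (Y n - y)"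
            by (metis norm_triangle_ineq norm_triangle_ineq4 order_trans add_right_mono)
          also have "\<dots> \<le> e + M * exp (w * t) * norm (Y n - y) + norm (Y n - y)"
          proof (intro add_mono)
            have "norm (T s (Y n - y)) \<le> M * exp (w * s) * norm (Y n - y)" using M s by simp
            also have "\<dots> \<le> M * exp (w * t) * norm (Y n - y)"
              using M s by (intro mult_right_mono mult_left_mono) (auto intro: mult_left_mono)
            finally show "norm (T s (Y n - y)) \<le> M * exp (w * t) * norm (Y n - y)" .
          qed (use e s in auto)
          finally show ?thesis by (simp add: B_def algebra_simps)
        qed
      qed (use t in \<open>auto intro!: continuous_intros derivative_eq_intros\<close>)
      then show ?thesis by (simp add: f_def B_def zero algebra_simps)
    qed
    then show "eventually (\<lambda>n. norm (T t (X n) - X n - t *\<^sub>R Y n) \<le> (e + (M * exp (w * t) + 1) * norm (Y n - y)) * t) sequentially"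
      by simp
  qed
  show ?thesis unfolding gen_def tendsto_iff
  proof (intro allI impI)
    fix e :: real assume e: "e > 0"
    have "eventually (\<lambda>s. dist (T s y) y < e/2) (at_right 0)"
      using cont0[of y] e unfolding tendsto_iff by (meson half_gt_zero)
    then obtain d where d: "d > 0" "\<And>s. 0 < s \<Longrightarrow> s < d \<Longrightarrow> dist (T s y) y < e/2"
      unfolding eventually_at_right_field by auto
    have "dist ((T t x - x) /\<^sub>R t) y < e" if "0 < t" "t < d" for t
    proof -
      have "norm (T t x - x - t *\<^sub>R y) \<le> e/2 * t"
        using that d by (intro est) (auto simp: dist_norm intro: less_imp_le)
      moreover have "(T t x - x) /\<^sub>R t - y = (T t x - x - t *\<^sub>R y) /\<^sub>R t"
        using that by (simp add: scaleR_diff_right)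
      ultimately have "dist ((T t x - x) /\<^sub>R t) y \<le> e/2"
        using that by (simp add: dist_norm divide_simps)
      then show ?thesis using e by simp
    qed
    then show "eventually (\<lambda>t. dist ((T t x - x) /\<^sub>R t) y < e) (at_right 0)"
      unfolding eventually_at_right_field using d by blast
  qed
qed

lemma eigenvector_orbit:
  assumes g: "gen x (c *\<^sub>R x)" and t: "t \<ge> 0"
  shows "T t x = exp (c * t) *\<^sub>R x"
proof -
  have "exp (- c * t) *\<^sub>R T t x = exp (- c * 0) *\<^sub>R T 0 x"
  proof (rule vector_derivative_zero_imp_const[OF t])
    show "continuous_on {0..t} (\<lambda>s. exp (- c * s) *\<^sub>R T s x)"
      by (intro continuous_intros continuous_on_subset[OF continuous_orbit]) auto
    fix s :: real assume "0 < s"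
    then show "((\<lambda>s. exp (- c * s) *\<^sub>R T s x) has_vector_derivative 0) (at s)"
      by (auto intro!: derivative_eq_intros orbit_has_derivative[OF g]
          simp: scale has_real_derivative_iff_has_vector_derivative[symmetric])
  qed
  then have "exp (c * t) *\<^sub>R exp (- c * t) *\<^sub>R T t x = exp (c * t) *\<^sub>R x" by (simp add: zero)
  then show ?thesis by (simp add: exp_minus)
qed

end

text \<open>For x in the domain of T the curve s \<mapsto> S (t - s) (T s x) has derivative zero on
  (0, t), so its end values S t x and T t x agree; density and continuity extend this to all
  x.\<close>

lemma C0_sg_unique:
  assumes "C0_sg T" "C0_sg S"
    and sub: "\<And>x y. C0_sg.gen T x y \<Longrightarrow> C0_sg.gen S x y"
    and dense: "\<And>x e. e > 0 \<Longrightarrow> \<exists>x' y. C0_sg.gen T x' y \<and> norm (x - x') < e"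
    and t: "t \<ge> 0"
  shows "T t x = S t x"
proof -
  interpret T: C0_sg T by fact
  interpret S: C0_sg S by fact
  have dom: "T t x = S t x" if g: "T.gen x y" for x y
  proof -
    have "S (t - t) (T t x) = S (t - 0) (T 0 x)"
    proof (rule vector_derivative_zero_imp_const[OF t, where f="\<lambda>s. S (t - s) (T s x)"])
      show "continuous_on {0..t} (\<lambda>s. S (t - s) (T s x))"
        unfolding continuous_on_def
      proof (intro ballI S.joint_tendsto)
        fix s assume s: "s \<in> {0..t}"
        show "((\<lambda>s. T s x) \<longlongrightarrow> T s x) (at s within {0..t})"
          using T.orbit_tendsto[of s x] s by (auto intro: tendsto_within_subset)
        show "eventually (\<lambda>s. 0 \<le> t - s) (at s within {0..t})" by (auto simp: eventually_at_filter)
      qed (auto intro!: tendsto_intros)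
      fix s assume s: "0 < s" "s < t"
      have 1: "((\<lambda>r. (T r x - T s x) /\<^sub>R (r - s)) \<longlongrightarrow> T s y) (at s)"
        using T.orbit_has_derivative[OF g s(1)] by (simp add: has_vector_derivative_iff_tendsto)
      have q1: "((\<lambda>r. S (t - r) ((T r x - T s x) /\<^sub>R (r - s))) \<longlongrightarrow> S (t - s) (T s y)) (at s)"
      proof (intro S.joint_tendsto 1)
        have "eventually (\<lambda>r. r \<in> {..<t}) (at s)" using s by (intro eventually_at_in_open') auto
        then show "eventually (\<lambda>r. 0 \<le> t - r) (at s)" by eventually_elim auto
      qed (use s in \<open>auto intro!: tendsto_intros\<close>)
      have d0: "((\<lambda>r. t - r) has_vector_derivative -1) (at s)"
        by (auto intro!: derivative_eq_intros simp: has_real_derivative_iff_has_vector_derivative[symmetric])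
      have d1: "((\<lambda>r. S r (T s x)) has_vector_derivative S (t - s) (T s y)) (at (t - s))"
        using S.orbit_has_derivative[OF sub[OF T.gen_orbit[OF g, of s]], of "t - s"] s by simp
      have "((\<lambda>r. S (t - r) (T s x)) has_vector_derivative (-1) *\<^sub>R S (t - s) (T s y)) (at s)"
        using vector_diff_chain_at[OF d0 d1] by (simp add: o_def)
      then have 2: "((\<lambda>r. (S (t - r) (T s x) - S (t - s) (T s x)) /\<^sub>R (r - s)) \<longlongrightarrow> - S (t - s) (T s y)) (at s)"
        by (simp add: has_vector_derivative_iff_tendsto)
      have "((\<lambda>r. (S (t - r) (T r x) - S (t - s) (T s x)) /\<^sub>R (r - s)) \<longlongrightarrow> 0) (at s)"
      proof (rule Lim_transform_eventually)
        show "((\<lambda>r. S (t - r) ((T r x - T s x) /\<^sub>R (r - s)) + (S (t - r) (T s x) - S (t - s) (T s x)) /\<^sub>R (r - s)) \<longlongrightarrow> 0) (at s)"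
          using tendsto_add[OF q1 2] by simp
        have "eventually (\<lambda>r. r \<in> {..<t}) (at s)" using s by (intro eventually_at_in_open') auto
        then show "eventually (\<lambda>r. S (t - r) ((T r x - T s x) /\<^sub>R (r - s)) + (S (t - r) (T s x) - S (t - s) (T s x)) /\<^sub>R (r - s)
           = (S (t - r) (T r x) - S (t - s) (T s x)) /\<^sub>R (r - s)) (at s)"
          by eventually_elim (simp add: S.scale S.diff scaleR_diff_right)
      qed
      then show "((\<lambda>s. S (t - s) (T s x)) has_vector_derivative 0) (at s)"
        unfolding has_vector_derivative_iff_tendsto .
    qed
    then show "T t x = S t x" using S.zero[of "T t x"] T.zero[of x] by simp
  qed
  have "\<exists>x' y. T.gen x' y \<and> norm (x - x') < 1 / real (Suc n)" for n using dense[of "1 / real (Suc n)" x] by simp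
  then obtain X Y where XY: "\<And>n. T.gen (X n) (Y n)" "\<And>n. norm (x - X n) < 1 / real (Suc n)"
    by metis
  have X: "X \<longlonglongrightarrow> x"
  proof (rule LIM_zero_cancel, rule Lim_null_comparison)
    show "eventually (\<lambda>n. norm (X n - x) \<le> 1 / real (Suc n)) sequentially"
      using less_imp_le[OF XY(2)] by (intro always_eventually allI) (simp add: norm_minus_commute)
    show "(\<lambda>n. 1 / real (Suc n)) \<longlonglongrightarrow> 0" using LIMSEQ_inverse_real_of_nat by (simp add: inverse_eq_divide)
  qed
  have "(\<lambda>n. T t (X n)) \<longlonglongrightarrow> T t x" "(\<lambda>n. S t (X n)) \<longlonglongrightarrow> S t x"
    using t X by (auto intro!: T.joint_tendsto S.joint_tendsto)
  then show ?thesis using dom[OF XY(1)] by (simp add: LIMSEQ_unique)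
qed

section \<open>The Hilbert space of square-integrable functions\<close>

lemma space_Mpi [simp]: "space Mpi = {0<..<pi}"
  by (simp add: Mpi_def space_restrict_space)

lemma emeasure_Mpi: "emeasure Mpi (space Mpi) = ennreal pi"
  by (simp add: Mpi_def emeasure_restrict_space space_restrict_space)

interpretation Mpi: finite_measure Mpi
  by standard (simp add: emeasure_Mpi del: space_Mpi)

lemma measure_Mpi [simp]: "measure Mpi {0<..<pi} = pi"
  using emeasure_Mpi by (simp add: measure_def)

lemma borel_measurable_Mpi [measurable (raw)]: "f \<in> borel_measurable borel \<Longrightarrow> f \<in> borel_measurable Mpi"
  unfolding Mpi_def by (rule measurable_restrict_space1) simp

lemma L2_measurable [measurable_dest]: "L2 f \<Longrightarrow> f \<in> borel_measurable Mpi"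
  by (simp add: L2_def)

lemma L2_integrable_norm2: "L2 f \<Longrightarrow> integrable Mpi (\<lambda>x. (cmod (f x))\<^sup>2)"
  by (simp add: L2_def)

lemma L2_integrable_mult:
  assumes "L2 f" "L2 g"
  shows "integrable Mpi (\<lambda>x. f x * g x)"
proof (rule Bochner_Integration.integrable_bound)
  show "integrable Mpi (\<lambda>x. (cmod (f x))\<^sup>2 + (cmod (g x))\<^sup>2)"
    using assms by (intro Bochner_Integration.integrable_add L2_integrable_norm2)
  show "(\<lambda>x. f x * g x) \<in> borel_measurable Mpi" using assms by measurable
  have "norm (f x * g x) \<le> norm ((cmod (f x))\<^sup>2 + (cmod (g x))\<^sup>2)" for x
  proof -
    have "2 * (cmod (f x) * cmod (g x)) \<le> (cmod (f x))\<^sup>2 + (cmod (g x))\<^sup>2"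
      using sum_squares_bound[of "cmod (f x)" "cmod (g x)"] by (simp add: mult.assoc)
    moreover have "0 \<le> cmod (f x) * cmod (g x)" by simp
    ultimately have "cmod (f x) * cmod (g x) \<le> (cmod (f x))\<^sup>2 + (cmod (g x))\<^sup>2" by linarith
    then show ?thesis by (simp add: norm_mult)
  qed
  then show "AE x in Mpi. norm (f x * g x) \<le> norm ((cmod (f x))\<^sup>2 + (cmod (g x))\<^sup>2)" by simp
qed

lemma L2_cnj: "L2 f \<Longrightarrow> L2 (\<lambda>x. cnj (f x))"
  unfolding L2_def by (auto intro!: borel_measurable_continuous_on[where f=cnj] continuous_intros)

lemma L2_integrable_cnj: "L2 f \<Longrightarrow> L2 g \<Longrightarrow> integrable Mpi (\<lambda>x. f x * cnj (g x))"
  using L2_integrable_mult L2_cnj by blast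

lemma L2_bounded:
  assumes "f \<in> borel_measurable Mpi" "\<And>x. 0 < x \<Longrightarrow> x < pi \<Longrightarrow> cmod (f x) \<le> C"
  shows "L2 f"
  unfolding L2_def
proof
  show "integrable Mpi (\<lambda>x. (cmod (f x))\<^sup>2)"
  proof (rule Mpi.integrable_const_bound[where B="C\<^sup>2"])
    show "AE x in Mpi. norm ((cmod (f x))\<^sup>2) \<le> C\<^sup>2" using assms(2) by (auto intro!: AE_I2 power_mono)
  qed (use assms in measurable)
qed fact

lemma L2_add: "L2 f \<Longrightarrow> L2 g \<Longrightarrow> L2 (\<lambda>x. f x + g x)"
proof -
  assume f: "L2 f" "L2 g"
  have "integrable Mpi (\<lambda>x. (cmod (f x + g x))\<^sup>2)"
  proof (rule Bochner_Integration.integrable_bound)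
    show "integrable Mpi (\<lambda>x. 2 * (cmod (f x))\<^sup>2 + 2 * (cmod (g x))\<^sup>2)"
      using f by (intro Bochner_Integration.integrable_add Bochner_Integration.integrable_mult_right L2_integrable_norm2)
    show "(\<lambda>x. (cmod (f x + g x))\<^sup>2) \<in> borel_measurable Mpi" using f by measurable
    have "norm ((cmod (f x + g x))\<^sup>2) \<le> norm (2 * (cmod (f x))\<^sup>2 + 2 * (cmod (g x))\<^sup>2)" for x
    proof -
      have "(cmod (f x + g x))\<^sup>2 \<le> (cmod (f x) + cmod (g x))\<^sup>2" by (intro power_mono norm_triangle_ineq) simp
      also have "\<dots> \<le> 2 * (cmod (f x))\<^sup>2 + 2 * (cmod (g x))\<^sup>2"
        using sum_squares_bound[of "cmod (f x)" "cmod (g x)"] by (simp add: power2_sum)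
      finally show ?thesis by simp
    qed
    then show "AE x in Mpi. norm ((cmod (f x + g x))\<^sup>2) \<le> norm (2 * (cmod (f x))\<^sup>2 + 2 * (cmod (g x))\<^sup>2)" by simp
  qed
  then show ?thesis using f by (auto simp: L2_def)
qed

lemma L2_mult_bounded:
  assumes "L2 f" "g \<in> borel_measurable Mpi" "\<And>x. 0 < x \<Longrightarrow> x < pi \<Longrightarrow> cmod (g x) \<le> C"
  shows "L2 (\<lambda>x. g x * f x)"
  unfolding L2_def
proof
  show m: "(\<lambda>x. g x * f x) \<in> borel_measurable Mpi" using assms by measurable
  show "integrable Mpi (\<lambda>x. (cmod (g x * f x))\<^sup>2)"
  proof (rule Bochner_Integration.integrable_bound)
    show "integrable Mpi (\<lambda>x. C\<^sup>2 * (cmod (f x))\<^sup>2)"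
      using assms by (intro Bochner_Integration.integrable_mult_right L2_integrable_norm2)
    show "(\<lambda>x. (cmod (g x * f x))\<^sup>2) \<in> borel_measurable Mpi" using m by measurable
    have "norm ((cmod (g x * f x))\<^sup>2) \<le> norm (C\<^sup>2 * (cmod (f x))\<^sup>2)" if "0 < x" "x < pi" for x
      using assms(3)[OF that] by (auto intro!: mult_right_mono power_mono simp: norm_mult power_mult_distrib)
    then show "AE x in Mpi. norm ((cmod (g x * f x))\<^sup>2) \<le> norm (C\<^sup>2 * (cmod (f x))\<^sup>2)"
      by (intro AE_I2) simp
  qed
qed

lemma L2_mult_const: "L2 f \<Longrightarrow> L2 (\<lambda>x. c * f x)"
  by (rule L2_mult_bounded[where C="cmod c"]) auto

lemma L2_uminus: "L2 f \<Longrightarrow> L2 (\<lambda>x. - f x)"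
  using L2_mult_const[of f "-1"] by simp

lemma L2_diff: "L2 f \<Longrightarrow> L2 g \<Longrightarrow> L2 (\<lambda>x. f x - g x)"
  using L2_add[of f "\<lambda>x. - g x"] L2_uminus[of g] by simp

lemma L2_const [simp]: "L2 (\<lambda>x. c)"
  by (rule L2_bounded[where C="cmod c"]) auto

lemma L2_integrable: "L2 f \<Longrightarrow> integrable Mpi f"
  using L2_integrable_mult[of f "\<lambda>_. 1"] by simp

lemma L2_cong_AE:
  assumes "L2 f" "g \<in> borel_measurable Mpi" "eqae f g" shows "L2 g"
proof -
  have "integrable Mpi (\<lambda>x. (cmod (g x))\<^sup>2)"
  proof (rule integrable_cong_AE_imp[OF L2_integrable_norm2[OF assms(1)]])
    show "AE x in Mpi. (cmod (f x))\<^sup>2 = (cmod (g x))\<^sup>2" using assms(3) unfolding eqae_def by eventually_elim simp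
  qed (use assms in measurable)
  then show ?thesis using assms by (simp add: L2_def)
qed

lemma eqae_refl [simp]: "eqae f f" by (simp add: eqae_def)
lemma eqae_sym: "eqae f g \<Longrightarrow> eqae g f" by (simp add: eqae_def eq_commute)
lemma eqae_trans: "eqae f g \<Longrightarrow> eqae g h \<Longrightarrow> eqae f h"
  unfolding eqae_def by (auto elim: eventually_elim2)

\<comment> \<open>On functions \<open>norm_L2\<close> is only a seminorm; classes modulo null sets
  make it a norm, so that abstract semigroup theory applies. The relation is partial because
  functions outside L2 belong to no class.\<close>
quotient_type l2 = fn / partial: "\<lambda>f g. L2 f \<and> L2 g \<and> eqae f g"
proof (rule part_equivpI)
  show "\<exists>x. L2 x \<and> L2 x \<and> eqae x x" by (rule exI[of _ "\<lambda>_. 0"]) simp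
qed (auto intro!: sympI transpI dest: eqae_sym eqae_trans)

lemma inner_L2_add_left:
  assumes "L2 f" "L2 g" "L2 h"
  shows "inner_L2 (\<lambda>x. f x + g x) h = inner_L2 f h + inner_L2 g h"
  unfolding inner_L2_def using assms by (simp add: algebra_simps L2_integrable_cnj)

lemma inner_L2_cong:
  assumes "L2 f" "L2 g" "L2 f'" "L2 g'" "eqae f f'" "eqae g g'"
  shows "inner_L2 f g = inner_L2 f' g'"
  unfolding inner_L2_def
proof (rule integral_cong_AE)
  show "AE x in Mpi. f x * cnj (g x) = f' x * cnj (g' x)"
    using assms(5,6) unfolding eqae_def by eventually_elim simp
  show "(\<lambda>x. f x * cnj (g x)) \<in> borel_measurable Mpi" "(\<lambda>x. f' x * cnj (g' x)) \<in> borel_measurable Mpi"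
    using L2_integrable_cnj assms(1-4) borel_measurable_integrable by blast+
qed

lemma inner_L2_self: "inner_L2 f f = complex_of_real (LINT x|Mpi. (cmod (f x))\<^sup>2)"
  unfolding inner_L2_def by (simp flip: complex_norm_square integral_complex_of_real)

lemma inner_L2_commute: "inner_L2 g f = cnj (inner_L2 f g)"
  unfolding inner_L2_def by (simp only: Bochner_Integration.integral_cnj[symmetric] complex_cnj_mult complex_cnj_cnj mult.commute)

lemma inner_L2_cmult: "inner_L2 (\<lambda>x. c * f x) g = c * inner_L2 f g"
  unfolding inner_L2_def by (simp add: mult.assoc)

lemma eqae_add: "eqae f f' \<Longrightarrow> eqae g g' \<Longrightarrow> eqae (\<lambda>x. f x + g x) (\<lambda>x. f' x + g' x)"
  unfolding eqae_def by (auto elim: eventually_elim2)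

lemma eqae_cmult: "eqae f f' \<Longrightarrow> eqae (\<lambda>x. c * f x) (\<lambda>x. c * f' x)"
  unfolding eqae_def by (auto elim: eventually_mono)

text \<open>The complex space is viewed as a real Hilbert space, with the real part of the complex
  product. Norm, convergence and generators stay the same, and complex orthogonality is recovered by
  testing also with i times a vector.\<close>

instantiation l2 :: real_inner
begin

lift_definition zero_l2 :: l2 is "\<lambda>x. 0" by simp
lift_definition plus_l2 :: "l2 \<Rightarrow> l2 \<Rightarrow> l2" is "\<lambda>f g x. f x + g x" by (simp add: L2_add eqae_add)
lift_definition scaleR_l2 :: "real \<Rightarrow> l2 \<Rightarrow> l2" is "\<lambda>r f x. complex_of_real r * f x"
  by (simp add: L2_mult_const eqae_cmult)
lift_definition inner_l2 :: "l2 \<Rightarrow> l2 \<Rightarrow> real" is "\<lambda>f g. Re (inner_L2 f g)"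
  by (metis inner_L2_cong)
definition uminus_l2 :: "l2 \<Rightarrow> l2" where "uminus_l2 x = (-1) *\<^sub>R x"
definition minus_l2 :: "l2 \<Rightarrow> l2 \<Rightarrow> l2" where "minus_l2 x y = x + (- y)"
definition norm_l2 :: "l2 \<Rightarrow> real" where "norm_l2 x = sqrt (inner x x)"
definition dist_l2 :: "l2 \<Rightarrow> l2 \<Rightarrow> real" where "dist_l2 x y = norm (x - y)"
definition sgn_l2 :: "l2 \<Rightarrow> l2" where "sgn_l2 x = inverse (norm x) *\<^sub>R x"
definition uniformity_l2 :: "(l2 \<times> l2) filter" where
  "uniformity_l2 = (INF e\<in>{0 <..}. principal {(x, y). dist x y < e})"
definition open_l2 :: "l2 set \<Rightarrow> bool" where
  "open_l2 U = (\<forall>x\<in>U. eventually (\<lambda>(x', y). x' = x \<longrightarrow> y \<in> U) uniformity)"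

instance
proof
  fix x y z :: l2 and a b r :: real
  show "x + y + z = x + (y + z)" by transfer (simp add: L2_add add.assoc)
  show "x + y = y + x"
    by transfer (auto intro!: L2_add AE_I2 simp: eqae_def)
  show "0 + x = x" by transfer auto
  show "- x + x = 0" unfolding uminus_l2_def by transfer (auto simp: L2_add L2_mult_const L2_uminus)
  show "x - y = x + - y" by (simp add: minus_l2_def)
  show "a *\<^sub>R (x + y) = a *\<^sub>R x + a *\<^sub>R y"
    by transfer (simp add: L2_add L2_mult_const distrib_left)
  show "(a + b) *\<^sub>R x = a *\<^sub>R x + b *\<^sub>R x"
    by transfer (simp add: L2_add L2_mult_const distrib_right)
  show "a *\<^sub>R b *\<^sub>R x = (a * b) *\<^sub>R x" by transfer (simp add: L2_mult_const mult.assoc)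
  show "1 *\<^sub>R x = x" by transfer auto
  show "dist x y = norm (x - y)" by (simp add: dist_l2_def)
  show "sgn x = inverse (norm x) *\<^sub>R x" by (simp add: sgn_l2_def)
  show "(uniformity :: (l2 \<times> l2) filter) = (INF e\<in>{0 <..}. principal {(x, y). dist x y < e})"
    by (simp add: uniformity_l2_def)
  show "open U = (\<forall>x\<in>U. eventually (\<lambda>(x', y). x' = x \<longrightarrow> y \<in> U) uniformity)" for U :: "l2 set"
    by (simp add: open_l2_def)
  show "inner x y = inner y x" by transfer (metis inner_L2_commute cnj.sel(1))
  show "inner (x + y) z = inner x z + inner y z" by transfer (auto simp: inner_L2_add_left)
  show "inner (r *\<^sub>R x) y = r * inner x y" by transfer (simp add: inner_L2_cmult)
  show "0 \<le> inner x x" by transfer (simp add: inner_L2_self)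
  show "inner x x = 0 \<longleftrightarrow> x = 0"
  proof (transfer, goal_cases)
    case (1 x)
    then have "L2 x" by simp
    then have "(LINT t|Mpi. (cmod (x t))\<^sup>2) = 0 \<longleftrightarrow> (AE t in Mpi. (cmod (x t))\<^sup>2 = 0)"
      by (intro integral_nonneg_eq_0_iff_AE L2_integrable_norm2) auto
    then show ?case using 1 by (simp add: inner_L2_self eqae_def)
  qed
  show "norm x = sqrt (inner x x)" by (simp add: norm_l2_def)
qed

end

lemma abs_l2_eq_iff: "L2 f \<Longrightarrow> L2 g \<Longrightarrow> abs_l2 f = abs_l2 g \<longleftrightarrow> eqae f g"
  using Quotient_rel[OF Quotient_l2, of f g] by simp

lemma L2_rep [simp]: "L2 (rep_l2 x)" and abs_rep_l2 [simp]: "abs_l2 (rep_l2 x) = x"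
  using Quotient_rep_reflp[OF Quotient_l2, of x] Quotient_abs_rep[OF Quotient_l2, of x] by auto

lemma rep_abs_l2: "L2 f \<Longrightarrow> eqae (rep_l2 (abs_l2 f)) f"
  by (metis L2_rep abs_l2_eq_iff abs_rep_l2)

lemma abs_l2_add: "L2 f \<Longrightarrow> L2 g \<Longrightarrow> abs_l2 (\<lambda>x. f x + g x) = abs_l2 f + abs_l2 g"
  by (simp add: plus_l2.abs_eq)

lemma abs_l2_scaleR: "L2 f \<Longrightarrow> abs_l2 (\<lambda>x. complex_of_real r * f x) = r *\<^sub>R abs_l2 f"
  by (simp add: scaleR_l2.abs_eq)

lemma abs_l2_uminus: "L2 f \<Longrightarrow> abs_l2 (\<lambda>x. - f x) = - abs_l2 f"
  using abs_l2_scaleR[of f "-1"] by simp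

lemma abs_l2_diff: "L2 f \<Longrightarrow> L2 g \<Longrightarrow> abs_l2 (\<lambda>x. f x - g x) = abs_l2 f - abs_l2 g"
  using abs_l2_add[of f "\<lambda>x. - g x"] by (simp add: L2_uminus abs_l2_uminus)

lemma abs_l2_zero: "abs_l2 (\<lambda>x. 0) = 0"
  by (simp add: zero_l2_def)

lemma inner_abs_l2: "L2 f \<Longrightarrow> L2 g \<Longrightarrow> inner (abs_l2 f) (abs_l2 g) = Re (inner_L2 f g)"
  by (simp add: inner_l2.abs_eq)

lemma norm_abs_l2: "L2 f \<Longrightarrow> norm (abs_l2 f) = norm_L2 f"
  by (simp add: norm_eq_sqrt_inner inner_abs_l2 inner_L2_self norm_L2_def)

lemma norm_rep_l2: "norm_L2 (rep_l2 x) = norm x"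
  using norm_abs_l2[OF L2_rep, of x] by simp

lemma L1_le_L2:
  assumes "L2 f" shows "(LINT x|Mpi. cmod (f x)) \<le> sqrt pi * norm (abs_l2 f)"
proof -
  have L: "L2 (\<lambda>x. complex_of_real (cmod (f x)))" using assms by (auto simp: L2_def)
  have "(LINT x|Mpi. cmod (f x)) = inner (abs_l2 (\<lambda>x. complex_of_real (cmod (f x)))) (abs_l2 (\<lambda>x. 1))"
    using L by (simp add: inner_abs_l2 inner_L2_def integral_complex_of_real)
  also have "\<dots> \<le> norm (abs_l2 (\<lambda>x. complex_of_real (cmod (f x)))) * norm (abs_l2 (\<lambda>x. 1))"
    by (rule norm_cauchy_schwarz)
  also have "\<dots> = sqrt pi * norm (abs_l2 f)"
    using assms L by (simp add: norm_abs_l2 norm_L2_def)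
  finally show ?thesis .
qed

text \<open>Riesz-Fischer. The measure is finite, so an L2-Cauchy sequence is L1-Cauchy and a
  subsequence converges almost everywhere; Fatou's lemma then bounds the distance from each late
  member of the sequence to that limit.\<close>

instance l2 :: complete_space
proof
  fix X :: "nat \<Rightarrow> l2" assume X: "Cauchy X"
  define f where "f n = rep_l2 (X n)" for n
  have L: "L2 (f n)" for n by (simp add: f_def)
  have Xf: "X n = abs_l2 (f n)" for n by (simp add: f_def)
  have d: "norm (X i - X j) = norm_L2 (\<lambda>x. f i x - f j x)" for i j
    using L by (simp add: Xf abs_l2_diff[symmetric] norm_abs_l2 L2_diff)
  have "\<exists>r. strict_mono r \<and> (AE x in Mpi. Cauchy (\<lambda>i. f (r i) x))"
  proof -
    have "\<exists>N. \<forall>i\<ge>N. \<forall>j\<ge>N. LINT x|Mpi. norm (f i x - f j x) < e" if e: "e > 0" for e :: real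
    proof -
      obtain N where N: "\<And>i j. i \<ge> N \<Longrightarrow> j \<ge> N \<Longrightarrow> norm (X i - X j) < e / sqrt pi"
        using CauchyD[OF X, of "e / sqrt pi"] e by auto
      have "LINT x|Mpi. norm (f i x - f j x) < e" if "i \<ge> N" "j \<ge> N" for i j
      proof -
        have "LINT x|Mpi. norm (f i x - f j x) \<le> sqrt pi * norm (X i - X j)"
          using L1_le_L2[of "\<lambda>x. f i x - f j x"] L by (simp add: L2_diff abs_l2_diff Xf)
        also have "\<dots> < e" using N[OF that] by (simp add: field_simps)
        finally show ?thesis .
      qed
      then show ?thesis by blast
    qed
    from cauchy_L1_AE_cauchy_subseq[OF L2_integrable[OF L] this] show ?thesis by blast
  qed
  then obtain r where r: "strict_mono r" and c: "AE x in Mpi. Cauchy (\<lambda>i. f (r i) x)" by blast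
  define F where "F x = lim (\<lambda>i. f (r i) x)" for x
  have [measurable]: "\<And>i. f i \<in> borel_measurable Mpi" using L by (simp add: L2_def)
  have [measurable]: "F \<in> borel_measurable Mpi" unfolding F_def by (rule borel_measurable_lim_metric) simp
  have lim: "AE x in Mpi. (\<lambda>i. f (r i) x) \<longlonglongrightarrow> F x"
    using c unfolding F_def by eventually_elim (metis Cauchy_convergent convergent_LIMSEQ_iff)
  have est: "L2 (\<lambda>x. F x - f n x) \<and> norm_L2 (\<lambda>x. F x - f n x) \<le> e"
    if e: "e > 0" and n: "\<And>j. j \<ge> n \<Longrightarrow> norm (X j - X n) < e" for e n
  proof -
    have "(\<integral>\<^sup>+x. ennreal ((cmod (F x - f n x))\<^sup>2) \<partial>Mpi) = (\<integral>\<^sup>+x. liminf (\<lambda>i. ennreal ((cmod (f (r i) x - f n x))\<^sup>2)) \<partial>Mpi)"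
    proof (rule nn_integral_cong_AE, use lim in eventually_elim)
      case (elim x)
      then have "(\<lambda>i. ennreal ((cmod (f (r i) x - f n x))\<^sup>2)) \<longlonglongrightarrow> ennreal ((cmod (F x - f n x))\<^sup>2)"
        by (intro tendsto_intros)
      then show ?case by (rule lim_imp_Liminf[OF sequentially_bot, symmetric])
    qed
    also have "\<dots> \<le> liminf (\<lambda>i. \<integral>\<^sup>+x. ennreal ((cmod (f (r i) x - f n x))\<^sup>2) \<partial>Mpi)"
      by (rule nn_integral_liminf) simp
    also have "\<dots> \<le> liminf (\<lambda>i. ennreal (e\<^sup>2))"
    proof (rule Liminf_mono)
      have "(\<integral>\<^sup>+x. ennreal ((cmod (f (r i) x - f n x))\<^sup>2) \<partial>Mpi) \<le> ennreal (e\<^sup>2)" if "i \<ge> n" for i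
      proof -
        have "(\<integral>\<^sup>+x. ennreal ((cmod (f (r i) x - f n x))\<^sup>2) \<partial>Mpi) = ennreal (LINT x|Mpi. (cmod (f (r i) x - f n x))\<^sup>2)"
          using L by (intro nn_integral_eq_integral L2_integrable_norm2 L2_diff) auto
        also have "(LINT x|Mpi. (cmod (f (r i) x - f n x))\<^sup>2) = (norm (X (r i) - X n))\<^sup>2"
          unfolding d norm_L2_def by simp
        also have "\<dots> \<le> e\<^sup>2"
          using n[of "r i"] that seq_suble[OF r, of i] by (intro power_mono) auto
        finally show ?thesis by (simp add: ennreal_leI)
      qed
      then show "eventually (\<lambda>i. (\<integral>\<^sup>+x. ennreal ((cmod (f (r i) x - f n x))\<^sup>2) \<partial>Mpi) \<le> ennreal (e\<^sup>2)) sequentially"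
        unfolding eventually_sequentially by blast
    qed
    also have "\<dots> = ennreal (e\<^sup>2)" by (simp add: Liminf_const)
    finally have *: "(\<integral>\<^sup>+x. ennreal ((cmod (F x - f n x))\<^sup>2) \<partial>Mpi) \<le> ennreal (e\<^sup>2)" .
    then have i: "integrable Mpi (\<lambda>x. (cmod (F x - f n x))\<^sup>2)"
      by (intro integrableI_bounded) (auto simp: le_less_trans[OF _ ennreal_less_top])
    then have "ennreal (LINT x|Mpi. (cmod (F x - f n x))\<^sup>2) \<le> ennreal (e\<^sup>2)"
      using * by (subst (asm) nn_integral_eq_integral) auto
    then have "(LINT x|Mpi. (cmod (F x - f n x))\<^sup>2) \<le> e\<^sup>2" by (simp add: ennreal_le_iff)
    then have "norm_L2 (\<lambda>x. F x - f n x) \<le> e"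
      unfolding norm_L2_def using e by (metis real_sqrt_le_mono real_sqrt_abs abs_of_pos)
    moreover have "L2 (\<lambda>x. F x - f n x)" using i by (simp add: L2_def)
    ultimately show ?thesis by blast
  qed
  have F: "L2 F"
  proof -
    obtain N where "\<And>i j. i \<ge> N \<Longrightarrow> j \<ge> N \<Longrightarrow> norm (X i - X j) < 1" using CauchyD[OF X, of 1] by auto
    then have "L2 (\<lambda>x. F x - f N x)" using est[of 1 N] by auto
    from L2_add[OF this L[of N]] show ?thesis by simp
  qed
  have "X \<longlonglongrightarrow> abs_l2 F"
  proof (rule LIMSEQ_I)
    fix e :: real assume e: "e > 0"
    obtain N where N: "\<And>i j. i \<ge> N \<Longrightarrow> j \<ge> N \<Longrightarrow> norm (X i - X j) < e/2"
      using CauchyD[OF X, of "e/2"] e by auto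
    have "norm (X n - abs_l2 F) < e" if "n \<ge> N" for n
    proof -
      have "norm_L2 (\<lambda>x. F x - f n x) \<le> e / 2" using est[of "e/2" n] N that e by auto
      moreover have "norm (X n - abs_l2 F) = norm_L2 (\<lambda>x. F x - f n x)"
        using F L by (simp add: Xf norm_L2_def norm_minus_commute abs_l2_diff[symmetric] norm_abs_l2 L2_diff)
      ultimately show ?thesis using e by simp
    qed
    then show "\<exists>N. \<forall>n\<ge>N. norm (X n - abs_l2 F) < e" by blast
  qed
  then show "convergent X" by (auto simp: convergent_def)
qed

instance l2 :: banach ..

section \<open>Uniform boundedness and lifting of semigroups\<close>

text \<open>The gliding hump argument in Sokal's form: one of two points at distance \<open>3\<^sup>-\<^sup>k\<close>
  from the current one has a large image under the \<open>k\<close>-th chosen operator, and the later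
  moves are too small to undo this.\<close>

lemma uniform_boundedness:
  fixes L :: "nat \<Rightarrow> 'a::banach \<Rightarrow> 'b::real_normed_vector"
  assumes lin: "\<And>n. bounded_linear (L n)" and ptw: "\<And>x. \<exists>B. \<forall>n. norm (L n x) \<le> B"
  shows "\<exists>B. \<forall>n x. norm (L n x) \<le> B * norm x"
proof (rule ccontr)
  assume neg: "\<not> ?thesis"
  \<comment> \<open>The constants leave room: the k-th point has an image of at least 3/4 (1/3)^k
    times the operator norm, all later moves together have size at most 1/2 (1/3)^k, and the
    surviving quarter exceeds 1/4 (4/3)^k because the operator norm exceeds 4^k.\<close>
  have "\<forall>k. \<exists>n v. onorm (L n) > 4 ^ k \<and> norm v \<le> 1 \<and> norm (L n v) \<ge> 3/4 * onorm (L n)"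
  proof
    fix k :: nat
    obtain n where n: "onorm (L n) > 4 ^ k"
    proof (rule ccontr)
      assume "\<not> thesis"
      then have "onorm (L n) \<le> 4 ^ k" for n using that by (meson not_le)
      then have P: "norm (L n x) \<le> 4 ^ k * norm x" for n x
        using onorm[OF lin, of n x] by (meson mult_right_mono norm_ge_zero order_trans)
      show False using neg P by metis
    qed
    have pos: "onorm (L n) > 0" using n zero_less_power[of "4::real" k] by linarith
    obtain x where x: "norm (L n x) > 3/4 * onorm (L n) * norm x"
    proof (rule ccontr)
      assume "\<not> thesis"
      then have "norm (L n x) \<le> 3/4 * onorm (L n) * norm x" for x using that by (meson not_le)
      then have "onorm (L n) \<le> 3/4 * onorm (L n)" by (intro onorm_bound) (use pos in auto)
      with pos show False by simp
    qed
    interpret bounded_linear "L n" by (rule lin)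
    have x0: "x \<noteq> 0" using x by (auto simp: zero)
    have "norm (L n (x /\<^sub>R norm x)) > 3/4 * onorm (L n)"
      using x x0 by (simp add: scale divide_simps mult.commute)
    moreover have "norm (x /\<^sub>R norm x) \<le> 1" using x0 by simp
    ultimately show "\<exists>n v. onorm (L n) > 4 ^ k \<and> norm v \<le> 1 \<and> norm (L n v) \<ge> 3/4 * onorm (L n)"
      using n by (meson less_imp_le)
  qed
  then obtain n v where nv: "\<And>k. onorm (L (n k)) > 4 ^ k" "\<And>k. norm (v k) \<le> 1"
      "\<And>k. norm (L (n k) (v k)) \<ge> 3/4 * onorm (L (n k))" by metis
  have "\<exists>x. \<forall>k. True \<and> (norm (x (Suc k) - x k) \<le> (1/3) ^ k \<and>
       norm (L (n k) (x (Suc k))) \<ge> 3/4 * onorm (L (n k)) * (1/3) ^ k)"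
  proof (rule dependent_nat_choice)
    fix x k
    interpret bounded_linear "L (n k)" by (rule lin)
    define w where "w = (1/3) ^ k *\<^sub>R v k"
    have w: "norm w \<le> (1/3) ^ k" using nv(2)[of k] by (simp add: w_def mult_left_le divide_simps)
    have big: "norm (L (n k) w) \<ge> 3/4 * onorm (L (n k)) * (1/3) ^ k"
      using mult_right_mono[OF nv(3)[of k], of "(1/3)^k"] by (simp add: w_def scale mult.commute)
    have "2 * norm (L (n k) w) = norm (L (n k) (x + w) - L (n k) (x - w))"
      by (simp add: add diff flip: scaleR_2)
    also have "\<dots> \<le> norm (L (n k) (x + w)) + norm (L (n k) (x - w))" by (rule norm_triangle_ineq4)
    finally have "norm (L (n k) (x + w)) \<ge> norm (L (n k) w) \<or> norm (L (n k) (x - w)) \<ge> norm (L (n k) w)"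
      by linarith
    then show "\<exists>y. True \<and> (norm (y - x) \<le> (1/3) ^ k \<and> norm (L (n k) y) \<ge> 3/4 * onorm (L (n k)) * (1/3) ^ k)"
    proof
      assume "norm (L (n k) (x + w)) \<ge> norm (L (n k) w)"
      then show ?thesis using w big by (intro exI[of _ "x + w"]) auto
    next
      assume "norm (L (n k) (x - w)) \<ge> norm (L (n k) w)"
      then show ?thesis using w big by (intro exI[of _ "x - w"]) auto
    qed
  qed simp
  then obtain x where x: "\<And>k. norm (x (Suc k) - x k) \<le> (1/3) ^ k"
      "\<And>k. norm (L (n k) (x (Suc k))) \<ge> 3/4 * onorm (L (n k)) * (1/3) ^ k" by blast
  define d where "d k = x (Suc k) - x k" for k
  have g: "(\<lambda>k. (1/3) ^ k :: real) sums (3/2)" using geometric_sums[of "1/3::real"] by simp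
  have dn: "norm (d k) \<le> (1/3) ^ k" for k using x(1) by (simp add: d_def)
  have sd: "summable (\<lambda>k. norm (d k))"
    by (rule summable_comparison_test[OF _ sums_summable[OF g]]) (use dn in auto)
  define y where "y = x 0 + suminf d"
  have tail: "norm (y - x (Suc k)) \<le> (1/3) ^ k / 2" for k
  proof -
    have ss: "summable (\<lambda>j. norm (d (j + Suc k)))"
      using summable_iff_shift[of "\<lambda>k. norm (d k)" "Suc k"] sd by blast
    have "(\<Sum>j<Suc k. d j) = x (Suc k) - x 0" unfolding d_def by (rule sum_lessThan_telescope)
    then have "y - x (Suc k) = (\<Sum>j. d (j + Suc k))"
      using suminf_minus_initial_segment[OF summable_norm_cancel[OF sd], of "Suc k"] by (simp add: y_def)
    also have "norm \<dots> \<le> (\<Sum>j. norm (d (j + Suc k)))"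
      using ss by (rule summable_norm)
    also have "\<dots> \<le> (\<Sum>j. (1/3) ^ Suc k * (1/3) ^ j)"
    proof (rule suminf_le)
      show "norm (d (j + Suc k)) \<le> (1/3) ^ Suc k * (1/3) ^ j" for j
        using dn[of "j + Suc k"] by (simp add: power_add mult_ac)
      show "summable (\<lambda>j. norm (d (j + Suc k)))" by (rule ss)
      show "summable (\<lambda>j. (1/3::real) ^ Suc k * (1/3) ^ j)" by (intro summable_mult sums_summable[OF g])
    qed
    also have "\<dots> = (1/3) ^ Suc k * (3/2)" by (rule sums_unique[OF sums_mult[OF g], symmetric])
    finally show ?thesis by simp
  qed
  obtain B where B: "\<And>n. norm (L n y) \<le> B" using ptw by blast
  have up: "(1/4) * (4/3) ^ k \<le> B" for k
  proof -
    interpret bounded_linear "L (n k)" by (rule lin)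
    have "3/4 * onorm (L (n k)) * (1/3) ^ k \<le> norm (L (n k) y - L (n k) (y - x (Suc k)))"
      using x(2)[of k] by (simp add: diff)
    also have "\<dots> \<le> norm (L (n k) y) + norm (L (n k) (y - x (Suc k)))" by (rule norm_triangle_ineq4)
    also have "norm (L (n k) (y - x (Suc k))) \<le> onorm (L (n k)) * ((1/3) ^ k / 2)"
      using onorm[OF lin, of "n k" "y - x (Suc k)"] mult_left_mono[OF tail[of k] onorm_pos_le[OF lin, of "n k"]] by linarith
    finally have "1/4 * onorm (L (n k)) * (1/3) ^ k \<le> B" using B[of "n k"] by (simp add: algebra_simps)
    moreover have "1/4 * 4 ^ k * (1/3) ^ k \<le> 1/4 * onorm (L (n k)) * (1/3) ^ k"
      using nv(1)[of k] by (intro mult_right_mono mult_left_mono) auto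
    ultimately show ?thesis by (simp add: power_divide)
  qed
  obtain k where "(4/3) ^ k > 4 * B" using real_arch_pow[of "4/3" "4*B"] by auto
  with up[of k] show False by simp
qed

text \<open>Were the operators not uniformly bounded near time 0, there would be times tending to 0
  along which their norms are unbounded; but each orbit converges along these times and so is
  bounded, against \<open>uniform_boundedness\<close>. The semigroup law carries the bound from
  [0, d] to [0, 1].\<close>

lemma C0_sgI:
  fixes T :: "real \<Rightarrow> 'a::banach \<Rightarrow> 'a"
  assumes lin: "\<And>t. t \<ge> 0 \<Longrightarrow> bounded_linear (T t)"
    and zero: "\<And>x. T 0 x = x"
    and add: "\<And>s t x. s \<ge> 0 \<Longrightarrow> t \<ge> 0 \<Longrightarrow> T (s + t) x = T s (T t x)"
    and cont0: "\<And>x. ((\<lambda>t. T t x) \<longlongrightarrow> x) (at_right 0)"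
  shows "C0_sg T"
proof -
  have "\<exists>d>0. \<exists>M. \<forall>t\<in>{0..d}. \<forall>x. norm (T t x) \<le> M * norm x"
  proof (rule ccontr)
    assume neg: "\<not> ?thesis"
    have "\<forall>n. \<exists>t x. 0 \<le> t \<and> t \<le> 1 / real (Suc n) \<and> norm (T t x) > real n * norm x"
    proof
      fix n show "\<exists>t x. 0 \<le> t \<and> t \<le> 1 / real (Suc n) \<and> norm (T t x) > real n * norm x"
        using neg[simplified, rule_format, of "1 / real (Suc n)" "real n"] by (auto simp: not_le)
    qed
    then obtain t x where tx: "\<And>n. 0 \<le> t n" "\<And>n. t n \<le> 1 / real (Suc n)" "\<And>n. norm (T (t n) (x n)) > real n * norm (x n)"
      by metis
    have t0: "t \<longlonglongrightarrow> 0"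
    proof (rule tendsto_sandwich[OF _ _ tendsto_const])
      show "(\<lambda>n. 1 / real (Suc n)) \<longlonglongrightarrow> 0" using LIMSEQ_inverse_real_of_nat by (simp add: inverse_eq_divide)
    qed (use tx in auto)
    have "\<exists>B. \<forall>n x. norm (T (t n) x) \<le> B * norm x"
    proof (rule uniform_boundedness)
      fix y
      have "((\<lambda>s. T s y) \<longlongrightarrow> T 0 y) (at 0 within {0..})"
        using cont0[of y] by (simp add: zero at_within_Ici_at_right)
      then have "(\<lambda>n. T (t n) y) \<longlonglongrightarrow> T 0 y"
        using continuous_within_tendsto_compose[of 0 "{0..}" "\<lambda>s. T s y" t sequentially] t0 tx(1)
        by (simp add: continuous_within)
      then have "Bseq (\<lambda>n. T (t n) y)" by (intro convergent_imp_Bseq convergentI)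
      then show "\<exists>B. \<forall>n. norm (T (t n) y) \<le> B" by (auto simp: Bseq_def)
    qed (use lin tx in auto)
    then obtain B where B: "\<And>n x. norm (T (t n) x) \<le> B * norm x" by blast
    obtain n :: nat where "real n > B" using reals_Archimedean2 by blast
    then have "norm (T (t n) (x n)) \<le> real n * norm (x n)"
      using B[of n "x n"] by (meson less_imp_le mult_right_mono norm_ge_zero order_trans)
    with tx(3)[of n] show False by simp
  qed
  then obtain d M0 where d: "d > 0" and M0: "\<And>t x. t \<in> {0..d} \<Longrightarrow> norm (T t x) \<le> M0 * norm x" by blast
  define M where "M = max 1 M0"
  have M1: "M \<ge> 1" by (simp add: M_def)
  have M: "norm (T t x) \<le> M * norm x" if "t \<in> {0..d}" for t x
    using M0[OF that, of x] by (smt (verit) M_def mult_right_mono norm_ge_zero)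
  have step: "norm (T t x) \<le> M ^ n * norm x" if "0 \<le> t" "t \<le> real n * d" for n t x
    using that
  proof (induction n arbitrary: t)
    case (Suc n)
    show ?case
    proof (cases "t \<le> d")
      case True
      have "norm (T t x) \<le> M * norm x" using M True Suc.prems by auto
      also have "\<dots> \<le> M ^ Suc n * norm x"
        using power_increasing[of 1 "Suc n" M] M1 by (intro mult_right_mono) auto
      finally show ?thesis .
    next
      case False
      have "T t x = T d (T (t - d) x)" using add[of d "t-d" x] False d by simp
      then have "norm (T t x) \<le> M * norm (T (t - d) x)" using M[of d] d by simp
      also have "\<dots> \<le> M * (M ^ n * norm x)" using M1 False Suc by (intro mult_left_mono Suc.IH) (auto simp: algebra_simps)
      finally show ?thesis by (simp add: mult_ac)
    qed
  qed (simp add: zero)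
  obtain n :: nat where n: "real n > 1 / d" using reals_Archimedean2 by blast
  then have "1 \<le> real n * d" using d by (simp add: field_simps)
  then have "\<forall>t\<in>{0..1}. \<forall>x. norm (T t x) \<le> M ^ n * norm x"
    by (intro ballI allI step) auto
  then show ?thesis by (intro C0_sg.intro lin zero add cont0 exI[of _ "M ^ n"])
qed

definition lift_sg :: "(real \<Rightarrow> fn \<Rightarrow> fn) \<Rightarrow> real \<Rightarrow> l2 \<Rightarrow> l2" where
  "lift_sg T t x = abs_l2 (T t (rep_l2 x))"

context
  fixes T :: "real \<Rightarrow> fn \<Rightarrow> fn"
  assumes sg: "C0_semigroup T"
begin

lemma sg_L2: "t \<ge> 0 \<Longrightarrow> L2 f \<Longrightarrow> L2 (T t f)"
  using sg by (simp add: C0_semigroup_def)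

lemma sg_lin: "t \<ge> 0 \<Longrightarrow> L2 f \<Longrightarrow> L2 g \<Longrightarrow> eqae (T t (\<lambda>x. f x + c * g x)) (\<lambda>x. T t f x + c * T t g x)"
  using sg by (simp add: C0_semigroup_def)

lemma sg_bdd: "t \<ge> 0 \<Longrightarrow> \<exists>C. \<forall>f. L2 f \<longrightarrow> norm_L2 (T t f) \<le> C * norm_L2 f"
  using sg by (simp add: C0_semigroup_def)

text \<open>\<open>C0_semigroup\<close> speaks about functions and does not say that equivalent
  functions have equivalent images. Linearity and boundedness force it: a null function is mapped to
  a function of norm zero.\<close>

lemma sg_cong:
  assumes t: "t \<ge> 0" and f: "L2 f" "L2 g" "eqae f g"
  shows "eqae (T t f) (T t g)"
proof -
  define h where "h = (\<lambda>x. g x - f x)"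
  have h: "L2 h" using f by (simp add: h_def L2_diff)
  have "abs_l2 f = abs_l2 g" using f by (simp add: abs_l2_eq_iff)
  then have "abs_l2 h = 0" using f by (simp add: h_def abs_l2_diff)
  then have h0: "norm_L2 h = 0" using norm_abs_l2[OF h] by simp
  obtain C where "norm_L2 (T t h) \<le> C * norm_L2 h" using sg_bdd[OF t] h by blast
  then have "norm (abs_l2 (T t h)) \<le> 0" using h0 norm_abs_l2[OF sg_L2[OF t h]] by simp
  then have "eqae (T t h) (\<lambda>x. 0)"
    using abs_l2_eq_iff[OF sg_L2[OF t h] L2_const[of 0]] by (simp add: abs_l2_zero)
  moreover have "eqae (T t g) (\<lambda>x. T t f x + 1 * T t h x)"
    using sg_lin[OF t f(1) h, of 1] by (simp add: h_def)
  ultimately show ?thesis unfolding eqae_def by eventually_elim simp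
qed

lemma lift_sg_abs: "t \<ge> 0 \<Longrightarrow> L2 f \<Longrightarrow> lift_sg T t (abs_l2 f) = abs_l2 (T t f)"
  unfolding lift_sg_def by (simp add: abs_l2_eq_iff sg_L2 sg_cong rep_abs_l2)

lemma C0_sg_lift: "C0_sg (lift_sg T)"
proof (rule C0_sgI)
  fix t :: real assume t: "t \<ge> 0"
  have comb: "lift_sg T t (x + c *\<^sub>R y) = lift_sg T t x + c *\<^sub>R lift_sg T t y" for x y c
  proof -
    have "x + c *\<^sub>R y = abs_l2 (\<lambda>s. rep_l2 x s + complex_of_real c * rep_l2 y s)"
      by (simp add: abs_l2_add abs_l2_scaleR L2_mult_const)
    then have "lift_sg T t (x + c *\<^sub>R y) = abs_l2 (T t (\<lambda>s. rep_l2 x s + complex_of_real c * rep_l2 y s))"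
      using t by (simp add: lift_sg_abs L2_add L2_mult_const)
    also have "\<dots> = abs_l2 (\<lambda>s. T t (rep_l2 x) s + complex_of_real c * T t (rep_l2 y) s)"
      using t by (subst abs_l2_eq_iff) (auto intro!: sg_L2 L2_add L2_mult_const sg_lin)
    also have "\<dots> = lift_sg T t x + c *\<^sub>R lift_sg T t y"
      using t by (simp add: lift_sg_def abs_l2_add abs_l2_scaleR L2_mult_const sg_L2)
    finally show ?thesis .
  qed
  obtain C where C: "\<And>f. L2 f \<Longrightarrow> norm_L2 (T t f) \<le> C * norm_L2 f" using sg_bdd[OF t] by blast
  have z: "lift_sg T t 0 = 0" using comb[of 0 1 0] by simp
  show "bounded_linear (lift_sg T t)"
  proof (rule bounded_linear_intro[where K=C])
    show "lift_sg T t (x + y) = lift_sg T t x + lift_sg T t y" for x y using comb[of x 1 y] by simp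
    show "lift_sg T t (r *\<^sub>R x) = r *\<^sub>R lift_sg T t x" for r x using comb[of 0 r x] z by simp
    show "norm (lift_sg T t x) \<le> norm x * C" for x
      using C[OF L2_rep, of x] t by (simp add: lift_sg_def norm_abs_l2 sg_L2 norm_rep_l2 mult.commute)
  qed
next
  show "lift_sg T 0 x = x" for x
    using sg abs_l2_eq_iff[of "T 0 (rep_l2 x)" "rep_l2 x"] by (simp add: lift_sg_def C0_semigroup_def)
  show "lift_sg T (s + t) x = lift_sg T s (lift_sg T t x)" if "s \<ge> 0" "t \<ge> 0" for s t x
  proof -
    have "lift_sg T s (lift_sg T t x) = abs_l2 (T s (T t (rep_l2 x)))"
      using that by (simp add: lift_sg_def[of T t] lift_sg_abs sg_L2)
    also have "\<dots> = abs_l2 (T (s + t) (rep_l2 x))"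
      using that sg by (subst abs_l2_eq_iff) (auto simp: sg_L2 C0_semigroup_def eqae_sym)
    finally show ?thesis by (simp add: lift_sg_def)
  qed
  show "((\<lambda>t. lift_sg T t x) \<longlongrightarrow> x) (at_right 0)" for x
  proof -
    have "((\<lambda>t. norm_L2 (\<lambda>s. T t (rep_l2 x) s - rep_l2 x s)) \<longlongrightarrow> 0) (at_right 0)"
      using sg by (simp add: C0_semigroup_def)
    moreover have "eventually (\<lambda>t. norm_L2 (\<lambda>s. T t (rep_l2 x) s - rep_l2 x s) = norm (lift_sg T t x - x)) (at_right 0)"
      by (auto simp: eventually_at_filter lift_sg_def abs_l2_diff sg_L2 L2_diff simp flip: norm_abs_l2 intro!: always_eventually)
    ultimately have "((\<lambda>t. norm (lift_sg T t x - x)) \<longlongrightarrow> 0) (at_right 0)" by (rule Lim_transform_eventually)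
    then show ?thesis by (simp add: LIM_zero_iff tendsto_norm_zero_iff)
  qed
qed

lemma sg_generator_iff: 
  assumes f: "L2 f" "L2 g"
  shows "sg_generator T f g \<longleftrightarrow> C0_sg.gen (lift_sg T) (abs_l2 f) (abs_l2 g)"
proof -
  have "norm_L2 (\<lambda>x. (T t f x - f x) / complex_of_real t - g x)
      = norm ((lift_sg T t (abs_l2 f) - abs_l2 f) /\<^sub>R t - abs_l2 g)" if t: "t > 0" for t
  proof -
    have "(\<lambda>x. (T t f x - f x) / complex_of_real t - g x) = (\<lambda>x. complex_of_real (inverse t) * (T t f x - f x) - g x)"
      by (simp add: divide_inverse mult.commute)
    moreover have "norm_L2 \<dots> = norm ((lift_sg T t (abs_l2 f) - abs_l2 f) /\<^sub>R t - abs_l2 g)"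
      using t f by (subst norm_abs_l2[symmetric])
        (simp_all add: abs_l2_diff abs_l2_scaleR L2_diff L2_mult_const sg_L2 lift_sg_abs del: of_real_inverse)
    ultimately show ?thesis by simp
  qed
  then have "((\<lambda>t. norm_L2 (\<lambda>x. (T t f x - f x) / complex_of_real t - g x)) \<longlongrightarrow> 0) (at_right 0) \<longleftrightarrow>
     ((\<lambda>t. norm ((lift_sg T t (abs_l2 f) - abs_l2 f) /\<^sub>R t - abs_l2 g)) \<longlongrightarrow> 0) (at_right 0)"
    by (intro filterlim_cong refl) (auto simp: eventually_at_filter intro!: always_eventually)
  then show ?thesis
    using f by (simp add: sg_generator_def C0_sg.gen_def[OF C0_sg_lift] LIM_zero_iff tendsto_norm_zero_iff)
qed

end

section \<open>Test functions\<close>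

text \<open>The exchanges of complex integrals below all have this shape: two integrable factors and
  a bounded measurable kernel. Unbounded weights are first moved from the kernel into the
  factors.\<close>

lemma (in pair_sigma_finite) Fubini_kernel:
  fixes f :: "'a \<Rightarrow> complex" and g :: "'b \<Rightarrow> complex" and k :: "'a \<Rightarrow> 'b \<Rightarrow> complex"
  assumes f: "integrable M1 f" and g: "integrable M2 g"
    and k[measurable]: "case_prod k \<in> borel_measurable (M1 \<Otimes>\<^sub>M M2)"
    and C: "\<And>x y. x \<in> space M1 \<Longrightarrow> y \<in> space M2 \<Longrightarrow> cmod (k x y) \<le> C"
  shows Fubini_kernel_integrable: "integrable (M1 \<Otimes>\<^sub>M M2) (\<lambda>(x, y). f x * (k x y * g y))" (is ?I)
    and Fubini_kernel_integral: "(\<integral>x. f x * (\<integral>y. k x y * g y \<partial>M2) \<partial>M1) = (\<integral>y. g y * (\<integral>x. k x y * f x \<partial>M1) \<partial>M2)" (is ?E)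
    and Fubini_kernel_integrable1: "integrable M1 (\<lambda>x. f x * (\<integral>y. k x y * g y \<partial>M2))" (is ?F)
proof -
  have [measurable]: "f \<in> borel_measurable M1" "g \<in> borel_measurable M2" using f g by auto
  have fg: "integrable (M1 \<Otimes>\<^sub>M M2) (\<lambda>(x, y). f x * g y)"
  proof (rule Fubini_integrable)
    show "integrable M1 (\<lambda>x. \<integral>y. norm (case (x, y) of (x, y) \<Rightarrow> f x * g y) \<partial>M2)"
      using f by (simp add: norm_mult)
    show "AE x in M1. integrable M2 (\<lambda>y. case (x, y) of (x, y) \<Rightarrow> f x * g y)" using g by simp
  qed measurable
  show I: ?I
  proof (rule Bochner_Integration.integrable_bound)
    show "integrable (M1 \<Otimes>\<^sub>M M2) (\<lambda>z. of_real C * (case z of (x, y) \<Rightarrow> f x * g y))"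
      using fg by (rule Bochner_Integration.integrable_mult_right)
    show "AE z in M1 \<Otimes>\<^sub>M M2. norm (case z of (x, y) \<Rightarrow> f x * (k x y * g y)) \<le> norm (of_real C * (case z of (x, y) \<Rightarrow> f x * g y))"
    proof (rule AE_I2, clarsimp simp: norm_mult space_pair_measure)
      fix x y assume xy: "x \<in> space M1" "y \<in> space M2"
      have "cmod (k x y) \<le> \<bar>C\<bar>" using C[OF xy] by linarith
      then have "cmod (k x y) * (cmod (f x) * cmod (g y)) \<le> \<bar>C\<bar> * (cmod (f x) * cmod (g y))"
        by (intro mult_right_mono) auto
      then show "cmod (f x) * (cmod (k x y) * cmod (g y)) \<le> \<bar>C\<bar> * (cmod (f x) * cmod (g y))"
        by (simp add: mult_ac)
    qed
  qed measurable
  show ?F using integrable_fst[OF I] by simp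
  have "(\<integral>y. (\<integral>x. f x * (k x y * g y) \<partial>M1) \<partial>M2) = (\<integral>x. (\<integral>y. f x * (k x y * g y) \<partial>M2) \<partial>M1)"
    using I by (rule Fubini_integral)
  moreover have "(\<integral>x. f x * (k x y * g y) \<partial>M1) = g y * (\<integral>x. k x y * f x \<partial>M1)" for y
  proof -
    have "(\<integral>x. f x * (k x y * g y) \<partial>M1) = (\<integral>x. g y * (k x y * f x) \<partial>M1)"
      by (rule Bochner_Integration.integral_cong) (simp_all add: mult_ac)
    then show ?thesis by simp
  qed
  ultimately show ?E by simp
qed

interpretation MM: pair_sigma_finite Mpi Mpi
  by (intro pair_sigma_finite.intro Mpi.sigma_finite_measure_axioms)

section \<open>Smooth functions with compact support\<close>

lemma poly_exp_tendsto:
  assumes "c > 0" shows "((\<lambda>u. poly p u * exp (- c * u)) \<longlongrightarrow> (0::real)) at_top"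
proof -
  have "((\<lambda>u. u ^ i * exp (- c * u)) \<longlongrightarrow> 0) at_top" for i
  proof -
    have "((\<lambda>u. (c * u) ^ i / exp (c * u)) \<longlongrightarrow> 0) at_top"
      by (rule filterlim_compose[OF tendsto_power_div_exp_0])
        (use assms in \<open>auto intro: filterlim_tendsto_pos_mult_at_top[OF tendsto_const _ filterlim_ident]\<close>)
    from tendsto_mult_right[OF this, of "1 / c ^ i"] show ?thesis
      using assms by (simp add: power_mult_distrib exp_minus field_simps)
  qed
  then have "((\<lambda>u. \<Sum>i\<le>degree p. coeff p i * (u ^ i * exp (- c * u))) \<longlongrightarrow> 0) at_top"
    by (intro tendsto_null_sum tendsto_mult_right_zero)
  then show ?thesis by (simp add: poly_altdef sum_distrib_right mult.assoc)
qed

text \<open>The classical flat function exp (- c / y), with a polynomial in 1 / y carried along so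
  that the family is closed under differentiation.\<close>

definition flat :: "real \<Rightarrow> real poly \<Rightarrow> real \<Rightarrow> real" where
  "flat c p y = (if y > 0 then poly p (1 / y) * exp (- c / y) else 0)"

text \<open>With r = 1 / y the chain rule gives r^2 (c p(r) - p'(r)) exp (- c r) for positive y,
  which explains the polynomial. At 0 the right difference quotient is r p(r) exp (- c r) with r
  tending to infinity.\<close>

lemma flat_deriv:
  assumes c: "c > 0"
  shows "(flat c p has_real_derivative flat c ([:0, 0, 1:] * (smult c p - pderiv p)) y) (at y)"
proof -
  consider "y > 0" | "y < 0" | "y = 0" by linarith
  then show ?thesis
  proof cases
    case 1
    have "((\<lambda>y. poly p (1 / y) * exp (- c / y)) has_real_derivative
       flat c ([:0, 0, 1:] * (smult c p - pderiv p)) y) (at y)"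
      using 1 by (auto intro!: derivative_eq_intros DERIV_chain2[OF poly_DERIV, of _ p "1/y" for p]
          simp: flat_def field_simps power2_eq_square)
    then show ?thesis
      by (rule has_field_derivative_transform_within_open[of _ _ _ "{0<..}"]) (use 1 in \<open>auto simp: flat_def\<close>)
  next
    case 2
    have "((\<lambda>y. 0) has_real_derivative flat c ([:0, 0, 1:] * (smult c p - pderiv p)) y) (at y)"
      using 2 by (auto simp: flat_def)
    then show ?thesis
      by (rule has_field_derivative_transform_within_open[of _ _ _ "{..<0}"]) (use 2 in \<open>auto simp: flat_def\<close>)
  next
    case 3
    have "((\<lambda>h. flat c p h / h) \<longlongrightarrow> 0) (at_right 0)"
    proof (rule Lim_transform_eventually)
      show "((\<lambda>h. poly (pCons 0 p) (inverse h) * exp (- c * inverse h)) \<longlongrightarrow> 0) (at_right 0)"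
        by (rule filterlim_compose[OF poly_exp_tendsto[OF c] filterlim_inverse_at_top_right])
      show "eventually (\<lambda>h. poly (pCons 0 p) (inverse h) * exp (- c * inverse h) = flat c p h / h) (at_right 0)"
        by (auto simp: eventually_at_filter flat_def field_simps intro!: always_eventually)
    qed
    moreover have "((\<lambda>h. flat c p h / h) \<longlongrightarrow> 0) (at_left 0)"
      by (rule tendsto_eventually) (auto simp: eventually_at_filter flat_def intro!: always_eventually)
    ultimately have "((\<lambda>h. flat c p h / h) \<longlongrightarrow> 0) (at 0)" by (simp add: filterlim_split_at)
    then show ?thesis using 3 by (simp add: DERIV_def flat_def)
  qed
qed

text \<open>An algebra generated by flat functions and constants that contains a derivative of each
  member. \<open>test_fn\<close> asks for all iterated derivatives, and closure under one derivative
  yields them by iteration.\<close>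

inductive smooth_fn :: "(real \<Rightarrow> real) \<Rightarrow> bool" where
  right: "c > 0 \<Longrightarrow> smooth_fn (\<lambda>x. flat c p (x - a))"
| left: "c > 0 \<Longrightarrow> smooth_fn (\<lambda>x. flat c p (b - x))"
| const: "smooth_fn (\<lambda>x. c)"
| add: "smooth_fn f \<Longrightarrow> smooth_fn g \<Longrightarrow> smooth_fn (\<lambda>x. f x + g x)"
| mult: "smooth_fn f \<Longrightarrow> smooth_fn g \<Longrightarrow> smooth_fn (\<lambda>x. f x * g x)"

lemma smooth_fn_deriv: "smooth_fn f \<Longrightarrow> \<exists>f'. smooth_fn f' \<and> (\<forall>x. (f has_real_derivative f' x) (at x))"
proof (induction rule: smooth_fn.induct)
  case (right c p a)
  have "((\<lambda>x. flat c p (x - a)) has_real_derivative flat c ([:0, 0, 1:] * (smult c p - pderiv p)) (x - a)) (at x)" for x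
  proof -
    have d: "((\<lambda>x. x - a) has_real_derivative 1) (at x)" by (auto intro!: derivative_eq_intros)
    show ?thesis using DERIV_chain2[where f="flat c p" and g="\<lambda>x. x - a", OF flat_deriv[OF right] d] by simp
  qed
  then show ?case using smooth_fn.right[OF right] by blast
next
  case (left c p b)
  have "smooth_fn (\<lambda>x. (-1) * flat c ([:0, 0, 1:] * (smult c p - pderiv p)) (b - x))"
    by (intro smooth_fn.mult smooth_fn.const smooth_fn.left left)
  moreover have "((\<lambda>x. flat c p (b - x)) has_real_derivative (-1) * flat c ([:0, 0, 1:] * (smult c p - pderiv p)) (b - x)) (at x)" for x
  proof -
    have d: "((\<lambda>x. b - x) has_real_derivative -1) (at x)" by (auto intro!: derivative_eq_intros)
    show ?thesis using DERIV_chain2[where f="flat c p" and g="\<lambda>x. b - x", OF flat_deriv[OF left] d]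
      by (simp add: mult.commute)
  qed
  ultimately show ?case by blast
next
  case (const c)
  show ?case by (intro exI[of _ "\<lambda>x. 0"]) (auto intro: smooth_fn.const)
next
  case (add f g)
  then obtain f' g' where *: "smooth_fn f'" "smooth_fn g'"
    "\<And>x. (f has_real_derivative f' x) (at x)" "\<And>x. (g has_real_derivative g' x) (at x)" by blast
  show ?case by (intro exI[of _ "\<lambda>x. f' x + g' x"]) (auto intro!: smooth_fn.add * derivative_eq_intros)
next
  case (mult f g)
  then obtain f' g' where *: "smooth_fn f'" "smooth_fn g'"
    "\<And>x. (f has_real_derivative f' x) (at x)" "\<And>x. (g has_real_derivative g' x) (at x)" by blast
  show ?case using mult.hyps *
    by (intro exI[of _ "\<lambda>x. f' x * g x + g' x * f x"]) (auto intro!: smooth_fn.add smooth_fn.mult derivative_eq_intros)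
qed

lemma smooth_fn_deriv': "smooth_fn f \<Longrightarrow> smooth_fn (deriv f) \<and> (f has_real_derivative deriv f x) (at x)"
proof -
  assume "smooth_fn f"
  then obtain f' where f': "smooth_fn f'" "\<And>x. (f has_real_derivative f' x) (at x)" using smooth_fn_deriv by blast
  then have "deriv f = f'" by (auto intro: DERIV_imp_deriv)
  with f' show ?thesis by simp
qed

lemma smooth_fn_derivs: "smooth_fn f \<Longrightarrow> smooth_fn ((deriv ^^ k) f)"
  by (induction k) (auto simp: smooth_fn_deriv')

lemma test_fnI: 
  assumes "smooth_fn f" "compact K" "K \<subseteq> {0<..<pi}" "\<And>x. x \<notin> K \<Longrightarrow> f x = 0"
  shows "test_fn f"
  unfolding test_fn_def using assms smooth_fn_deriv'[OF smooth_fn_derivs[OF assms(1)]] by auto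

lemma test_fn_antideriv:
  assumes "test_fn f" and "\<And>x. (F has_real_derivative f x) (at x)"
    and K: "compact K" "K \<subseteq> {0<..<pi}" "\<And>x. x \<notin> K \<Longrightarrow> F x = 0"
  shows "test_fn F"
proof -
  have d: "deriv F = f" using assms(2) by (auto intro: DERIV_imp_deriv)
  have "((deriv ^^ k) F has_real_derivative (deriv ^^ Suc k) F x) (at x)" for k x
  proof (cases k)
    case 0 then show ?thesis using assms(2) d by simp
  next
    case (Suc j)
    have *: "(deriv ^^ Suc j) F = (deriv ^^ j) f" for j by (simp only: funpow_Suc_right comp_apply d)
    show ?thesis unfolding Suc * using assms(1) by (simp add: test_fn_def)
  qed
  then show ?thesis unfolding test_fn_def using K by blast
qed

lemma test_fn_DERIV: "test_fn f \<Longrightarrow> (f has_real_derivative deriv f x) (at x)"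
  and test_fn_DERIV2: "test_fn f \<Longrightarrow> (deriv f has_real_derivative deriv (deriv f) x) (at x)"
proof -
  assume "test_fn f"
  then have *: "((deriv ^^ k) f has_real_derivative (deriv ^^ Suc k) f x) (at x)" for k by (simp add: test_fn_def)
  show "(f has_real_derivative deriv f x) (at x)" "(deriv f has_real_derivative deriv (deriv f) x) (at x)"
    using *[of 0] *[of 1] by simp_all
qed

lemma test_fn_continuous: "test_fn f \<Longrightarrow> continuous_on A f" "test_fn f \<Longrightarrow> continuous_on A (deriv f)"
  by (meson DERIV_isCont continuous_at_imp_continuous_on test_fn_DERIV test_fn_DERIV2)+

lemma test_fn_boundary: "test_fn f \<Longrightarrow> f 0 = 0" "test_fn f \<Longrightarrow> f pi = 0"
  unfolding test_fn_def by (force)+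

text \<open>On (a, b) this is exp (- c / (x - a) - c / (b - x)). The parameter c is there to be sent
  to 0, where the bumps converge to the indicator of (a, b).\<close>

definition bump :: "real \<Rightarrow> real \<Rightarrow> real \<Rightarrow> real \<Rightarrow> real" where
  "bump a b c x = flat c 1 (x - a) * flat c 1 (b - x)"

lemma bump_eq_0: "x \<notin> {a..b} \<Longrightarrow> bump a b c x = 0"
  by (auto simp: bump_def flat_def)

lemma bump_pos: "a < x \<Longrightarrow> x < b \<Longrightarrow> bump a b c x > 0"
  by (simp add: bump_def flat_def)

lemma bump_bounds: "c > 0 \<Longrightarrow> 0 \<le> bump a b c x \<and> bump a b c x \<le> 1"
  by (auto simp: bump_def flat_def intro!: mult_le_one)

lemma bump_tendsto: "(\<lambda>n. bump a b (1 / real (Suc n)) x) \<longlonglongrightarrow> indicator {a<..<b} x"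
proof -
  have l: "(\<lambda>n. flat (1 / real (Suc n)) 1 y) \<longlonglongrightarrow> (if y > 0 then 1 else 0)" for y
  proof (cases "y > 0")
    case True
    have "(\<lambda>n. exp (- (1 / real (Suc n)) / y)) \<longlonglongrightarrow> exp (- 0 / y)"
      using LIMSEQ_inverse_real_of_nat True by (intro tendsto_intros) (auto simp: inverse_eq_divide)
    then show ?thesis using True by (simp add: flat_def)
  qed (simp add: flat_def)
  show ?thesis using tendsto_mult[OF l[of "x - a"] l[of "b - x"]]
    by (auto simp: bump_def indicator_def split: if_splits)
qed

lemma test_fn_bump: "c > 0 \<Longrightarrow> 0 < a \<Longrightarrow> b < pi \<Longrightarrow> test_fn (bump a b c)"
proof (rule test_fnI[of _ "{a..b}"])
  assume "c > 0"
  then have "smooth_fn (\<lambda>x. flat c 1 (x - a) * flat c 1 (b - x))" by (intro smooth_fn.intros)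
  then show "smooth_fn (bump a b c)" by (simp add: bump_def[abs_def])
qed (auto simp: bump_eq_0)

section \<open>Integration over (0, pi) and separation of functions by test functions\<close>

lemma cont_measurable_Mpi: "continuous_on UNIV f \<Longrightarrow> f \<in> borel_measurable Mpi" for f :: "real \<Rightarrow> 'b::topological_space"
  by (intro borel_measurable_Mpi borel_measurable_continuous_onI)

lemma integral_Mpi: "(LINT x|Mpi. f x) = (LINT x|lborel. indicator {0<..<pi} x *\<^sub>R f x)"
  for f :: "real \<Rightarrow> 'b::{banach, second_countable_topology}"
  unfolding Mpi_def by (rule integral_restrict_space) simp

lemma integral_Mpi_interval: "0 \<le> a \<Longrightarrow> a \<le> b \<Longrightarrow> b \<le> pi \<Longrightarrow>
    (LINT x|Mpi. indicator {a<..<b} x *\<^sub>R f x) = (LBINT x=a..b. f x)"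
  for f :: "real \<Rightarrow> 'b::{banach, second_countable_topology}"
  unfolding integral_Mpi interval_lebesgue_integral_def set_lebesgue_integral_def
  by (auto intro!: Bochner_Integration.integral_cong simp: einterval_def indicator_def)

lemma integral_Mpi_FTC:
  fixes F :: "real \<Rightarrow> 'b::euclidean_space"
  assumes "0 \<le> a" "a \<le> b" "b \<le> pi" "continuous_on {a..b} f"
    and "\<And>x. x \<in> {a..b} \<Longrightarrow> (F has_vector_derivative f x) (at x within {a..b})"
  shows "(LINT x|Mpi. indicator {a<..<b} x *\<^sub>R f x) = F b - F a"
  using assms by (subst integral_Mpi_interval) (auto intro!: interval_integral_FTC_finite)

lemma integrable_Mpi_continuous:
  fixes f :: "real \<Rightarrow> 'b::euclidean_space"
  assumes "continuous_on {0..pi} f" shows "integrable Mpi f"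
proof -
  have "set_integrable lborel {0..pi} f"
    using assms by (rule borel_integrable_atLeastAtMost')
  then have "set_integrable lborel {0<..<pi} f" by (rule set_integrable_subset) auto
  then show ?thesis unfolding Mpi_def by (subst integrable_restrict_space) (auto simp: set_integrable_def)
qed


lemma integrable_Mpi_bounded_mult:
  fixes f g :: fn
  assumes "integrable Mpi f" "g \<in> borel_measurable Mpi" "\<And>x. 0 < x \<Longrightarrow> x < pi \<Longrightarrow> cmod (g x) \<le> C"
  shows "integrable Mpi (\<lambda>x. f x * g x)"
proof (rule Bochner_Integration.integrable_bound)
  show "integrable Mpi (\<lambda>x. of_real C * f x)" using assms by simp
  have "norm (f x * g x) \<le> norm (of_real C * f x)" if "0 < x" "x < pi" for x
    using mult_right_mono[of "cmod (g x)" "\<bar>C\<bar>" "cmod (f x)"] assms(3)[OF that] by (simp add: norm_mult mult.commute)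
  then show "AE x in Mpi. norm (f x * g x) \<le> norm (of_real C * f x)" by (intro AE_I2) simp
qed (use assms in measurable)

lemma integrable_indicator_mult:
  fixes g :: fn
  assumes "integrable Mpi g" "A \<in> sets borel"
  shows "integrable Mpi (\<lambda>x. indicator A x *\<^sub>R g x)"
proof (rule Bochner_Integration.integrable_bound[OF assms(1)])
  have [measurable]: "g \<in> borel_measurable Mpi" using assms by simp
  have [measurable]: "(indicator A :: real \<Rightarrow> real) \<in> borel_measurable Mpi" using assms(2) by (intro borel_measurable_Mpi) simp
  show "(\<lambda>x. indicat_real A x *\<^sub>R g x) \<in> borel_measurable Mpi" by measurable
qed (auto simp: indicator_def)

text \<open>A Dynkin system argument over open intervals. Bumps that are test functions only reach
  intervals staying away from 0 and pi, so the hypothesis is restricted to those; exhausting by such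
  intervals removes the restriction.\<close>

lemma integral_eq_0_on_intervals_imp_AE:
  fixes g :: fn
  assumes g: "integrable Mpi g" and int: "\<And>a b. 0 < a \<Longrightarrow> b < pi \<Longrightarrow> (LINT x|Mpi. indicator {a<..<b} x *\<^sub>R g x) = 0"
  shows "AE x in Mpi. g x = 0"
proof (rule Mpi.density_zero[OF g])
  have [measurable]: "g \<in> borel_measurable Mpi" using g by simp
  have conv: "(LINT x|Mpi. indicator (\<Union>i. A i) x *\<^sub>R g x) = 0"
    if m: "\<And>i. A i \<in> sets borel" and "incseq A" and "\<And>i. (LINT x|Mpi. indicator (A i) x *\<^sub>R g x) = 0" for A :: "nat \<Rightarrow> real set"
  proof -
    have [measurable]: "A i \<in> sets borel" for i by (rule m)
    have "(\<lambda>i. LINT x|Mpi. indicator (A i) x *\<^sub>R g x) \<longlonglongrightarrow> (LINT x|Mpi. indicator (\<Union>i. A i) x *\<^sub>R g x)"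
    proof (rule integral_dominated_convergence[where w="\<lambda>x. norm (g x)"])
      show "AE x in Mpi. (\<lambda>i. indicat_real (A i) x *\<^sub>R g x) \<longlonglongrightarrow> indicat_real (\<Union>i. A i) x *\<^sub>R g x"
        by (intro AE_I2 tendsto_scaleR tendsto_const LIMSEQ_indicator_incseq that)
      show "AE x in Mpi. norm (indicat_real (A i) x *\<^sub>R g x) \<le> norm (g x)" for i
        by (auto simp: indicator_def)
    qed (use g in \<open>auto intro!: borel_measurable_scaleR borel_measurable_Mpi\<close>)
    then show ?thesis using that(3) by (simp add: LIMSEQ_const_iff)
  qed
  have all: "(LINT x|Mpi. indicator {a<..<b} x *\<^sub>R g x) = 0" for a b :: real
  proof -
    define A where "A n = {max a (1 / real (Suc n))<..<min b (pi - 1 / real (Suc n))}" for n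
    have "incseq A"
    proof (rule incseq_SucI)
      fix n
      have "1 / real (Suc (Suc n)) \<le> 1 / real (Suc n)" by (intro divide_left_mono) auto
      then show "A n \<le> A (Suc n)" by (auto simp: A_def)
    qed
    then have "(LINT x|Mpi. indicator (\<Union>i. A i) x *\<^sub>R g x) = 0"
      by (rule conv[rotated]) (auto simp: A_def less_max_iff_disj min_less_iff_disj intro!: int)
    moreover have "x \<in> (\<Union>i. A i) \<longleftrightarrow> x \<in> {a<..<b}" if "0 < x" "x < pi" for x
    proof
      assume x: "x \<in> {a<..<b}"
      have "0 < min x (pi - x)" using that by simp
      from reals_Archimedean[OF this] obtain n where n: "1 / real (Suc n) < min x (pi - x)"
        unfolding inverse_eq_divide by blast
      then show "x \<in> (\<Union>i. A i)" using x that by (auto simp: A_def intro!: exI[of _ n])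
    qed (auto simp: A_def)
    then have "(LINT x|Mpi. indicator (\<Union>i. A i) x *\<^sub>R g x) = (LINT x|Mpi. indicator {a<..<b} x *\<^sub>R g x)"
      by (intro Bochner_Integration.integral_cong) (auto simp: indicator_def)
    ultimately show ?thesis by simp
  qed
  have UN: "(LINT x|Mpi. g x) = 0"
  proof -
    have "(LINT x|Mpi. g x) = (LINT x|Mpi. indicator {-1<..<pi+1} x *\<^sub>R g x)"
      by (rule Bochner_Integration.integral_cong) (auto simp: indicator_def)
    then show ?thesis using all by simp
  qed
  fix A assume A: "A \<in> sets Mpi"
  then have "A \<in> sets borel" by (auto simp: Mpi_def sets_restrict_space)
  then have A: "A \<in> sigma_sets UNIV (range (\<lambda>(a::real, b). {a<..<b}))"
    by (simp add: borel_eq_box box_real)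
  have "(LINT x|Mpi. indicator A x *\<^sub>R g x) = 0"
  proof (rule sigma_sets_induct_disjoint[OF _ _ A, where P="\<lambda>A. (LINT x|Mpi. indicator A x *\<^sub>R g x) = 0"])
    show "Int_stable (range (\<lambda>(a::real, b). {a<..<b}))" by (auto simp: Int_stable_def)
    fix A assume "A \<in> sigma_sets UNIV (range (\<lambda>(a::real, b). {a<..<b}))" and 0: "(LINT x|Mpi. indicator A x *\<^sub>R g x) = 0"
    then have [measurable]: "A \<in> sets borel" by (simp add: borel_eq_box box_real)
    have "(LINT x|Mpi. indicator (UNIV - A) x *\<^sub>R g x) = (LINT x|Mpi. g x - indicator A x *\<^sub>R g x)"
      by (intro Bochner_Integration.integral_cong) (auto simp: indicator_def)
    also have "\<dots> = (LINT x|Mpi. g x) - (LINT x|Mpi. indicator A x *\<^sub>R g x)"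
      using g by (intro Bochner_Integration.integral_diff) (auto intro!: integrable_indicator_mult)
    finally show "(LINT x|Mpi. indicator (UNIV - A) x *\<^sub>R g x) = 0" using UN 0 by simp
  next
    fix A :: "nat \<Rightarrow> real set"
    assume "disjoint_family A" "range A \<subseteq> sigma_sets UNIV (range (\<lambda>(a::real, b). {a<..<b}))"
      and 0: "\<And>i. (LINT x|Mpi. indicator (A i) x *\<^sub>R g x) = 0"
    then have A: "A i \<in> sets borel" for i by (auto simp: borel_eq_box box_real)
    have "(LINT x|Mpi. indicator (\<Union>n. \<Union>i<n. A i) x *\<^sub>R g x) = 0"
    proof (rule conv)
      fix n
      have "(LINT x|Mpi. indicator (\<Union>i<n. A i) x *\<^sub>R g x) = (LINT x|Mpi. (\<Sum>i<n. indicator (A i) x *\<^sub>R g x))"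
        using \<open>disjoint_family A\<close> by (intro Bochner_Integration.integral_cong refl)
          (auto simp: scaleR_sum_left[symmetric] indicator_UN_disjoint disjoint_family_on_def)
      also have "\<dots> = (\<Sum>i<n. (LINT x|Mpi. indicator (A i) x *\<^sub>R g x))"
        using g A by (intro Bochner_Integration.integral_sum integrable_indicator_mult)
      finally show "(LINT x|Mpi. indicator (\<Union>i<n. A i) x *\<^sub>R g x) = 0" using 0 by simp
    next
      show "incseq (\<lambda>n. \<Union>i<n. A i)" by (rule incseq_SucI) (auto simp: lessThan_Suc)
    qed (use A in auto)
    moreover have "(\<Union>n. \<Union>i<n. A i) = (\<Union>i. A i)" by auto
    ultimately show "(LINT x|Mpi. indicator (\<Union>i. A i) x *\<^sub>R g x) = 0" by simp
  qed (use all in auto)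
  then show "set_lebesgue_integral Mpi A g = 0" by (simp add: set_lebesgue_integral_def)
qed


text \<open>Bumps stay between 0 and 1 and converge to interval indicators, so dominated convergence
  carries the orthogonality over to intervals.\<close>

lemma test_fn_orthogonal_imp_AE_0:
  fixes g :: fn
  assumes g: "integrable Mpi g" and orth: "\<And>\<phi>. test_fn \<phi> \<Longrightarrow> (LINT x|Mpi. g x * complex_of_real (\<phi> x)) = 0"
  shows "AE x in Mpi. g x = 0"
proof (rule integral_eq_0_on_intervals_imp_AE[OF g])
  fix a b :: real assume ab: "0 < a" "b < pi"
  have [measurable]: "g \<in> borel_measurable Mpi" using g by simp
  let ?\<phi> = "\<lambda>n. bump a b (1 / real (Suc n))"
  have [measurable]: "(indicator {a<..<b} :: real \<Rightarrow> real) \<in> borel_measurable Mpi"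
    by (intro borel_measurable_Mpi) simp
  have t: "test_fn (?\<phi> n)" for n using ab by (intro test_fn_bump) auto
  have mphi: "?\<phi> n \<in> borel_measurable Mpi" for n
    by (rule cont_measurable_Mpi[OF test_fn_continuous(1)[OF t]])
  have "(\<lambda>n. LINT x|Mpi. g x * complex_of_real (?\<phi> n x)) \<longlonglongrightarrow> (LINT x|Mpi. g x * complex_of_real (indicator {a<..<b} x))"
  proof (rule integral_dominated_convergence[where w="\<lambda>x. norm (g x)"])
    show "AE x in Mpi. (\<lambda>n. g x * complex_of_real (?\<phi> n x)) \<longlonglongrightarrow> g x * complex_of_real (indicator {a<..<b} x)"
      by (intro AE_I2 tendsto_mult tendsto_const tendsto_of_real bump_tendsto)
    show "AE x in Mpi. norm (g x * complex_of_real (?\<phi> n x)) \<le> norm (g x)" for n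
      using bump_bounds[of "1 / real (Suc n)" a b] by (auto simp: norm_mult intro!: AE_I2 mult_left_le)
    show "(\<lambda>x. g x * complex_of_real (indicator {a<..<b} x)) \<in> borel_measurable Mpi"
      by measurable
    show "(\<lambda>x. g x * complex_of_real (?\<phi> n x)) \<in> borel_measurable Mpi" for n
      using measurable_compose[OF mphi[of n], of complex_of_real borel] by (intro borel_measurable_times) auto
    show "integrable Mpi (\<lambda>x. norm (g x))" using g by simp
  qed
  then have "(LINT x|Mpi. g x * complex_of_real (indicator {a<..<b} x)) = 0"
    using orth[OF t] by (simp add: LIMSEQ_const_iff)
  then show "(LINT x|Mpi. indicator {a<..<b} x *\<^sub>R g x) = 0" by (simp add: scaleR_conv_of_real mult.commute)
qed

lemma test_fn_support:
  assumes "test_fn f" obtains a b where "0 < a" "a \<le> b" "b < pi" "\<And>x. x \<notin> {a..b} \<Longrightarrow> f x = 0"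
proof -
  obtain K where K: "compact K" "K \<subseteq> {0<..<pi}" "\<And>x. x \<notin> K \<Longrightarrow> f x = 0" using assms by (auto simp: test_fn_def)
  show ?thesis
  proof (cases "K = {}")
    case True
    then show ?thesis using K by (intro that[of "pi/2" "pi/2"]) auto
  next
    case False
    obtain a b where ab: "a \<in> K" "b \<in> K" "\<And>x. x \<in> K \<Longrightarrow> a \<le> x \<and> x \<le> b"
      using compact_attains_inf[OF K(1) False] compact_attains_sup[OF K(1) False] by metis
    then show ?thesis using K(2,3) by (intro that[of a b]) auto
  qed
qed

text \<open>The primitive starting at 0 is constant on either side of the support of f: zero on the
  left, and the total integral on the right. Mean zero is thus what keeps its support
  compact.\<close>

lemma test_fn_primitive:
  assumes f: "test_fn f" and 0: "(LINT x|Mpi. f x) = 0"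
  shows "\<exists>F. test_fn F \<and> deriv F = f"
proof -
  obtain a b where ab: "0 < a" "a \<le> b" "b < pi" "\<And>x. x \<notin> {a..b} \<Longrightarrow> f x = 0" using test_fn_support[OF f] by blast
  have c: "continuous_on A f" for A by (rule test_fn_continuous[OF f])
  define F where "F x = (LBINT y=0..x. f y)" for x :: real
  have F: "(F has_real_derivative f x) (at x)" for x
  proof -
    have "(F has_vector_derivative f x) (at x within {-\<bar>x\<bar> - 1..\<bar>x\<bar> + 1})"
      unfolding F_def zero_ereal_def by (rule interval_integral_FTC2) (auto intro: c)
    moreover have "x \<in> interior {-\<bar>x\<bar> - 1..\<bar>x\<bar> + 1}" by (auto simp: interior_atLeastAtMost_real)
    ultimately show ?thesis
      using at_within_interior by (metis has_real_derivative_iff_has_vector_derivative)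
  qed
  have "F x = 0" if "x \<notin> {a..b}" for x
  proof (cases "x < a")
    case True
    obtain c where c: "\<And>y. y \<in> {..<a} \<Longrightarrow> F y = c"
      using has_field_derivative_zero_constant[of "{..<a}" F] F ab(4)
      by (metis (no_types, lifting) atLeastAtMost_iff convex_real_interval(4) has_field_derivative_at_within lessThan_iff not_le)
    have "F x = F 0" using c[of x] c[of 0] True ab by simp
    then show ?thesis by (simp add: F_def zero_ereal_def)
  next
    case False
    obtain c where c: "\<And>y. y \<in> {b<..} \<Longrightarrow> F y = c"
      using has_field_derivative_zero_constant[of "{b<..}" F] F ab(4)
      by (metis (no_types, lifting) atLeastAtMost_iff convex_real_interval(3) has_field_derivative_at_within greaterThan_iff not_le)
    have "F x = F pi" using c[of x] c[of pi] False that ab by simp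
    also have "F pi = (LINT x|Mpi. indicator {0<..<pi} x *\<^sub>R f x)"
      unfolding F_def using integral_Mpi_interval[of 0 pi f] by (simp add: zero_ereal_def)
    also have "\<dots> = (LINT x|Mpi. f x)" by (rule Bochner_Integration.integral_cong) auto
    finally show ?thesis using 0 by simp
  qed
  then have "test_fn F" using ab by (intro test_fn_antideriv[OF f F, of "{a..b}"]) auto
  moreover have "deriv F = f" using F by (auto intro: DERIV_imp_deriv)
  ultimately show ?thesis by blast
qed

section \<open>The form domain and the operator\<close>

lemma id_measurable_Mpi [measurable]: "(\<lambda>x. x) \<in> borel_measurable Mpi"
  by (intro borel_measurable_Mpi) simp

lemma integral_Mpi_full: "(LINT x|Mpi. indicator {0<..<pi} x *\<^sub>R f x) = (LINT x|Mpi. f x)"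
  for f :: "real \<Rightarrow> 'b::{banach, second_countable_topology}"
  by (rule Bochner_Integration.integral_cong) auto

lemma AE_Mpi_neq: "AE s in Mpi. s \<noteq> x"
  unfolding Mpi_def by (subst AE_restrict_space_iff) (auto intro: AE_mp[OF AE_lborel_singleton[of x]])

text \<open>The primitive of the difference vanishes on all of [0, pi]; differentiating it recovers
  the difference at every point, the two endpoints included. Boundary values of classes are well
  defined for this reason.\<close>

lemma continuous_AE_eq_Mpi:
  fixes w w' :: fn
  assumes c: "continuous_on {0..pi} w" "continuous_on {0..pi} w'" and ae: "AE x in Mpi. w x = w' x"
    and x: "x \<in> {0..pi}"
  shows "w x = w' x"
proof -
  define h where "h = (\<lambda>x. w x - w' x)"
  have ch: "continuous_on {0..pi} h" unfolding h_def by (intro continuous_intros c)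
  define F where "F x = (LBINT y=0..x. h y)" for x :: real
  have d: "(F has_vector_derivative h y) (at y within {0..pi})" if "y \<in> {0..pi}" for y
    unfolding F_def zero_ereal_def by (rule interval_integral_FTC2) (use that ch in auto)
  have F0: "F y = 0" if "y \<in> {0..pi}" for y
  proof -
    have "F y = (LINT s|Mpi. indicator {0<..<y} s *\<^sub>R h s)"
      unfolding F_def using that integral_Mpi_interval[of 0 y h] by (simp add: zero_ereal_def)
    also have "\<dots> = (LINT s|Mpi. 0)"
    proof (rule integral_cong_AE)
      have "h \<in> borel_measurable Mpi" using integrable_Mpi_continuous[OF ch] by simp
      moreover have "(indicator {0<..<y} :: real \<Rightarrow> real) \<in> borel_measurable Mpi" by (intro borel_measurable_Mpi) simp
      ultimately show "(\<lambda>s. indicat_real {0<..<y} s *\<^sub>R h s) \<in> borel_measurable Mpi" by (rule borel_measurable_scaleR[rotated])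
      show "AE s in Mpi. indicat_real {0<..<y} s *\<^sub>R h s = 0" using ae by (auto simp: h_def elim: eventually_mono)
    qed simp
    finally show ?thesis by simp
  qed
  have "(F has_vector_derivative 0) (at x within {0..pi})"
    by (rule has_vector_derivative_transform[OF x _ has_vector_derivative_const[of 0]]) (simp add: F0)
  then have "h x = 0" using d[OF x] x vector_derivative_unique_within_closed_interval[of 0 pi x F "h x" 0] by (simp add: cbox_interval)
  then show ?thesis by (simp add: h_def)
qed

lemma continuous_on_Icc_bounded:
  fixes f :: "real \<Rightarrow> 'b::real_normed_vector"
  assumes "continuous_on {a..b} f" shows "\<exists>C. \<forall>x\<in>{a..b}. norm (f x) \<le> C"
  using compact_imp_bounded[OF compact_continuous_image[OF assms]] by (auto simp: bounded_iff)

text \<open>The Volterra primitive of g starting at 0, written with a kernel on the whole interval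
  so that \<open>Fubini_kernel\<close> applies.\<close>

definition V :: "fn \<Rightarrow> fn" where
  "V g x = (LINT s|Mpi. (if s < x then 1 else 0) * g s)"

text \<open>Solution operator of v'' = f with v(pi) = v'(pi) = 0. Hence the functions a - Bop f are
  the solutions of - u'' = f with u'(pi) = 0, and a is their value at pi.\<close>

definition Bop :: "fn \<Rightarrow> fn" where
  "Bop f x = (LINT s|Mpi. of_real (max 0 (s - x)) * f s)"

lemma continuous_kernel_integral:
  fixes k :: "real \<Rightarrow> real \<Rightarrow> complex"
  assumes g: "integrable Mpi g" and m[measurable]: "\<And>x. k x \<in> borel_measurable Mpi"
    and C: "\<And>x s. x \<in> {0..pi} \<Longrightarrow> 0 < s \<Longrightarrow> s < pi \<Longrightarrow> cmod (k x s) \<le> C"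
    and cont: "\<And>x s. x \<noteq> s \<Longrightarrow> isCont (\<lambda>x. k x s) x"
  shows "continuous_on {0..pi} (\<lambda>x. LINT s|Mpi. k x s * g s)"
  unfolding continuous_on_sequentially comp_def
proof (intro allI ballI impI, elim conjE)
  fix X :: "nat \<Rightarrow> real" and x assume x: "x \<in> {0..pi}" and X: "\<forall>n. X n \<in> {0..pi}" "X \<longlonglongrightarrow> x"
  have [measurable]: "g \<in> borel_measurable Mpi" using g by simp
  show "(\<lambda>n. LINT s|Mpi. k (X n) s * g s) \<longlonglongrightarrow> (LINT s|Mpi. k x s * g s)"
  proof (rule integral_dominated_convergence[where w="\<lambda>s. \<bar>C\<bar> * norm (g s)"])
    show "AE s in Mpi. (\<lambda>n. k (X n) s * g s) \<longlonglongrightarrow> k x s * g s"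
      using AE_Mpi_neq[of x]
    proof eventually_elim
      case (elim s)
      then have "isCont (\<lambda>x. k x s) x" by (intro cont) auto
      from isCont_tendsto_compose[OF this X(2)] show ?case by (intro tendsto_mult tendsto_const)
    qed
    have "norm (k (X n) s * g s) \<le> \<bar>C\<bar> * norm (g s)" if "0 < s" "s < pi" for n s
    proof -
      have "cmod (k (X n) s) \<le> C" using C[of "X n" s] that X by blast
      then have "cmod (k (X n) s) \<le> \<bar>C\<bar>" by linarith
      then show ?thesis unfolding norm_mult by (rule mult_right_mono) simp
    qed
    then show "AE s in Mpi. norm (k (X n) s * g s) \<le> \<bar>C\<bar> * norm (g s)" for n by (intro AE_I2) simp
  qed (use g in auto)
qed

lemma V_continuous: 
  assumes "integrable Mpi g" shows "continuous_on {0..pi} (V g)"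
  unfolding V_def
proof (rule continuous_kernel_integral[OF assms, where C=1])
  fix x s :: real assume "x \<noteq> s"
  then consider "x < s" | "s < x" by linarith
  then show "isCont (\<lambda>x. if s < x then 1 else 0 :: complex) x"
  proof cases
    case 1
    then have "eventually (\<lambda>y. (if s < y then 1 else 0 :: complex) = 0) (nhds x)"
      using eventually_nhds_in_open[of "{..<s}" x] by (auto elim!: eventually_mono)
    then show ?thesis by (simp add: isCont_cong)
  next
    case 2
    then have "eventually (\<lambda>y. (if s < y then 1 else 0 :: complex) = 1) (nhds x)"
      using eventually_nhds_in_open[of "{s<..}" x] by (auto elim!: eventually_mono)
    then show ?thesis by (simp add: isCont_cong)
  qed
qed auto

lemma Bop_continuous: "integrable Mpi f \<Longrightarrow> continuous_on {0..pi} (Bop f)"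
  unfolding Bop_def by (rule continuous_kernel_integral[where C=pi]) (auto intro!: continuous_intros)

lemma L2_continuous:
  assumes "continuous_on {0..pi} f" shows "L2 f"
proof -
  have m: "f \<in> borel_measurable Mpi" using integrable_Mpi_continuous[OF assms] by simp
  obtain C where "\<forall>x\<in>{0..pi}. cmod (f x) \<le> C" using continuous_on_Icc_bounded[OF assms] by blast
  then show ?thesis by (intro L2_bounded[OF m, of C]) auto
qed

section \<open>Weak derivatives on (0, pi)\<close>

lemma test_fn_lincomb:
  assumes "test_fn f" "test_fn g" shows "test_fn (\<lambda>x. f x + c * g x)"
proof -
  have f: "((deriv ^^ k) f has_real_derivative (deriv ^^ Suc k) f x) (at x)" for k x using assms(1) by (simp add: test_fn_def)
  have g: "((deriv ^^ k) g has_real_derivative (deriv ^^ Suc k) g x) (at x)" for k x using assms(2) by (simp add: test_fn_def)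
  have d: "((\<lambda>x. (deriv ^^ k) f x + c * (deriv ^^ k) g x) has_real_derivative
      (deriv ^^ Suc k) f x + c * (deriv ^^ Suc k) g x) (at x)" for k x
    by (auto intro!: derivative_eq_intros f[of k x] g[of k x])
  have e: "(deriv ^^ k) (\<lambda>x. f x + c * g x) = (\<lambda>x. (deriv ^^ k) f x + c * (deriv ^^ k) g x)" for k
  proof (induction k)
    case (Suc k)
    show ?case using DERIV_imp_deriv[OF d[of k]] by (simp add: Suc fun_eq_iff)
  qed simp
  obtain K K' where "compact K" "K \<subseteq> {0<..<pi}" "\<And>x. x \<notin> K \<Longrightarrow> f x = 0" "compact K'" "K' \<subseteq> {0<..<pi}" "\<And>x. x \<notin> K' \<Longrightarrow> g x = 0"
    using assms unfolding test_fn_def by blast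
  then show ?thesis unfolding test_fn_def e by (intro conjI allI d exI[of _ "K \<union> K'"]) auto
qed

lemma integrable_test_fn: "test_fn \<phi> \<Longrightarrow> integrable Mpi \<phi>" "test_fn \<phi> \<Longrightarrow> integrable Mpi (deriv \<phi>)"
  by (simp_all add: integrable_Mpi_continuous test_fn_continuous)

lemma integrable_mult_test_fn:
  assumes "integrable Mpi u" "continuous_on {0..pi} \<phi>"
  shows "integrable Mpi (\<lambda>x. u x * complex_of_real (\<phi> x))"
proof -
  have m: "(\<lambda>x. complex_of_real (\<phi> x)) \<in> borel_measurable Mpi"
    using assms(2) by (intro borel_measurable_integrable integrable_Mpi_continuous continuous_intros)
  obtain C where "\<forall>x\<in>{0..pi}. norm (\<phi> x) \<le> C" using continuous_on_Icc_bounded[OF assms(2)] by blast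
  then show ?thesis by (intro integrable_Mpi_bounded_mult[OF assms(1) m, of C]) auto
qed

lemma is_weak_deriv_V:
  assumes g: "integrable Mpi g" shows "is_weak_deriv (\<lambda>x. c + V g x) g"
  unfolding is_weak_deriv_def
proof (intro allI impI)
  fix \<phi> assume t: "test_fn \<phi>"
  have cd: "continuous_on A (\<lambda>x. complex_of_real (deriv \<phi> x))" for A
    by (intro continuous_intros test_fn_continuous[OF t])
  have vd: "((\<lambda>x. complex_of_real (\<phi> x)) has_vector_derivative complex_of_real (deriv \<phi> x)) (at x within A)" for x A
    using test_fn_DERIV[OF t, of x] has_vector_derivative_at_within
    by (metis has_vector_derivative_of_real has_real_derivative_iff_has_vector_derivative)
  have FTC: "(LINT x|Mpi. indicator {s<..<pi} x *\<^sub>R complex_of_real (deriv \<phi> x)) = - complex_of_real (\<phi> s)"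
    if "0 \<le> s" "s \<le> pi" for s
    using integral_Mpi_FTC[of s pi "\<lambda>x. complex_of_real (deriv \<phi> x)" "\<lambda>x. complex_of_real (\<phi> x)"] that cd vd
    by (simp add: test_fn_boundary[OF t])
  have i: "integrable Mpi (\<lambda>x. complex_of_real (deriv \<phi> x))" by (rule integrable_Mpi_continuous[OF cd])
  have "(LINT x|Mpi. complex_of_real (deriv \<phi> x) * V g x)
      = (LINT s|Mpi. g s * (LINT x|Mpi. (if s < x then 1 else 0) * complex_of_real (deriv \<phi> x)))"
    unfolding V_def by (rule MM.Fubini_kernel_integral[OF i g, where C=1]) auto
  also have "\<dots> = (LINT s|Mpi. g s * (- complex_of_real (\<phi> s)))"
  proof (rule Bochner_Integration.integral_cong[OF refl])
    fix s assume "s \<in> space Mpi"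
    then have s: "0 < s" "s < pi" by auto
    have "(LINT x|Mpi. (if s < x then 1 else 0) * complex_of_real (deriv \<phi> x))
      = (LINT x|Mpi. indicator {s<..<pi} x *\<^sub>R complex_of_real (deriv \<phi> x))"
      by (rule Bochner_Integration.integral_cong) auto
    then show "g s * (LINT x|Mpi. (if s < x then 1 else 0) * complex_of_real (deriv \<phi> x)) = g s * (- complex_of_real (\<phi> s))"
      using FTC[of s] s by simp
  qed
  finally have 1: "(LINT x|Mpi. complex_of_real (deriv \<phi> x) * V g x) = - (LINT x|Mpi. g x * complex_of_real (\<phi> x))"
    by simp
  have "(LINT x|Mpi. (c + V g x) * complex_of_real (deriv \<phi> x))
     = (LINT x|Mpi. c * complex_of_real (deriv \<phi> x) + complex_of_real (deriv \<phi> x) * V g x)"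
    by (simp add: algebra_simps)
  also have "\<dots> = c * (LINT x|Mpi. complex_of_real (deriv \<phi> x)) + (LINT x|Mpi. complex_of_real (deriv \<phi> x) * V g x)"
    using i integrable_Mpi_continuous[OF continuous_on_mult[OF cd V_continuous[OF g]]]
    by (subst Bochner_Integration.integral_add) auto
  also have "(LINT x|Mpi. complex_of_real (deriv \<phi> x)) = 0"
    using FTC[of 0] integral_Mpi_full[of "\<lambda>x. complex_of_real (deriv \<phi> x)"] by (simp add: test_fn_boundary[OF t])
  finally show "(LINT x|Mpi. (c + V g x) * complex_of_real (deriv \<phi> x)) = - (LINT x|Mpi. g x * complex_of_real (\<phi> x))"
    using 1 by simp
qed

lemma is_weak_deriv_unique:
  assumes "is_weak_deriv u g" "is_weak_deriv u g'" "integrable Mpi g" "integrable Mpi g'"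
  shows "eqae g g'"
proof -
  have "AE x in Mpi. g x - g' x = 0"
  proof (rule test_fn_orthogonal_imp_AE_0)
    fix \<phi> assume t: "test_fn \<phi>"
    have "(LINT x|Mpi. (g x - g' x) * complex_of_real (\<phi> x))
       = (LINT x|Mpi. g x * complex_of_real (\<phi> x)) - (LINT x|Mpi. g' x * complex_of_real (\<phi> x))"
      unfolding left_diff_distrib using assms(3,4) test_fn_continuous[OF t]
      by (intro Bochner_Integration.integral_diff integrable_mult_test_fn)
    also have "\<dots> = 0" proof -
      have "(LINT x|Mpi. g x * complex_of_real (\<phi> x)) = (LINT x|Mpi. g' x * complex_of_real (\<phi> x))"
        using assms(1)[unfolded is_weak_deriv_def, rule_format, OF t] assms(2)[unfolded is_weak_deriv_def, rule_format, OF t]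
        by (metis minus_equation_iff)
      then show ?thesis by simp
    qed
    finally show "(LINT x|Mpi. (g x - g' x) * complex_of_real (\<phi> x)) = 0" .
  qed (use assms in auto)
  then show ?thesis unfolding eqae_def by simp
qed

text \<open>Du Bois-Reymond: adding a multiple of one fixed bump \<eta> turns any test function into
  one of mean zero, which is the derivative of a test function and so annihilated by u. The constant
  is the \<eta>-weighted mean of u.\<close>

lemma is_weak_deriv_0_imp_const:
  assumes u: "integrable Mpi u" and 0: "is_weak_deriv u (\<lambda>x. 0)"
  shows "\<exists>c. eqae u (\<lambda>x. c)"
proof -
  define \<eta> where "\<eta> = bump 1 2 1"
  have te: "test_fn \<eta>" unfolding \<eta>_def using pi_gt3 by (intro test_fn_bump) auto
  define I where "I = (LINT x|Mpi. \<eta> x)"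
  have "I \<noteq> 0"
  proof
    assume "I = 0"
    then have "AE x in Mpi. \<eta> x = 0"
      using integral_nonneg_eq_0_iff_AE[OF integrable_test_fn(1)[OF te]] bump_bounds[of 1 1 2] by (simp add: I_def \<eta>_def)
    then have "complex_of_real (\<eta> (3/2)) = 0"
      by (intro continuous_AE_eq_Mpi[where w'="\<lambda>x. 0"] continuous_intros test_fn_continuous[OF te]) (use pi_gt3 in auto)
    then show False using bump_pos[of 1 "3/2" 2 1] by (simp add: \<eta>_def)
  qed
  define c where "c = (LINT x|Mpi. u x * complex_of_real (\<eta> x)) / of_real I"
  have "AE x in Mpi. u x - c = 0"
  proof (rule test_fn_orthogonal_imp_AE_0)
    fix \<psi> assume t: "test_fn \<psi>"
    define r where "r = - (LINT x|Mpi. \<psi> x) / I"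
    have tf: "test_fn (\<lambda>x. \<psi> x + r * \<eta> x)" by (rule test_fn_lincomb[OF t te])
    have "(LINT x|Mpi. \<psi> x + r * \<eta> x) = 0"
      using integrable_test_fn(1)[OF t] integrable_test_fn(1)[OF te] \<open>I \<noteq> 0\<close> by (simp add: r_def I_def[symmetric])
    then obtain F where F: "test_fn F" "deriv F = (\<lambda>x. \<psi> x + r * \<eta> x)" using test_fn_primitive[OF tf] by blast
    have "(LINT x|Mpi. u x * complex_of_real (deriv F x)) = 0" using 0 F(1) by (simp add: is_weak_deriv_def)
    also have "(LINT x|Mpi. u x * complex_of_real (deriv F x)) =
       (LINT x|Mpi. u x * complex_of_real (\<psi> x) + of_real r * (u x * complex_of_real (\<eta> x)))"
      by (simp add: F(2) algebra_simps)
    also have "\<dots> = (LINT x|Mpi. u x * complex_of_real (\<psi> x)) + of_real r * (LINT x|Mpi. u x * complex_of_real (\<eta> x))"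
      using integrable_mult_test_fn[OF u test_fn_continuous(1)[OF t]] integrable_mult_test_fn[OF u test_fn_continuous(1)[OF te]]
      by (subst Bochner_Integration.integral_add) auto
    finally have 1: "(LINT x|Mpi. u x * complex_of_real (\<psi> x)) = c * complex_of_real (LINT x|Mpi. \<psi> x)"
      using \<open>I \<noteq> 0\<close> by (simp add: c_def r_def field_simps)
    have "(LINT x|Mpi. (u x - c) * complex_of_real (\<psi> x)) = (LINT x|Mpi. u x * complex_of_real (\<psi> x)) - (LINT x|Mpi. c * complex_of_real (\<psi> x))"
      unfolding left_diff_distrib
      using integrable_mult_test_fn[OF u test_fn_continuous(1)[OF t]] integrable_test_fn(1)[OF t]
      by (intro Bochner_Integration.integral_diff) auto
    then show "(LINT x|Mpi. (u x - c) * complex_of_real (\<psi> x)) = 0" using 1 by simp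
  qed (use u in auto)
  then show ?thesis unfolding eqae_def by auto
qed

lemma weak_deriv_repr:
  assumes u: "integrable Mpi u" and g: "integrable Mpi g" and w: "is_weak_deriv u g"
  shows "\<exists>c. eqae u (\<lambda>x. c + V g x)"
proof -
  have i: "integrable Mpi (V g)" by (intro integrable_Mpi_continuous V_continuous g)
  have "is_weak_deriv (\<lambda>x. u x - V g x) (\<lambda>x. 0)"
    unfolding is_weak_deriv_def
  proof (intro allI impI)
    fix \<phi> assume t: "test_fn \<phi>"
    have "(LINT x|Mpi. (u x - V g x) * complex_of_real (deriv \<phi> x))
      = (LINT x|Mpi. u x * complex_of_real (deriv \<phi> x)) - (LINT x|Mpi. V g x * complex_of_real (deriv \<phi> x))"
      unfolding left_diff_distrib using u i test_fn_continuous(2)[OF t]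
      by (intro Bochner_Integration.integral_diff integrable_mult_test_fn)
    also have "\<dots> = 0" using w is_weak_deriv_V[OF g, of 0] t by (simp add: is_weak_deriv_def)
    finally show "(LINT x|Mpi. (u x - V g x) * complex_of_real (deriv \<phi> x)) = - (LINT x|Mpi. 0 * complex_of_real (\<phi> x))"
      by simp
  qed
  then obtain c where "eqae (\<lambda>x. u x - V g x) (\<lambda>x. c)" using is_weak_deriv_0_imp_const u i by blast
  then show ?thesis unfolding eqae_def by (intro exI[of _ c]) (auto elim!: eventually_mono simp: algebra_simps)
qed

lemma H1_wderiv: "H1 u \<Longrightarrow> L2 (wderiv u) \<and> is_weak_deriv u (wderiv u)"
  unfolding H1_def wderiv_def using someI_ex[of "\<lambda>g. L2 g \<and> is_weak_deriv u g"] by blast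

lemma cont_rep_eq:
  assumes c: "continuous_on {0..pi} w" and e: "eqae w u" and x: "x \<in> {0..pi}"
  shows "cont_rep u x = w x"
proof -
  have "continuous_on {0..pi} (cont_rep u) \<and> (AE x in Mpi. cont_rep u x = u x)"
    unfolding cont_rep_def by (rule someI[of _ w]) (use c e in \<open>simp add: eqae_def\<close>)
  then show ?thesis using eqae_trans[of "cont_rep u" u w] eqae_sym[OF e]
    by (intro continuous_AE_eq_Mpi[OF _ c _ x]) (auto simp: eqae_def)
qed

lemma H1_repr:
  assumes "H1 u"
  shows "\<exists>c. eqae u (\<lambda>x. c + V (wderiv u) x) \<and> (\<forall>x\<in>{0..pi}. cont_rep u x = c + V (wderiv u) x)"
proof -
  have *: "integrable Mpi u" "integrable Mpi (wderiv u)" "is_weak_deriv u (wderiv u)"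
    using assms H1_wderiv by (auto intro: L2_integrable simp: H1_def)
  obtain c where c: "eqae u (\<lambda>x. c + V (wderiv u) x)" using weak_deriv_repr[OF *] by blast
  moreover have "continuous_on {0..pi} (\<lambda>x. c + V (wderiv u) x)" by (intro continuous_intros V_continuous *)
  ultimately show ?thesis using cont_rep_eq[OF _ eqae_sym] by blast
qed

lemma H1_V:
  assumes g: "L2 g" and u: "L2 u" "eqae u (\<lambda>x. c + V g x)"
  shows "H1 u" "eqae (wderiv u) g" "x \<in> {0..pi} \<Longrightarrow> cont_rep u x = c + V g x"
proof -
  have i: "integrable Mpi g" by (rule L2_integrable[OF g])
  have c: "continuous_on {0..pi} (\<lambda>x. c + V g x)" by (intro continuous_intros V_continuous i)
  have "is_weak_deriv u g"
    unfolding is_weak_deriv_def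
  proof (intro allI impI)
    fix \<phi> assume t: "test_fn \<phi>"
    have "(LINT x|Mpi. u x * complex_of_real (deriv \<phi> x)) = (LINT x|Mpi. (c + V g x) * complex_of_real (deriv \<phi> x))"
    proof (rule integral_cong_AE)
      show "AE x in Mpi. u x * complex_of_real (deriv \<phi> x) = (c + V g x) * complex_of_real (deriv \<phi> x)"
        using u(2) unfolding eqae_def by eventually_elim simp
    qed (intro borel_measurable_integrable integrable_mult_test_fn test_fn_continuous[OF t]
          L2_integrable u(1) integrable_Mpi_continuous[OF c])+
    then show "(LINT x|Mpi. u x * complex_of_real (deriv \<phi> x)) = - (LINT x|Mpi. g x * complex_of_real (\<phi> x))"
      using is_weak_deriv_V[OF i, of c] t by (simp add: is_weak_deriv_def)
  qed
  then show H: "H1 u" using g u by (auto simp: H1_def)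
  show "eqae (wderiv u) g"
    using H1_wderiv[OF H] \<open>is_weak_deriv u g\<close> by (intro is_weak_deriv_unique[of u] L2_integrable i) auto
  show "x \<in> {0..pi} \<Longrightarrow> cont_rep u x = c + V g x" by (rule cont_rep_eq[OF c eqae_sym[OF u(2)]])
qed


text \<open>The integral of f from x to pi (see \<open>Tail_eq\<close>), which is u' for a solution
  of - u'' = f with u'(pi) = 0. In this form continuity is inherited from \<open>V\<close>.\<close>

definition Tail :: "fn \<Rightarrow> fn" where
  "Tail f x = (LINT s|Mpi. f s) - V f x"

lemma Tail_eq: 
  assumes "integrable Mpi f" shows "(LINT s|Mpi. (if x < s then 1 else 0) * f s) = Tail f x"
proof -
  have [measurable]: "f \<in> borel_measurable Mpi" using assms by simp
  have 1: "integrable Mpi (\<lambda>s. (if s < x then 1 else 0) * f s)"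
    using integrable_Mpi_bounded_mult[OF assms, of "\<lambda>s. if s < x then 1 else 0" 1] by (simp add: mult.commute)
  have "(LINT s|Mpi. (if x < s then 1 else 0) * f s) = (LINT s|Mpi. f s - (if s < x then 1 else 0) * f s)"
  proof (rule integral_cong_AE)
    show "AE s in Mpi. (if x < s then 1 else 0) * f s = f s - (if s < x then 1 else 0) * f s"
      using AE_Mpi_neq[of x] by eventually_elim auto
  qed measurable
  also have "\<dots> = Tail f x" unfolding Tail_def V_def by (rule Bochner_Integration.integral_diff[OF assms 1])
  finally show ?thesis .
qed

lemma Tail_continuous: "integrable Mpi f \<Longrightarrow> continuous_on {0..pi} (Tail f)"
  unfolding Tail_def by (intro continuous_intros V_continuous)

lemma V_Tail:
  assumes f: "integrable Mpi f" and x: "x \<in> {0..pi}"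
  shows "V (Tail f) x = V (Tail f) pi - Bop f x"
proof -
  have [measurable]: "f \<in> borel_measurable Mpi" using f by simp
  have *: "V (Tail f) y = (LINT r|Mpi. of_real (min r y) * f r)" if y: "y \<in> {0..pi}" for y
  proof -
    have "V (Tail f) y = (LINT s|Mpi. (if s < y then 1 else 0) * (LINT r|Mpi. (if s < r then 1 else 0) * f r))"
      unfolding V_def by (simp add: Tail_eq[OF f])
    also have "\<dots> = (LINT r|Mpi. f r * (LINT s|Mpi. (if s < r then 1 else 0) * (if s < y then 1 else 0)))"
    proof (rule MM.Fubini_kernel_integral[where C=1, OF _ f])
      show "integrable Mpi (\<lambda>s. if s < y then 1 else 0 :: complex)"
        by (rule Mpi.integrable_const_bound[where B=1]) auto
    qed auto
    also have "\<dots> = (LINT r|Mpi. of_real (min r y) * f r)"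
    proof (rule Bochner_Integration.integral_cong[OF refl])
      fix r assume "r \<in> space Mpi"
      then have r: "0 < r" "r < pi" by auto
      have "(LINT s|Mpi. (if s < r then 1 else 0) * (if s < y then 1 else 0))
         = (LINT s|Mpi. indicator {0<..<min r y} s *\<^sub>R (1 :: complex))"
        by (rule Bochner_Integration.integral_cong) auto
      also have "\<dots> = of_real (min r y) - of_real 0"
        using r y by (intro integral_Mpi_FTC) (auto intro!: derivative_eq_intros)
      finally show "f r * (LINT s|Mpi. (if s < r then 1 else 0) * (if s < y then 1 else 0)) = of_real (min r y) * f r"
        by simp
    qed
    finally show ?thesis .
  qed
  have i: "integrable Mpi (\<lambda>r. of_real (min r y) * f r)" if "y \<in> {0..pi}" for y
    using integrable_Mpi_bounded_mult[OF f, of "\<lambda>r. of_real (min r y)" pi] that by (simp add: mult.commute min_def)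
  have ib: "integrable Mpi (\<lambda>r. of_real (max 0 (r - x)) * f r)"
    using integrable_Mpi_bounded_mult[OF f, of "\<lambda>r. of_real (max 0 (r - x))" pi] x by (simp add: mult.commute max_def)
  have "V (Tail f) pi - Bop f x = (LINT r|Mpi. of_real (min r pi) * f r - of_real (max 0 (r - x)) * f r)"
    unfolding *[of pi, simplified] Bop_def by (rule Bochner_Integration.integral_diff[symmetric, OF i ib]) simp
  \<comment> \<open>Pointwise min r pi - max 0 (r - x) = min r x for r in (0, pi).\<close>
  also have "\<dots> = (LINT r|Mpi. of_real (min r x) * f r)"
    by (rule Bochner_Integration.integral_cong) (auto simp: min_def max_def algebra_simps)
  finally show ?thesis using * x by simp
qed

lemma aform_eq: "aform \<beta> u v = inner_L2 (wderiv u) (wderiv v) + of_real \<beta> * cont_rep u pi * cnj (cont_rep v 0)"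
  by (simp add: aform_def)

text \<open>Integration by parts for an f that is merely L2: d is the value of v at 0 and k its
  derivative, and Fubini moves the integration from k to f.\<close>

lemma inner_L2_V:
  assumes f: "L2 f" and k: "L2 k" and v: "L2 v" "eqae v (\<lambda>x. d + V k x)"
  shows "inner_L2 f v = cnj d * (LINT x|Mpi. f x) + inner_L2 (Tail f) k"
proof -
  have i: "integrable Mpi f" "integrable Mpi k" "integrable Mpi (\<lambda>x. cnj (k x))"
    using f k by (auto intro: L2_integrable L2_cnj)
  have V: "L2 (V k)" by (intro L2_continuous V_continuous i)
  have cV: "cnj (V k x) = (LINT s|Mpi. (if s < x then 1 else 0) * cnj (k s))" for x
    unfolding V_def Bochner_Integration.integral_cnj[symmetric] by (rule Bochner_Integration.integral_cong) auto
  have "inner_L2 f v = inner_L2 f (\<lambda>x. d + V k x)"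
    using f v V by (intro inner_L2_cong L2_add) auto
  also have "\<dots> = (LINT x|Mpi. cnj d * f x + f x * cnj (V k x))"
    by (simp add: inner_L2_def algebra_simps)
  also have "\<dots> = cnj d * (LINT x|Mpi. f x) + (LINT x|Mpi. f x * cnj (V k x))"
    using i L2_integrable_cnj[OF f V] by (subst Bochner_Integration.integral_add) auto
  also have "(LINT x|Mpi. f x * cnj (V k x)) = (LINT x|Mpi. f x * (LINT s|Mpi. (if s < x then 1 else 0) * cnj (k s)))"
    by (simp add: cV)
  also have "\<dots> = (LINT s|Mpi. cnj (k s) * (LINT x|Mpi. (if s < x then 1 else 0) * f x))"
    by (rule MM.Fubini_kernel_integral[OF i(1,3), where C=1]) auto
  also have "\<dots> = inner_L2 (Tail f) k" unfolding Tail_eq[OF i(1)] inner_L2_def by (simp only: mult.commute)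
  finally show ?thesis .
qed

text \<open>An H1 test function is freely given by its value d at 0 and its derivative k. Taking k =
  0 isolates the boundary condition u'(0) = \<integral> f = \<beta> u(pi); taking d = 0 gives u' =
  \<open>Tail f\<close>. The number a is u(pi).\<close>

theorem opA_iff:
  "opA \<beta> u f \<longleftrightarrow> L2 u \<and> L2 f \<and> (\<exists>a. eqae u (\<lambda>x. a - Bop f x) \<and> (LINT s|Mpi. f s) = of_real \<beta> * a)"
proof (intro iffI conjI)
  assume A: "opA \<beta> u f"
  then have H: "H1 u" and f: "L2 f" and eq: "\<And>v. H1 v \<Longrightarrow> aform \<beta> u v = inner_L2 f v" by (auto simp: opA_def)
  show u: "L2 u" using H by (simp add: H1_def)
  show "L2 f" by fact
  have i: "integrable Mpi f" by (rule L2_integrable[OF f])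
  let ?g = "wderiv u"
  have g: "L2 ?g" using H1_wderiv[OF H] by simp
  obtain c where c: "eqae u (\<lambda>x. c + V ?g x)" "\<And>x. x \<in> {0..pi} \<Longrightarrow> cont_rep u x = c + V ?g x"
    using H1_repr[OF H] by blast
  have eq': "inner_L2 ?g k + of_real \<beta> * cont_rep u pi * cnj d = cnj d * (LINT x|Mpi. f x) + inner_L2 (Tail f) k"
    if k: "L2 k" for k d
  proof -
    let ?v = "\<lambda>x. d + V k x"
    have v: "L2 ?v" by (intro L2_continuous continuous_intros V_continuous L2_integrable k)
    note v' = H1_V[OF k v eqae_refl]
    have "V k 0 = (LINT s|Mpi. 0)" unfolding V_def by (rule Bochner_Integration.integral_cong) auto
    then have "cont_rep ?v 0 = d" using v'(3)[of 0] by simp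
    moreover have "inner_L2 ?g (wderiv ?v) = inner_L2 ?g k"
      using g k v'(2) H1_wderiv[OF v'(1)] by (intro inner_L2_cong) auto
    ultimately show ?thesis using eq[OF v'(1)] inner_L2_V[OF f k v eqae_refl] by (simp add: aform_eq)
  qed
  have bc: "(LINT s|Mpi. f s) = of_real \<beta> * cont_rep u pi"
    using eq'[of "\<lambda>x. 0" 1] by (simp add: inner_L2_def)
  have T: "L2 (Tail f)" by (intro L2_continuous Tail_continuous i)
  define h where "h = (\<lambda>x. ?g x - Tail f x)"
  have h: "L2 h" unfolding h_def by (intro L2_diff g T)
  \<comment> \<open>The difference h itself serves as the derivative of the test function, so it is
    orthogonal to itself.\<close>
  have "inner_L2 ?g h = inner_L2 (Tail f) h" using eq'[OF h, of 0] by simp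
  then have "inner_L2 h h = 0"
    unfolding h_def using g T h[unfolded h_def]
    by (subst inner_L2_def, simp add: left_diff_distrib)
      (subst Bochner_Integration.integral_diff, auto simp: inner_L2_def intro!: L2_integrable_cnj[of _ "\<lambda>x. ?g x - Tail f x", simplified])
  then have "norm (abs_l2 h) = 0" using h by (simp add: norm_eq_sqrt_inner inner_abs_l2)
  then have "abs_l2 ?g = abs_l2 (Tail f)" using g T by (simp add: h_def abs_l2_diff)
  then have gT: "eqae ?g (Tail f)" using g T by (simp add: abs_l2_eq_iff)
  have VV: "V ?g x = V (Tail f) x" for x
    unfolding V_def
  proof (rule integral_cong_AE)
    show "AE s in Mpi. (if s < x then 1 else 0) * ?g s = (if s < x then 1 else 0) * Tail f s"
      using gT unfolding eqae_def by eventually_elim simp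
  qed (use g T in measurable)
  show "\<exists>a. eqae u (\<lambda>x. a - Bop f x) \<and> (LINT s|Mpi. f s) = of_real \<beta> * a"
  proof (intro exI conjI)
    show "(LINT s|Mpi. f s) = of_real \<beta> * cont_rep u pi" by (rule bc)
    have "c + V ?g x = cont_rep u pi - Bop f x" if "x \<in> {0..pi}" for x
      using V_Tail[OF i that] c(2)[of pi] by (simp add: VV)
    then have "eqae (\<lambda>x. c + V ?g x) (\<lambda>x. cont_rep u pi - Bop f x)" unfolding eqae_def by (intro AE_I2) auto
    then show "eqae u (\<lambda>x. cont_rep u pi - Bop f x)" using c(1) eqae_trans by blast
  qed
next
  assume "L2 u \<and> L2 f \<and> (\<exists>a. eqae u (\<lambda>x. a - Bop f x) \<and> (LINT s|Mpi. f s) = of_real \<beta> * a)"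
  then obtain a where u: "L2 u" and f: "L2 f" and a: "eqae u (\<lambda>x. a - Bop f x)" "(LINT s|Mpi. f s) = of_real \<beta> * a" by blast
  have i: "integrable Mpi f" by (rule L2_integrable[OF f])
  have T: "L2 (Tail f)" by (intro L2_continuous Tail_continuous i)
  define c where "c = a - V (Tail f) pi"
  have ac: "a - Bop f x = c + V (Tail f) x" if "x \<in> {0..pi}" for x using V_Tail[OF i that] by (simp add: c_def)
  then have "eqae (\<lambda>x. a - Bop f x) (\<lambda>x. c + V (Tail f) x)" unfolding eqae_def by (intro AE_I2) auto
  then have uc: "eqae u (\<lambda>x. c + V (Tail f) x)" using a(1) eqae_trans by blast
  note H = H1_V[OF T u uc]
  have "aform \<beta> u v = inner_L2 f v" if v: "H1 v" for v
  proof -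
    obtain d where d: "eqae v (\<lambda>x. d + V (wderiv v) x)" "\<And>x. x \<in> {0..pi} \<Longrightarrow> cont_rep v x = d + V (wderiv v) x"
      using H1_repr[OF v] by blast
    have L: "L2 v" "L2 (wderiv v)" using v H1_wderiv[OF v] by (auto simp: H1_def)
    have "V (wderiv v) 0 = (LINT s|Mpi. 0)" unfolding V_def by (rule Bochner_Integration.integral_cong) auto
    then have "cont_rep v 0 = d" using d(2)[of 0] by simp
    moreover have "cont_rep u pi = a" using H(3)[of pi] by (simp add: c_def)
    moreover have "inner_L2 (wderiv u) (wderiv v) = inner_L2 (Tail f) (wderiv v)"
      using H(1,2) T L H1_wderiv[OF H(1)] by (intro inner_L2_cong) auto
    ultimately show ?thesis using inner_L2_V[OF f L(2) L(1) d(1)] a(2) by (simp add: aform_eq)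
  qed
  then show "opA \<beta> u f" using H(1) f by (simp add: opA_def)
qed

section \<open>Convolution with rapidly decreasing kernels\<close>

declare id_measurable_Mpi [measurable del]

lemma norm_integral_le:
  fixes f :: "'a \<Rightarrow> 'b::{banach, second_countable_topology}"
  assumes "integrable M f" "integrable M g" "\<And>x. norm (f x) \<le> g x"
  shows "norm (integral\<^sup>L M f) \<le> integral\<^sup>L M g"
  using assms by (intro order_trans[OF integral_norm_bound Bochner_Integration.integral_mono] integrable_norm)

text \<open>Exponential growth in an integrated sense. The norms of the blocks of \<open>ext\<close>
  grow at most geometrically, so its result is in general neither bounded nor integrable, and this
  weighted condition is what remains.\<close>

definition egrow :: "real \<Rightarrow> fn \<Rightarrow> bool" where
  "egrow c H \<longleftrightarrow> c \<ge> 0 \<and> H \<in> borel_measurable borel \<and> integrable lborel (\<lambda>y. complex_of_real (exp (- c * \<bar>y\<bar>)) * H y)"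

text \<open>Decay beyond every exponential rate rather than one fixed rate, because the growth rate
  provided for \<open>J\<close> and \<open>conv\<close> rises by 1 at each application.\<close>

definition fast :: "(real \<Rightarrow> real) \<Rightarrow> bool" where
  "fast k \<longleftrightarrow> continuous_on UNIV k \<and> (\<forall>c. \<exists>C. \<forall>z. \<bar>k z\<bar> \<le> C * exp (- c * \<bar>z\<bar>))"

definition conv :: "(real \<Rightarrow> real) \<Rightarrow> fn \<Rightarrow> fn" where
  "conv k H z = (LINT y|lborel. complex_of_real (k (z - y)) * H y)"

text \<open>The signed indicator that writes an oriented integral from 0 to z as an integral over
  the line. It treats both signs of z at once and fits \<open>Fubini_kernel\<close>.\<close>

definition jk :: "real \<Rightarrow> real \<Rightarrow> real" where
  "jk z y = (if 0 < y \<and> y < z then 1 else if z < y \<and> y < 0 then -1 else 0)"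

text \<open>The oriented primitive \<open>\<integral>\<^sub>0\<^sup>z H\<close>.\<close>

definition J :: "fn \<Rightarrow> fn" where
  "J H z = (LINT y|lborel. complex_of_real (jk z y) * H y)"

lemma egrow_measurable [measurable_dest]: "egrow c H \<Longrightarrow> H \<in> borel_measurable borel"
  by (simp add: egrow_def)

lemma egrow_mono:
  assumes "egrow c H" "c \<le> d" shows "egrow d H"
  unfolding egrow_def
proof (intro conjI)
  have [measurable]: "H \<in> borel_measurable borel" using assms by (simp add: egrow_def)
  show "integrable lborel (\<lambda>y. complex_of_real (exp (- d * \<bar>y\<bar>)) * H y)"
  proof (rule Bochner_Integration.integrable_bound)
    show "integrable lborel (\<lambda>y. complex_of_real (exp (- c * \<bar>y\<bar>)) * H y)" using assms by (simp add: egrow_def)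
    have "norm (complex_of_real (exp (- d * \<bar>y\<bar>)) * H y) \<le> norm (complex_of_real (exp (- c * \<bar>y\<bar>)) * H y)" for y
      using assms(2) unfolding norm_mult by (intro mult_right_mono) (auto intro: mult_right_mono)
    then show "AE y in lborel. norm (complex_of_real (exp (- d * \<bar>y\<bar>)) * H y) \<le> norm (complex_of_real (exp (- c * \<bar>y\<bar>)) * H y)"
      by simp
  qed measurable
qed (use assms in \<open>auto simp: egrow_def\<close>)

lemma fast_measurable [measurable_dest]: "fast k \<Longrightarrow> k \<in> borel_measurable borel"
  by (simp add: fast_def borel_measurable_continuous_onI)

lemma integrable_exp_neg_abs:
  fixes a :: real
  assumes "a > 0" shows "integrable lborel (\<lambda>y. exp (- a * \<bar>y\<bar>))"
proof (rule Bochner_Integration.integrableI_nonneg)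
  have 1: "(\<integral>\<^sup>+y. ennreal (exp (- a * y)) * indicator {0..} y \<partial>lborel) = ennreal (0 - (- exp (- a * 0) / a))"
  proof (rule nn_integral_FTC_atLeast)
    show "((\<lambda>y. - exp (- a * y) / a) has_real_derivative exp (- a * y)) (at y)" for y
      using assms by (auto intro!: derivative_eq_intros)
    have "((\<lambda>y. exp (- (a * y))) \<longlongrightarrow> 0) at_top"
      using assms by (intro filterlim_compose[OF exp_at_bot] filterlim_compose[OF filterlim_uminus_at_bot_at_top]
        filterlim_tendsto_pos_mult_at_top[OF tendsto_const _ filterlim_ident])
    from tendsto_divide[OF tendsto_minus[OF this] tendsto_const[of a]] assms
    show "((\<lambda>y. - exp (- a * y) / a) \<longlongrightarrow> 0) at_top" by simp
  qed auto
  have "(\<integral>\<^sup>+y. ennreal (exp (- a * \<bar>y\<bar>)) \<partial>lborel)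
      \<le> (\<integral>\<^sup>+y. ennreal (exp (- a * y)) * indicator {0..} y + ennreal (exp (a * y)) * indicator {..0} y \<partial>lborel)"
    by (intro nn_integral_mono) (auto simp: indicator_def)
  also have "\<dots> = (\<integral>\<^sup>+y. ennreal (exp (- a * y)) * indicator {0..} y \<partial>lborel) + (\<integral>\<^sup>+y. ennreal (exp (a * y)) * indicator {..0} y \<partial>lborel)"
    by (rule nn_integral_add) auto
  also have "(\<integral>\<^sup>+y. ennreal (exp (a * y)) * indicator {..0} y \<partial>lborel) = (\<integral>\<^sup>+y. ennreal (exp (- a * y)) * indicator {0..} y \<partial>lborel)"
    by (subst nn_integral_real_affine[of _ "-1" 0]) (auto intro!: nn_integral_cong simp: indicator_def)
  finally show "(\<integral>\<^sup>+y. ennreal (exp (- a * \<bar>y\<bar>)) \<partial>lborel) < \<infinity>"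
    unfolding 1 by (rule le_less_trans) (simp add: ennreal_plus[symmetric] del: ennreal_plus)
qed auto

text \<open>Since |y| is at most |z| + |z - y|, decay in z - y at rate c splits into growth in z and
  decay in y. This separates the variables in the convolution estimates.\<close>

lemma fast_bound:
  assumes "fast k" "c \<ge> 0"
  shows "\<exists>C\<ge>0. \<forall>z y. \<bar>k (z - y)\<bar> \<le> C * exp (c * \<bar>z\<bar>) * exp (- c * \<bar>y\<bar>)"
proof -
  obtain C where C: "\<And>z. \<bar>k z\<bar> \<le> C * exp (- c * \<bar>z\<bar>)" using assms by (auto simp: fast_def)
  have C0: "C \<ge> 0" using C[of 0] by simp
  have "\<bar>k (z - y)\<bar> \<le> C * exp (c * \<bar>z\<bar>) * exp (- c * \<bar>y\<bar>)" for z y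
  proof -
    have "c * \<bar>y\<bar> \<le> c * (\<bar>z\<bar> + \<bar>z - y\<bar>)" using assms(2) by (intro mult_left_mono) auto
    then have "exp (- c * \<bar>z - y\<bar>) \<le> exp (c * \<bar>z\<bar>) * exp (- c * \<bar>y\<bar>)"
      by (subst exp_add[symmetric]) (simp add: algebra_simps)
    then have "C * exp (- c * \<bar>z - y\<bar>) \<le> C * (exp (c * \<bar>z\<bar>) * exp (- c * \<bar>y\<bar>))"
      using C0 by (rule mult_left_mono)
    with C[of "z - y"] show ?thesis by (simp add: mult.assoc)
  qed
  with C0 show ?thesis by blast
qed

lemma fast_exp_integrable:
  assumes k: "fast k"
  shows "integrable lborel (\<lambda>y. k (z - y) * exp (c * \<bar>y\<bar>))"
proof -
  have [measurable]: "k \<in> borel_measurable borel" using k by measurable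
  define d where "d = \<bar>c\<bar> + 1"
  obtain C where C: "C \<ge> 0" "\<And>z y. \<bar>k (z - y)\<bar> \<le> C * exp (d * \<bar>z\<bar>) * exp (- d * \<bar>y\<bar>)"
    using fast_bound[OF k, of d] by (auto simp: d_def)
  show ?thesis
  proof (rule Bochner_Integration.integrable_bound)
    show "integrable lborel (\<lambda>y. C * exp (d * \<bar>z\<bar>) * exp (- 1 * \<bar>y\<bar>))"
      by (intro Bochner_Integration.integrable_mult_right integrable_exp_neg_abs) simp
    have "norm (k (z - y) * exp (c * \<bar>y\<bar>)) \<le> norm (C * exp (d * \<bar>z\<bar>) * exp (- 1 * \<bar>y\<bar>))" for y
    proof -
      have "c * \<bar>y\<bar> \<le> \<bar>c\<bar> * \<bar>y\<bar>" by (intro mult_right_mono) auto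
      then have "exp (- d * \<bar>y\<bar>) * exp (c * \<bar>y\<bar>) \<le> exp (- 1 * \<bar>y\<bar>)"
        by (subst exp_add[symmetric]) (simp add: d_def algebra_simps)
      then have "C * exp (d * \<bar>z\<bar>) * (exp (- d * \<bar>y\<bar>) * exp (c * \<bar>y\<bar>)) \<le> C * exp (d * \<bar>z\<bar>) * exp (- 1 * \<bar>y\<bar>)"
        using C(1) by (intro mult_left_mono) auto
      moreover have "\<bar>k (z - y)\<bar> * exp (c * \<bar>y\<bar>) \<le> C * exp (d * \<bar>z\<bar>) * exp (- d * \<bar>y\<bar>) * exp (c * \<bar>y\<bar>)"
        using C(2) by (intro mult_right_mono) auto
      ultimately have "\<bar>k (z - y)\<bar> * exp (c * \<bar>y\<bar>) \<le> C * exp (d * \<bar>z\<bar>) * exp (- 1 * \<bar>y\<bar>)"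
        unfolding mult.assoc by linarith
      then show ?thesis using C(1) by (simp add: abs_mult)
    qed
    then show "AE y in lborel. norm (k (z - y) * exp (c * \<bar>y\<bar>)) \<le> norm (C * exp (d * \<bar>z\<bar>) * exp (- 1 * \<bar>y\<bar>))" by simp
  qed measurable
qed

lemma conv_integrable:
  assumes k: "fast k" and H: "egrow c H"
  shows "integrable lborel (\<lambda>y. complex_of_real (k (z - y)) * H y)"
proof -
  have [measurable]: "k \<in> borel_measurable borel" "H \<in> borel_measurable borel" using k H by measurable
  have c: "c \<ge> 0" and iH: "integrable lborel (\<lambda>y. complex_of_real (exp (- c * \<bar>y\<bar>)) * H y)" using H by (auto simp: egrow_def)
  obtain C where C: "C \<ge> 0" "\<And>z y. \<bar>k (z - y)\<bar> \<le> C * exp (c * \<bar>z\<bar>) * exp (- c * \<bar>y\<bar>)"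
    using fast_bound[OF k c] by blast
  show ?thesis
  proof (rule Bochner_Integration.integrable_bound)
    show "integrable lborel (\<lambda>y. complex_of_real (C * exp (c * \<bar>z\<bar>)) * (complex_of_real (exp (- c * \<bar>y\<bar>)) * H y))"
      by (intro Bochner_Integration.integrable_mult_right iH)
    have "norm (complex_of_real (k (z - y)) * H y) \<le> norm (complex_of_real (C * exp (c * \<bar>z\<bar>)) * (complex_of_real (exp (- c * \<bar>y\<bar>)) * H y))" for y
      using mult_right_mono[OF C(2)[of z y], of "cmod (H y)"] C(1) by (simp add: norm_mult mult.assoc)
    then show "AE y in lborel. norm (complex_of_real (k (z - y)) * H y) \<le> norm (complex_of_real (C * exp (c * \<bar>z\<bar>)) * (complex_of_real (exp (- c * \<bar>y\<bar>)) * H y))"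
      by simp
  qed measurable
qed

lemma conv_bound:
  assumes k: "fast k" and H: "egrow c H"
  shows "\<exists>C\<ge>0. \<forall>z. cmod (conv k H z) \<le> C * exp (c * \<bar>z\<bar>)"
proof -
  have c: "c \<ge> 0" and iH: "integrable lborel (\<lambda>y. complex_of_real (exp (- c * \<bar>y\<bar>)) * H y)" using H by (auto simp: egrow_def)
  obtain C where C: "C \<ge> 0" "\<And>z y. \<bar>k (z - y)\<bar> \<le> C * exp (c * \<bar>z\<bar>) * exp (- c * \<bar>y\<bar>)"
    using fast_bound[OF k c] by blast
  define N where "N = (LINT y|lborel. cmod (complex_of_real (exp (- c * \<bar>y\<bar>)) * H y))"
  have "cmod (conv k H z) \<le> C * N * exp (c * \<bar>z\<bar>)" for z
  proof -
    have "cmod (conv k H z) \<le> (LINT y|lborel. C * exp (c * \<bar>z\<bar>) * cmod (complex_of_real (exp (- c * \<bar>y\<bar>)) * H y))"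
      unfolding conv_def
    proof (rule norm_integral_le[OF conv_integrable[OF k H]])
      show "integrable lborel (\<lambda>y. C * exp (c * \<bar>z\<bar>) * cmod (complex_of_real (exp (- c * \<bar>y\<bar>)) * H y))"
        by (intro Bochner_Integration.integrable_mult_right integrable_norm iH)
      show "norm (complex_of_real (k (z - y)) * H y) \<le> C * exp (c * \<bar>z\<bar>) * cmod (complex_of_real (exp (- c * \<bar>y\<bar>)) * H y)" for y
        using mult_right_mono[OF C(2)[of z y], of "cmod (H y)"] by (simp add: norm_mult mult.assoc)
    qed
    then show ?thesis by (simp add: N_def mult_ac)
  qed
  moreover have "C * N \<ge> 0" using C(1) by (simp add: N_def)
  ultimately show ?thesis by blast
qed

lemma conv_continuous:
  assumes k: "fast k" and H: "egrow c H"
  shows "continuous_on A (conv k H)"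
proof (rule continuous_on_subset[OF _ subset_UNIV], unfold continuous_on_sequentially comp_def, intro allI ballI impI, elim conjE)
  have [measurable]: "k \<in> borel_measurable borel" "H \<in> borel_measurable borel" using k H by measurable
  have c: "c \<ge> 0" and iH: "integrable lborel (\<lambda>y. complex_of_real (exp (- c * \<bar>y\<bar>)) * H y)" using H by (auto simp: egrow_def)
  obtain C where C: "C \<ge> 0" "\<And>z y. \<bar>k (z - y)\<bar> \<le> C * exp (c * \<bar>z\<bar>) * exp (- c * \<bar>y\<bar>)"
    using fast_bound[OF k c] by blast
  fix X and x :: real assume X: "X \<longlonglongrightarrow> x"
  obtain R where R: "\<And>n. \<bar>X n\<bar> \<le> R" using convergent_imp_Bseq[OF convergentI[OF X]] by (auto simp: Bseq_def)
  show "(\<lambda>n. conv k H (X n)) \<longlonglongrightarrow> conv k H x"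
    unfolding conv_def
  proof (rule integral_dominated_convergence[where w="\<lambda>y. C * exp (c * R) * cmod (complex_of_real (exp (- c * \<bar>y\<bar>)) * H y)"])
    show "integrable lborel (\<lambda>y. C * exp (c * R) * cmod (complex_of_real (exp (- c * \<bar>y\<bar>)) * H y))"
      by (intro Bochner_Integration.integrable_mult_right integrable_norm iH)
    show "AE y in lborel. (\<lambda>n. complex_of_real (k (X n - y)) * H y) \<longlonglongrightarrow> complex_of_real (k (x - y)) * H y"
    proof (intro AE_I2 tendsto_mult tendsto_const tendsto_of_real)
      fix y
      have "isCont k (x - y)" using k by (simp add: fast_def continuous_on_eq_continuous_at)
      then show "(\<lambda>n. k (X n - y)) \<longlonglongrightarrow> k (x - y)" by (rule isCont_tendsto_compose) (intro tendsto_diff X tendsto_const)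
    qed
    have "norm (complex_of_real (k (X n - y)) * H y) \<le> C * exp (c * R) * cmod (complex_of_real (exp (- c * \<bar>y\<bar>)) * H y)" for n y
    proof -
      have "C * exp (c * \<bar>X n\<bar>) * exp (- c * \<bar>y\<bar>) \<le> C * exp (c * R) * exp (- c * \<bar>y\<bar>)"
        using C(1) c R[of n] by (intro mult_right_mono mult_left_mono) (auto intro: mult_left_mono)
      from mult_right_mono[OF order_trans[OF C(2) this], of "cmod (H y)"] show ?thesis
        by (simp add: norm_mult mult.assoc)
    qed
    then show "AE y in lborel. norm (complex_of_real (k (X n - y)) * H y) \<le> C * exp (c * R) * cmod (complex_of_real (exp (- c * \<bar>y\<bar>)) * H y)" for n
      by simp
  qed measurable
qed

lemma conv_egrow:
  assumes k: "fast k" and H: "egrow c H" shows "egrow (c + 1) (conv k H)"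
proof -
  have c: "c \<ge> 0" using H by (simp add: egrow_def)
  obtain C where C: "C \<ge> 0" "\<And>z. cmod (conv k H z) \<le> C * exp (c * \<bar>z\<bar>)" using conv_bound[OF k H] by blast
  have m[measurable]: "conv k H \<in> borel_measurable borel"
    by (rule borel_measurable_continuous_onI[OF conv_continuous[OF k H]])
  have "integrable lborel (\<lambda>y. complex_of_real (exp (- (c + 1) * \<bar>y\<bar>)) * conv k H y)"
  proof (rule Bochner_Integration.integrable_bound)
    show "integrable lborel (\<lambda>y. C * exp (- 1 * \<bar>y\<bar>))" by (intro Bochner_Integration.integrable_mult_right integrable_exp_neg_abs) simp
    have "norm (complex_of_real (exp (- (c + 1) * \<bar>y\<bar>)) * conv k H y) \<le> norm (C * exp (- 1 * \<bar>y\<bar>))" for y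
    proof -
      have "exp (- (c + 1) * \<bar>y\<bar>) * exp (c * \<bar>y\<bar>) = exp (- 1 * \<bar>y\<bar>)"
        by (subst exp_add[symmetric]) (simp add: algebra_simps)
      then have "exp (- (c + 1) * \<bar>y\<bar>) * (C * exp (c * \<bar>y\<bar>)) = C * exp (- 1 * \<bar>y\<bar>)"
        by (metis mult.left_commute)
      moreover have "exp (- (c + 1) * \<bar>y\<bar>) * cmod (conv k H y) \<le> exp (- (c + 1) * \<bar>y\<bar>) * (C * exp (c * \<bar>y\<bar>))"
        by (intro mult_left_mono C(2)) simp
      ultimately have "exp (- (c + 1) * \<bar>y\<bar>) * cmod (conv k H y) \<le> C * exp (- 1 * \<bar>y\<bar>)" by linarith
      then show ?thesis using C(1) by (simp only: norm_mult norm_of_real) simp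
    qed
    then show "AE y in lborel. norm (complex_of_real (exp (- (c + 1) * \<bar>y\<bar>)) * conv k H y) \<le> norm (C * exp (- 1 * \<bar>y\<bar>))" by simp
  qed measurable
  then show ?thesis using c m by (simp add: egrow_def)
qed

lemma jk_measurable [measurable]: "(\<lambda>(z, y). jk z y) \<in> borel_measurable (borel \<Otimes>\<^sub>M borel)"
  unfolding jk_def by measurable

lemma jk_exp: "c \<ge> 0 \<Longrightarrow> \<bar>jk z y\<bar> * exp (c * \<bar>y\<bar>) \<le> exp (c * \<bar>z\<bar>)"
  by (auto simp: jk_def intro: mult_left_mono)

lemma egrow_jk:
  assumes H: "egrow c H"
  shows "integrable lborel (\<lambda>y. complex_of_real (jk z y) * H y)"
    and "cmod (J H z) \<le> exp (c * \<bar>z\<bar>) * (LINT y|lborel. cmod (complex_of_real (exp (- c * \<bar>y\<bar>)) * H y))"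
proof -
  have [measurable]: "H \<in> borel_measurable borel" using H by measurable
  have c: "c \<ge> 0" and iH: "integrable lborel (\<lambda>y. complex_of_real (exp (- c * \<bar>y\<bar>)) * H y)" using H by (auto simp: egrow_def)
  have b: "norm (complex_of_real (jk z y) * H y) \<le> exp (c * \<bar>z\<bar>) * cmod (complex_of_real (exp (- c * \<bar>y\<bar>)) * H y)" for y
  proof -
    have "\<bar>jk z y\<bar> * exp (c * \<bar>y\<bar>) * (exp (- c * \<bar>y\<bar>) * cmod (H y)) = \<bar>jk z y\<bar> * cmod (H y)"
      by (simp add: exp_minus)
    moreover have "\<bar>jk z y\<bar> * exp (c * \<bar>y\<bar>) * (exp (- c * \<bar>y\<bar>) * cmod (H y)) \<le> exp (c * \<bar>z\<bar>) * (exp (- c * \<bar>y\<bar>) * cmod (H y))"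
      by (intro mult_right_mono jk_exp[OF c]) simp
    ultimately have "\<bar>jk z y\<bar> * cmod (H y) \<le> exp (c * \<bar>z\<bar>) * (exp (- c * \<bar>y\<bar>) * cmod (H y))" by linarith
    then show ?thesis by (simp add: norm_mult)
  qed
  show i: "integrable lborel (\<lambda>y. complex_of_real (jk z y) * H y)"
  proof (rule Bochner_Integration.integrable_bound)
    show "integrable lborel (\<lambda>y. exp (c * \<bar>z\<bar>) * cmod (complex_of_real (exp (- c * \<bar>y\<bar>)) * H y))"
      by (intro Bochner_Integration.integrable_mult_right integrable_norm iH)
    show "AE y in lborel. norm (complex_of_real (jk z y) * H y) \<le> norm (exp (c * \<bar>z\<bar>) * cmod (complex_of_real (exp (- c * \<bar>y\<bar>)) * H y))"
      using b by (intro AE_I2) (metis abs_ge_self order_trans real_norm_def)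
  qed measurable
  have "cmod (J H z) \<le> (LINT y|lborel. exp (c * \<bar>z\<bar>) * cmod (complex_of_real (exp (- c * \<bar>y\<bar>)) * H y))"
    unfolding J_def by (rule norm_integral_le[OF i _ b])
      (intro Bochner_Integration.integrable_mult_right integrable_norm iH)
  then show "cmod (J H z) \<le> exp (c * \<bar>z\<bar>) * (LINT y|lborel. cmod (complex_of_real (exp (- c * \<bar>y\<bar>)) * H y))" by simp
qed

lemma J_measurable:
  assumes [measurable]: "H \<in> borel_measurable borel" shows "J H \<in> borel_measurable borel"
proof -
  have "(\<lambda>z. LINT y|lborel. (case (z, y) of (z, y) \<Rightarrow> complex_of_real (jk z y) * H y)) \<in> borel_measurable borel"
    by measurable
  then show ?thesis by (simp add: J_def[abs_def])
qed

lemma J_egrow: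
  assumes H: "egrow c H" shows "egrow (c + 1) (J H)"
proof -
  have c: "c \<ge> 0" using H by (simp add: egrow_def)
  define N where "N = (LINT y|lborel. cmod (complex_of_real (exp (- c * \<bar>y\<bar>)) * H y))"
  have N0: "N \<ge> 0" by (simp add: N_def)
  have m[measurable]: "J H \<in> borel_measurable borel" by (intro J_measurable egrow_measurable[OF H])
  have "integrable lborel (\<lambda>y. complex_of_real (exp (- (c + 1) * \<bar>y\<bar>)) * J H y)"
  proof (rule Bochner_Integration.integrable_bound)
    show "integrable lborel (\<lambda>y. N * exp (- 1 * \<bar>y\<bar>))" by (intro Bochner_Integration.integrable_mult_right integrable_exp_neg_abs) simp
    have "norm (complex_of_real (exp (- (c + 1) * \<bar>y\<bar>)) * J H y) \<le> norm (N * exp (- 1 * \<bar>y\<bar>))" for y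
    proof -
      have "exp (- (c + 1) * \<bar>y\<bar>) * exp (c * \<bar>y\<bar>) = exp (- 1 * \<bar>y\<bar>)"
        by (subst exp_add[symmetric]) (simp add: algebra_simps)
      then have "exp (- (c + 1) * \<bar>y\<bar>) * (exp (c * \<bar>y\<bar>) * N) = N * exp (- 1 * \<bar>y\<bar>)"
        by (metis mult.assoc mult.commute)
      moreover have "exp (- (c + 1) * \<bar>y\<bar>) * cmod (J H y) \<le> exp (- (c + 1) * \<bar>y\<bar>) * (exp (c * \<bar>y\<bar>) * N)"
        by (intro mult_left_mono egrow_jk(2)[OF H, folded N_def]) simp
      ultimately have "exp (- (c + 1) * \<bar>y\<bar>) * cmod (J H y) \<le> N * exp (- 1 * \<bar>y\<bar>)" by linarith
      then show ?thesis using N0 by (simp only: norm_mult norm_of_real) simp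
    qed
    then show "AE y in lborel. norm (complex_of_real (exp (- (c + 1) * \<bar>y\<bar>)) * J H y) \<le> norm (N * exp (- 1 * \<bar>y\<bar>))" by simp
  qed measurable
  then show ?thesis using c m by (simp add: egrow_def)
qed

lemma J_0 [simp]: "J H 0 = 0"
proof -
  have "jk 0 y = 0" for y by (simp add: jk_def)
  then show ?thesis by (simp add: J_def)
qed

lemma J_interval: "J H z = (LBINT y=0..z. H y)"
proof (cases "0 \<le> z")
  case True
  then have "(LBINT y=0..z. H y) = (LINT y|lborel. indicator {0<..<z} y *\<^sub>R H y)"
    by (simp add: interval_lebesgue_integral_def set_lebesgue_integral_def zero_ereal_def)
  also have "\<dots> = J H z" unfolding J_def using True
    by (intro Bochner_Integration.integral_cong) (auto simp: jk_def)
  finally show ?thesis by simp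
next
  case False
  then have "(LBINT y=0..z. H y) = - (LINT y|lborel. indicator {z<..<0} y *\<^sub>R H y)"
    by (simp add: interval_lebesgue_integral_def set_lebesgue_integral_def zero_ereal_def)
  also have "\<dots> = (LINT y|lborel. - (indicator {z<..<0} y *\<^sub>R H y))" by simp
  also have "\<dots> = J H z" unfolding J_def using False
    by (intro Bochner_Integration.integral_cong) (auto simp: jk_def indicator_def)
  finally show ?thesis by simp
qed

lemma J_has_derivative:
  assumes "continuous_on UNIV G" shows "(J G has_vector_derivative G z) (at z)"
proof -
  have "((\<lambda>u. LBINT y=0..u. G y) has_vector_derivative G z) (at z within {-\<bar>z\<bar> - 1..\<bar>z\<bar> + 1})"
    unfolding zero_ereal_def by (rule interval_integral_FTC2) (auto intro: continuous_on_subset[OF assms])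
  moreover have "z \<in> interior {-\<bar>z\<bar> - 1..\<bar>z\<bar> + 1}" by (auto simp: interior_atLeastAtMost_real)
  moreover have "J G = (\<lambda>u. LBINT y=0..u. G y)" by (simp add: J_interval fun_eq_iff)
  ultimately show ?thesis using at_within_interior by metis
qed


lemma fast_reflect: "fast k \<Longrightarrow> fast (\<lambda>u. k (- u))"
  unfolding fast_def
proof (elim conjE, intro conjI allI)
  fix c assume "\<forall>c. \<exists>C. \<forall>z. \<bar>k z\<bar> \<le> C * exp (- c * \<bar>z\<bar>)"
  then obtain C where "\<And>z. \<bar>k z\<bar> \<le> C * exp (- c * \<bar>z\<bar>)" by blast
  from this[of "- _"] show "\<exists>C. \<forall>z. \<bar>k (- z)\<bar> \<le> C * exp (- c * \<bar>z\<bar>)" by (intro exI[of _ C]) simp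
qed (auto intro!: continuous_on_compose2[of UNIV k] continuous_intros)

lemma fast_integrable: "fast k \<Longrightarrow> integrable lborel k"
  using fast_exp_integrable[of "\<lambda>u. k (- u)" 0 0] fast_reflect[of k] by simp

lemma fast_FTC_right:
  assumes k: "fast k" "fast k'" and d: "\<And>x. (k has_real_derivative k' x) (at x)"
  shows "(LINT u|lborel. indicator {a<..} u * k' u) = - k a"
proof -
  have [measurable]: "k' \<in> borel_measurable borel" using k(2) by (rule fast_measurable)
  have "(\<lambda>n. LINT u|lborel. indicator {a<..<a + real n} u * k' u) \<longlonglongrightarrow> (LINT u|lborel. indicator {a<..} u * k' u)"
  proof (rule integral_dominated_convergence[where w="\<lambda>u. norm (k' u)"])
    show "integrable lborel (\<lambda>u. norm (k' u))" using fast_integrable[OF k(2)] by simp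
    show "AE u in lborel. (\<lambda>n. indicat_real {a<..<a + real n} u * k' u) \<longlonglongrightarrow> indicat_real {a<..} u * k' u"
    proof (intro AE_I2 tendsto_mult tendsto_const)
      fix u :: real
      obtain N :: nat where N: "u - a < real N" using reals_Archimedean2 by blast
      then have "eventually (\<lambda>n. indicat_real {a<..<a + real n} u = indicat_real {a<..} u) sequentially"
        unfolding eventually_sequentially by (intro exI[of _ N]) (auto simp: indicator_def)
      then show "(\<lambda>n. indicat_real {a<..<a + real n} u) \<longlonglongrightarrow> indicat_real {a<..} u" by (rule tendsto_eventually)
    qed
    show "AE u in lborel. norm (indicat_real {a<..<a + real n} u * k' u) \<le> norm (k' u)" for n
      by (auto simp: indicator_def)
  qed measurable
  moreover have "(LINT u|lborel. indicator {a<..<a + real n} u * k' u) = k (a + real n) - k a" for n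
  proof -
    have "(LBINT u=a..a + real n. k' u) = k (a + real n) - k a"
      using k(2) d by (intro interval_integral_FTC_finite)
        (auto simp: fast_def has_real_derivative_iff_has_vector_derivative[symmetric]
          intro: continuous_on_subset has_field_derivative_at_within)
    then show ?thesis by (simp add: interval_lebesgue_integral_def set_lebesgue_integral_def)
  qed
  moreover have "(\<lambda>n. k (a + real n) - k a) \<longlonglongrightarrow> 0 - k a"
  proof (intro tendsto_diff tendsto_const)
    obtain C where C: "\<And>z. \<bar>k z\<bar> \<le> C * exp (- 1 * \<bar>z\<bar>)" using k(1) unfolding fast_def by blast
    have at: "filterlim (\<lambda>n. a + real n) at_top sequentially"
      by (rule filterlim_tendsto_add_at_top[OF tendsto_const filterlim_real_sequentially])
    have "((\<lambda>x::real. exp (- x)) \<longlongrightarrow> 0) at_top"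
      by (rule filterlim_compose[OF exp_at_bot filterlim_uminus_at_bot_at_top])
    from filterlim_compose[OF this at] have l: "(\<lambda>n. C * exp (- (a + real n))) \<longlonglongrightarrow> 0"
      by (rule tendsto_mult_right_zero)
    show "(\<lambda>n. k (a + real n)) \<longlonglongrightarrow> 0"
    proof (rule Lim_null_comparison[OF _ l])
      have "eventually (\<lambda>n. a + real n \<ge> 0) sequentially" using at by (simp add: filterlim_at_top)
      then show "eventually (\<lambda>n. norm (k (a + real n)) \<le> C * exp (- (a + real n))) sequentially"
      proof eventually_elim
        case (elim n)
        then show ?case using C[of "a + real n"] by simp
      qed
    qed
  qed
  ultimately show ?thesis by (simp add: LIMSEQ_unique)
qed

lemma fast_FTC_left:
  assumes k: "fast k" "fast k'" and d: "\<And>x. (k has_real_derivative k' x) (at x)"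
  shows "(LINT u|lborel. indicator {..<a} u * k' u) = k a"
proof -
  have dr: "((\<lambda>u. k (- u)) has_real_derivative - k' (- x)) (at x)" for x
  proof -
    have "((\<lambda>u. - u) has_real_derivative -1) (at x)" by (auto intro!: derivative_eq_intros)
    from DERIV_chain2[where f=k and g="\<lambda>u. - u", OF d this] show ?thesis by simp
  qed
  have f: "fast (\<lambda>u. - k' (- u))" using fast_reflect[OF k(2)] by (auto simp: fast_def intro!: continuous_intros)
  have "(LINT u|lborel. indicator {..<a} u * k' u) = (LINT u|lborel. indicator {..<a} (0 + (-1) * u) * k' (0 + (-1) * u))"
    by (subst lborel_integral_real_affine[of "-1" _ 0]) auto
  also have "\<dots> = (LINT u|lborel. - (indicator {- a<..} u * (- k' (- u))))"
    by (rule Bochner_Integration.integral_cong) (auto simp: indicator_def)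
  also have "\<dots> = k a" using fast_FTC_right[OF fast_reflect[OF k(1)] f dr, of "- a"] by simp
  finally show ?thesis .
qed

lemma integral_affine_reflect: "(LINT y|lborel. f (z - y)) = (LINT y|lborel. f y)"
  for f :: "real \<Rightarrow> 'b::{banach, second_countable_topology}"
  using lborel_integral_real_affine[of "-1" f z] by simp

text \<open>Integration by parts, with the derivative moved from the kernel to \<open>J H\<close>.
  As H is only locally integrable, it is carried out by Fubini and by the fundamental theorem for k
  on half lines.\<close>

lemma conv_deriv_J:
  assumes k: "fast k" "fast k'" and d: "\<And>x. (k has_real_derivative k' x) (at x)" and H: "egrow c H"
  shows "conv k' (J H) z = conv k H z"
proof -
  have [measurable]: "k' \<in> borel_measurable borel" using k(2) by (rule fast_measurable)
  have [measurable]: "H \<in> borel_measurable borel" using H by (rule egrow_measurable)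
  have c: "c \<ge> 0" and iH: "integrable lborel (\<lambda>y. complex_of_real (exp (- c * \<bar>y\<bar>)) * H y)" using H by (auto simp: egrow_def)
  \<comment> \<open>The weights are distributed so that f and g are integrable; what is left in K is
    bounded by 1 because \<open>jk y r\<close> vanishes unless |r| is at most |y|.\<close>
  define f where "f y = complex_of_real (k' (z - y) * exp (c * \<bar>y\<bar>))" for y
  define g where "g r = complex_of_real (exp (- c * \<bar>r\<bar>)) * H r" for r
  define K where "K y r = complex_of_real (jk y r * exp (c * \<bar>r\<bar>) * exp (- c * \<bar>y\<bar>))" for y r
  have gi: "integrable lborel g" unfolding g_def by (rule iH)
  have fi: "integrable lborel f" unfolding f_def
    by (intro integrable_of_real fast_exp_integrable k)
  have Kg: "K y r * g r = complex_of_real (exp (- c * \<bar>y\<bar>)) * (complex_of_real (jk y r) * H r)" for y r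
    by (simp add: K_def g_def exp_minus)
  have "conv k' (J H) z = (LINT y|lborel. f y * (LINT r|lborel. K y r * g r))"
    unfolding conv_def
  proof (rule Bochner_Integration.integral_cong[OF refl])
    fix y
    show "complex_of_real (k' (z - y)) * J H y = f y * (LINT r|lborel. K y r * g r)"
      unfolding Kg J_def by (simp add: f_def exp_minus)
  qed
  also have "\<dots> = (LINT r|lborel. g r * (LINT y|lborel. K y r * f y))"
  proof (rule lborel_pair.Fubini_kernel_integral[OF fi gi, where C=1])
    show "case_prod K \<in> borel_measurable (lborel \<Otimes>\<^sub>M lborel)" unfolding K_def by measurable
    show "cmod (K y r) \<le> 1" for y r
      using mult_right_mono[OF jk_exp[OF c, of y r], of "exp (- c * \<bar>y\<bar>)"]
      by (simp add: K_def norm_mult exp_minus abs_mult norm_inverse)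
  qed
  also have "\<dots> = conv k H z"
    unfolding conv_def
  proof (rule integral_cong_AE)
    have inner: "(LINT y|lborel. K y r * f y) = complex_of_real (exp (c * \<bar>r\<bar>) * k (z - r))" if "r \<noteq> 0" for r
    proof -
      have "(LINT y|lborel. K y r * f y) = (LINT y|lborel. complex_of_real (exp (c * \<bar>r\<bar>) * (jk y r * k' (z - y))))"
        by (rule Bochner_Integration.integral_cong) (auto simp: K_def f_def exp_minus)
      also have "\<dots> = complex_of_real (exp (c * \<bar>r\<bar>) * (LINT y|lborel. jk y r * k' (z - y)))"
        by (simp only: integral_complex_of_real integral_mult_right_zero)
      also have "(LINT y|lborel. jk y r * k' (z - y)) = k (z - r)"
      proof (cases "r > 0")
        case True
        have "(LINT y|lborel. jk y r * k' (z - y)) = (LINT y|lborel. indicator {..<z - r} (z - y) * k' (z - y))"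
          using True by (intro Bochner_Integration.integral_cong) (auto simp: jk_def indicator_def)
        also have "\<dots> = (LINT u|lborel. indicator {..<z - r} u * k' u)"
          by (rule integral_affine_reflect)
        finally show ?thesis using fast_FTC_left[OF k d] by simp
      next
        case False
        have "(LINT y|lborel. jk y r * k' (z - y)) = (LINT y|lborel. - (indicator {z - r<..} (z - y) * k' (z - y)))"
          using False that by (intro Bochner_Integration.integral_cong) (auto simp: jk_def indicator_def)
        also have "\<dots> = - (LINT u|lborel. indicator {z - r<..} u * k' u)"
          using integral_affine_reflect[of "\<lambda>u. indicator {z - r<..} u * k' u" z] by simp
        finally show ?thesis using fast_FTC_right[OF k d] by simp
      qed
      finally show ?thesis .
    qed
    have "AE r in lborel. r \<noteq> (0::real)" by (rule AE_lborel_singleton)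
    then show "AE r in lborel. g r * (LINT y|lborel. K y r * f y) = complex_of_real (k (z - r)) * H r"
      by eventually_elim (simp add: inner, simp add: g_def exp_minus)
    show "(\<lambda>r. g r * (LINT y|lborel. K y r * f y)) \<in> borel_measurable lborel"
    proof (intro borel_measurable_times)
      have "(\<lambda>r. LINT y|lborel. (case (r, y) of (r, y) \<Rightarrow> K y r * f y)) \<in> borel_measurable lborel"
        unfolding K_def f_def by measurable
      then show "(\<lambda>r. LINT y|lborel. K y r * f y) \<in> borel_measurable lborel" by simp
      show "g \<in> borel_measurable lborel" using gi by simp
    qed
    show "(\<lambda>y. complex_of_real (k (z - y)) * H y) \<in> borel_measurable lborel"
      using conv_integrable[OF k(1) H] by simp
  qed
  finally show ?thesis .
qed

text \<open>The integrated form of the rule that the derivative of k * H is k' * H. Fubini gives it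
  directly, and \<open>conv_has_derivative\<close> reads the derivative off because k' * H is
  continuous.\<close>

lemma conv_diff:
  assumes k: "fast k" "fast k'" and d: "\<And>x. (k has_real_derivative k' x) (at x)" and H: "egrow c H"
  shows "conv k H z - conv k H 0 = J (conv k' H) z"
proof -
  have [measurable]: "k' \<in> borel_measurable borel" using k(2) by (rule fast_measurable)
  have [measurable]: "H \<in> borel_measurable borel" using H by (rule egrow_measurable)
  have c: "c \<ge> 0" and iH: "integrable lborel (\<lambda>y. complex_of_real (exp (- c * \<bar>y\<bar>)) * H y)" using H by (auto simp: egrow_def)
  obtain C where C: "C \<ge> 0" "\<And>z y. \<bar>k' (z - y)\<bar> \<le> C * exp (c * \<bar>z\<bar>) * exp (- c * \<bar>y\<bar>)"
    using fast_bound[OF k(2) c] by blast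
  define g where "g r = complex_of_real (exp (- c * \<bar>r\<bar>)) * H r" for r
  define f where "f s = complex_of_real (jk z s)" for s
  \<comment> \<open>The cut-off at |z| keeps the kernel bounded, and \<open>jk z\<close> vanishes
    beyond it, so the product is unchanged.\<close>
  define K where "K s y = (if \<bar>s\<bar> \<le> \<bar>z\<bar> then complex_of_real (k' (s - y) * exp (c * \<bar>y\<bar>)) else 0)" for s y
  have gi: "integrable lborel g" unfolding g_def by (rule iH)
  have fi: "integrable lborel f"
    using egrow_jk(1)[of 1 "\<lambda>_. 1" z] integrable_exp_neg_abs[of 1] unfolding f_def egrow_def
    by (simp add: integrable_of_real del: of_real_exp)
  have "J (conv k' H) z = (LINT s|lborel. f s * (LINT y|lborel. K s y * g y))"
    unfolding J_def
  proof (rule Bochner_Integration.integral_cong[OF refl])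
    fix s
    show "complex_of_real (jk z s) * conv k' H s = f s * (LINT y|lborel. K s y * g y)"
    proof (cases "\<bar>s\<bar> \<le> \<bar>z\<bar>")
      case True
      then have "K s y * g y = complex_of_real (k' (s - y)) * H y" for y by (simp add: K_def g_def exp_minus)
      then show ?thesis by (simp add: conv_def f_def)
    next
      case False
      then have "jk z s = 0" by (auto simp: jk_def)
      then show ?thesis by (simp add: f_def)
    qed
  qed
  also have "\<dots> = (LINT y|lborel. g y * (LINT s|lborel. K s y * f s))"
  proof (rule lborel_pair.Fubini_kernel_integral[OF fi gi, where C="C * exp (c * \<bar>z\<bar>)"])
    show "case_prod K \<in> borel_measurable (lborel \<Otimes>\<^sub>M lborel)" unfolding K_def by measurable
    show "cmod (K s y) \<le> C * exp (c * \<bar>z\<bar>)" for s y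
    proof (cases "\<bar>s\<bar> \<le> \<bar>z\<bar>")
      case True
      have "\<bar>k' (s - y)\<bar> * exp (c * \<bar>y\<bar>) \<le> C * exp (c * \<bar>s\<bar>) * exp (- c * \<bar>y\<bar>) * exp (c * \<bar>y\<bar>)"
        by (intro mult_right_mono C(2)) simp
      also have "\<dots> = C * exp (c * \<bar>s\<bar>)" by (simp add: exp_minus)
      also have "\<dots> \<le> C * exp (c * \<bar>z\<bar>)" using True c C(1) by (intro mult_left_mono) (auto intro: mult_left_mono)
      finally show ?thesis using True by (simp add: K_def norm_mult)
    qed (use C(1) in \<open>simp add: K_def\<close>)
  qed
  also have "\<dots> = (LINT y|lborel. complex_of_real (k (z - y)) * H y - complex_of_real (k (0 - y)) * H y)"
  proof (rule Bochner_Integration.integral_cong[OF refl])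
    fix y
    have "(LINT s|lborel. K s y * f s) = (LINT s|lborel. complex_of_real (exp (c * \<bar>y\<bar>)) * (complex_of_real (jk z s) * complex_of_real (k' (s - y))))"
      by (rule Bochner_Integration.integral_cong) (auto simp: K_def f_def jk_def)
    also have "\<dots> = complex_of_real (exp (c * \<bar>y\<bar>)) * J (\<lambda>s. complex_of_real (k' (s - y))) z"
      by (simp add: J_def)
    also have "J (\<lambda>s. complex_of_real (k' (s - y))) z = complex_of_real (k (z - y)) - complex_of_real (k (0 - y))"
      unfolding J_interval zero_ereal_def
    proof (rule interval_integral_FTC_finite)
      show "continuous_on {min 0 z..max 0 z} (\<lambda>s. complex_of_real (k' (s - y)))"
        using k(2) unfolding fast_def by (auto intro!: continuous_intros continuous_on_compose2[of UNIV k'])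
      show "((\<lambda>s. complex_of_real (k (s - y))) has_vector_derivative complex_of_real (k' (x - y))) (at x within {min 0 z..max 0 z})" for x
      proof (rule bounded_linear.has_vector_derivative[OF bounded_linear_of_real])
        have "((\<lambda>s. k (s - y)) has_real_derivative k' (x - y)) (at x)"
        proof -
          have "((\<lambda>s. s - y) has_real_derivative 1) (at x)" by (auto intro!: derivative_eq_intros)
          from DERIV_chain2[where f=k and g="\<lambda>s. s - y", OF d this] show ?thesis by simp
        qed
        then show "((\<lambda>s. k (s - y)) has_vector_derivative k' (x - y)) (at x within {min 0 z..max 0 z})"
          by (metis has_real_derivative_iff_has_vector_derivative has_vector_derivative_at_within)
      qed
    qed
    finally have I: "(LINT s|lborel. K s y * f s) = complex_of_real (exp (c * \<bar>y\<bar>)) * (complex_of_real (k (z - y)) - complex_of_real (k (0 - y)))" .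
    show "g y * (LINT s|lborel. K s y * f s) = complex_of_real (k (z - y)) * H y - complex_of_real (k (0 - y)) * H y"
      unfolding I g_def by (simp add: exp_minus field_simps)
  qed
  also have "\<dots> = conv k H z - conv k H 0"
    unfolding conv_def by (rule Bochner_Integration.integral_diff[OF conv_integrable[OF k(1) H] conv_integrable[OF k(1) H]])
  finally show ?thesis by simp
qed

lemma conv_has_derivative:
  assumes k: "fast k" "fast k'" and d: "\<And>x. (k has_real_derivative k' x) (at x)" and H: "egrow c H"
  shows "(conv k H has_vector_derivative conv k' H z) (at z)"
proof -
  have D: "((\<lambda>z. conv k H 0 + J (conv k' H) z) has_vector_derivative conv k' H z) (at z)"
    using J_has_derivative[OF conv_continuous[OF k(2) H], of z] by (auto intro!: derivative_eq_intros)
  have "conv k H 0 + J (conv k' H) z = conv k H z" for z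
    using conv_diff[OF k d H, of z] by (metis add.commute diff_add_cancel)
  with D show ?thesis by simp
qed

text \<open>Convolution commutes with the primitive up to a constant. This lets the functional
  equation of \<open>ext\<close>, which contains a primitive, survive the heat flow.\<close>

lemma conv_J:
  assumes k: "fast k" "fast k'" and d: "\<And>x. (k has_real_derivative k' x) (at x)" and H: "egrow c H"
  shows "conv k (J H) z - conv k (J H) 0 = J (conv k H) z"
proof -
  have "conv k' (J H) = conv k H" using conv_deriv_J[OF k d H] by blast
  then show ?thesis using conv_diff[OF k d J_egrow[OF H], of z] by simp
qed

lemma conv_lincomb:
  assumes k: "fast k" and H: "egrow c G" "egrow d H"
  shows "conv k (\<lambda>y. G y + a * H y) z = conv k G z + a * conv k H z"
proof -
  have "conv k (\<lambda>y. G y + a * H y) z = (LINT y|lborel. complex_of_real (k (z - y)) * G y + a * (complex_of_real (k (z - y)) * H y))"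
    unfolding conv_def by (rule Bochner_Integration.integral_cong) (auto simp: algebra_simps)
  also have "\<dots> = conv k G z + a * conv k H z"
    unfolding conv_def using conv_integrable[OF k H(1)] conv_integrable[OF k H(2)]
    by (subst Bochner_Integration.integral_add) auto
  finally show ?thesis .
qed

lemma conv_shift: "conv k (\<lambda>y. H (y + a)) z = conv k H (z + a)"
proof -
  define f where "f = (\<lambda>y. complex_of_real (k (z - y)) * H (y + a))"
  have "(LINT y|lborel. f y) = (LINT y|lborel. f (- a + 1 * y))"
    using lborel_integral_real_affine[of 1 f "- a"] by simp
  then show ?thesis by (simp add: conv_def f_def algebra_simps)
qed

lemma conv_even:
  assumes "\<And>u. k (- u) = k u" "\<And>u. H (- u) = H u"
  shows "conv k H (- z) = conv k H z"
proof -
  define f where "f = (\<lambda>y. complex_of_real (k (- z - y)) * H y)"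
  have e: "k (- z + y) = k (z - y)" for y using assms(1)[of "z - y"] by simp
  have "(LINT y|lborel. f y) = (LINT y|lborel. f (0 - y))" by (rule integral_affine_reflect[symmetric])
  also have "\<dots> = conv k H z" unfolding f_def conv_def
    by (rule Bochner_Integration.integral_cong) (auto simp only: diff_0 diff_minus_eq_add assms(2) e)
  finally show ?thesis by (simp only: conv_def f_def)
qed

section \<open>The heat kernel\<close>

definition heat :: "real \<Rightarrow> real \<Rightarrow> real" where
  "heat t z = exp (- z\<^sup>2 / (4 * t)) / sqrt (4 * pi * t)"

definition heat1 :: "real \<Rightarrow> real \<Rightarrow> real" where
  "heat1 t z = - (z / (2 * t)) * heat t z"

definition heat2 :: "real \<Rightarrow> real \<Rightarrow> real" where
  "heat2 t z = (z\<^sup>2 / (4 * t\<^sup>2) - 1 / (2 * t)) * heat t z"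

lemma heat_normal: "t > 0 \<Longrightarrow> heat t z = normal_density 0 (sqrt (2 * t)) z"
  by (simp add: heat_def normal_density_def)

lemma heat_normal': "t > 0 \<Longrightarrow> heat t = normal_density 0 (sqrt (2 * t))"
  by (simp add: fun_eq_iff heat_normal)

lemma heat_pos: "t > 0 \<Longrightarrow> heat t z > 0" by (simp add: heat_def)

lemma heat_even: "heat t (- z) = heat t z" by (simp add: heat_def)

lemma heat_integrable: "t > 0 \<Longrightarrow> integrable lborel (heat t)"
  and heat_integral: "t > 0 \<Longrightarrow> (LINT z|lborel. heat t z) = 1"
  using integrable_normal_density[of "sqrt (2 * t)" 0] integral_normal_density[of "sqrt (2 * t)" 0]
  by (simp_all add: heat_normal')

lemma heat_continuous: "t > 0 \<Longrightarrow> continuous_on A (heat t)"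
  unfolding heat_def by (intro continuous_intros) auto

lemma heat_measurable [measurable]: "heat t \<in> borel_measurable borel"
  unfolding heat_def by measurable

lemma heat_deriv: "t > 0 \<Longrightarrow> (heat t has_real_derivative heat1 t z) (at z)"
  unfolding heat_def heat1_def by (auto intro!: derivative_eq_intros simp: field_simps)

lemma heat1_deriv: "t > 0 \<Longrightarrow> (heat1 t has_real_derivative heat2 t z) (at z)"
proof -
  assume t: "t > 0"
  have "((\<lambda>z. - (z / (2 * t)) * heat t z) has_real_derivative heat2 t z) (at z)"
    using t by (auto intro!: derivative_eq_intros heat_deriv simp: heat1_def heat2_def field_simps power2_eq_square)
  then show ?thesis by (simp add: heat1_def[abs_def])
qed

text \<open>Together with \<open>heat_deriv\<close> and \<open>heat1_deriv\<close> this is the heat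
  equation: \<open>heat2\<close> is at once the second space derivative and the time
  derivative.\<close>

lemma heat_time_deriv: "t > 0 \<Longrightarrow> ((\<lambda>t. heat t z) has_real_derivative heat2 t z) (at t)"
proof -
  assume t: "t > 0"
  have "((\<lambda>t. exp (- z\<^sup>2 / (4 * t)) / sqrt (4 * pi * t)) has_real_derivative
    (exp (- z\<^sup>2 / (4 * t)) * (z\<^sup>2 / (4 * t\<^sup>2)) * sqrt (4 * pi * t) - exp (- z\<^sup>2 / (4 * t)) * (4 * pi * (inverse (sqrt (4 * pi * t)) / 2))) / (sqrt (4 * pi * t))\<^sup>2) (at t)"
    using t by (auto intro!: derivative_eq_intros simp: mult_less_0_iff) (simp add: field_simps power2_eq_square)?
  moreover have "(exp (- z\<^sup>2 / (4 * t)) * (z\<^sup>2 / (4 * t\<^sup>2)) * sqrt (4 * pi * t) - exp (- z\<^sup>2 / (4 * t)) * (4 * pi * (inverse (sqrt (4 * pi * t)) / 2))) / (sqrt (4 * pi * t))\<^sup>2 = heat2 t z"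
  proof -
    define q where "q = sqrt (4 * pi * t)"
    have q: "q > 0" "q * q = 4 * pi * t" using t by (simp_all add: q_def)
    have "4 * pi = q * q / t" using q t by simp
    then show ?thesis unfolding heat2_def heat_def q_def[symmetric] using q(1) t
      by (simp add: field_simps power2_eq_square)
  qed
  ultimately show ?thesis by (simp add: heat_def[abs_def])
qed

lemma gauss_le:
  fixes t z c :: real
  assumes "t > 0" shows "exp (- z\<^sup>2 / (4 * t)) \<le> exp (c\<^sup>2 * t) * exp (- c * \<bar>z\<bar>)"
proof -
  have "0 \<le> (\<bar>z\<bar> - 2 * c * t)\<^sup>2 / (4 * t)" using assms by simp
  also have "\<dots> = z\<^sup>2 / (4 * t) - c * \<bar>z\<bar> + c\<^sup>2 * t"
    using assms by (simp add: power2_eq_square field_simps)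
  finally have "- z\<^sup>2 / (4 * t) \<le> c\<^sup>2 * t + - c * \<bar>z\<bar>" by simp
  then show ?thesis by (simp only: exp_add[symmetric] exp_le_cancel_iff)
qed

lemma poly_gauss_bound:
  assumes "0 < a" "0 \<le> A" "0 \<le> B"
  shows "\<exists>C. \<forall>t z. a \<le> t \<longrightarrow> t \<le> b \<longrightarrow> (A + B * z\<^sup>2) * heat t z \<le> C * exp (- c * \<bar>z\<bar>)"
proof (intro exI allI impI)
  fix t z :: real assume t: "a \<le> t" "t \<le> b"
  \<comment> \<open>The extra 2 pays for the polynomial factor, since z^2 is at most exp (2
    |z|).\<close>
  define d where "d = \<bar>c\<bar> + 2"
  have t0: "t > 0" using t assms by simp
  have "\<bar>z\<bar> \<le> exp \<bar>z\<bar>" using exp_ge_add_one_self[of "\<bar>z\<bar>"] by linarith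
  then have "\<bar>z\<bar> * \<bar>z\<bar> \<le> exp \<bar>z\<bar> * exp \<bar>z\<bar>" by (intro mult_mono) auto
  then have z2: "z\<^sup>2 \<le> exp (2 * \<bar>z\<bar>)" by (simp add: power2_eq_square exp_double)
  have "exp (- z\<^sup>2 / (4 * t)) \<le> exp (d\<^sup>2 * t) * exp (- d * \<bar>z\<bar>)" by (rule gauss_le[OF t0])
  also have "\<dots> \<le> exp (d\<^sup>2 * b) * exp (- d * \<bar>z\<bar>)" using t by (intro mult_right_mono) (auto intro: mult_left_mono)
  finally have "heat t z \<le> exp (d\<^sup>2 * b) * exp (- d * \<bar>z\<bar>) / sqrt (4 * pi * a)"
    unfolding heat_def using t assms by (intro frac_le) auto
  moreover have "A + B * z\<^sup>2 \<le> (A + B) * exp (2 * \<bar>z\<bar>)"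
    using mult_left_mono[OF z2 assms(3)] mult_left_mono[of 1 "exp (2 * \<bar>z\<bar>)" A] assms(2) by (simp add: algebra_simps)
  ultimately have "(A + B * z\<^sup>2) * heat t z \<le> (A + B) * exp (2 * \<bar>z\<bar>) * (exp (d\<^sup>2 * b) * exp (- d * \<bar>z\<bar>) / sqrt (4 * pi * a))"
    using assms heat_pos[OF t0, of z] by (intro mult_mono) auto
  also have "\<dots> = ((A + B) * exp (d\<^sup>2 * b) / sqrt (4 * pi * a)) * (exp (2 * \<bar>z\<bar>) * exp (- d * \<bar>z\<bar>))" by simp
  also have "exp (2 * \<bar>z\<bar>) * exp (- d * \<bar>z\<bar>) = exp (- \<bar>c\<bar> * \<bar>z\<bar>)"
    by (subst exp_add[symmetric]) (simp add: d_def algebra_simps)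
  also have "((A + B) * exp (d\<^sup>2 * b) / sqrt (4 * pi * a)) * exp (- \<bar>c\<bar> * \<bar>z\<bar>) \<le> ((A + B) * exp (d\<^sup>2 * b) / sqrt (4 * pi * a)) * exp (- c * \<bar>z\<bar>)"
    using assms by (intro mult_left_mono) (auto intro: mult_right_mono)
  finally show "(A + B * z\<^sup>2) * heat t z \<le> ((A + B) * exp ((\<bar>c\<bar> + 2)\<^sup>2 * b) / sqrt (4 * pi * a)) * exp (- c * \<bar>z\<bar>)"
    by (simp add: d_def)
qed

lemma heat_fast: "t > 0 \<Longrightarrow> fast (heat t)"
proof -
  assume t: "t > 0"
  have "\<exists>C. \<forall>z. \<bar>heat t z\<bar> \<le> C * exp (- c * \<bar>z\<bar>)" for c
    using poly_gauss_bound[OF t, of 1 0 t c] heat_pos[OF t] by (auto simp: abs_of_pos)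
  then show ?thesis using heat_continuous[OF t] by (simp add: fast_def)
qed

lemma heat1_fast: "t > 0 \<Longrightarrow> fast (heat1 t)"
proof -
  assume t: "t > 0"
  have "\<exists>C. \<forall>z. \<bar>heat1 t z\<bar> \<le> C * exp (- c * \<bar>z\<bar>)" for c
  proof -
    obtain C where C: "\<And>z. (1 / (2 * t) + 1 / (2 * t) * z\<^sup>2) * heat t z \<le> C * exp (- c * \<bar>z\<bar>)"
      using poly_gauss_bound[OF t, of "1 / (2 * t)" "1 / (2 * t)" t c] t by auto
    have "\<bar>heat1 t z\<bar> \<le> (1 / (2 * t) + 1 / (2 * t) * z\<^sup>2) * heat t z" for z
    proof -
      have "\<bar>z\<bar> \<le> 1 + z\<^sup>2" using sum_squares_bound[of "\<bar>z\<bar>" 1] by simp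
      then have "\<bar>z\<bar> / (2 * t) \<le> 1 / (2 * t) + 1 / (2 * t) * z\<^sup>2" using t by (simp add: field_simps)
      then have "\<bar>z\<bar> / (2 * t) * heat t z \<le> (1 / (2 * t) + 1 / (2 * t) * z\<^sup>2) * heat t z"
        using heat_pos[OF t, of z] by (intro mult_right_mono) auto
      then show ?thesis unfolding heat1_def using heat_pos[OF t, of z] t by (simp add: abs_mult)
    qed
    then show ?thesis using C order_trans by blast
  qed
  moreover have "continuous_on UNIV (heat1 t)" unfolding heat1_def using t by (intro continuous_intros heat_continuous) auto
  ultimately show ?thesis by (simp add: fast_def)
qed

lemma heat2_bound:
  assumes a: "0 < a" shows "\<exists>C. \<forall>t z. a \<le> t \<longrightarrow> t \<le> b \<longrightarrow> \<bar>heat2 t z\<bar> \<le> C * exp (- c * \<bar>z\<bar>)"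
proof -
  obtain C where C: "\<And>t z. a \<le> t \<Longrightarrow> t \<le> b \<Longrightarrow> (1 / (2 * a) + 1 / (4 * a\<^sup>2) * z\<^sup>2) * heat t z \<le> C * exp (- c * \<bar>z\<bar>)"
    using poly_gauss_bound[OF a, of "1 / (2 * a)" "1 / (4 * a\<^sup>2)" b c] a by auto
  have "\<bar>heat2 t z\<bar> \<le> (1 / (2 * a) + 1 / (4 * a\<^sup>2) * z\<^sup>2) * heat t z" if "a \<le> t" for t z
  proof -
    have t: "t > 0" using that a by simp
    have "z\<^sup>2 / (4 * t\<^sup>2) \<le> z\<^sup>2 / (4 * a\<^sup>2)" using that a by (intro divide_left_mono mult_left_mono power_mono) auto
    moreover have "1 / (2 * t) \<le> 1 / (2 * a)" using that a by (intro divide_left_mono) auto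
    moreover have "0 \<le> z\<^sup>2 / (4 * t\<^sup>2)" "0 \<le> 1 / (2 * t)" using t by auto
    ultimately have "\<bar>z\<^sup>2 / (4 * t\<^sup>2) - 1 / (2 * t)\<bar> \<le> 1 / (2 * a) + z\<^sup>2 / (4 * a\<^sup>2)"
      unfolding abs_le_iff by linarith
    then have "\<bar>z\<^sup>2 / (4 * t\<^sup>2) - 1 / (2 * t)\<bar> * heat t z \<le> (1 / (2 * a) + z\<^sup>2 / (4 * a\<^sup>2)) * heat t z"
      using heat_pos[OF t, of z] by (intro mult_right_mono) auto
    then show ?thesis unfolding heat2_def using heat_pos[OF t, of z] by (simp add: abs_mult)
  qed
  then show ?thesis using C order_trans by blast
qed

lemma heat2_fast: "t > 0 \<Longrightarrow> fast (heat2 t)"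
proof -
  assume t: "t > 0"
  have "\<exists>C. \<forall>z. \<bar>heat2 t z\<bar> \<le> C * exp (- c * \<bar>z\<bar>)" for c
    using heat2_bound[OF t, of t c] by auto
  moreover have "continuous_on UNIV (heat2 t)" unfolding heat2_def using t by (intro continuous_intros heat_continuous) auto
  ultimately show ?thesis by (simp add: fast_def)
qed

lemma heat_exp_integrable: "t > 0 \<Longrightarrow> integrable lborel (\<lambda>w. heat t w * exp (c * \<bar>w\<bar>))"
  using fast_exp_integrable[OF heat_fast, of t 0 c] by (simp add: heat_even)

lemma heat_mgf: 
  assumes t: "t > 0" shows "(LINT w|lborel. heat t w * exp (c * \<bar>w\<bar>)) \<le> 2 * exp (c\<^sup>2 * t)"
proof -
  \<comment> \<open>Completing the square: the weight exp (d w) only shifts the Gaussian and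
    contributes exp (d^2 t). The weight exp (c |w|) is dominated by the sum of the cases d = c and d
    = - c, which gives the factor 2.\<close>
  have shift: "heat t w * exp (d * w) = exp (d\<^sup>2 * t) * heat t (w - 2 * d * t)" for d w
    using t by (simp add: heat_def exp_add[symmetric] power2_eq_square field_simps)
  have i: "integrable lborel (\<lambda>w. heat t (w - 2 * d * t))" for d
    using lborel_integrable_real_affine[OF heat_integrable[OF t], of 1 "- 2 * d * t"] by (simp add: algebra_simps)
  have v: "(LINT w|lborel. heat t (w - 2 * d * t)) = 1" for d
    using lborel_integral_real_affine[of 1 "heat t" "- 2 * d * t"] heat_integral[OF t] by (simp add: algebra_simps)
  have "(LINT w|lborel. heat t w * exp (c * \<bar>w\<bar>)) \<le> (LINT w|lborel. exp (c\<^sup>2 * t) * heat t (w - 2 * c * t) + exp ((-c)\<^sup>2 * t) * heat t (w - 2 * (-c) * t))"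
  proof (rule Bochner_Integration.integral_mono[OF heat_exp_integrable[OF t]])
    show "integrable lborel (\<lambda>w. exp (c\<^sup>2 * t) * heat t (w - 2 * c * t) + exp ((-c)\<^sup>2 * t) * heat t (w - 2 * (-c) * t))"
      by (intro Bochner_Integration.integrable_add Bochner_Integration.integrable_mult_right i)
    show "heat t w * exp (c * \<bar>w\<bar>) \<le> exp (c\<^sup>2 * t) * heat t (w - 2 * c * t) + exp ((-c)\<^sup>2 * t) * heat t (w - 2 * (-c) * t)" for w
      unfolding shift[symmetric] using heat_pos[OF t, of w] by (auto simp: abs_if)
  qed
  also have "\<dots> = 2 * exp (c\<^sup>2 * t)"
    by (subst Bochner_Integration.integral_add) (auto simp: v v[of "-c", simplified] i[of "-c", simplified] i intro!: Bochner_Integration.integrable_mult_right)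
  finally show ?thesis .
qed

text \<open>The kernel at time t is the centred normal density of variance 2 t, and variances add
  under convolution.\<close>

lemma heat_conv:
  assumes s: "s > 0" and t: "t > 0"
  shows "(LINT w|lborel. heat s (z - w) * heat t (w - y)) = heat (s + t) (z - y)"
proof -
  have "(LINT w|lborel. heat s (z - w) * heat t (w - y)) = (LINT u|lborel. heat s ((z - y) - u) * heat t u)"
    by (subst lborel_integral_real_affine[of 1 _ y]) (auto simp: algebra_simps)
  also have "\<dots> = enn2real (\<integral>\<^sup>+u. ennreal (heat s ((z - y) - u) * heat t u) \<partial>lborel)"
    using heat_pos[OF s] heat_pos[OF t] by (intro integral_eq_nn_integral) (auto intro!: AE_I2 less_imp_le)
  also have "\<dots> = heat (s + t) (z - y)"
    using fun_cong[OF conv_normal_density_zero_mean[of "sqrt (2 * s)" "sqrt (2 * t)"], of "z - y"] s t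
    by (simp add: heat_normal' algebra_simps)
  finally show ?thesis .
qed

lemma conv_heat_heat:
  assumes s: "s > 0" and t: "t > 0" and H: "egrow c H"
  shows "conv (heat s) (conv (heat t) H) z = conv (heat (s + t)) H z"
proof -
  have [measurable]: "H \<in> borel_measurable borel" using H by (rule egrow_measurable)
  have c: "c \<ge> 0" and iH: "integrable lborel (\<lambda>y. complex_of_real (exp (- c * \<bar>y\<bar>)) * H y)" using H by (auto simp: egrow_def)
  obtain C where C: "C \<ge> 0" "\<And>z y. \<bar>heat t (z - y)\<bar> \<le> C * exp (c * \<bar>z\<bar>) * exp (- c * \<bar>y\<bar>)"
    using fast_bound[OF heat_fast[OF t] c] by blast
  define g where "g r = complex_of_real (exp (- c * \<bar>r\<bar>)) * H r" for r
  define f where "f w = complex_of_real (heat s (z - w) * exp (c * \<bar>w\<bar>))" for w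
  define K where "K w y = complex_of_real (heat t (w - y) * exp (c * \<bar>y\<bar>) * exp (- c * \<bar>w\<bar>))" for w y
  have gi: "integrable lborel g" unfolding g_def by (rule iH)
  have fi: "integrable lborel f" unfolding f_def
    by (intro integrable_of_real fast_exp_integrable heat_fast s)
  have Kg: "K w y * g y = complex_of_real (exp (- c * \<bar>w\<bar>)) * (complex_of_real (heat t (w - y)) * H y)" for w y
    by (simp add: K_def g_def exp_minus)
  have "conv (heat s) (conv (heat t) H) z = (LINT w|lborel. f w * (LINT y|lborel. K w y * g y))"
    unfolding conv_def[of "heat s"]
  proof (rule Bochner_Integration.integral_cong[OF refl])
    fix w
    show "complex_of_real (heat s (z - w)) * conv (heat t) H w = f w * (LINT y|lborel. K w y * g y)"
      unfolding Kg by (simp add: f_def exp_minus conv_def)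
  qed
  also have "\<dots> = (LINT y|lborel. g y * (LINT w|lborel. K w y * f w))"
  proof (rule lborel_pair.Fubini_kernel_integral[OF fi gi, where C=C])
    show "case_prod K \<in> borel_measurable (lborel \<Otimes>\<^sub>M lborel)" unfolding K_def by measurable
    show "cmod (K w y) \<le> C" for w y
    proof -
      have "\<bar>heat t (w - y)\<bar> * (exp (c * \<bar>y\<bar>) * exp (- c * \<bar>w\<bar>)) \<le> C * exp (c * \<bar>w\<bar>) * exp (- c * \<bar>y\<bar>) * (exp (c * \<bar>y\<bar>) * exp (- c * \<bar>w\<bar>))"
        by (intro mult_right_mono C(2)) simp
      also have "\<dots> = C" by (simp add: exp_minus field_simps)
      finally show ?thesis by (simp add: K_def norm_mult abs_mult norm_inverse mult.assoc)
    qed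
  qed
  also have "\<dots> = conv (heat (s + t)) H z"
    unfolding conv_def
  proof (rule Bochner_Integration.integral_cong[OF refl])
    fix y
    have "(LINT w|lborel. K w y * f w) = (LINT w|lborel. complex_of_real (exp (c * \<bar>y\<bar>) * (heat s (z - w) * heat t (w - y))))"
      by (rule Bochner_Integration.integral_cong) (auto simp: K_def f_def exp_minus)
    also have "\<dots> = complex_of_real (exp (c * \<bar>y\<bar>) * heat (s + t) (z - y))"
      by (simp only: integral_complex_of_real integral_mult_right_zero heat_conv[OF s t])
    finally have I: "(LINT w|lborel. K w y * f w) = complex_of_real (exp (c * \<bar>y\<bar>) * heat (s + t) (z - y))" .
    show "g y * (LINT w|lborel. K w y * f w) = complex_of_real (heat (s + t) (z - y)) * H y"
      unfolding I g_def by (simp add: exp_minus)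
  qed
  finally show ?thesis .
qed

lemma conv_heat_const: "t > 0 \<Longrightarrow> conv (heat t) (\<lambda>_. a) z = a"
proof -
  assume t: "t > 0"
  have "conv (heat t) (\<lambda>_. a) z = (LINT y|lborel. complex_of_real (heat t (z - y))) * a" by (simp add: conv_def)
  also have "(LINT y|lborel. complex_of_real (heat t (z - y))) = complex_of_real (LINT y|lborel. heat t (z - y))"
    by (rule integral_complex_of_real)
  also have "(LINT y|lborel. heat t (z - y)) = 1" using integral_affine_reflect[of "heat t" z] heat_integral[OF t] by simp
  finally show ?thesis by simp
qed

lemma conv_reflect: "conv k H z = (LINT w|lborel. complex_of_real (k w) * H (z - w))"
  using integral_affine_reflect[of "\<lambda>y. complex_of_real (k (z - y)) * H y" z] by (simp add: conv_def)

lemma conv_heat_tendsto: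
  assumes c: "c \<ge> 0" and G: "continuous_on UNIV G" "\<And>y. cmod (G y) \<le> A * exp (c * \<bar>y\<bar>)"
    and X: "\<And>i::nat. X i > 0" "X \<longlonglongrightarrow> 0"
  shows "(\<lambda>i. conv (heat (X i)) G z) \<longlonglongrightarrow> G z"
proof -
  have [measurable]: "G \<in> borel_measurable borel" by (rule borel_measurable_continuous_onI[OF G(1)])
  obtain R where R: "\<And>n. \<bar>X n\<bar> \<le> R" using convergent_imp_Bseq[OF convergentI[OF X(2)]] by (auto simp: Bseq_def)
  have A0: "A \<ge> 0" using order_trans[OF norm_ge_zero G(2)[of 0]] by simp
  \<comment> \<open>The substitution w = sqrt t v moves the time dependence into the argument of G,
    so that one fixed Gaussian with an exponential weight dominates.\<close>
  have scale: "conv (heat t) G z = (LINT v|lborel. complex_of_real (heat 1 v) * G (z - sqrt t * v))" if t: "t > 0" for t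
  proof -
    have h: "sqrt t * heat t (sqrt t * v) = heat 1 v" for v
      using t by (simp add: heat_def power_mult_distrib real_sqrt_mult)
    have "conv (heat t) G z = sqrt t *\<^sub>R (LINT v|lborel. complex_of_real (heat t (0 + sqrt t * v)) * G (z - (0 + sqrt t * v)))"
      unfolding conv_reflect using t by (subst lborel_integral_real_affine[of "sqrt t" _ 0]) auto
    also have "\<dots> = (LINT v|lborel. sqrt t *\<^sub>R (complex_of_real (heat t (0 + sqrt t * v)) * G (z - (0 + sqrt t * v))))"
      by simp
    also have "\<dots> = (LINT v|lborel. complex_of_real (heat 1 v) * G (z - sqrt t * v))"
      unfolding h[symmetric] by (simp add: scaleR_conv_of_real mult.assoc)
    finally show ?thesis .
  qed
  have "(\<lambda>i. LINT v|lborel. complex_of_real (heat 1 v) * G (z - sqrt (X i) * v)) \<longlonglongrightarrow> (LINT v|lborel. complex_of_real (heat 1 v) * G z)"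
  proof (rule integral_dominated_convergence[where w="\<lambda>v. A * exp (c * \<bar>z\<bar>) * (heat 1 v * exp (c * sqrt R * \<bar>v\<bar>))"])
    show "integrable lborel (\<lambda>v. A * exp (c * \<bar>z\<bar>) * (heat 1 v * exp (c * sqrt R * \<bar>v\<bar>)))"
      by (intro Bochner_Integration.integrable_mult_right heat_exp_integrable) simp
    show "AE v in lborel. (\<lambda>i. complex_of_real (heat 1 v) * G (z - sqrt (X i) * v)) \<longlonglongrightarrow> complex_of_real (heat 1 v) * G z"
    proof (intro AE_I2 tendsto_mult tendsto_const)
      fix v
      have "(\<lambda>i. z - sqrt (X i) * v) \<longlonglongrightarrow> z - sqrt 0 * v" by (intro tendsto_intros X)
      then have l: "(\<lambda>i. z - sqrt (X i) * v) \<longlonglongrightarrow> z" by simp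
      have "isCont G z" using G(1) by (simp add: continuous_on_eq_continuous_at)
      from isCont_tendsto_compose[OF this l] show "(\<lambda>i. G (z - sqrt (X i) * v)) \<longlonglongrightarrow> G z" .
    qed
    have "norm (complex_of_real (heat 1 v) * G (z - sqrt (X i) * v)) \<le> A * exp (c * \<bar>z\<bar>) * (heat 1 v * exp (c * sqrt R * \<bar>v\<bar>))" for i v
    proof -
      have "\<bar>z - sqrt (X i) * v\<bar> \<le> \<bar>z\<bar> + sqrt (X i) * \<bar>v\<bar>" using X(1)[of i] by (simp add: abs_mult order_trans[OF abs_triangle_ineq4])
      also have "\<dots> \<le> \<bar>z\<bar> + sqrt R * \<bar>v\<bar>" using R[of i] by (intro add_left_mono mult_right_mono) auto
      finally have "c * \<bar>z - sqrt (X i) * v\<bar> \<le> c * \<bar>z\<bar> + c * sqrt R * \<bar>v\<bar>" using c mult_left_mono by (fastforce simp: algebra_simps)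
      then have "exp (c * \<bar>z - sqrt (X i) * v\<bar>) \<le> exp (c * \<bar>z\<bar>) * exp (c * sqrt R * \<bar>v\<bar>)" by (simp add: exp_add[symmetric])
      then have "A * exp (c * \<bar>z - sqrt (X i) * v\<bar>) \<le> A * (exp (c * \<bar>z\<bar>) * exp (c * sqrt R * \<bar>v\<bar>))" using A0 by (rule mult_left_mono)
      then have "cmod (G (z - sqrt (X i) * v)) \<le> A * (exp (c * \<bar>z\<bar>) * exp (c * sqrt R * \<bar>v\<bar>))" using G(2) order_trans by blast
      then have "heat 1 v * cmod (G (z - sqrt (X i) * v)) \<le> heat 1 v * (A * (exp (c * \<bar>z\<bar>) * exp (c * sqrt R * \<bar>v\<bar>)))"
        using heat_pos[of 1 v] by (intro mult_left_mono) auto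
      then show ?thesis using heat_pos[of 1 v] by (simp add: norm_mult mult_ac)
    qed
    then show "AE v in lborel. norm (complex_of_real (heat 1 v) * G (z - sqrt (X i) * v)) \<le> A * exp (c * \<bar>z\<bar>) * (heat 1 v * exp (c * sqrt R * \<bar>v\<bar>))" for i
      by simp
  qed measurable
  moreover have "(LINT v|lborel. complex_of_real (heat 1 v) * G z) = G z"
    using heat_integral[of 1] by (simp add: integral_complex_of_real)
  ultimately show ?thesis by (simp add: scale X(1) heat_integral)
qed

lemma conv_heat_bound:
  assumes t: "t > 0" and c: "c \<ge> 0" and G: "G \<in> borel_measurable borel" "\<And>y. cmod (G y) \<le> A * exp (c * \<bar>y\<bar>)"
  shows "cmod (conv (heat t) G z) \<le> 2 * A * exp (c * \<bar>z\<bar>) * exp (c\<^sup>2 * t)"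
proof -
  note [measurable] = G(1)
  have A0: "A \<ge> 0" using order_trans[OF norm_ge_zero G(2)[of 0]] by simp
  have b: "norm (complex_of_real (heat t w) * G (z - w)) \<le> A * exp (c * \<bar>z\<bar>) * (heat t w * exp (c * \<bar>w\<bar>))" for w
  proof -
    have "c * \<bar>z - w\<bar> \<le> c * (\<bar>z\<bar> + \<bar>w\<bar>)" using c by (intro mult_left_mono) auto
    then have "exp (c * \<bar>z - w\<bar>) \<le> exp (c * \<bar>z\<bar>) * exp (c * \<bar>w\<bar>)" by (simp add: exp_add[symmetric] algebra_simps)
    then have "cmod (G (z - w)) \<le> A * (exp (c * \<bar>z\<bar>) * exp (c * \<bar>w\<bar>))" using G(2)[of "z - w"] A0 mult_left_mono order_trans by blast
    then have "heat t w * cmod (G (z - w)) \<le> heat t w * (A * (exp (c * \<bar>z\<bar>) * exp (c * \<bar>w\<bar>)))"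
      using heat_pos[OF t, of w] by (intro mult_left_mono) auto
    then show ?thesis using heat_pos[OF t, of w] by (simp add: norm_mult mult_ac)
  qed
  have i: "integrable lborel (\<lambda>w. A * exp (c * \<bar>z\<bar>) * (heat t w * exp (c * \<bar>w\<bar>)))"
    by (intro Bochner_Integration.integrable_mult_right heat_exp_integrable t)
  have "integrable lborel (\<lambda>w. complex_of_real (heat t w) * G (z - w))"
  proof (rule Bochner_Integration.integrable_bound[OF i])
    show "AE w in lborel. norm (complex_of_real (heat t w) * G (z - w)) \<le> norm (A * exp (c * \<bar>z\<bar>) * (heat t w * exp (c * \<bar>w\<bar>)))"
      using b by (intro AE_I2) (metis abs_ge_self order_trans real_norm_def)
  qed measurable
  then have "cmod (conv (heat t) G z) \<le> (LINT w|lborel. A * exp (c * \<bar>z\<bar>) * (heat t w * exp (c * \<bar>w\<bar>)))"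
    unfolding conv_reflect by (rule norm_integral_le[OF _ i b])
  also have "\<dots> \<le> A * exp (c * \<bar>z\<bar>) * (2 * exp (c\<^sup>2 * t))"
    using A0 heat_mgf[OF t, of c] by (simp add: mult_left_mono)
  finally show ?thesis by (simp add: mult_ac)
qed

section \<open>Extension to the line\<close>

lemma Mpi_measurable_iff: "f \<in> borel_measurable Mpi \<longleftrightarrow> (\<lambda>x. indicator {0<..<pi} x *\<^sub>R f x) \<in> borel_measurable borel"
  for f :: "real \<Rightarrow> 'b::real_normed_vector"
  unfolding Mpi_def by (subst borel_measurable_restrict_space_iff) (auto simp: measurable_lborel1)

lemma integrable_Mpi_iff: "integrable Mpi f \<longleftrightarrow> integrable lborel (\<lambda>x. indicator {0<..<pi} x *\<^sub>R f x)"
  for f :: "real \<Rightarrow> 'b::{banach, second_countable_topology}"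
  unfolding Mpi_def by (rule integrable_restrict_space) simp

lemma indicator_reflect: "indicator {0<..<pi} (pi - x) = (indicator {0<..<pi} x :: real)"
  by (auto simp: indicator_def)

lemma Mpi_reflect_measurable:
  fixes f :: "real \<Rightarrow> 'b::{real_normed_vector}"
  assumes "f \<in> borel_measurable Mpi" shows "(\<lambda>x. f (pi - x)) \<in> borel_measurable Mpi"
proof -
  have "(\<lambda>x. indicator {0<..<pi} x *\<^sub>R f x) \<in> borel_measurable borel" using assms by (simp add: Mpi_measurable_iff)
  from measurable_compose[of "\<lambda>x. pi - x" borel, OF _ this]
  show ?thesis by (simp add: Mpi_measurable_iff indicator_reflect)
qed

lemma integral_Mpi_reflect: "(LINT x|Mpi. f (pi - x)) = (LINT x|Mpi. f x)"
  for f :: "real \<Rightarrow> 'b::{banach, second_countable_topology}"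
  using integral_affine_reflect[of "\<lambda>x. indicator {0<..<pi} x *\<^sub>R f x" pi]
  by (simp add: integral_Mpi indicator_reflect)

lemma integrable_Mpi_reflect: "integrable Mpi f \<Longrightarrow> integrable Mpi (\<lambda>x. f (pi - x))"
  for f :: "real \<Rightarrow> 'b::{banach, second_countable_topology}"
  using lborel_integrable_real_affine[of "\<lambda>x. indicator {0<..<pi} x *\<^sub>R f x" "-1" pi]
  by (simp add: integrable_Mpi_iff indicator_reflect)

lemma L2_reflect: "L2 f \<Longrightarrow> L2 (\<lambda>x. f (pi - x))"
  using integrable_Mpi_reflect[of "\<lambda>x. (cmod (f x))\<^sup>2"] Mpi_reflect_measurable[of f] by (simp add: L2_def)

lemma norm_L2_reflect: "norm_L2 (\<lambda>x. f (pi - x)) = norm_L2 f"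
  using integral_Mpi_reflect[of "\<lambda>x. (cmod (f x))\<^sup>2"] by (simp add: norm_L2_def)

lemma norm_L2_nonneg [simp]: "norm_L2 f \<ge> 0" by (simp add: norm_L2_def)

lemma norm_L2_add: "L2 f \<Longrightarrow> L2 g \<Longrightarrow> norm_L2 (\<lambda>x. f x + g x) \<le> norm_L2 f + norm_L2 g"
  using norm_triangle_ineq[of "abs_l2 f" "abs_l2 g"]
  by (simp add: norm_abs_l2 L2_add abs_l2_add[symmetric])

lemma norm_L2_cmult: "norm_L2 (\<lambda>x. c * f x) = cmod c * norm_L2 f"
  by (simp add: norm_L2_def norm_mult power_mult_distrib real_sqrt_mult)

lemma norm_L2_le_sup:
  assumes "f \<in> borel_measurable Mpi" "C \<ge> 0" "\<And>x. 0 < x \<Longrightarrow> x < pi \<Longrightarrow> cmod (f x) \<le> C"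
  shows "norm_L2 f \<le> sqrt pi * C"
proof -
  have "(LINT x|Mpi. (cmod (f x))\<^sup>2) \<le> (LINT x|Mpi. C\<^sup>2)"
    using L2_bounded[OF assms(1,3)] assms(3)
    by (intro integral_mono_AE) (auto simp: L2_def intro!: AE_I2 power_mono)
  also have "\<dots> = (sqrt pi * C)\<^sup>2" by (simp add: power_mult_distrib)
  finally show ?thesis unfolding norm_L2_def using assms(2) by (intro real_le_lsqrt) auto
qed

lemma V_bound: "L2 q \<Longrightarrow> cmod (V q x) \<le> sqrt pi * norm_L2 q"
proof -
  assume q: "L2 q"
  have [measurable]: "q \<in> borel_measurable Mpi" using q by (simp add: L2_def)
  note id_measurable_Mpi [measurable]
  have i: "integrable Mpi (\<lambda>s. (if s < x then 1 else 0) * q s)"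
    using integrable_Mpi_bounded_mult[OF L2_integrable[OF q], of "\<lambda>s. if s < x then 1 else 0" 1] by (simp add: mult.commute)
  have "cmod (V q x) \<le> (LINT s|Mpi. cmod (q s))"
    unfolding V_def by (rule norm_integral_le[OF i]) (use L2_integrable[OF q] in auto)
  also have "\<dots> \<le> sqrt pi * norm_L2 q" using L1_le_L2[OF q] q by (simp add: norm_abs_l2)
  finally show ?thesis .
qed

lemma L2_V: "L2 q \<Longrightarrow> L2 (V q)"
  by (rule L2_continuous[OF V_continuous[OF L2_integrable]])

lemma norm_L2_V: "L2 q \<Longrightarrow> norm_L2 (V q) \<le> pi * norm_L2 q"
  using norm_L2_le_sup[of "V q" "sqrt pi * norm_L2 q"] V_bound[of q] L2_V[of q]
  by (simp add: L2_def mult.assoc[symmetric])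

text \<open>Let G be the extension in the coordinate centred at pi. The n-th triple holds G on
  [(n - 1) pi, n pi] and on [n pi, (n + 1) pi], both in a local variable s in [0, pi], and the
  integral of G from 0 to n pi. The recursion step is the functional equation at z = n pi + s. For n
  = 0 the first entry is f itself because evenness gives G(s - pi) = G(pi - s) = f(s).\<close>

primrec blocks :: "real \<Rightarrow> fn \<Rightarrow> nat \<Rightarrow> fn \<times> fn \<times> complex" where
  "blocks \<beta> f 0 = (f, (\<lambda>s. f (pi - s)), 0)"
| "blocks \<beta> f (Suc n) = (case blocks \<beta> f n of (p, q, c) \<Rightarrow>
      (q, (\<lambda>s. p s - 2 * of_real \<beta> * (c + V q s)), c + V q pi))"

definition pB where "pB \<beta> f n = fst (blocks \<beta> f n)"
definition qB where "qB \<beta> f n = fst (snd (blocks \<beta> f n))"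
definition cB where "cB \<beta> f n = snd (snd (blocks \<beta> f n))"

lemma B_simps:
  "pB \<beta> f 0 = f" "qB \<beta> f 0 = (\<lambda>s. f (pi - s))" "cB \<beta> f 0 = 0"
  "pB \<beta> f (Suc n) = qB \<beta> f n"
  "qB \<beta> f (Suc n) = (\<lambda>s. pB \<beta> f n s - 2 * of_real \<beta> * (cB \<beta> f n + V (qB \<beta> f n) s))"
  "cB \<beta> f (Suc n) = cB \<beta> f n + V (qB \<beta> f n) pi"
  by (simp_all add: pB_def qB_def cB_def split: prod.split)

text \<open>A factor by which all three block quantities grow at most. \<open>V\<close> has norm at
  most pi; \<open>V q\<close> and the accumulated constant both enter with 2 |\<beta>|, giving 4 pi
  |\<beta>|; the 2 covers the previous block and the sum c + V q pi.\<close>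

definition Qc :: "real \<Rightarrow> real" where "Qc \<beta> = 2 + 4 * pi * \<bar>\<beta>\<bar>"

lemma Qc_ge: "Qc \<beta> \<ge> 2" by (simp add: Qc_def)

lemma B_bounds:
  assumes f: "L2 f"
  shows "L2 (pB \<beta> f n) \<and> L2 (qB \<beta> f n) \<and> norm_L2 (pB \<beta> f n) \<le> Qc \<beta> ^ n * norm_L2 f \<and>
    norm_L2 (qB \<beta> f n) \<le> Qc \<beta> ^ n * norm_L2 f \<and> sqrt pi * cmod (cB \<beta> f n) \<le> pi * (Qc \<beta> ^ n * norm_L2 f)"
proof (induction n)
  case 0
  show ?case using f by (simp add: B_simps L2_reflect norm_L2_reflect)
next
  case (Suc n)
  define p where "p = pB \<beta> f n"
  define q where "q = qB \<beta> f n"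
  define c where "c = cB \<beta> f n"
  define M where "M = Qc \<beta> ^ n * norm_L2 f"
  have IH: "L2 p" "L2 q" "norm_L2 p \<le> M" "norm_L2 q \<le> M" "sqrt pi * cmod c \<le> pi * M"
    using Suc by (auto simp: p_def q_def c_def M_def)
  have M0: "M \<ge> 0" using Qc_ge[of \<beta>] by (simp add: M_def)
  have QM: "2 * M \<le> Qc \<beta> * M" using Qc_ge[of \<beta>] M0 by (rule mult_right_mono)
  have Suc_M: "Qc \<beta> ^ Suc n * norm_L2 f = Qc \<beta> * M" by (simp add: M_def)
  have LcV: "L2 (\<lambda>s. c + V q s)" by (intro L2_add L2_const L2_V IH)
  have nc: "norm_L2 (\<lambda>s. c) = sqrt pi * cmod c" by (simp add: norm_L2_def real_sqrt_mult)
  have "norm_L2 (\<lambda>s. c + V q s) \<le> sqrt pi * cmod c + pi * norm_L2 q"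
    using norm_L2_add[OF L2_const[of c] L2_V[OF IH(2)]] norm_L2_V[OF IH(2)] nc by linarith
  also have "\<dots> \<le> pi * M + pi * M" using IH(4,5) by (intro add_mono mult_left_mono) auto
  finally have a: "norm_L2 (\<lambda>s. c + V q s) \<le> 2 * pi * M" by (simp add: mult_ac)
  have "norm_L2 (\<lambda>s. p s + (- (2 * of_real \<beta>)) * (c + V q s)) \<le> norm_L2 p + norm_L2 (\<lambda>s. (- (2 * of_real \<beta>)) * (c + V q s))"
    by (intro norm_L2_add IH L2_mult_const LcV)
  also have "norm_L2 (\<lambda>s. (- (2 * of_real \<beta>)) * (c + V q s)) = 2 * \<bar>\<beta>\<bar> * norm_L2 (\<lambda>s. c + V q s)"
    unfolding norm_L2_cmult by (simp add: norm_mult)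
  also have "norm_L2 p + 2 * \<bar>\<beta>\<bar> * norm_L2 (\<lambda>s. c + V q s) \<le> M + 2 * \<bar>\<beta>\<bar> * (2 * pi * M)"
    using IH(3) a by (intro add_mono mult_left_mono) auto
  also have "\<dots> \<le> Qc \<beta> * M" using M0 by (simp add: Qc_def algebra_simps)
  finally have nq: "norm_L2 (\<lambda>s. p s - 2 * of_real \<beta> * (c + V q s)) \<le> Qc \<beta> * M" by simp
  have "sqrt pi * cmod (c + V q pi) \<le> sqrt pi * cmod c + sqrt pi * cmod (V q pi)"
    using mult_left_mono[OF norm_triangle_ineq[of c "V q pi"], of "sqrt pi"] by (simp add: distrib_left)
  also have "sqrt pi * cmod (V q pi) \<le> sqrt pi * (sqrt pi * norm_L2 q)"
    by (intro mult_left_mono V_bound IH) simp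
  also have "\<dots> \<le> pi * M" using IH(4) by (simp add: mult.assoc[symmetric])
  finally have "sqrt pi * cmod (c + V q pi) \<le> pi * (2 * M)" using IH(5) by simp
  also have "\<dots> \<le> pi * (Qc \<beta> * M)" using QM by (intro mult_left_mono) auto
  finally have nc': "sqrt pi * cmod (c + V q pi) \<le> pi * (Qc \<beta> * M)" .
  have "L2 (\<lambda>s. p s - 2 * of_real \<beta> * (c + V q s))" by (intro L2_diff L2_mult_const LcV IH)
  then show ?case using IH nq nc' QM M0 unfolding Suc_M B_simps p_def[symmetric] q_def[symmetric] c_def[symmetric] by simp
qed

definition blk :: "real \<Rightarrow> nat" where "blk y = nat \<lfloor>\<bar>y\<bar> / pi\<rfloor>"

definition ext :: "real \<Rightarrow> fn \<Rightarrow> fn" where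
  "ext \<beta> f y = qB \<beta> f (blk y) (\<bar>y\<bar> - pi * real (blk y))"

lemma blk_bounds: "pi * real (blk y) \<le> \<bar>y\<bar>" "\<bar>y\<bar> < pi * real (blk y) + pi"
proof -
  have "real (blk y) = of_int \<lfloor>\<bar>y\<bar> / pi\<rfloor>" by (simp add: blk_def)
  then have "real (blk y) \<le> \<bar>y\<bar> / pi" "\<bar>y\<bar> / pi < real (blk y) + 1" by linarith+
  then show "pi * real (blk y) \<le> \<bar>y\<bar>" "\<bar>y\<bar> < pi * real (blk y) + pi" by (simp_all add: field_simps)
qed

lemma blk_eq: "0 \<le> s \<Longrightarrow> s < pi \<Longrightarrow> blk (pi * real n + s) = n"
proof -
  assume s: "0 \<le> s" "s < pi"
  have "\<bar>pi * real n + s\<bar> / pi = real n + s / pi" using s by (simp add: field_simps)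
  moreover have "\<lfloor>real n + s / pi\<rfloor> = int n" using s by (intro floor_unique) (auto simp: field_simps)
  ultimately show ?thesis by (simp add: blk_def)
qed

lemma ext_even: "ext \<beta> f (- y) = ext \<beta> f y" by (simp add: ext_def blk_def)

lemma ext_block: "0 \<le> s \<Longrightarrow> s < pi \<Longrightarrow> ext \<beta> f (pi * real n + s) = qB \<beta> f n s"
  using blk_eq[of s n] by (simp add: ext_def)

lemma V_0: "V q 0 = 0"
proof -
  have "V q 0 = (LINT s|Mpi. 0)" unfolding V_def by (rule Bochner_Integration.integral_cong) auto
  then show ?thesis by simp
qed

lemma ext_start: "y \<in> {0..pi} \<Longrightarrow> ext \<beta> f y = f (pi - y)"
  using ext_block[of y \<beta> f 0] ext_block[of 0 \<beta> f 1] by (cases "y = pi") (auto simp: B_simps V_0)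

text \<open>A block function is known to be measurable only on (0, pi); cutting it off outside
  [0, pi] makes it Borel on the line, so that the blocks can be glued measurably.\<close>

definition clip :: "fn \<Rightarrow> fn" where "clip q s = (if s \<in> {0..pi} then q s else 0)"

lemma clip_measurable: "q \<in> borel_measurable Mpi \<Longrightarrow> clip q \<in> borel_measurable borel"
proof -
  assume "q \<in> borel_measurable Mpi"
  then have [measurable]: "(\<lambda>x. indicator {0<..<pi} x *\<^sub>R q x) \<in> borel_measurable borel" by (simp add: Mpi_measurable_iff)
  have "clip q = (\<lambda>x. if x = 0 then q 0 else if x = pi then q pi else indicator {0<..<pi} x *\<^sub>R q x)"
    by (auto simp: clip_def indicator_def fun_eq_iff)
  then show ?thesis by simp
qed

lemma ext_clip: "ext \<beta> f y = clip (qB \<beta> f (blk y)) (\<bar>y\<bar> - pi * real (blk y))"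
  using blk_bounds[of y] by (simp add: ext_def clip_def)

lemma blk_measurable [measurable]: "blk \<in> measurable borel (count_space UNIV)"
  unfolding blk_def[abs_def] by measurable

lemma ext_measurable:
  assumes f: "L2 f" shows "ext \<beta> f \<in> borel_measurable borel"
proof -
  have "(\<lambda>y. clip (qB \<beta> f (blk y)) (\<bar>y\<bar> - pi * real (blk y))) \<in> borel_measurable borel"
  proof (rule measurable_compose_countable[where g=blk])
    fix n
    have [measurable]: "clip (qB \<beta> f n) \<in> borel_measurable borel"
      using B_bounds[OF f, of \<beta> n] by (intro clip_measurable) (simp add: L2_def)
    show "(\<lambda>y. clip (qB \<beta> f n) (\<bar>y\<bar> - pi * real n)) \<in> borel_measurable borel" by measurable
  qed measurable
  then show ?thesis by (simp add: ext_clip[abs_def])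
qed

text \<open>Chosen so that exp (- gr pi) Qc^2 = 1/2: in the weighted square integral of the
  extension the bound for each block is half of the bound for the one before.\<close>

definition gr :: "real \<Rightarrow> real" where "gr \<beta> = ln (2 * (Qc \<beta>)\<^sup>2) / pi"

lemma gr_nonneg: "gr \<beta> \<ge> 0"
proof -
  have "1 \<le> 2 * (Qc \<beta>)\<^sup>2" using power_mono[OF Qc_ge[of \<beta>], of 2] by simp
  then show ?thesis by (simp add: gr_def)
qed

lemma nn_integral_clip: "L2 q \<Longrightarrow> (\<integral>\<^sup>+s. ennreal ((cmod (clip q s))\<^sup>2) \<partial>lborel) = ennreal ((norm_L2 q)\<^sup>2)"
proof -
  assume q: "L2 q"
  have "(\<integral>\<^sup>+s. ennreal ((cmod (clip q s))\<^sup>2) \<partial>lborel) = (\<integral>\<^sup>+s. ennreal ((cmod (q s))\<^sup>2) * indicator {0<..<pi} s \<partial>lborel)"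
  proof (rule nn_integral_cong_AE)
    have "AE s in lborel. s \<noteq> (0::real)" "AE s in lborel. s \<noteq> pi" by (rule AE_lborel_singleton)+
    then show "AE s in lborel. ennreal ((cmod (clip q s))\<^sup>2) = ennreal ((cmod (q s))\<^sup>2) * indicator {0<..<pi} s"
      by eventually_elim (auto simp: clip_def indicator_def)
  qed
  also have "\<dots> = (\<integral>\<^sup>+s. ennreal ((cmod (q s))\<^sup>2) \<partial>Mpi)"
    unfolding Mpi_def by (subst nn_integral_restrict_space) auto
  also have "\<dots> = ennreal ((norm_L2 q)\<^sup>2)"
    using q by (subst nn_integral_eq_integral[OF L2_integrable_norm2]) (auto simp: norm_L2_def)
  finally show ?thesis .
qed

lemma ext_weighted_L2:
  assumes f: "L2 f"
  shows "integrable lborel (\<lambda>y. exp (- gr \<beta> * \<bar>y\<bar>) * (cmod (ext \<beta> f y))\<^sup>2)"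
    and "(LINT y|lborel. exp (- gr \<beta> * \<bar>y\<bar>) * (cmod (ext \<beta> f y))\<^sup>2) \<le> 4 * (norm_L2 f)\<^sup>2"
proof -
  let ?c = "gr \<beta>" and ?Q = "Qc \<beta>" and ?N = "norm_L2 f"
  note [measurable] = ext_measurable[OF f]
  have Lq: "L2 (qB \<beta> f n)" and nq: "norm_L2 (qB \<beta> f n) \<le> ?Q ^ n * ?N" for n using B_bounds[OF f] by auto
  have [measurable]: "clip (qB \<beta> f n) \<in> borel_measurable borel" for n using Lq by (intro clip_measurable) (simp add: L2_def)
  let ?A = "\<lambda>n. {y. blk y = n}"
  let ?g = "\<lambda>y. ennreal (exp (- ?c * \<bar>y\<bar>) * (cmod (ext \<beta> f y))\<^sup>2)"
  have Q: "exp (- ?c * pi) * ?Q\<^sup>2 = 1 / 2"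
    using Qc_ge[of \<beta>] by (simp add: gr_def exp_minus)
  have "(\<integral>\<^sup>+y. ?g y \<partial>lborel) = (\<integral>\<^sup>+y. (\<Sum>n. ?g y * indicator (?A n) y) \<partial>lborel)"
  proof (rule nn_integral_cong)
    fix y
    have "(\<Sum>n. ?g y * indicator (?A n) y) = ?g y"
      by (rule suminf_cmult_indicator[of ?A _ "blk y"]) (auto simp: disjoint_family_on_def)
    then show "?g y = (\<Sum>n. ?g y * indicator (?A n) y)" by simp
  qed
  also have "\<dots> = (\<Sum>n. \<integral>\<^sup>+y. ?g y * indicator (?A n) y \<partial>lborel)"
    by (rule nn_integral_suminf) measurable
  also have "\<dots> \<le> (\<Sum>n. ennreal (2 * ?N\<^sup>2 * (1 / 2) ^ n))"
  proof (rule suminf_le)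
    fix n
    let ?q = "\<lambda>s. ennreal ((cmod (clip (qB \<beta> f n) s))\<^sup>2)"
    have "(\<integral>\<^sup>+y. ?g y * indicator (?A n) y \<partial>lborel)
       \<le> (\<integral>\<^sup>+y. ennreal (exp (- ?c * pi) ^ n) * (?q (y - pi * real n) + ?q (- y - pi * real n)) \<partial>lborel)"
    proof (rule nn_integral_mono)
      fix y
      show "?g y * indicator (?A n) y \<le> ennreal (exp (- ?c * pi) ^ n) * (?q (y - pi * real n) + ?q (- y - pi * real n))"
      proof (cases "blk y = n")
        case True
        have "?c * (pi * real n) \<le> ?c * \<bar>y\<bar>" using blk_bounds(1)[of y] True gr_nonneg by (intro mult_left_mono) auto
        then have e: "exp (- ?c * \<bar>y\<bar>) \<le> exp (- ?c * pi) ^ n" by (simp add: exp_of_nat_mult[symmetric] algebra_simps)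
        have "?g y \<le> ennreal (exp (- ?c * pi) ^ n * (cmod (clip (qB \<beta> f n) (\<bar>y\<bar> - pi * real n)))\<^sup>2)"
          using e True by (intro ennreal_leI) (simp add: ext_clip mult_right_mono)
        also have "\<dots> = ennreal (exp (- ?c * pi) ^ n) * ?q (\<bar>y\<bar> - pi * real n)" by (simp add: ennreal_mult)
        also have "\<dots> \<le> ennreal (exp (- ?c * pi) ^ n) * (?q (y - pi * real n) + ?q (- y - pi * real n))"
          by (intro mult_left_mono) (auto simp: abs_if)
        finally show ?thesis using True by simp
      qed simp
    qed
    also have "\<dots> = ennreal (exp (- ?c * pi) ^ n) * ((\<integral>\<^sup>+y. ?q (y - pi * real n) \<partial>lborel) + (\<integral>\<^sup>+y. ?q (- y - pi * real n) \<partial>lborel))"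
      by (subst nn_integral_cmult) (auto simp: nn_integral_add)
    also have "(\<integral>\<^sup>+y. ?q (y - pi * real n) \<partial>lborel) = (\<integral>\<^sup>+s. ?q s \<partial>lborel)"
      using nn_integral_real_affine[of ?q 1 "- pi * real n"] by (simp add: algebra_simps)
    also have "(\<integral>\<^sup>+y. ?q (- y - pi * real n) \<partial>lborel) = (\<integral>\<^sup>+s. ?q s \<partial>lborel)"
      using nn_integral_real_affine[of ?q "-1" "- pi * real n"] by (simp add: algebra_simps)
    also have "(\<integral>\<^sup>+s. ?q s \<partial>lborel) = ennreal ((norm_L2 (qB \<beta> f n))\<^sup>2)" by (rule nn_integral_clip[OF Lq])
    also have "ennreal (exp (- ?c * pi) ^ n) * (ennreal ((norm_L2 (qB \<beta> f n))\<^sup>2) + ennreal ((norm_L2 (qB \<beta> f n))\<^sup>2))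
        = ennreal (exp (- ?c * pi) ^ n * (2 * (norm_L2 (qB \<beta> f n))\<^sup>2))"
      by (simp add: ennreal_mult ennreal_plus[symmetric] del: ennreal_plus)
    also have "\<dots> \<le> ennreal (2 * ?N\<^sup>2 * (1 / 2) ^ n)"
    proof (rule ennreal_leI)
      have "(norm_L2 (qB \<beta> f n))\<^sup>2 \<le> (?Q ^ n * ?N)\<^sup>2" by (intro power_mono nq) simp
      then have "exp (- ?c * pi) ^ n * (2 * (norm_L2 (qB \<beta> f n))\<^sup>2) \<le> exp (- ?c * pi) ^ n * (2 * (?Q ^ n * ?N)\<^sup>2)"
        by (intro mult_left_mono) auto
      also have "\<dots> = 2 * ?N\<^sup>2 * (exp (- ?c * pi) * ?Q\<^sup>2) ^ n"
        by (simp add: power_mult_distrib power_mult[symmetric] mult.commute)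
      finally show "exp (- ?c * pi) ^ n * (2 * (norm_L2 (qB \<beta> f n))\<^sup>2) \<le> 2 * ?N\<^sup>2 * (1 / 2) ^ n" unfolding Q .
    qed
    finally show "(\<integral>\<^sup>+y. ?g y * indicator (?A n) y \<partial>lborel) \<le> ennreal (2 * ?N\<^sup>2 * (1 / 2) ^ n)" .
  qed auto
  also have "\<dots> = ennreal (2 * ?N\<^sup>2 * 2)"
  proof (rule suminf_ennreal_eq)
    show "(\<lambda>n. 2 * ?N\<^sup>2 * (1 / 2) ^ n) sums (2 * ?N\<^sup>2 * 2)"
      by (intro sums_mult) (use geometric_sums[of "1/2::real"] in simp)
  qed auto
  finally have *: "(\<integral>\<^sup>+y. ?g y \<partial>lborel) \<le> ennreal (4 * ?N\<^sup>2)" by simp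
  show i: "integrable lborel (\<lambda>y. exp (- ?c * \<bar>y\<bar>) * (cmod (ext \<beta> f y))\<^sup>2)"
    by (rule Bochner_Integration.integrableI_nonneg) (use * in \<open>auto intro: le_less_trans[OF _ ennreal_less_top]\<close>)
  show "(LINT y|lborel. exp (- ?c * \<bar>y\<bar>) * (cmod (ext \<beta> f y))\<^sup>2) \<le> 4 * ?N\<^sup>2"
    using * by (subst (asm) nn_integral_eq_integral[OF i]) (auto simp: ennreal_le_iff)
qed

text \<open>From weighted L2 to weighted L1 by 2 x y \<le> x^2 + y^2, where x carries the function
  and half of the old weight and y an integrable exponential; this raises the rate by 1.\<close>

lemma ext_egrow:
  assumes f: "L2 f" shows "egrow (gr \<beta> + 1) (ext \<beta> f)"
  unfolding egrow_def
proof (intro conjI)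
  let ?c = "gr \<beta>"
  note [measurable] = ext_measurable[OF f]
  show "ext \<beta> f \<in> borel_measurable borel" by measurable
  show "?c + 1 \<ge> 0" using gr_nonneg[of \<beta>] by simp
  show "integrable lborel (\<lambda>y. complex_of_real (exp (- (?c + 1) * \<bar>y\<bar>)) * ext \<beta> f y)"
  proof (rule Bochner_Integration.integrable_bound)
    show "integrable lborel (\<lambda>y. exp (- ?c * \<bar>y\<bar>) * (cmod (ext \<beta> f y))\<^sup>2 + exp (- (?c + 2) * \<bar>y\<bar>))"
      using gr_nonneg[of \<beta>] by (intro Bochner_Integration.integrable_add ext_weighted_L2 f integrable_exp_neg_abs) auto
    have "norm (complex_of_real (exp (- (?c + 1) * \<bar>y\<bar>)) * ext \<beta> f y) \<le> norm (exp (- ?c * \<bar>y\<bar>) * (cmod (ext \<beta> f y))\<^sup>2 + exp (- (?c + 2) * \<bar>y\<bar>))" for y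
    proof -
      let ?m = "cmod (ext \<beta> f y)" and ?a = "exp (- ?c * \<bar>y\<bar> / 2)" and ?b = "exp (- (?c + 2) * \<bar>y\<bar> / 2)"
      have ab: "?a * ?b = exp (- (?c + 1) * \<bar>y\<bar>)" "?a * ?a = exp (- ?c * \<bar>y\<bar>)" "?b * ?b = exp (- (?c + 2) * \<bar>y\<bar>)"
        by (simp_all only: exp_add[symmetric] exp_inj_iff) (simp_all add: field_simps)
      have "0 \<le> (?a * ?m - ?b)\<^sup>2" by simp
      also have "\<dots> = (?a * ?a) * ?m\<^sup>2 + ?b * ?b - 2 * ((?a * ?b) * ?m)" by (simp add: power2_eq_square algebra_simps)
      finally have "2 * ((?a * ?b) * ?m) \<le> (?a * ?a) * ?m\<^sup>2 + ?b * ?b" by simp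
      moreover have "0 \<le> (?a * ?b) * ?m" by simp
      ultimately have "(?a * ?b) * ?m \<le> (?a * ?a) * ?m\<^sup>2 + ?b * ?b" by linarith
      then show ?thesis unfolding ab by (simp add: norm_mult)
    qed
    then show "AE y in lborel. norm (complex_of_real (exp (- (?c + 1) * \<bar>y\<bar>)) * ext \<beta> f y) \<le> norm (exp (- ?c * \<bar>y\<bar>) * (cmod (ext \<beta> f y))\<^sup>2 + exp (- (?c + 2) * \<bar>y\<bar>))"
      by simp
  qed measurable
qed

section \<open>Shifts and parity of primitives, and the functional equation of the extension\<close>

lemma egrow_shift:
  assumes H: "egrow c H" shows "egrow c (\<lambda>y. H (y + a))"
proof -
  have [measurable]: "H \<in> borel_measurable borel" using H by (rule egrow_measurable)
  have c: "c \<ge> 0" and iH: "integrable lborel (\<lambda>y. complex_of_real (exp (- c * \<bar>y\<bar>)) * H y)" using H by (auto simp: egrow_def)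
  have "integrable lborel (\<lambda>y. complex_of_real (exp (- c * \<bar>a + 1 * y\<bar>)) * H (a + 1 * y))"
    by (rule lborel_integrable_real_affine[OF iH]) simp
  then have i: "integrable lborel (\<lambda>y. complex_of_real (exp (c * \<bar>a\<bar>)) * (complex_of_real (exp (- c * \<bar>y + a\<bar>)) * H (y + a)))"
    by (intro Bochner_Integration.integrable_mult_right) (simp add: add.commute)
  have "integrable lborel (\<lambda>y. complex_of_real (exp (- c * \<bar>y\<bar>)) * H (y + a))"
  proof (rule Bochner_Integration.integrable_bound[OF i])
    have "norm (complex_of_real (exp (- c * \<bar>y\<bar>)) * H (y + a)) \<le> norm (complex_of_real (exp (c * \<bar>a\<bar>)) * (complex_of_real (exp (- c * \<bar>y + a\<bar>)) * H (y + a)))" for y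
    proof -
      have "c * \<bar>y + a\<bar> \<le> c * (\<bar>y\<bar> + \<bar>a\<bar>)" using c by (intro mult_left_mono) auto
      then have "exp (- c * \<bar>y\<bar>) \<le> exp (c * \<bar>a\<bar>) * exp (- c * \<bar>y + a\<bar>)"
        by (subst exp_add[symmetric]) (simp add: algebra_simps)
      then have "exp (- c * \<bar>y\<bar>) * cmod (H (y + a)) \<le> exp (c * \<bar>a\<bar>) * exp (- c * \<bar>y + a\<bar>) * cmod (H (y + a))"
        by (rule mult_right_mono) simp
      then show ?thesis by (simp add: norm_mult mult.assoc)
    qed
    then show "AE y in lborel. norm (complex_of_real (exp (- c * \<bar>y\<bar>)) * H (y + a)) \<le> norm (complex_of_real (exp (c * \<bar>a\<bar>)) * (complex_of_real (exp (- c * \<bar>y + a\<bar>)) * H (y + a)))"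
      by simp
  qed measurable
  then show ?thesis using c by (simp add: egrow_def)
qed

lemma J_shift:
  assumes H: "egrow c H" shows "J H (z + a) - J H a = J (\<lambda>y. H (y + a)) z"
proof -
  have [measurable]: "H \<in> borel_measurable borel" using H by (rule egrow_measurable)
  have "J H (z + a) - J H a = (LINT y|lborel. complex_of_real (jk (z + a) y) * H y - complex_of_real (jk a y) * H y)"
    unfolding J_def by (rule Bochner_Integration.integral_diff[symmetric]; rule egrow_jk(1)[OF H])
  also have "\<dots> = (LINT y|lborel. complex_of_real (jk z (y - a)) * H (y - a + a))"
  proof (rule integral_cong_AE)
    have "AE y in lborel. y \<noteq> (0::real)" "AE y in lborel. y \<noteq> a" "AE y in lborel. y \<noteq> z + a" by (rule AE_lborel_singleton)+
    then show "AE y in lborel. complex_of_real (jk (z + a) y) * H y - complex_of_real (jk a y) * H y = complex_of_real (jk z (y - a)) * H (y - a + a)"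
      by eventually_elim (auto simp: jk_def)
  qed measurable
  also have "\<dots> = J (\<lambda>y. H (y + a)) z"
    unfolding J_def using lborel_integral_real_affine[of 1 "\<lambda>y. complex_of_real (jk z y) * H (y + a)" "- a"]
    by (simp add: algebra_simps)
  finally show ?thesis .
qed

lemma J_lincomb:
  assumes "egrow c G" "egrow d H" shows "J (\<lambda>y. G y + a * H y) z = J G z + a * J H z"
proof -
  have "J (\<lambda>y. G y + a * H y) z = (LINT y|lborel. complex_of_real (jk z y) * G y + a * (complex_of_real (jk z y) * H y))"
    unfolding J_def by (rule Bochner_Integration.integral_cong) (auto simp: algebra_simps)
  also have "\<dots> = J G z + a * J H z"
    unfolding J_def using egrow_jk(1)[OF assms(1)] egrow_jk(1)[OF assms(2)] by (subst Bochner_Integration.integral_add) auto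
  finally show ?thesis .
qed

lemma J_odd: "(\<And>y. H (- y) = H y) \<Longrightarrow> J H (- z) = - J H z"
proof -
  assume e: "\<And>y. H (- y) = H y"
  have "J H (- z) = (LINT y|lborel. complex_of_real (jk (- z) (0 - y)) * H (0 - y))"
    unfolding J_def by (rule integral_affine_reflect[symmetric])
  also have "\<dots> = (LINT y|lborel. - (complex_of_real (jk z y) * H y))"
    by (rule Bochner_Integration.integral_cong) (auto simp: jk_def e)
  finally show ?thesis by (simp add: J_def)
qed

lemma J_even: "(\<And>y. H (- y) = - H y) \<Longrightarrow> J H (- z) = J H z"
proof -
  assume e: "\<And>y. H (- y) = - H y"
  have "J H (- z) = (LINT y|lborel. complex_of_real (jk (- z) (0 - y)) * H (0 - y))"
    unfolding J_def by (rule integral_affine_reflect[symmetric])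
  also have "\<dots> = (LINT y|lborel. complex_of_real (jk z y) * H y)"
    by (rule Bochner_Integration.integral_cong) (auto simp: jk_def e)
  finally show ?thesis by (simp add: J_def)
qed

lemma J_block:
  assumes G: "egrow c G" and q: "\<And>r. 0 < r \<Longrightarrow> r < pi \<Longrightarrow> q r = G (b + r)" and s: "s \<in> {0..pi}"
  shows "J G (b + s) = J G b + V q s"
proof -
  have "J G (s + b) - J G b = J (\<lambda>y. G (y + b)) s" by (rule J_shift[OF G])
  also have "\<dots> = (LINT y|lborel. indicator {0<..<pi} y *\<^sub>R ((if y < s then 1 else 0) * q y))"
    unfolding J_def using s q by (intro Bochner_Integration.integral_cong) (auto simp: jk_def indicator_def add.commute)
  also have "\<dots> = V q s" by (simp add: V_def integral_Mpi)
  finally show ?thesis by (simp add: algebra_simps)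
qed

text \<open>The half-open block formula is extended to s = pi, where \<open>ext\<close> switches to
  the next block: by the recursion neighbouring blocks agree there pointwise. The second part
  identifies the running constant with the primitive of the extension.\<close>

lemma ext_block': "s \<in> {0..pi} \<Longrightarrow> L2 f \<Longrightarrow> ext \<beta> f (pi * real n + s) = qB \<beta> f n s"
  and cB_J: "L2 f \<Longrightarrow> J (ext \<beta> f) (pi * real n) = cB \<beta> f n"
proof -
  have cJ: "J (ext \<beta> f) (pi * real n) = cB \<beta> f n" if f: "L2 f" for n
  proof (induction n)
    case (Suc n)
    have "J (ext \<beta> f) (pi * real n + pi) = J (ext \<beta> f) (pi * real n) + V (qB \<beta> f n) pi"
      by (rule J_block[OF ext_egrow[OF f]]) (auto simp: ext_block)
    then show ?case using Suc by (simp add: B_simps algebra_simps)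
  qed (simp add: B_simps)
  then show "L2 f \<Longrightarrow> J (ext \<beta> f) (pi * real n) = cB \<beta> f n" .
  show "ext \<beta> f (pi * real n + s) = qB \<beta> f n s" if s: "s \<in> {0..pi}" and f: "L2 f"
  proof (cases "s = pi")
    case True
    have *: "qB \<beta> f (Suc n) 0 = qB \<beta> f n pi" for n
    proof (induction n rule: less_induct)
      case (less n)
      show ?case
      proof (cases n)
        case 0 then show ?thesis by (simp add: B_simps V_0)
      next
        case (Suc m)
        have "qB \<beta> f m 0 = pB \<beta> f m pi"
        proof (cases m)
          case (Suc k)
          then show ?thesis using less.IH[of k] \<open>n = Suc m\<close> by (simp add: B_simps(4))
        qed (simp add: B_simps)
        moreover have "qB \<beta> f (Suc n) 0 = qB \<beta> f m 0 - 2 * of_real \<beta> * cB \<beta> f (Suc m)"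
          unfolding Suc B_simps(5)[of \<beta> f "Suc m"] B_simps(4)[of \<beta> f m] by (simp add: V_0)
        moreover have "qB \<beta> f n pi = pB \<beta> f m pi - 2 * of_real \<beta> * cB \<beta> f (Suc m)"
          unfolding Suc by (simp add: B_simps)
        ultimately show ?thesis by simp
      qed
    qed
    show ?thesis using ext_block[of 0 \<beta> f "Suc n"] *[of n] True by (simp add: algebra_simps)
  qed (use s ext_block in auto)
qed

lemma J_ext: "L2 f \<Longrightarrow> s \<in> {0..pi} \<Longrightarrow> J (ext \<beta> f) (pi * real n + s) = cB \<beta> f n + V (qB \<beta> f n) s"
  using J_block[OF ext_egrow, of f "qB \<beta> f n" \<beta> "pi * real n" s] by (simp add: ext_block cB_J)

text \<open>For z \<ge> 0 this is the block recursion, with the reflected block in the case n = 0;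
  the case z < 0 follows because both sides are odd in z.\<close>

lemma ext_functional_eq:
  assumes f: "L2 f"
  shows "ext \<beta> f (z + pi) - ext \<beta> f (z - pi) = - 2 * of_real \<beta> * J (ext \<beta> f) z"
proof -
  have pos: "ext \<beta> f (z + pi) - ext \<beta> f (z - pi) = - 2 * of_real \<beta> * J (ext \<beta> f) z" if "z \<ge> 0" for z
  proof -
    define n where "n = blk z"
    define s where "s = \<bar>z\<bar> - pi * real n"
    have ns: "z = pi * real n + s" "0 \<le> s" "s < pi" using blk_bounds[of z] that by (auto simp: n_def s_def)
    have 1: "ext \<beta> f (z + pi) = qB \<beta> f (Suc n) s" using ext_block[of s \<beta> f "Suc n"] ns by (simp add: algebra_simps)
    have 2: "ext \<beta> f (z - pi) = pB \<beta> f n s"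
    proof (cases n)
      case 0
      have "ext \<beta> f (z - pi) = ext \<beta> f (pi - s)" using ext_even[of \<beta> f "pi - s"] ns 0 by simp
      also have "\<dots> = f s" using ext_start[of "pi - s"] ns by simp
      finally show ?thesis using 0 by (simp add: B_simps)
    next
      case (Suc m)
      then show ?thesis using ext_block[of s \<beta> f m] ns by (simp add: B_simps algebra_simps)
    qed
    have "J (ext \<beta> f) z = cB \<beta> f n + V (qB \<beta> f n) s" unfolding ns(1) using ns by (intro J_ext f) auto
    then show ?thesis unfolding 1 2 by (simp add: B_simps)
  qed
  show ?thesis
  proof (cases "z \<ge> 0")
    case False
    have refl2: "ext \<beta> f (- z - pi) = ext \<beta> f (z + pi)" "ext \<beta> f (- z + pi) = ext \<beta> f (z - pi)"
      using ext_even[of \<beta> f "z + pi"] ext_even[of \<beta> f "z - pi"] by simp_all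
    have "ext \<beta> f (- z + pi) - ext \<beta> f (- z - pi) = - 2 * of_real \<beta> * J (ext \<beta> f) (- z)"
      using False by (intro pos) simp
    then have "- (ext \<beta> f (z + pi) - ext \<beta> f (z - pi)) = - (- 2 * of_real \<beta> * J (ext \<beta> f) z)"
      unfolding J_odd[of "ext \<beta> f" z, OF ext_even] refl2 by simp
    then show ?thesis by (simp only: neg_equal_iff_equal)
  qed (rule pos)
qed

text \<open>Values on [- pi, 0], evenness and the functional equation determine everything else
  block by block. Extensions of linear combinations, of heat orbits and of domain elements are
  identified through this instead of through the recursion.\<close>

lemma ext_unique:
  assumes G: "egrow c G" and even: "\<And>y. G (- y) = G y"
    and fe: "\<And>z. G (z + pi) - G (z - pi) = - 2 * of_real \<beta> * J G z"
    and f: "\<And>x. x \<in> {0..pi} \<Longrightarrow> f x = G (x - pi)"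
  shows "ext \<beta> f = G"
proof -
  have fr: "f (pi - s) = G s" if "s \<in> {0..pi}" for s using f[of "pi - s"] that even[of s] by simp
  have "(\<forall>s\<in>{0..pi}. pB \<beta> f n s = G (pi * real n + s - pi)) \<and> (\<forall>s\<in>{0..pi}. qB \<beta> f n s = G (pi * real n + s)) \<and> cB \<beta> f n = J G (pi * real n)" for n
  proof (induction n)
    case 0
    show ?case using f fr by (simp add: B_simps)
  next
    case (Suc n)
    have JV: "J G (pi * real n + s) = J G (pi * real n) + V (qB \<beta> f n) s" if "s \<in> {0..pi}" for s
      using Suc that by (intro J_block[OF G]) auto
    have "qB \<beta> f (Suc n) s = G (pi * real (Suc n) + s)" if s: "s \<in> {0..pi}" for s
    proof -
      have "qB \<beta> f (Suc n) s = G (pi * real n + s - pi) - 2 * of_real \<beta> * J G (pi * real n + s)"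
        using Suc s JV[OF s] by (simp add: B_simps)
      also have "\<dots> = G (pi * real n + s + pi)" using fe[of "pi * real n + s"] by (simp add: algebra_simps)
      finally show ?thesis by (simp add: algebra_simps)
    qed
    moreover have "cB \<beta> f (Suc n) = J G (pi * real (Suc n))"
      using Suc JV[of pi] by (simp add: B_simps algebra_simps)
    moreover have "pB \<beta> f (Suc n) s = G (pi * real (Suc n) + s - pi)" if s: "s \<in> {0..pi}" for s
      using Suc s by (simp add: B_simps algebra_simps)
    ultimately show ?case by blast
  qed
  then have q: "qB \<beta> f n s = G (pi * real n + s)" if "s \<in> {0..pi}" for n s using that by blast
  show ?thesis
  proof
    fix y
    have "ext \<beta> f y = G \<bar>y\<bar>" unfolding ext_def using blk_bounds[of y] q[of "\<bar>y\<bar> - pi * real (blk y)" "blk y"] by auto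
    then show "ext \<beta> f y = G y" using even[of y] by (simp add: abs_if split: if_splits)
  qed
qed

lemma ext_lincomb:
  assumes "L2 f" "L2 g" shows "ext \<beta> (\<lambda>x. f x + a * g x) = (\<lambda>y. ext \<beta> f y + a * ext \<beta> g y)"
proof (rule ext_unique)
  let ?F = "ext \<beta> f" and ?G = "ext \<beta> g"
  have F: "egrow (gr \<beta> + 1) ?F" "egrow (gr \<beta> + 1) ?G" using assms by (simp_all add: ext_egrow)
  show "egrow (gr \<beta> + 1) (\<lambda>y. ?F y + a * ?G y)"
  proof -
    have "integrable lborel (\<lambda>y. complex_of_real (exp (- (gr \<beta> + 1) * \<bar>y\<bar>)) * ?F y + a * (complex_of_real (exp (- (gr \<beta> + 1) * \<bar>y\<bar>)) * ?G y))"
      using F unfolding egrow_def by (intro Bochner_Integration.integrable_add Bochner_Integration.integrable_mult_right) auto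
    moreover have "(\<lambda>y. ?F y + a * ?G y) \<in> borel_measurable borel"
      by (intro borel_measurable_add borel_measurable_times borel_measurable_const ext_measurable assms)
    ultimately show ?thesis using gr_nonneg[of \<beta>] by (simp add: egrow_def distrib_left mult.left_commute)
  qed
  show "?F (- y) + a * ?G (- y) = ?F y + a * ?G y" for y by (simp add: ext_even)
  show "?F (z + pi) + a * ?G (z + pi) - (?F (z - pi) + a * ?G (z - pi)) = - 2 * of_real \<beta> * J (\<lambda>y. ?F y + a * ?G y) z" for z
  proof -
    have "?F (z + pi) + a * ?G (z + pi) - (?F (z - pi) + a * ?G (z - pi)) = (?F (z + pi) - ?F (z - pi)) + a * (?G (z + pi) - ?G (z - pi))"
      by (simp add: algebra_simps)
    then show ?thesis unfolding ext_functional_eq[OF assms(1)] ext_functional_eq[OF assms(2)] J_lincomb[OF F]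
      by (simp add: algebra_simps)
  qed
  show "f x + a * g x = ?F (x - pi) + a * ?G (x - pi)" if "x \<in> {0..pi}" for x
    using ext_start[of "pi - x"] ext_even[of \<beta> _ "pi - x"] that by simp
qed

section \<open>The semigroup\<close>

text \<open>The case t = 0 is separate because \<open>heat 0\<close> is the zero function by the
  convention on division by zero.\<close>

definition S :: "real \<Rightarrow> real \<Rightarrow> fn \<Rightarrow> fn" where
  "S \<beta> t f x = (if t = 0 then f x else conv (heat t) (ext \<beta> f) (x - pi))"

lemma conv_heat_odd_0:
  assumes "\<And>y. H (- y) = - H y" shows "conv (heat t) H 0 = 0"
proof -
  have "conv (heat t) H 0 = (LINT y|lborel. complex_of_real (heat t (0 - (0 - y))) * H (0 - y))"
    unfolding conv_def by (rule integral_affine_reflect[symmetric])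
  also have "\<dots> = (LINT y|lborel. - (complex_of_real (heat t (0 - y)) * H y))"
    using heat_even by (intro Bochner_Integration.integral_cong) (auto simp: assms)
  also have "\<dots> = - conv (heat t) H 0" by (simp add: conv_def)
  finally show ?thesis by simp
qed

lemma conv_ext_functional_eq:
  assumes f: "L2 f" and t: "t > 0"
  shows "conv (heat t) (ext \<beta> f) (z + pi) - conv (heat t) (ext \<beta> f) (z - pi) = - 2 * of_real \<beta> * J (conv (heat t) (ext \<beta> f)) z"
proof -
  let ?H = "ext \<beta> f"
  have H: "egrow (gr \<beta> + 1) ?H" by (rule ext_egrow[OF f])
  have "?H (y + pi) = ?H (y + (- pi)) + (- 2 * of_real \<beta>) * J ?H y" for y
    using ext_functional_eq[OF f, of \<beta> y] by (simp add: algebra_simps)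
  then have "conv (heat t) ?H (z + pi) = conv (heat t) (\<lambda>y. ?H (y + (- pi)) + (- 2 * of_real \<beta>) * J ?H y) z"
    unfolding conv_shift[symmetric] by simp
  also have "\<dots> = conv (heat t) (\<lambda>y. ?H (y + (- pi))) z + (- 2 * of_real \<beta>) * conv (heat t) (J ?H) z"
    by (rule conv_lincomb[OF heat_fast[OF t] egrow_shift[OF H] J_egrow[OF H]])
  also have "conv (heat t) (\<lambda>y. ?H (y + (- pi))) z = conv (heat t) ?H (z - pi)"
    unfolding conv_shift by simp
  also have "conv (heat t) (J ?H) z = J (conv (heat t) ?H) z"
    using conv_J[OF heat_fast[OF t] heat1_fast[OF t] heat_deriv[OF t] H, of z]
      conv_heat_odd_0[of "J ?H" t] J_odd[of ?H, OF ext_even] by simp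
  finally show ?thesis by simp
qed

lemma conv_ext_even: "t > 0 \<Longrightarrow> conv (heat t) (ext \<beta> f) (- z) = conv (heat t) (ext \<beta> f) z"
  by (rule conv_even[of "heat t" "ext \<beta> f", OF heat_even ext_even])

text \<open>Convolution keeps evenness and the functional equation, so by \<open>ext_unique\<close>
  extending commutes with the flow; the semigroup law is then that of the heat kernel on the
  line.\<close>

lemma ext_S:
  assumes "L2 f" "t > 0" shows "ext \<beta> (S \<beta> t f) = conv (heat t) (ext \<beta> f)"
proof (rule ext_unique)
  show "egrow (gr \<beta> + 1 + 1) (conv (heat t) (ext \<beta> f))"
    by (rule conv_egrow[OF heat_fast[OF assms(2)] ext_egrow[OF assms(1)]])
qed (use assms in \<open>auto simp: conv_ext_even conv_ext_functional_eq S_def\<close>)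

lemma S_continuous: "L2 f \<Longrightarrow> t > 0 \<Longrightarrow> continuous_on {0..pi} (S \<beta> t f)"
proof -
  assume f: "L2 f" and t: "t > 0"
  have "continuous_on {0..pi} (\<lambda>x. conv (heat t) (ext \<beta> f) (x - pi))"
    by (rule continuous_on_compose2[OF conv_continuous[OF heat_fast[OF t] ext_egrow[OF f], of UNIV]])
      (intro continuous_intros, simp)
  then show ?thesis using t by (simp add: S_def[abs_def])
qed

lemma S_L2: "L2 f \<Longrightarrow> t \<ge> 0 \<Longrightarrow> L2 (S \<beta> t f)"
  using S_continuous[of f t \<beta>] L2_continuous by (cases "t = 0") (auto simp: S_def[abs_def])

lemma S_lincomb: "L2 f \<Longrightarrow> L2 g \<Longrightarrow> t \<ge> 0 \<Longrightarrow> S \<beta> t (\<lambda>x. f x + a * g x) x = S \<beta> t f x + a * S \<beta> t g x"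
  by (cases "t = 0") (simp_all add: S_def ext_lincomb conv_lincomb[OF heat_fast ext_egrow ext_egrow])

lemma S_add: "L2 f \<Longrightarrow> s \<ge> 0 \<Longrightarrow> t \<ge> 0 \<Longrightarrow> S \<beta> (s + t) f x = S \<beta> s (S \<beta> t f) x"
proof -
  assume f: "L2 f" and st: "s \<ge> 0" "t \<ge> 0"
  consider "s = 0" | "t = 0" | "s > 0" "t > 0" using st by linarith
  then show ?thesis
  proof cases
    case 2
    then have "S \<beta> t f = f" by (simp add: S_def fun_eq_iff)
    then show ?thesis using 2 by simp
  next
    case 3
    then show ?thesis using conv_heat_heat[OF 3 ext_egrow[OF f]] ext_S[OF f 3(2)] by (simp add: S_def)
  qed (simp add: S_def)
qed

text \<open>The kernel is a probability density and m is the mean of H under it; the inequality is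
  the nonnegativity of the variance, the kernel-weighted integral of |H - m|^2.\<close>

lemma conv_heat_Jensen:
  assumes t: "t > 0" and H: "egrow d H" and i: "integrable lborel (\<lambda>y. heat t (z - y) * (cmod (H y))\<^sup>2)"
  shows "(cmod (conv (heat t) H z))\<^sup>2 \<le> (LINT y|lborel. heat t (z - y) * (cmod (H y))\<^sup>2)"
proof -
  define m where "m = conv (heat t) H z"
  have i1: "integrable lborel (\<lambda>y. complex_of_real (heat t (z - y)) * H y)" by (rule conv_integrable[OF heat_fast[OF t] H])
  have ik: "integrable lborel (\<lambda>y. heat t (z - y))"
    using fast_exp_integrable[OF heat_fast[OF t], of z 0] by simp
  have k1: "(LINT y|lborel. heat t (z - y)) = 1" using integral_affine_reflect[of "heat t" z] heat_integral[OF t] by simp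
  have iR: "integrable lborel (\<lambda>y. Re (cnj m * (complex_of_real (heat t (z - y)) * H y)))"
    by (intro integrable_Re Bochner_Integration.integrable_mult_right i1)
  have "(LINT y|lborel. Re (cnj m * (complex_of_real (heat t (z - y)) * H y))) = Re (LINT y|lborel. cnj m * (complex_of_real (heat t (z - y)) * H y))"
    by (rule integral_Re[OF Bochner_Integration.integrable_mult_right[OF i1]])
  also have "\<dots> = Re (cnj m * m)" by (simp only: integral_mult_right_zero m_def conv_def)
  also have "\<dots> = (cmod m)\<^sup>2" by (metis complex_norm_square mult.commute Re_complex_of_real)
  finally have R: "(LINT y|lborel. Re (cnj m * (complex_of_real (heat t (z - y)) * H y))) = (cmod m)\<^sup>2" .
  have eq: "heat t (z - y) * (cmod (H y - m))\<^sup>2 =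
      heat t (z - y) * (cmod (H y))\<^sup>2 - 2 * Re (cnj m * (complex_of_real (heat t (z - y)) * H y)) + (cmod m)\<^sup>2 * heat t (z - y)" for y
  proof -
    have sq: "(cmod (H y - m))\<^sup>2 = (cmod (H y))\<^sup>2 - 2 * Re (cnj m * H y) + (cmod m)\<^sup>2"
      unfolding cmod_power2 by (simp add: power2_eq_square algebra_simps)
    show ?thesis unfolding sq by (simp add: algebra_simps)
  qed
  have "0 \<le> (LINT y|lborel. heat t (z - y) * (cmod (H y - m))\<^sup>2)"
    using heat_pos[OF t] by (intro integral_nonneg_AE AE_I2) (simp add: less_imp_le)
  also have "\<dots> = (LINT y|lborel. heat t (z - y) * (cmod (H y))\<^sup>2) - 2 * (cmod m)\<^sup>2 + (cmod m)\<^sup>2"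
  proof -
    define r where "r = (\<lambda>y. Re (cnj m * (complex_of_real (heat t (z - y)) * H y)))"
    have ir: "integrable lborel r" "(LINT y|lborel. r y) = (cmod m)\<^sup>2" using iR R by (simp_all only: r_def)
    have ry: "Re (cnj m * (complex_of_real (heat t (z - y)) * H y)) = r y" for y by (simp only: r_def)
    show ?thesis unfolding eq ry using i ir ik by (simp add: k1)
  qed
  finally show ?thesis by (simp add: m_def)
qed

lemma heat_ext_integrable:
  assumes f: "L2 f" and t: "t > 0"
  shows "integrable lborel (\<lambda>y. heat t (z - y) * (cmod (ext \<beta> f y))\<^sup>2)"
proof -
  let ?H = "ext \<beta> f" and ?c = "gr \<beta>"
  note [measurable] = ext_measurable[OF f]
  obtain C where C: "C \<ge> 0" "\<And>z y. \<bar>heat t (z - y)\<bar> \<le> C * exp (?c * \<bar>z\<bar>) * exp (- ?c * \<bar>y\<bar>)"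
    using fast_bound[OF heat_fast[OF t] gr_nonneg] by blast
  show ?thesis
  proof (rule Bochner_Integration.integrable_bound)
    show "integrable lborel (\<lambda>y. C * exp (?c * \<bar>z\<bar>) * (exp (- ?c * \<bar>y\<bar>) * (cmod (?H y))\<^sup>2))"
      by (intro Bochner_Integration.integrable_mult_right ext_weighted_L2 f)
    show "AE y in lborel. norm (heat t (z - y) * (cmod (?H y))\<^sup>2) \<le> norm (C * exp (?c * \<bar>z\<bar>) * (exp (- ?c * \<bar>y\<bar>) * (cmod (?H y))\<^sup>2))"
      using mult_right_mono[OF C(2), of "(cmod (?H y))\<^sup>2" z y for y] C(1) by (intro AE_I2) (simp add: abs_mult mult.assoc)
  qed measurable
qed

text \<open>Jensen's inequality at each point and Tonelli reduce the bound to the weighted square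
  integral of the extension, which \<open>ext_weighted_L2\<close> controls by the norm of f.\<close>

lemma S_norm_bound:
  assumes f: "L2 f" and t: "t > 0"
  shows "(norm_L2 (S \<beta> t f))\<^sup>2 \<le> 8 * exp (gr \<beta> * pi) * exp ((gr \<beta>)\<^sup>2 * t) * (norm_L2 f)\<^sup>2"
proof -
  let ?H = "ext \<beta> f" and ?c = "gr \<beta>"
  note [measurable] = ext_measurable[OF f]
  have c: "?c \<ge> 0" by (rule gr_nonneg)
  have H: "egrow (?c + 1) ?H" by (rule ext_egrow[OF f])
  have w: "integrable lborel (\<lambda>y. exp (- ?c * \<bar>y\<bar>) * (cmod (?H y))\<^sup>2)" by (rule ext_weighted_L2[OF f])
  have i: "integrable lborel (\<lambda>y. heat t (z - y) * (cmod (?H y))\<^sup>2)" for z by (rule heat_ext_integrable[OF f t])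
  have "ennreal ((norm_L2 (S \<beta> t f))\<^sup>2) = (\<integral>\<^sup>+x. ennreal ((cmod (S \<beta> t f x))\<^sup>2) \<partial>Mpi)"
    using S_L2[OF f, of t] t by (subst nn_integral_eq_integral[OF L2_integrable_norm2]) (auto simp: norm_L2_def)
  also have "\<dots> \<le> (\<integral>\<^sup>+x. (\<integral>\<^sup>+y. ennreal (heat t (x - pi - y) * (cmod (?H y))\<^sup>2) \<partial>lborel) \<partial>Mpi)"
  proof (rule nn_integral_mono)
    fix x
    have "(cmod (S \<beta> t f x))\<^sup>2 \<le> (LINT y|lborel. heat t (x - pi - y) * (cmod (?H y))\<^sup>2)"
      using conv_heat_Jensen[OF t H i] t by (simp add: S_def)
    then show "ennreal ((cmod (S \<beta> t f x))\<^sup>2) \<le> (\<integral>\<^sup>+y. ennreal (heat t (x - pi - y) * (cmod (?H y))\<^sup>2) \<partial>lborel)"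
      using less_imp_le[OF heat_pos[OF t]] by (subst nn_integral_eq_integral[OF i]) (auto intro!: ennreal_leI AE_I2 mult_nonneg_nonneg)
  qed
  also have "\<dots> = (\<integral>\<^sup>+y. (\<integral>\<^sup>+x. ennreal (heat t (x - pi - y) * (cmod (?H y))\<^sup>2) \<partial>Mpi) \<partial>lborel)"
  proof -
    interpret P: pair_sigma_finite Mpi lborel
      by (intro pair_sigma_finite.intro Mpi.sigma_finite_measure_axioms sigma_finite_lborel)
    have m0: "(\<lambda>(x, y). ennreal (heat t (x - pi - y) * (cmod (?H y))\<^sup>2)) \<in> borel_measurable (borel \<Otimes>\<^sub>M lborel)"
      by measurable
    have "(\<lambda>z. (fst z, snd z)) \<in> measurable (Mpi \<Otimes>\<^sub>M lborel) (borel \<Otimes>\<^sub>M lborel)"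
      by (intro measurable_Pair measurable_compose[OF measurable_fst id_measurable_Mpi] measurable_snd)
    from measurable_compose[OF this m0] show ?thesis by (intro P.Fubini'[symmetric]) (simp add: case_prod_beta')
  qed
  also have "\<dots> \<le> (\<integral>\<^sup>+y. ennreal (exp (?c * pi) * (2 * exp (?c\<^sup>2 * t))) * ennreal (exp (- ?c * \<bar>y\<bar>) * (cmod (?H y))\<^sup>2) \<partial>lborel)"
  proof (rule nn_integral_mono)
    fix y
    let ?g = "\<lambda>w. heat t w * exp (?c * \<bar>w\<bar>)"
    have "(\<integral>\<^sup>+x. ennreal (heat t (x - pi - y)) \<partial>Mpi) \<le> (\<integral>\<^sup>+x. ennreal (exp (?c * pi) * exp (- ?c * \<bar>y\<bar>)) * ennreal (?g (x - pi - y)) \<partial>Mpi)"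
    proof (rule nn_integral_mono)
      fix x assume "x \<in> space Mpi"
      then have x: "0 < x" "x < pi" by auto
      \<comment> \<open>As |x - pi| is at most pi, the weight exp (- c |y|) can be split off at the
        cost of exp (c pi) and of an exponential weight on the Gaussian, whose integral
        \<open>heat_mgf\<close> bounds.\<close>
      have "?c * \<bar>y\<bar> \<le> ?c * (pi + \<bar>x - pi - y\<bar>)" using c x by (intro mult_left_mono) auto
      then have "1 \<le> exp (?c * pi) * exp (- ?c * \<bar>y\<bar>) * exp (?c * \<bar>x - pi - y\<bar>)"
        by (simp add: exp_add[symmetric] algebra_simps)
      then have "heat t (x - pi - y) \<le> heat t (x - pi - y) * (exp (?c * pi) * exp (- ?c * \<bar>y\<bar>) * exp (?c * \<bar>x - pi - y\<bar>))"
        using heat_pos[OF t, of "x - pi - y"] by (intro mult_le_cancel_left1[THEN iffD2]) auto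
      then show "ennreal (heat t (x - pi - y)) \<le> ennreal (exp (?c * pi) * exp (- ?c * \<bar>y\<bar>)) * ennreal (?g (x - pi - y))"
        using heat_pos[OF t, of "x - pi - y"] by (subst ennreal_mult[symmetric]) (auto intro!: ennreal_leI simp: mult_ac)
    qed
    also have "\<dots> = ennreal (exp (?c * pi) * exp (- ?c * \<bar>y\<bar>)) * (\<integral>\<^sup>+x. ennreal (?g (x - pi - y)) \<partial>Mpi)"
      by (rule nn_integral_cmult, rule borel_measurable_Mpi) measurable
    also have "(\<integral>\<^sup>+x. ennreal (?g (x - pi - y)) \<partial>Mpi) \<le> (\<integral>\<^sup>+x. ennreal (?g (x - pi - y)) \<partial>lborel)"
      unfolding Mpi_def by (subst nn_integral_restrict_space) (auto intro!: nn_integral_mono simp: indicator_def)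
    also have "\<dots> = (\<integral>\<^sup>+w. ennreal (?g w) \<partial>lborel)"
      using nn_integral_real_affine[of "\<lambda>w. ennreal (?g w)" 1 "- pi - y"] by (simp add: algebra_simps)
    also have "\<dots> = ennreal (LINT w|lborel. ?g w)"
      using heat_pos[OF t] by (intro nn_integral_eq_integral heat_exp_integrable t) (auto simp: less_imp_le)
    also have "\<dots> \<le> ennreal (2 * exp (?c\<^sup>2 * t))" by (intro ennreal_leI heat_mgf t)
    finally have 1: "(\<integral>\<^sup>+x. ennreal (heat t (x - pi - y)) \<partial>Mpi) \<le> ennreal (exp (?c * pi) * exp (- ?c * \<bar>y\<bar>)) * ennreal (2 * exp (?c\<^sup>2 * t))"
      by (simp add: mult_left_mono)
    have "(\<integral>\<^sup>+x. ennreal (heat t (x - pi - y) * (cmod (?H y))\<^sup>2) \<partial>Mpi) = (\<integral>\<^sup>+x. ennreal (heat t (x - pi - y)) \<partial>Mpi) * ennreal ((cmod (?H y))\<^sup>2)"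
      using heat_pos[OF t] by (subst nn_integral_multc[symmetric]) (auto simp: ennreal_mult less_imp_le intro!: borel_measurable_Mpi)
    also have "\<dots> \<le> ennreal (exp (?c * pi) * exp (- ?c * \<bar>y\<bar>)) * ennreal (2 * exp (?c\<^sup>2 * t)) * ennreal ((cmod (?H y))\<^sup>2)"
      by (intro mult_right_mono 1) simp
    also have "\<dots> = ennreal (exp (?c * pi) * (2 * exp (?c\<^sup>2 * t))) * ennreal (exp (- ?c * \<bar>y\<bar>) * (cmod (?H y))\<^sup>2)"
      by (subst ennreal_mult[symmetric], simp, simp)+ (simp add: mult_ac)
    finally show "(\<integral>\<^sup>+x. ennreal (heat t (x - pi - y) * (cmod (?H y))\<^sup>2) \<partial>Mpi) \<le> ennreal (exp (?c * pi) * (2 * exp (?c\<^sup>2 * t))) * ennreal (exp (- ?c * \<bar>y\<bar>) * (cmod (?H y))\<^sup>2)" .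
  qed
  also have "\<dots> = ennreal (exp (?c * pi) * (2 * exp (?c\<^sup>2 * t))) * (\<integral>\<^sup>+y. ennreal (exp (- ?c * \<bar>y\<bar>) * (cmod (?H y))\<^sup>2) \<partial>lborel)"
    by (rule nn_integral_cmult) measurable
  also have "(\<integral>\<^sup>+y. ennreal (exp (- ?c * \<bar>y\<bar>) * (cmod (?H y))\<^sup>2) \<partial>lborel) = ennreal (LINT y|lborel. exp (- ?c * \<bar>y\<bar>) * (cmod (?H y))\<^sup>2)"
    by (rule nn_integral_eq_integral[OF w]) simp
  also have "\<dots> \<le> ennreal (4 * (norm_L2 f)\<^sup>2)" by (intro ennreal_leI ext_weighted_L2 f)
  finally have "ennreal ((norm_L2 (S \<beta> t f))\<^sup>2) \<le> ennreal (exp (?c * pi) * (2 * exp (?c\<^sup>2 * t))) * ennreal (4 * (norm_L2 f)\<^sup>2)"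
    by (simp add: mult_left_mono)
  also have "\<dots> = ennreal (8 * exp (?c * pi) * exp (?c\<^sup>2 * t) * (norm_L2 f)\<^sup>2)"
    by (subst ennreal_mult[symmetric]) (auto simp: mult_ac)
  finally show ?thesis by (simp add: ennreal_le_iff)
qed

lemma S_uniform_bound: "\<exists>C\<ge>0. \<forall>t f. 0 \<le> t \<longrightarrow> t \<le> T \<longrightarrow> L2 f \<longrightarrow> norm_L2 (S \<beta> t f) \<le> C * norm_L2 f"
proof -
  define D where "D = 8 * exp (gr \<beta> * pi) * exp ((gr \<beta>)\<^sup>2 * T) + 1"
  have D: "D \<ge> 1" by (simp add: D_def)
  have "norm_L2 (S \<beta> t f) \<le> sqrt D * norm_L2 f" if t: "0 \<le> t" "t \<le> T" and f: "L2 f" for t f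
  proof (cases "t = 0")
    case True
    then have "S \<beta> t f = f" by (simp add: S_def fun_eq_iff)
    then show ?thesis using D mult_right_mono[of 1 "sqrt D" "norm_L2 f"] by simp
  next
    case False
    have "(norm_L2 (S \<beta> t f))\<^sup>2 \<le> 8 * exp (gr \<beta> * pi) * exp ((gr \<beta>)\<^sup>2 * t) * (norm_L2 f)\<^sup>2"
      using S_norm_bound[OF f] False t by simp
    also have "\<dots> \<le> D * (norm_L2 f)\<^sup>2"
    proof (rule mult_right_mono)
      have "8 * exp (gr \<beta> * pi) * exp ((gr \<beta>)\<^sup>2 * t) \<le> 8 * exp (gr \<beta> * pi) * exp ((gr \<beta>)\<^sup>2 * T)"
        using t by (intro mult_left_mono) (auto intro: mult_left_mono)
      then show "8 * exp (gr \<beta> * pi) * exp ((gr \<beta>)\<^sup>2 * t) \<le> D" unfolding D_def by linarith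
    qed simp
    also have "\<dots> = (sqrt D * norm_L2 f)\<^sup>2" using D by (simp add: power_mult_distrib)
    finally show ?thesis using D by (intro power2_le_imp_le[OF _ mult_nonneg_nonneg]) auto
  qed
  then show ?thesis using D by (intro exI[of _ "sqrt D"]) auto
qed

section \<open>Elements of the domain, and strong continuity\<close>

lemma J_continuous:
  assumes H: "egrow c H" shows "continuous_on UNIV (J H)"
  unfolding continuous_on_sequentially comp_def
proof (intro allI ballI impI, elim conjE)
  have [measurable]: "H \<in> borel_measurable borel" using H by (rule egrow_measurable)
  have c: "c \<ge> 0" and iH: "integrable lborel (\<lambda>y. complex_of_real (exp (- c * \<bar>y\<bar>)) * H y)" using H by (auto simp: egrow_def)
  fix X and x :: real assume X: "X \<longlonglongrightarrow> x"
  obtain R where R: "\<And>n. \<bar>X n\<bar> \<le> R" using convergent_imp_Bseq[OF convergentI[OF X]] by (auto simp: Bseq_def)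
  show "(\<lambda>n. J H (X n)) \<longlonglongrightarrow> J H x"
    unfolding J_def
  proof (rule integral_dominated_convergence[where w="\<lambda>y. exp (c * R) * cmod (complex_of_real (exp (- c * \<bar>y\<bar>)) * H y)"])
    show "integrable lborel (\<lambda>y. exp (c * R) * cmod (complex_of_real (exp (- c * \<bar>y\<bar>)) * H y))"
      by (intro Bochner_Integration.integrable_mult_right integrable_norm iH)
    have "AE y in lborel. y \<noteq> x" by (rule AE_lborel_singleton)
    then show "AE y in lborel. (\<lambda>n. complex_of_real (jk (X n) y) * H y) \<longlonglongrightarrow> complex_of_real (jk x y) * H y"
    proof eventually_elim
      case (elim y)
      then consider "y < x" | "x < y" by linarith
      then have "eventually (\<lambda>n. jk (X n) y = jk x y) sequentially"
      proof cases
        case 1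
        have "eventually (\<lambda>n. y < X n) sequentially" using X 1 by (rule order_tendstoD)
        then show ?thesis by eventually_elim (use 1 in \<open>auto simp: jk_def\<close>)
      next
        case 2
        have "eventually (\<lambda>n. X n < y) sequentially" using X 2 by (rule order_tendstoD)
        then show ?thesis by eventually_elim (use 2 in \<open>auto simp: jk_def\<close>)
      qed
      then show ?case by (intro tendsto_mult tendsto_of_real tendsto_const tendsto_eventually)
    qed
    have "norm (complex_of_real (jk (X n) y) * H y) \<le> exp (c * R) * cmod (complex_of_real (exp (- c * \<bar>y\<bar>)) * H y)" for n y
    proof -
      have "\<bar>jk (X n) y\<bar> * exp (c * \<bar>y\<bar>) \<le> exp (c * \<bar>X n\<bar>)" by (rule jk_exp[OF c])
      also have "\<dots> \<le> exp (c * R)" using c R[of n] by (auto intro: mult_left_mono)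
      finally have "\<bar>jk (X n) y\<bar> * exp (c * \<bar>y\<bar>) * (exp (- c * \<bar>y\<bar>) * cmod (H y)) \<le> exp (c * R) * (exp (- c * \<bar>y\<bar>) * cmod (H y))"
        by (intro mult_right_mono) auto
      moreover have "\<bar>jk (X n) y\<bar> * exp (c * \<bar>y\<bar>) * (exp (- c * \<bar>y\<bar>) * cmod (H y)) = \<bar>jk (X n) y\<bar> * cmod (H y)"
        by (simp add: exp_minus)
      ultimately have "\<bar>jk (X n) y\<bar> * cmod (H y) \<le> exp (c * R) * (exp (- c * \<bar>y\<bar>) * cmod (H y))" by linarith
      then show ?thesis by (simp add: norm_mult)
    qed
    then show "AE y in lborel. norm (complex_of_real (jk (X n) y) * H y) \<le> exp (c * R) * cmod (complex_of_real (exp (- c * \<bar>y\<bar>)) * H y)" for n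
      by simp
  qed measurable
qed

lemma V_V: 
  assumes q: "integrable Mpi q" and y: "y \<in> {0..pi}"
  shows "V (V q) y = (LINT r|Mpi. of_real (max 0 (y - r)) * q r)"
proof -
  note id_measurable_Mpi [measurable]
  have "V (V q) y = (LINT s|Mpi. (if s < y then 1 else 0) * (LINT r|Mpi. (if r < s then 1 else 0) * q r))"
    by (simp add: V_def)
  also have "\<dots> = (LINT r|Mpi. q r * (LINT s|Mpi. (if r < s then 1 else 0) * (if s < y then 1 else 0)))"
  proof (rule MM.Fubini_kernel_integral[where C=1, OF _ q])
    show "integrable Mpi (\<lambda>s. if s < y then 1 else 0 :: complex)"
      by (rule Mpi.integrable_const_bound[where B=1]) auto
  qed auto
  also have "\<dots> = (LINT r|Mpi. of_real (max 0 (y - r)) * q r)"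
  proof (rule Bochner_Integration.integral_cong[OF refl])
    fix r assume "r \<in> space Mpi"
    then have r: "0 < r" "r < pi" by auto
    have "(LINT s|Mpi. (if r < s then 1 else 0) * (if s < y then 1 else 0))
       = (LINT s|Mpi. indicator {r<..<max r y} s *\<^sub>R (1 :: complex))"
      by (rule Bochner_Integration.integral_cong) auto
    also have "\<dots> = of_real (max r y) - of_real r"
      using r y by (intro integral_Mpi_FTC) (auto intro!: derivative_eq_intros)
    also have "\<dots> = of_real (max 0 (y - r))" by (auto simp: max_def)
    finally show "q r * (LINT s|Mpi. (if r < s then 1 else 0) * (if s < y then 1 else 0)) = of_real (max 0 (y - r)) * q r"
      by simp
  qed
  finally show ?thesis .
qed

lemma J_J_ext:
  assumes f: "L2 f" and y: "y \<in> {0..pi}" shows "J (J (ext \<beta> f)) y = Bop f (pi - y)"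
proof -
  have q: "integrable Mpi (\<lambda>s. f (pi - s))" by (intro L2_integrable L2_reflect f)
  have "J (ext \<beta> f) s = V (\<lambda>s. f (pi - s)) s" if "s \<in> {0..pi}" for s
    using J_ext[OF f that, of \<beta> 0] by (simp add: B_simps)
  then have "J (J (ext \<beta> f)) (0 + y) = J (J (ext \<beta> f)) 0 + V (V (\<lambda>s. f (pi - s))) y"
    using y by (intro J_block[OF J_egrow[OF ext_egrow[OF f]]]) auto
  also have "\<dots> = (LINT r|Mpi. of_real (max 0 (y - r)) * f (pi - r))" using V_V[OF q y] by simp
  also have "\<dots> = (LINT r|Mpi. of_real (max 0 (y - (pi - r))) * f r)"
    using integral_Mpi_reflect[of "\<lambda>r. of_real (max 0 (y - (pi - r))) * f r"] by simp
  finally show ?thesis by (simp add: Bop_def algebra_simps)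
qed

lemma egrow_const: "egrow 1 (\<lambda>_. a)"
  using integrable_exp_neg_abs[of 1] by (auto simp: egrow_def intro!: Bochner_Integration.integrable_mult_left integrable_of_real)

lemma egrow_lincomb:
  assumes "egrow c F" "egrow c G" shows "egrow c (\<lambda>y. F y + a * G y)"
proof -
  have "integrable lborel (\<lambda>y. complex_of_real (exp (- c * \<bar>y\<bar>)) * F y + a * (complex_of_real (exp (- c * \<bar>y\<bar>)) * G y))"
    using assms unfolding egrow_def by (intro Bochner_Integration.integrable_add Bochner_Integration.integrable_mult_right) auto
  then have i: "integrable lborel (\<lambda>y. complex_of_real (exp (- c * \<bar>y\<bar>)) * (F y + a * G y))"
    by (simp add: distrib_left mult.left_commute)
  have m: "(\<lambda>y. F y + a * G y) \<in> borel_measurable borel"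
    by (intro borel_measurable_add borel_measurable_times borel_measurable_const egrow_measurable[OF assms(1)] egrow_measurable[OF assms(2)])
  have "c \<ge> 0" using assms by (simp add: egrow_def)
  then show ?thesis using i m unfolding egrow_def by blast
qed

text \<open>The extension of a function in the domain: its second derivative extends the second
  derivative of the function.\<close>

lemma ext_domain:
  assumes f: "L2 f" and bc: "(LINT s|Mpi. f s) = of_real \<beta> * a" and w: "\<And>x. x \<in> {0..pi} \<Longrightarrow> w x = a - Bop f x"
  shows "ext \<beta> w = (\<lambda>y. a + (- 1) * J (J (ext \<beta> f)) y)"
proof (rule ext_unique)
  let ?H = "ext \<beta> f" and ?c = "gr \<beta> + 1 + 1 + 1"
  let ?G = "\<lambda>y. a + (- 1) * J (J ?H) y"
  have H: "egrow (gr \<beta> + 1) ?H" by (rule ext_egrow[OF f])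
  have JH: "egrow (gr \<beta> + 1 + 1) (J ?H)" by (rule J_egrow[OF H])
  have JJH: "egrow ?c (J (J ?H))" by (rule J_egrow[OF JH])
  have Ho: "J ?H (- y) = - J ?H y" for y by (rule J_odd[of ?H, OF ext_even])
  have He: "J (J ?H) (- y) = J (J ?H) y" for y by (rule J_even[of "J ?H", OF Ho])
  have ec: "egrow ?c (\<lambda>_. a)" by (rule egrow_mono[OF egrow_const]) (use gr_nonneg[of \<beta>] in simp)
  show "egrow ?c ?G" by (rule egrow_lincomb[OF ec JJH])
  show "?G (- y) = ?G y" for y by (simp add: He)
  show "w x = ?G (x - pi)" if "x \<in> {0..pi}" for x
    using J_J_ext[OF f, of "pi - x" \<beta>] He[of "pi - x"] w[OF that] that by simp
  \<comment> \<open>The boundary condition at 0 enters here: it fixes the constant of integration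
    when the functional equation of \<open>ext \<beta> f\<close> is integrated once. A second
    integration gives the equation for the claimed extension.\<close>
  have Jpi: "J ?H pi = of_real \<beta> * a"
  proof -
    have "J ?H pi = V (\<lambda>s. f (pi - s)) pi" using J_ext[OF f, of pi \<beta> 0] by (simp add: B_simps)
    also have "\<dots> = (LINT s|Mpi. f (pi - s))" unfolding V_def by (rule Bochner_Integration.integral_cong) auto
    finally show ?thesis using bc integral_Mpi_reflect[of f] by simp
  qed
  have H2: "?H (y + pi) = ?H (y + - pi) + (- 2 * of_real \<beta>) * J ?H y" for y
    using ext_functional_eq[OF f, of \<beta> y] by (simp add: algebra_simps)
  have J1: "J ?H (y + pi) - J ?H (y - pi) = 2 * of_real \<beta> * ?G y" for y
  proof -
    have "J ?H (y + pi) - J ?H pi = J (\<lambda>y. ?H (y + - pi) + (- 2 * of_real \<beta>) * J ?H y) y"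
      using J_shift[OF H, of y pi] H2 by simp
    also have "\<dots> = J (\<lambda>y. ?H (y + - pi)) y + (- 2 * of_real \<beta>) * J (J ?H) y"
      by (rule J_lincomb[OF egrow_shift[OF H] JH])
    also have "J (\<lambda>y. ?H (y + - pi)) y = J ?H (y + - pi) - J ?H (- pi)" by (rule J_shift[OF H, symmetric])
    finally show ?thesis using Ho[of pi] Jpi by (simp add: algebra_simps)
  qed
  show "?G (z + pi) - ?G (z - pi) = - 2 * of_real \<beta> * J ?G z" for z
  proof -
    have J2: "J ?H (y + pi) = J ?H (y + - pi) + (2 * of_real \<beta>) * ?G y" for y
      using J1[of y] by (simp add: algebra_simps)
    have "J (J ?H) (z + pi) - J (J ?H) pi = J (\<lambda>y. J ?H (y + - pi) + (2 * of_real \<beta>) * ?G y) z"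
      using J_shift[OF JH, of z pi] J2 by simp
    also have "\<dots> = J (\<lambda>y. J ?H (y + - pi)) z + (2 * of_real \<beta>) * J ?G z"
      by (rule J_lincomb[OF egrow_shift[OF JH] egrow_lincomb[OF ec JJH]])
    also have "J (\<lambda>y. J ?H (y + - pi)) z = J (J ?H) (z + - pi) - J (J ?H) (- pi)" by (rule J_shift[OF JH, symmetric])
    finally show ?thesis using He[of pi] by (simp add: algebra_simps)
  qed
qed

lemma tendsto_norm_L2_dominated:
  assumes u: "\<And>i::nat. L2 (u i)" "L2 w"
    and lim: "\<And>x. 0 < x \<Longrightarrow> x < pi \<Longrightarrow> (\<lambda>i. u i x) \<longlonglongrightarrow> w x"
    and bd: "\<And>i x. 0 < x \<Longrightarrow> x < pi \<Longrightarrow> cmod (u i x) \<le> C"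
  shows "(\<lambda>i. norm_L2 (\<lambda>x. u i x - w x)) \<longlonglongrightarrow> 0"
proof -
  have bw: "cmod (w x) \<le> C" if "0 < x" "x < pi" for x
    using bd[OF that] by (intro LIMSEQ_le_const2[OF tendsto_norm[OF lim[OF that]]]) auto
  have "(\<lambda>i. LINT x|Mpi. (cmod (u i x - w x))\<^sup>2) \<longlonglongrightarrow> (LINT x|Mpi. 0)"
  proof (rule integral_dominated_convergence[where w="\<lambda>x. (2 * C)\<^sup>2"])
    show "AE x in Mpi. (\<lambda>i. (cmod (u i x - w x))\<^sup>2) \<longlonglongrightarrow> 0"
    proof (rule AE_I2)
      fix x assume "x \<in> space Mpi"
      then have "(\<lambda>i. (cmod (u i x - w x))\<^sup>2) \<longlonglongrightarrow> (cmod (w x - w x))\<^sup>2" by (intro tendsto_intros lim) auto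
      then show "(\<lambda>i. (cmod (u i x - w x))\<^sup>2) \<longlonglongrightarrow> 0" by simp
    qed
    show "AE x in Mpi. norm ((cmod (u i x - w x))\<^sup>2) \<le> (2 * C)\<^sup>2" for i
    proof (rule AE_I2)
      fix x assume "x \<in> space Mpi"
      then have "cmod (u i x - w x) \<le> 2 * C"
        using bd[of x i] bw[of x] norm_triangle_ineq4[of "u i x" "w x"] by simp
      then have "(cmod (u i x - w x))\<^sup>2 \<le> (2 * C)\<^sup>2" by (rule power_mono) simp
      then show "norm ((cmod (u i x - w x))\<^sup>2) \<le> (2 * C)\<^sup>2" by simp
    qed
    show "(\<lambda>x. (cmod (u i x - w x))\<^sup>2) \<in> borel_measurable Mpi" for i
      by (rule borel_measurable_integrable[OF L2_integrable_norm2[OF L2_diff[OF u(1) u(2)]]])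
  qed simp_all
  then have "(\<lambda>i. sqrt (LINT x|Mpi. (cmod (u i x - w x))\<^sup>2)) \<longlonglongrightarrow> sqrt 0" by (intro tendsto_real_sqrt) simp
  then show ?thesis by (simp add: norm_L2_def)
qed

text \<open>For domain elements the extension is continuous with a pointwise exponential bound, so
  pointwise convergence and domination are available. General L2 functions follow by density in
  \<open>S_strongly_continuous\<close>.\<close>

lemma S_domain_tendsto:
  assumes f: "L2 f" and bc: "(LINT s|Mpi. f s) = of_real \<beta> * a" and w: "\<And>x. x \<in> {0..pi} \<Longrightarrow> w x = a - Bop f x"
    and X: "\<And>i::nat. X i > 0" "X \<longlonglongrightarrow> 0"
  shows "(\<lambda>i. norm_L2 (\<lambda>x. S \<beta> (X i) w x - w x)) \<longlonglongrightarrow> 0"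
proof -
  let ?H = "ext \<beta> f" and ?c = "gr \<beta> + 1 + 1"
  have H: "egrow (gr \<beta> + 1) ?H" by (rule ext_egrow[OF f])
  have JH: "egrow ?c (J ?H)" by (rule J_egrow[OF H])
  have c: "?c \<ge> 0" using gr_nonneg[of \<beta>] by simp
  define G where "G y = a + (- 1) * J (J ?H) y" for y
  have ew: "ext \<beta> w = G" using ext_domain[OF f bc w] by (simp add: G_def[abs_def])
  have cw: "continuous_on {0..pi} w"
    using Bop_continuous[OF L2_integrable[OF f]] by (subst continuous_on_cong[OF refl w]) (auto intro!: continuous_intros)
  have Lw: "L2 w" by (rule L2_continuous[OF cw])
  define N where "N = (LINT y|lborel. cmod (complex_of_real (exp (- ?c * \<bar>y\<bar>)) * J ?H y))"
  have cont: "continuous_on UNIV G" unfolding G_def by (intro continuous_intros J_continuous[OF JH])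
  have bd: "cmod (G y) \<le> (cmod a + N) * exp (?c * \<bar>y\<bar>)" for y
  proof -
    have "cmod (G y) \<le> cmod a + cmod (J (J ?H) y)" unfolding G_def using norm_triangle_ineq4[of a "J (J ?H) y"] by simp
    also have "cmod a \<le> cmod a * exp (?c * \<bar>y\<bar>)" using c by (simp add: mult_le_cancel_left1)
    also have "cmod (J (J ?H) y) \<le> N * exp (?c * \<bar>y\<bar>)" using egrow_jk(2)[OF JH, of y] by (simp add: N_def mult.commute)
    finally show ?thesis by (simp add: distrib_right)
  qed
  have A0: "cmod a + N \<ge> 0" by (simp add: N_def)
  obtain R where R: "\<And>n. \<bar>X n\<bar> \<le> R" using convergent_imp_Bseq[OF convergentI[OF X(2)]] by (auto simp: Bseq_def)
  show ?thesis
  proof (rule tendsto_norm_L2_dominated[where C="2 * (cmod a + N) * exp (?c * pi) * exp (?c\<^sup>2 * R)"])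
    show "L2 (S \<beta> (X i) w)" for i using S_L2[OF Lw] X(1)[of i] by simp
    show "L2 w" by (rule Lw)
    fix x :: real assume x: "0 < x" "x < pi"
    have "w x = G (x - pi)" using ext_start[of "pi - x" \<beta> w] ext_even[of \<beta> w "pi - x"] ew x by simp
    then show "(\<lambda>i. S \<beta> (X i) w x) \<longlonglongrightarrow> w x"
      using conv_heat_tendsto[OF c cont bd X, of "x - pi"] X(1) by (simp add: S_def ew less_imp_neq[OF X(1), symmetric])
    fix i
    have "cmod (S \<beta> (X i) w x) \<le> 2 * (cmod a + N) * exp (?c * \<bar>x - pi\<bar>) * exp (?c\<^sup>2 * X i)"
      using conv_heat_bound[OF X(1) c borel_measurable_continuous_onI[OF cont] bd, of i "x - pi"] X(1)[of i] by (simp add: S_def ew)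
    also have "\<dots> \<le> 2 * (cmod a + N) * exp (?c * pi) * exp (?c\<^sup>2 * R)"
      using c x A0 R[of i] by (intro mult_mono) (auto intro!: mult_left_mono)
    finally show "cmod (S \<beta> (X i) w x) \<le> 2 * (cmod a + N) * exp (?c * pi) * exp (?c\<^sup>2 * R)" .
  qed
qed

lemma opA_C2:
  assumes d1: "\<And>x. x \<in> {0..pi} \<Longrightarrow> (w has_vector_derivative w' x) (at x within {0..pi})"
    and d2: "\<And>x. x \<in> {0..pi} \<Longrightarrow> (w' has_vector_derivative w'' x) (at x within {0..pi})"
    and c: "continuous_on {0..pi} w''" and bc: "w' pi = 0" "w' 0 = of_real \<beta> * w pi"
  shows "opA \<beta> w (\<lambda>x. - w'' x)" "(LINT x|Mpi. - w'' x) = of_real \<beta> * w pi" "x \<in> {0..pi} \<Longrightarrow> w x = w pi - Bop (\<lambda>x. - w'' x) x"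
proof -
  have cw: "continuous_on {0..pi} w" and cw': "continuous_on {0..pi} w'"
    using continuous_on_vector_derivative[OF d1] continuous_on_vector_derivative[OF d2] by simp_all
  have L: "L2 w" "L2 (\<lambda>x. - w'' x)" by (intro L2_continuous cw continuous_intros c)+
  have "(LINT x|Mpi. indicator {0<..<pi} x *\<^sub>R (- w'' x)) = - w' pi - (- w' 0)"
    by (rule integral_Mpi_FTC) (auto intro!: continuous_intros c derivative_eq_intros d2)
  then show i: "(LINT x|Mpi. - w'' x) = of_real \<beta> * w pi" using bc unfolding integral_Mpi_full by simp
  have B: "w x = w pi - Bop (\<lambda>x. - w'' x) x" if x: "x \<in> {0..pi}" for x
  proof -
    have sub: "{x..pi} \<subseteq> {0..pi}" using x by auto
    \<comment> \<open>Taylor expansion at pi with integral remainder: w - (s - x) w' is a primitive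
      of - (s - x) w'' in s.\<close>
    have "Bop (\<lambda>x. - w'' x) x = (LINT s|Mpi. indicator {x<..<pi} s *\<^sub>R (of_real (s - x) * (- w'' s)))"
      unfolding Bop_def by (rule Bochner_Integration.integral_cong) (auto simp: indicator_def max_def)
    also have "\<dots> = (w pi - of_real (pi - x) * w' pi) - (w x - of_real (x - x) * w' x)"
    proof (rule integral_Mpi_FTC)
      show "continuous_on {x..pi} (\<lambda>s. of_real (s - x) * (- w'' s))"
        by (intro continuous_intros continuous_on_subset[OF c sub])
      fix s assume s: "s \<in> {x..pi}"
      then have s': "s \<in> {0..pi}" using sub by auto
      have "((\<lambda>s. w s - of_real (s - x) * w' s) has_vector_derivative w' s - (of_real (s - x) * w'' s + of_real 1 * w' s)) (at s within {x..pi})"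
      proof (rule has_vector_derivative_diff[OF has_vector_derivative_within_subset[OF d1[OF s'] sub]], rule has_vector_derivative_mult)
        show "(w' has_vector_derivative w'' s) (at s within {x..pi})"
          by (rule has_vector_derivative_within_subset[OF d2[OF s'] sub])
        have "((\<lambda>s. s - x) has_vector_derivative 1) (at s within {x..pi})"
          by (auto intro!: derivative_eq_intros simp: has_real_derivative_iff_has_vector_derivative[symmetric])
        from bounded_linear.has_vector_derivative[OF bounded_linear_of_real this]
        show "((\<lambda>s. complex_of_real (s - x)) has_vector_derivative of_real 1) (at s within {x..pi})" .
      qed
      then show "((\<lambda>s. w s - of_real (s - x) * w' s) has_vector_derivative of_real (s - x) * (- w'' s)) (at s within {x..pi})"
        by simp
    qed (use x in auto)
    finally have e: "Bop (\<lambda>x. - w'' x) x = (w pi - of_real (pi - x) * w' pi) - (w x - of_real (x - x) * w' x)" .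
    show ?thesis unfolding e bc(1) by simp
  qed
  then show "x \<in> {0..pi} \<Longrightarrow> w x = w pi - Bop (\<lambda>x. - w'' x) x" .
  have "eqae w (\<lambda>x. w pi - Bop (\<lambda>x. - w'' x) x)" unfolding eqae_def by (intro AE_I2 B) simp
  then show "opA \<beta> w (\<lambda>x. - w'' x)" unfolding opA_iff using L i by blast
qed

text \<open>Projection onto the closure of U: a minimizing sequence is Cauchy by the parallelogram
  law, and the residual x - y is orthogonal to U because moving along a vector of U cannot shorten
  it. The hypothesis makes the residual zero.\<close>

lemma closure_UNIV_if_orthogonal:
  fixes U :: "'a::{real_inner, complete_space} set"
  assumes U: "subspace U" and orth: "\<And>x. (\<And>u. u \<in> U \<Longrightarrow> inner x u = 0) \<Longrightarrow> x = 0"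
  shows "x \<in> closure U"
proof -
  define d where "d = infdist x U"
  have ne: "U \<noteq> {}" using subspace_0[OF U] by auto
  have d0: "d \<ge> 0" by (simp add: d_def infdist_nonneg)
  have dle: "d \<le> norm (x - u)" if "u \<in> U" for u using infdist_le[OF that, of x] by (simp add: d_def dist_norm)
  have "\<exists>u\<in>U. norm (x - u) < d + 1 / real (Suc n)" for n
  proof (rule ccontr)
    assume "\<not> ?thesis"
    then have "d + 1 / real (Suc n) \<le> infdist x U" using ne
      by (subst infdist_notempty) (auto intro!: cINF_greatest simp: dist_norm not_less)
    then show False by (simp add: d_def)
  qed
  then obtain u where u: "\<And>n. u n \<in> U" "\<And>n. norm (x - u n) < d + 1 / real (Suc n)" by metis
  have lim: "(\<lambda>n. norm (x - u n)) \<longlonglongrightarrow> d"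
  proof (rule tendsto_sandwich[of "\<lambda>_. d" _ _ "\<lambda>n. d + 1 / real (Suc n)"])
    have "(\<lambda>n. d + inverse (real (Suc n))) \<longlonglongrightarrow> d + 0" by (intro tendsto_intros LIMSEQ_inverse_real_of_nat)
    then show "(\<lambda>n. d + 1 / real (Suc n)) \<longlonglongrightarrow> d" by (simp add: inverse_eq_divide)
  qed (use u dle in \<open>auto intro!: always_eventually less_imp_le\<close>)
  have par: "(norm (u m - u n))\<^sup>2 \<le> 2 * (norm (x - u m))\<^sup>2 + 2 * (norm (x - u n))\<^sup>2 - 4 * d\<^sup>2" for m n
  proof -
    have "(1/2) *\<^sub>R (u m + u n) \<in> U" using U u by (simp add: subspace_add subspace_scale)
    then have "d\<^sup>2 \<le> (norm (x - (1/2) *\<^sub>R (u m + u n)))\<^sup>2" using d0 by (intro power_mono dle) auto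
    moreover have "(norm (u m - u n))\<^sup>2 + 4 * (norm (x - (1/2) *\<^sub>R (u m + u n)))\<^sup>2 = 2 * (norm (x - u m))\<^sup>2 + 2 * (norm (x - u n))\<^sup>2"
      by (simp add: power2_norm_eq_inner inner_diff_left inner_diff_right inner_add_left inner_add_right inner_commute algebra_simps)
    ultimately show ?thesis by linarith
  qed
  have "Cauchy u"
  proof (rule metric_CauchyI)
    fix e :: real assume e: "e > 0"
    have "(\<lambda>n. 2 * (norm (x - u n))\<^sup>2 - 2 * d\<^sup>2) \<longlonglongrightarrow> 2 * d\<^sup>2 - 2 * d\<^sup>2" by (intro tendsto_intros lim)
    then have "eventually (\<lambda>n. 2 * (norm (x - u n))\<^sup>2 - 2 * d\<^sup>2 < e\<^sup>2 / 2) sequentially"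
      using e by (intro order_tendstoD) auto
    then obtain M where M: "\<And>n. n \<ge> M \<Longrightarrow> 2 * (norm (x - u n))\<^sup>2 - 2 * d\<^sup>2 < e\<^sup>2 / 2" by (auto simp: eventually_sequentially)
    have "dist (u m) (u n) < e" if "m \<ge> M" "n \<ge> M" for m n
    proof -
      have "(norm (u m - u n))\<^sup>2 < e\<^sup>2" using par[of m n] M[OF that(1)] M[OF that(2)] by linarith
      then show ?thesis using e by (simp add: dist_norm power_less_imp_less_base)
    qed
    then show "\<exists>M. \<forall>m\<ge>M. \<forall>n\<ge>M. dist (u m) (u n) < e" by blast
  qed
  then obtain y where y: "u \<longlonglongrightarrow> y" by (auto simp: Cauchy_convergent_iff convergent_def)
  have nxy: "norm (x - y) = d" using LIMSEQ_unique[OF tendsto_norm[OF tendsto_diff[OF tendsto_const y]] lim] .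
  have "x - y = 0"
  proof (rule orth)
    fix v assume v: "v \<in> U"
    show "inner (x - y) v = 0"
    proof (cases "v = 0")
      case False
      define s where "s = inner (x - y) v / inner v v"
      have "(\<lambda>n. norm (x - (u n + s *\<^sub>R v))) \<longlonglongrightarrow> norm (x - (y + s *\<^sub>R v))" by (intro tendsto_intros y)
      then have "d \<le> norm (x - (y + s *\<^sub>R v))"
        using U u v by (intro LIMSEQ_le_const) (auto intro!: dle subspace_add subspace_scale)
      then have "d\<^sup>2 \<le> (norm ((x - y) - s *\<^sub>R v))\<^sup>2" using d0 by (intro power_mono) (auto simp: diff_diff_eq)
      also have "\<dots> = d\<^sup>2 - (inner (x - y) v)\<^sup>2 / inner v v"
      proof -
        have "(norm (z - s *\<^sub>R v))\<^sup>2 = (norm z)\<^sup>2 - 2 * s * inner z v + s * s * inner v v" for z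
          by (simp add: power2_norm_eq_inner inner_diff_left inner_diff_right inner_commute algebra_simps)
        then show ?thesis using False nxy by (simp add: s_def power2_eq_square)
      qed
      finally have "(inner (x - y) v)\<^sup>2 / inner v v \<le> 0" by simp
      moreover have "inner v v > 0" using False by simp
      ultimately have "(inner (x - y) v)\<^sup>2 \<le> 0" by (simp add: divide_le_0_iff del: inner_gt_zero_iff)
      then show ?thesis by simp
    qed simp
  qed
  then show ?thesis using y u(1) unfolding closure_sequential by auto
qed

lemma test_fn_deriv: "test_fn f \<Longrightarrow> test_fn (deriv f)"
proof -
  assume t: "test_fn f"
  obtain K where K: "compact K" "K \<subseteq> {0<..<pi}" "\<And>x. x \<notin> K \<Longrightarrow> f x = 0" using t by (auto simp: test_fn_def)
  have *: "(deriv ^^ k) (deriv f) = (deriv ^^ Suc k) f" for k by (simp only: funpow_Suc_right comp_apply)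
  have "deriv f x = 0" if "x \<notin> K" for x
  proof -
    have "open (- K)" using K(1) by (simp add: compact_imp_closed open_Compl)
    then have "eventually (\<lambda>y. f y = 0) (nhds x)" using K(3) that by (auto simp: eventually_nhds)
    then have "(f has_real_derivative 0) (at x)" using DERIV_cong_ev[of x x f "\<lambda>_. 0" 0 0] by simp
    then show ?thesis by (rule DERIV_imp_deriv)
  qed
  then show ?thesis using t K unfolding test_fn_def * by blast
qed

text \<open>Test functions are real-valued; complex ones are assembled from a real and an imaginary
  part. They vanish near 0 and pi, so they satisfy the boundary conditions of A for every
  \<beta>.\<close>

definition ctest :: "(real \<Rightarrow> real) \<Rightarrow> (real \<Rightarrow> real) \<Rightarrow> fn" where
  "ctest \<phi> \<psi> x = complex_of_real (\<phi> x) + \<i> * complex_of_real (\<psi> x)"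

lemma ctest_continuous: "test_fn \<phi> \<Longrightarrow> test_fn \<psi> \<Longrightarrow> continuous_on A (ctest \<phi> \<psi>)"
  unfolding ctest_def by (intro continuous_intros test_fn_continuous)

lemma ctest_L2: "test_fn \<phi> \<Longrightarrow> test_fn \<psi> \<Longrightarrow> L2 (ctest \<phi> \<psi>)"
  by (intro L2_continuous ctest_continuous)

lemma ctest_deriv: "test_fn \<phi> \<Longrightarrow> test_fn \<psi> \<Longrightarrow> (ctest \<phi> \<psi> has_vector_derivative ctest (deriv \<phi>) (deriv \<psi>) x) (at x within A)"
proof -
  assume t: "test_fn \<phi>" "test_fn \<psi>"
  have d: "((\<lambda>x. complex_of_real (\<eta> x)) has_vector_derivative complex_of_real (deriv \<eta> x)) (at x within A)" if "test_fn \<eta>" for \<eta>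
    using test_fn_DERIV[OF that, of x] has_vector_derivative_at_within
    by (metis has_vector_derivative_of_real has_real_derivative_iff_has_vector_derivative)
  show ?thesis unfolding ctest_def[abs_def]
    by (intro has_vector_derivative_add has_vector_derivative_mult_right d t)
qed

lemma test_fn_0: "test_fn (\<lambda>x. 0)"
  by (rule test_fnI[of _ "{}"]) (auto intro: smooth_fn.const)

lemma ctest_dense: "e > 0 \<Longrightarrow> \<exists>\<phi> \<psi>. test_fn \<phi> \<and> test_fn \<psi> \<and> norm (x - abs_l2 (ctest \<phi> \<psi>)) < e"
proof -
  assume e: "e > 0"
  define U where "U = {abs_l2 (ctest \<phi> \<psi>) | \<phi> \<psi>. test_fn \<phi> \<and> test_fn \<psi>}"
  have "x \<in> closure U"
  proof (rule closure_UNIV_if_orthogonal)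
    have lin: "abs_l2 (ctest \<phi> \<psi>) + c *\<^sub>R abs_l2 (ctest \<phi>' \<psi>') = abs_l2 (ctest (\<lambda>x. \<phi> x + c * \<phi>' x) (\<lambda>x. \<psi> x + c * \<psi>' x))"
      if t: "test_fn \<phi>" "test_fn \<psi>" "test_fn \<phi>'" "test_fn \<psi>'" for c \<phi> \<psi> \<phi>' \<psi>'
    proof -
      have "ctest (\<lambda>x. \<phi> x + c * \<phi>' x) (\<lambda>x. \<psi> x + c * \<psi>' x) = (\<lambda>x. ctest \<phi> \<psi> x + complex_of_real c * ctest \<phi>' \<psi>' x)"
        by (simp add: ctest_def fun_eq_iff algebra_simps)
      then show ?thesis using t by (simp add: abs_l2_add abs_l2_scaleR L2_mult_const ctest_L2)
    qed
    have "abs_l2 (ctest (\<lambda>x. 0) (\<lambda>x. 0)) = 0" using abs_l2_zero by (simp add: ctest_def[abs_def])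
    then have U0: "0 \<in> U" unfolding U_def using test_fn_0 by (metis (mono_tags, lifting) mem_Collect_eq)
    have comb: "x + c *\<^sub>R y \<in> U" if "x \<in> U" "y \<in> U" for x y c
      using that unfolding U_def by (clarsimp simp: lin) (metis test_fn_lincomb)
    show "subspace U"
      unfolding subspace_def using U0 comb[of _ _ 1] comb[OF U0] by simp
    fix x assume orth: "\<And>u. u \<in> U \<Longrightarrow> inner x u = 0"
    let ?g = "rep_l2 x"
    have o: "Re (inner_L2 ?g (ctest \<phi> \<psi>)) = 0" if "test_fn \<phi>" "test_fn \<psi>" for \<phi> \<psi>
      using orth[of "abs_l2 (ctest \<phi> \<psi>)"] that inner_abs_l2[OF L2_rep ctest_L2[OF that], of x] by (auto simp: U_def)
    have "AE s in Mpi. ?g s = 0"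
    proof (rule test_fn_orthogonal_imp_AE_0)
      show "integrable Mpi ?g" by (rule L2_integrable) simp
      fix \<phi> assume t: "test_fn \<phi>"
      let ?I = "LINT s|Mpi. ?g s * complex_of_real (\<phi> s)"
      \<comment> \<open>The real inner product sees only real parts: \<phi> gives the real part of
        the integral and i \<phi> its imaginary part.\<close>
      have "inner_L2 ?g (ctest \<phi> (\<lambda>x. 0)) = ?I" by (simp add: inner_L2_def ctest_def)
      moreover have "inner_L2 ?g (ctest (\<lambda>x. 0) \<phi>) = - \<i> * ?I"
        by (simp add: inner_L2_def ctest_def mult.left_commute del: mult_minus_left)
      ultimately have "Re ?I = 0" "Im ?I = 0" using o[OF t test_fn_0] o[OF test_fn_0 t] by simp_all
      then show "?I = 0" by (simp add: complex_eq_iff)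
    qed
    then show "x = 0" using abs_l2_eq_iff[OF L2_rep L2_const, of x 0] by (simp add: eqae_def abs_l2_zero)
  qed
  then obtain u where "u \<in> U" "dist u x < e" using e unfolding closure_approachable by blast
  then obtain \<phi> \<psi> where "u = abs_l2 (ctest \<phi> \<psi>)" "test_fn \<phi>" "test_fn \<psi>" by (auto simp: U_def)
  then show ?thesis using \<open>dist u x < e\<close> by (intro exI[of _ \<phi>] exI[of _ \<psi>]) (simp add: dist_norm norm_minus_commute)
qed

lemma ctest_domain_tendsto:
  assumes t: "test_fn \<phi>" "test_fn \<psi>" and X: "\<And>i::nat. X i > 0" "X \<longlonglongrightarrow> 0"
  shows "(\<lambda>i. norm_L2 (\<lambda>x. S \<beta> (X i) (ctest \<phi> \<psi>) x - ctest \<phi> \<psi> x)) \<longlonglongrightarrow> 0"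
proof -
  let ?w = "ctest \<phi> \<psi>" and ?w' = "ctest (deriv \<phi>) (deriv \<psi>)" and ?w'' = "ctest (deriv (deriv \<phi>)) (deriv (deriv \<psi>))"
  note t' = test_fn_deriv[OF t(1)] test_fn_deriv[OF t(2)]
  note t'' = test_fn_deriv[OF t'(1)] test_fn_deriv[OF t'(2)]
  have bc: "?w' pi = 0" "?w' 0 = of_real \<beta> * ?w pi" using t t' by (simp_all add: ctest_def test_fn_boundary)
  note C2 = opA_C2[where w="?w" and w'="?w'" and w''="?w''" and \<beta>=\<beta>, OF ctest_deriv[OF t] ctest_deriv[OF t'] ctest_continuous[OF t''] bc]
  show ?thesis
    by (rule S_domain_tendsto[OF L2_uminus[OF ctest_L2[OF t'']] C2(2) C2(3) X])
qed

lemma at_right_0_sequentiallyI: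
  assumes "\<And>X. (\<And>i::nat. X i > 0) \<Longrightarrow> X \<longlonglongrightarrow> 0 \<Longrightarrow> (\<lambda>i. g (X i)) \<longlonglongrightarrow> l"
  shows "(g \<longlongrightarrow> l) (at_right (0::real))"
  unfolding tendsto_at_iff_sequentially comp_def using assms by auto

lemma S_strongly_continuous:
  assumes f: "L2 f" shows "((\<lambda>t. norm_L2 (\<lambda>x. S \<beta> t f x - f x)) \<longlongrightarrow> 0) (at_right 0)"
proof (rule at_right_0_sequentiallyI)
  fix X :: "nat \<Rightarrow> real" assume X: "\<And>i. X i > 0" "X \<longlonglongrightarrow> 0"
  obtain R where R: "\<And>n. \<bar>X n\<bar> \<le> R" using convergent_imp_Bseq[OF convergentI[OF X(2)]] by (auto simp: Bseq_def)
  obtain C where C: "C \<ge> 0" "\<And>t f. 0 \<le> t \<Longrightarrow> t \<le> R \<Longrightarrow> L2 f \<Longrightarrow> norm_L2 (S \<beta> t f) \<le> C * norm_L2 f"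
    using S_uniform_bound[of R \<beta>] by blast
  show "(\<lambda>i. norm_L2 (\<lambda>x. S \<beta> (X i) f x - f x)) \<longlonglongrightarrow> 0"
  proof (rule LIMSEQ_I)
    fix e :: real assume e: "e > 0"
    \<comment> \<open>The factor C + 1 is what the error f - w costs in S t f - f: C from the
      operator and 1 from the identity.\<close>
    obtain \<phi> \<psi> where t: "test_fn \<phi>" "test_fn \<psi>" and d: "norm (abs_l2 f - abs_l2 (ctest \<phi> \<psi>)) < e / (2 * (C + 1))"
      using ctest_dense[of "e / (2 * (C + 1))" "abs_l2 f"] e C(1) by auto
    define w where "w = ctest \<phi> \<psi>"
    have w: "L2 w" using t by (simp add: w_def ctest_L2)
    have dfw: "norm_L2 (\<lambda>x. f x - w x) < e / (2 * (C + 1))"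
      using d f w by (simp add: w_def[symmetric] abs_l2_diff[symmetric] norm_abs_l2 L2_diff)
    have "(\<lambda>i. norm_L2 (\<lambda>x. S \<beta> (X i) w x - w x)) \<longlonglongrightarrow> 0" unfolding w_def by (rule ctest_domain_tendsto[OF t X])
    then obtain N where N: "\<And>i. i \<ge> N \<Longrightarrow> norm_L2 (\<lambda>x. S \<beta> (X i) w x - w x) < e / 2"
      using LIMSEQ_D[of _ 0 "e/2"] e by fastforce
    have "norm_L2 (\<lambda>x. S \<beta> (X i) f x - f x) < e" if i: "i \<ge> N" for i
    proof -
      have X0: "X i \<ge> 0" "X i \<le> R" using X(1)[of i] R[of i] by auto
      have fw: "L2 (\<lambda>x. f x - w x)" by (intro L2_diff f w)
      have eq: "(\<lambda>x. S \<beta> (X i) f x - f x) = (\<lambda>x. S \<beta> (X i) (\<lambda>x. f x - w x) x + ((S \<beta> (X i) w x - w x) + (-1) * (f x - w x)))"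
        using S_lincomb[OF f w X0(1), of \<beta> "-1"] by (simp add: fun_eq_iff)
      have LL: "L2 (S \<beta> (X i) (\<lambda>x. f x - w x))" "L2 (\<lambda>x. S \<beta> (X i) w x - w x)" "L2 (\<lambda>x. (-1) * (f x - w x))"
        by (intro S_L2 fw X0 L2_diff w L2_mult_const)+
      have "norm_L2 (\<lambda>x. S \<beta> (X i) f x - f x) \<le> norm_L2 (S \<beta> (X i) (\<lambda>x. f x - w x)) + norm_L2 (\<lambda>x. (S \<beta> (X i) w x - w x) + (-1) * (f x - w x))"
        unfolding eq by (intro norm_L2_add LL L2_add)
      also have "norm_L2 (\<lambda>x. (S \<beta> (X i) w x - w x) + (-1) * (f x - w x)) \<le> norm_L2 (\<lambda>x. S \<beta> (X i) w x - w x) + norm_L2 (\<lambda>x. (-1) * (f x - w x))"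
        by (intro norm_L2_add LL)
      also have "norm_L2 (\<lambda>x. (-1) * (f x - w x)) = norm_L2 (\<lambda>x. f x - w x)" unfolding norm_L2_cmult by simp
      also have "norm_L2 (S \<beta> (X i) (\<lambda>x. f x - w x)) \<le> C * norm_L2 (\<lambda>x. f x - w x)" by (intro C X0 fw)
      finally have "norm_L2 (\<lambda>x. S \<beta> (X i) f x - f x) \<le> (C + 1) * norm_L2 (\<lambda>x. f x - w x) + norm_L2 (\<lambda>x. S \<beta> (X i) w x - w x)"
        by (simp add: algebra_simps)
      also have "\<dots> < (C + 1) * (e / (2 * (C + 1))) + e / 2"
        using dfw N[OF i] C(1) by (intro add_less_le_mono mult_strict_left_mono) auto
      also have "\<dots> = e" using C(1) by (simp add: field_simps)
      finally show ?thesis .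
    qed
    then show "\<exists>N. \<forall>i\<ge>N. norm (norm_L2 (\<lambda>x. S \<beta> (X i) f x - f x) - 0) < e" by auto
  qed
qed

lemma C0_semigroup_S: "C0_semigroup (S \<beta>)"
  unfolding C0_semigroup_def
proof (intro conjI allI impI)
  fix t :: real and f g c assume t: "t \<ge> 0"
  show "L2 f \<Longrightarrow> L2 (S \<beta> t f)" by (rule S_L2[OF _ t])
  show "L2 f \<and> L2 g \<Longrightarrow> eqae (S \<beta> t (\<lambda>x. f x + c * g x)) (\<lambda>x. S \<beta> t f x + c * S \<beta> t g x)"
    using S_lincomb[OF _ _ t] by (simp add: eqae_def)
  show "\<exists>C. \<forall>f. L2 f \<longrightarrow> norm_L2 (S \<beta> t f) \<le> C * norm_L2 f" using S_uniform_bound[of t \<beta>] t by blast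
next
  fix f assume f: "L2 f"
  show "eqae (S \<beta> 0 f) f" by (simp add: S_def[abs_def])
  show "((\<lambda>t. norm_L2 (\<lambda>x. S \<beta> t f x - f x)) \<longlongrightarrow> 0) (at_right 0)" by (rule S_strongly_continuous[OF f])
  fix s t :: real assume st: "s \<ge> 0" "t \<ge> 0"
  show "eqae (S \<beta> (s + t) f) (S \<beta> s (S \<beta> t f))" using S_add[OF f st, of \<beta>] by (simp add: eqae_def)
qed

lemma conv_heat_time_deriv:
  assumes H: "egrow c H" and e: "\<epsilon> > 0" and X: "\<And>i::nat. X i > 0" "X \<longlonglongrightarrow> 0"
  shows "(\<lambda>i. (conv (heat (\<epsilon> + X i)) H z - conv (heat \<epsilon>) H z) / complex_of_real (X i)) \<longlonglongrightarrow> conv (heat2 \<epsilon>) H z"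
    and "\<exists>C. \<forall>i z. cmod ((conv (heat (\<epsilon> + X i)) H z - conv (heat \<epsilon>) H z) / complex_of_real (X i)) \<le> C * exp (c * \<bar>z\<bar>)"
proof -
  have [measurable]: "H \<in> borel_measurable borel" using H by (rule egrow_measurable)
  have c: "c \<ge> 0" and iH: "integrable lborel (\<lambda>y. complex_of_real (exp (- c * \<bar>y\<bar>)) * H y)" using H by (auto simp: egrow_def)
  obtain R where R: "\<And>n. \<bar>X n\<bar> \<le> R" using convergent_imp_Bseq[OF convergentI[OF X(2)]] by (auto simp: Bseq_def)
  define q where "q i w = (heat (\<epsilon> + X i) w - heat \<epsilon> w) / X i" for i w
  have qm[measurable]: "q i \<in> borel_measurable borel" for i unfolding q_def by measurable
  obtain C where C: "\<And>t z. \<epsilon> \<le> t \<Longrightarrow> t \<le> \<epsilon> + R \<Longrightarrow> \<bar>heat2 t z\<bar> \<le> C * exp (- c * \<bar>z\<bar>)"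
    using heat2_bound[OF e, of "\<epsilon> + R" c] by blast
  have R0: "R \<ge> 0" using R[of 0] by simp
  have C0: "C \<ge> 0" using C[of \<epsilon> 0] R0 by simp
  have qC: "\<bar>q i w\<bar> \<le> C * exp (- c * \<bar>w\<bar>)" for i w
  proof -
    \<comment> \<open>By the mean value theorem in time the difference quotient is
      \<open>heat2\<close> at an intermediate time, so one bound over a compact time interval serves
      for all i.\<close>
    obtain s where s: "\<epsilon> < s" "s < \<epsilon> + X i" "heat (\<epsilon> + X i) w - heat \<epsilon> w = (\<epsilon> + X i - \<epsilon>) * heat2 s w"
      using MVT2[of \<epsilon> "\<epsilon> + X i" "\<lambda>t. heat t w" "\<lambda>t. heat2 t w"] X(1)[of i] e heat_time_deriv by auto
    then have "q i w = heat2 s w" using X(1)[of i] by (simp add: q_def)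
    then show ?thesis using C[of s w] s R[of i] by auto
  qed
  have b: "norm (complex_of_real (q i (z - y)) * H y) \<le> C * exp (c * \<bar>z\<bar>) * cmod (complex_of_real (exp (- c * \<bar>y\<bar>)) * H y)" for i z y
  proof -
    have "c * \<bar>y\<bar> \<le> c * (\<bar>z\<bar> + \<bar>z - y\<bar>)" using c by (intro mult_left_mono) auto
    then have "exp (- c * \<bar>z - y\<bar>) \<le> exp (c * \<bar>z\<bar>) * exp (- c * \<bar>y\<bar>)"
      by (subst exp_add[symmetric]) (simp add: algebra_simps)
    then have "C * exp (- c * \<bar>z - y\<bar>) \<le> C * (exp (c * \<bar>z\<bar>) * exp (- c * \<bar>y\<bar>))" using C0 by (rule mult_left_mono)
    then have "\<bar>q i (z - y)\<bar> \<le> C * (exp (c * \<bar>z\<bar>) * exp (- c * \<bar>y\<bar>))" using qC order_trans by blast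
    from mult_right_mono[OF this, of "cmod (H y)"] show ?thesis by (simp add: norm_mult mult.assoc)
  qed
  have eq: "(conv (heat (\<epsilon> + X i)) H z - conv (heat \<epsilon>) H z) / complex_of_real (X i) = (LINT y|lborel. complex_of_real (q i (z - y)) * H y)" for i z
  proof -
    have "conv (heat (\<epsilon> + X i)) H z - conv (heat \<epsilon>) H z = (LINT y|lborel. complex_of_real (heat (\<epsilon> + X i) (z - y)) * H y - complex_of_real (heat \<epsilon> (z - y)) * H y)"
      unfolding conv_def using e X(1)[of i]
      by (intro Bochner_Integration.integral_diff[symmetric] conv_integrable[OF heat_fast H]) auto
    also have "\<dots> = (LINT y|lborel. complex_of_real (X i) * (complex_of_real (q i (z - y)) * H y))"
    proof (rule Bochner_Integration.integral_cong[OF refl])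
      fix y
      have "X i * q i (z - y) = heat (\<epsilon> + X i) (z - y) - heat \<epsilon> (z - y)" using X(1)[of i] by (simp add: q_def)
      then have "complex_of_real (X i) * complex_of_real (q i (z - y)) = complex_of_real (heat (\<epsilon> + X i) (z - y)) - complex_of_real (heat \<epsilon> (z - y))"
        by (simp only: of_real_mult[symmetric] of_real_diff)
      then show "complex_of_real (heat (\<epsilon> + X i) (z - y)) * H y - complex_of_real (heat \<epsilon> (z - y)) * H y = complex_of_real (X i) * (complex_of_real (q i (z - y)) * H y)"
        by (simp only: mult.assoc[symmetric] left_diff_distrib)
    qed
    also have "\<dots> = complex_of_real (X i) * (LINT y|lborel. complex_of_real (q i (z - y)) * H y)" by simp
    finally show ?thesis using X(1)[of i] by simp
  qed
  have ib: "integrable lborel (\<lambda>y. C * exp (c * \<bar>z\<bar>) * cmod (complex_of_real (exp (- c * \<bar>y\<bar>)) * H y))" for z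
    by (intro Bochner_Integration.integrable_mult_right integrable_norm iH)
  show "(\<lambda>i. (conv (heat (\<epsilon> + X i)) H z - conv (heat \<epsilon>) H z) / complex_of_real (X i)) \<longlonglongrightarrow> conv (heat2 \<epsilon>) H z"
    unfolding eq conv_def[of "heat2 \<epsilon>"]
  proof (rule integral_dominated_convergence[OF _ _ ib])
    have [measurable]: "heat2 \<epsilon> \<in> borel_measurable borel" by (rule fast_measurable[OF heat2_fast[OF e]])
    show "(\<lambda>y. complex_of_real (heat2 \<epsilon> (z - y)) * H y) \<in> borel_measurable lborel" by measurable
    show "(\<lambda>y. complex_of_real (q i (z - y)) * H y) \<in> borel_measurable lborel" for i by measurable
    show "AE y in lborel. (\<lambda>i. complex_of_real (q i (z - y)) * H y) \<longlonglongrightarrow> complex_of_real (heat2 \<epsilon> (z - y)) * H y"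
    proof (intro AE_I2 tendsto_mult tendsto_const tendsto_of_real)
      fix y
      have "((\<lambda>h. (heat (\<epsilon> + h) (z - y) - heat \<epsilon> (z - y)) / h) \<longlongrightarrow> heat2 \<epsilon> (z - y)) (at 0)"
        using heat_time_deriv[OF e, of "z - y"] by (simp add: DERIV_def)
      then show "(\<lambda>i. q i (z - y)) \<longlonglongrightarrow> heat2 \<epsilon> (z - y)"
        unfolding tendsto_at_iff_sequentially comp_def q_def using X by (auto simp: less_imp_neq[symmetric])
    qed
    show "AE y in lborel. norm (complex_of_real (q i (z - y)) * H y) \<le> C * exp (c * \<bar>z\<bar>) * cmod (complex_of_real (exp (- c * \<bar>y\<bar>)) * H y)" for i
      using b by simp
  qed
  have "cmod ((conv (heat (\<epsilon> + X i)) H z - conv (heat \<epsilon>) H z) / complex_of_real (X i)) \<le> (C * (LINT y|lborel. cmod (complex_of_real (exp (- c * \<bar>y\<bar>)) * H y))) * exp (c * \<bar>z\<bar>)" for i z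
  proof -
    have "integrable lborel (\<lambda>y. complex_of_real (q i (z - y)) * H y)"
    proof (rule Bochner_Integration.integrable_bound[OF ib])
      show "AE y in lborel. norm (complex_of_real (q i (z - y)) * H y) \<le> norm (C * exp (c * \<bar>z\<bar>) * cmod (complex_of_real (exp (- c * \<bar>y\<bar>)) * H y))"
        using b by (intro AE_I2) (metis abs_ge_self order_trans real_norm_def)
    qed measurable
    from norm_integral_le[OF this ib b] show ?thesis unfolding eq by (simp add: mult_ac)
  qed
  then show "\<exists>C. \<forall>i z. cmod ((conv (heat (\<epsilon> + X i)) H z - conv (heat \<epsilon>) H z) / complex_of_real (X i)) \<le> C * exp (c * \<bar>z\<bar>)"
    by blast
qed

section \<open>Smoothing of orbits and their boundary conditions\<close>

definition D2 :: "real \<Rightarrow> real \<Rightarrow> fn \<Rightarrow> fn" where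
  "D2 \<beta> t f x = conv (heat2 t) (ext \<beta> f) (x - pi)"

definition D1 :: "real \<Rightarrow> real \<Rightarrow> fn \<Rightarrow> fn" where
  "D1 \<beta> t f x = conv (heat1 t) (ext \<beta> f) (x - pi)"

text \<open>The derivative of an even function is odd, so it vanishes at the centre, which is the
  condition at pi. Differentiating the functional equation at 0 and using oddness again gives the
  condition at 0.\<close>

lemma S_derivs:
  assumes f: "L2 f" and t: "t > 0"
  shows "(S \<beta> t f has_vector_derivative D1 \<beta> t f x) (at x within A)" "(D1 \<beta> t f has_vector_derivative D2 \<beta> t f x) (at x within A)"
    "continuous_on A (D2 \<beta> t f)" "continuous_on A (D1 \<beta> t f)"
    "D1 \<beta> t f pi = 0" "D1 \<beta> t f 0 = of_real \<beta> * S \<beta> t f pi"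
proof -
  let ?H = "ext \<beta> f"
  have H: "egrow (gr \<beta> + 1) ?H" by (rule ext_egrow[OF f])
  have sh: "((\<lambda>x. g (x - pi)) has_vector_derivative g' (x - pi)) (at x within A)"
    if "\<And>z. (g has_vector_derivative g' z) (at z)" for g g' :: fn and x A
  proof -
    have "((\<lambda>x. x - pi) has_vector_derivative 1) (at x)"
      by (auto intro!: derivative_eq_intros simp: has_real_derivative_iff_has_vector_derivative[symmetric])
    from vector_diff_chain_at[OF this that[of "x - pi"]] show ?thesis
      by (simp add: o_def has_vector_derivative_at_within)
  qed
  have S: "S \<beta> t f = (\<lambda>x. conv (heat t) ?H (x - pi))" using t by (simp add: S_def fun_eq_iff)
  have d1: "(conv (heat t) ?H has_vector_derivative conv (heat1 t) ?H z) (at z)" for z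
    by (rule conv_has_derivative[OF heat_fast[OF t] heat1_fast[OF t] heat_deriv[OF t] H])
  have d2: "(conv (heat1 t) ?H has_vector_derivative conv (heat2 t) ?H z) (at z)" for z
    by (rule conv_has_derivative[OF heat1_fast[OF t] heat2_fast[OF t] heat1_deriv[OF t] H])
  show "(S \<beta> t f has_vector_derivative D1 \<beta> t f x) (at x within A)" unfolding S D1_def by (rule sh[OF d1])
  show "(D1 \<beta> t f has_vector_derivative D2 \<beta> t f x) (at x within A)" unfolding D1_def[abs_def] D2_def by (rule sh[OF d2])
  show "continuous_on A (D2 \<beta> t f)" unfolding D2_def
    by (rule continuous_on_compose2[OF conv_continuous[OF heat2_fast[OF t] H, of UNIV]]) (intro continuous_intros, simp)
  show "continuous_on A (D1 \<beta> t f)" unfolding D1_def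
    by (rule continuous_on_compose2[OF conv_continuous[OF heat1_fast[OF t] H, of UNIV]]) (intro continuous_intros, simp)
  have odd: "conv (heat1 t) ?H (- z) = - conv (heat1 t) ?H z" for z
  proof -
    have "((\<lambda>z. - z) has_vector_derivative -1) (at z)"
      by (auto intro!: derivative_eq_intros simp: has_real_derivative_iff_has_vector_derivative[symmetric])
    from vector_diff_chain_at[OF this d1[of "- z"]]
    have "(conv (heat t) ?H has_vector_derivative - conv (heat1 t) ?H (- z)) (at z)"
      using conv_ext_even[OF t, of \<beta> f] by (simp add: o_def)
    from vector_derivative_unique_at[OF this d1[of z]] show ?thesis by (metis minus_minus)
  qed
  show "D1 \<beta> t f pi = 0" using odd[of 0] by (simp add: D1_def)
  have "((\<lambda>z. conv (heat t) ?H (z + pi) - conv (heat t) ?H (z - pi)) has_vector_derivative conv (heat1 t) ?H (0 + pi) - conv (heat1 t) ?H (0 - pi)) (at 0)"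
  proof (rule has_vector_derivative_diff)
    have "((\<lambda>x. x + pi) has_vector_derivative 1) (at 0)"
      by (auto intro!: derivative_eq_intros simp: has_real_derivative_iff_has_vector_derivative[symmetric])
    from vector_diff_chain_at[OF this d1[of "0 + pi"]]
    show "((\<lambda>z. conv (heat t) ?H (z + pi)) has_vector_derivative conv (heat1 t) ?H (0 + pi)) (at 0)" by (simp add: o_def)
    show "((\<lambda>z. conv (heat t) ?H (z - pi)) has_vector_derivative conv (heat1 t) ?H (0 - pi)) (at 0)" by (rule sh[OF d1])
  qed
  moreover have "((\<lambda>z. - 2 * of_real \<beta> * J (conv (heat t) ?H) z) has_vector_derivative - 2 * of_real \<beta> * conv (heat t) ?H 0) (at 0)"
    by (rule has_vector_derivative_mult_right[OF J_has_derivative[OF conv_continuous[OF heat_fast[OF t] H]]])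
  ultimately have "conv (heat1 t) ?H (0 + pi) - conv (heat1 t) ?H (0 - pi) = - 2 * of_real \<beta> * conv (heat t) ?H 0"
    unfolding conv_ext_functional_eq[OF f t] by (rule vector_derivative_unique_at)
  then show "D1 \<beta> t f 0 = of_real \<beta> * S \<beta> t f pi"
    using odd[of pi] t by (simp add: D1_def S_def)
qed

lemma S_opA:
  assumes "L2 f" "t > 0" shows "opA \<beta> (S \<beta> t f) (\<lambda>x. - D2 \<beta> t f x)"
  by (rule opA_C2(1)[OF S_derivs(1)[OF assms] S_derivs(2)[OF assms] S_derivs(3)[OF assms] S_derivs(5)[OF assms] S_derivs(6)[OF assms]])

lemma D2_L2: "L2 f \<Longrightarrow> t > 0 \<Longrightarrow> L2 (D2 \<beta> t f)"
  by (rule L2_continuous[OF S_derivs(3)])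

abbreviation TS :: "real \<Rightarrow> real \<Rightarrow> l2 \<Rightarrow> l2" where "TS \<beta> \<equiv> lift_sg (S \<beta>)"

lemma C0_sg_TS: "C0_sg (TS \<beta>)" by (rule C0_sg_lift[OF C0_semigroup_S])

lemma TS_abs: "t \<ge> 0 \<Longrightarrow> L2 f \<Longrightarrow> TS \<beta> t (abs_l2 f) = abs_l2 (S \<beta> t f)"
  by (rule lift_sg_abs[OF C0_semigroup_S])

text \<open>For arbitrary L2 data the orbit lies in the domain at every positive time. The
  regularisations in \<open>generated_by_S\<close> and the time derivatives in
  \<open>S_has_derivative\<close> rely on this smoothing.\<close>

lemma S_gen:
  assumes f: "L2 f" and t: "t > 0" shows "C0_sg.gen (TS \<beta>) (abs_l2 (S \<beta> t f)) (abs_l2 (D2 \<beta> t f))"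
  unfolding C0_sg.gen_def[OF C0_sg_TS]
proof (rule at_right_0_sequentiallyI)
  fix X :: "nat \<Rightarrow> real" assume X: "\<And>i. X i > 0" "X \<longlonglongrightarrow> 0"
  let ?H = "ext \<beta> f"
  have H: "egrow (gr \<beta> + 1) ?H" by (rule ext_egrow[OF f])
  define u where "u i x = (S \<beta> (X i) (S \<beta> t f) x - S \<beta> t f x) / complex_of_real (X i)" for i x
  have u': "u i x = complex_of_real (inverse (X i)) * (S \<beta> (X i) (S \<beta> t f) x - S \<beta> t f x)" for i x
    by (simp add: u_def divide_inverse mult.commute)
  have Ld: "L2 (\<lambda>x. S \<beta> (X i) (S \<beta> t f) x - S \<beta> t f x)" for i
    using t X(1)[of i] by (intro L2_diff S_L2 f) auto
  have Lu: "L2 (u i)" for i unfolding u'[abs_def] by (intro L2_mult_const Ld)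
  have eq: "u i x = (conv (heat (t + X i)) ?H (x - pi) - conv (heat t) ?H (x - pi)) / complex_of_real (X i)" for i x
    using S_add[OF f, of "X i" t \<beta> x] X(1)[of i] t by (simp add: u_def S_def add.commute)
  obtain C where C: "\<And>i z. cmod ((conv (heat (t + X i)) ?H z - conv (heat t) ?H z) / complex_of_real (X i)) \<le> C * exp ((gr \<beta> + 1) * \<bar>z\<bar>)"
    using conv_heat_time_deriv(2)[OF H t X] by blast
  have C0: "C \<ge> 0" using order_trans[OF norm_ge_zero C[of 0 0]] by simp
  have "(\<lambda>i. norm_L2 (\<lambda>x. u i x - D2 \<beta> t f x)) \<longlonglongrightarrow> 0"
  proof (rule tendsto_norm_L2_dominated[where C="C * exp ((gr \<beta> + 1) * pi)"])
    fix x :: real assume x: "0 < x" "x < pi"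
    show "(\<lambda>i. u i x) \<longlonglongrightarrow> D2 \<beta> t f x" unfolding eq D2_def by (rule conv_heat_time_deriv(1)[OF H t X])
    fix i
    have "cmod (u i x) \<le> C * exp ((gr \<beta> + 1) * \<bar>x - pi\<bar>)" unfolding eq by (rule C)
    also have "\<dots> \<le> C * exp ((gr \<beta> + 1) * pi)" using C0 x gr_nonneg[of \<beta>] by (intro mult_left_mono) auto
    finally show "cmod (u i x) \<le> C * exp ((gr \<beta> + 1) * pi)" .
  qed (auto intro: Lu D2_L2 f t)
  moreover have "norm_L2 (\<lambda>x. u i x - D2 \<beta> t f x) = norm ((TS \<beta> (X i) (abs_l2 (S \<beta> t f)) - abs_l2 (S \<beta> t f)) /\<^sub>R X i - abs_l2 (D2 \<beta> t f))" for i
  proof -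
    have "norm_L2 (\<lambda>x. u i x - D2 \<beta> t f x) = norm (abs_l2 (u i) - abs_l2 (D2 \<beta> t f))"
      by (subst abs_l2_diff[symmetric, OF Lu D2_L2[OF f t]], subst norm_abs_l2) (auto intro: L2_diff Lu D2_L2 f t)
    also have "abs_l2 (u i) = (abs_l2 (S \<beta> (X i) (S \<beta> t f)) - abs_l2 (S \<beta> t f)) /\<^sub>R X i"
    proof -
      have "abs_l2 (u i) = inverse (X i) *\<^sub>R abs_l2 (\<lambda>x. S \<beta> (X i) (S \<beta> t f) x - S \<beta> t f x)"
        unfolding u'[abs_def] by (rule abs_l2_scaleR[OF Ld])
      then show ?thesis using t X(1)[of i] f by (simp add: abs_l2_diff S_L2)
    qed
    also have "abs_l2 (S \<beta> (X i) (S \<beta> t f)) = TS \<beta> (X i) (abs_l2 (S \<beta> t f))"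
      using t X(1)[of i] f by (simp add: TS_abs S_L2)
    finally show ?thesis .
  qed
  ultimately show "(\<lambda>i. (TS \<beta> (X i) (abs_l2 (S \<beta> t f)) - abs_l2 (S \<beta> t f)) /\<^sub>R X i) \<longlonglongrightarrow> abs_l2 (D2 \<beta> t f)"
    by (simp add: LIM_zero_iff tendsto_norm_zero_iff)
qed

lemma Bop_bound: "L2 f \<Longrightarrow> x \<in> {0..pi} \<Longrightarrow> cmod (Bop f x) \<le> pi * (sqrt pi * norm_L2 f)"
proof -
  assume f: "L2 f" and x: "x \<in> {0..pi}"
  have i: "integrable Mpi (\<lambda>s. of_real (max 0 (s - x)) * f s)"
    using integrable_Mpi_bounded_mult[OF L2_integrable[OF f], of "\<lambda>s. of_real (max 0 (s - x))" pi] x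
    by (simp add: mult.commute max_def borel_measurable_Mpi)
  have "cmod (Bop f x) \<le> (LINT s|Mpi. pi * cmod (f s))"
    unfolding Bop_def
  proof (rule order_trans[OF integral_norm_bound Bochner_Integration.integral_mono])
    fix s assume "s \<in> space Mpi"
    then show "norm (complex_of_real (max 0 (s - x)) * f s) \<le> pi * cmod (f s)"
      using x unfolding norm_mult by (intro mult_right_mono) auto
  qed (use i L2_integrable[OF f] in auto)
  also have "\<dots> \<le> pi * (sqrt pi * norm_L2 f)" using L1_le_L2[OF f] f by (simp add: norm_abs_l2)
  finally show ?thesis .
qed

lemma Bop_L2: "L2 f \<Longrightarrow> L2 (Bop f)"
  by (rule L2_continuous[OF Bop_continuous[OF L2_integrable]])

lemma Bop_diff: "L2 f \<Longrightarrow> L2 g \<Longrightarrow> x \<in> {0..pi} \<Longrightarrow> Bop (\<lambda>s. f s - g s) x = Bop f x - Bop g x"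
proof -
  assume f: "L2 f" "L2 g" and x: "x \<in> {0..pi}"
  have i: "integrable Mpi (\<lambda>s. of_real (max 0 (s - x)) * f s)" if "L2 f" for f
    using integrable_Mpi_bounded_mult[OF L2_integrable[OF that], of "\<lambda>s. of_real (max 0 (s - x))" pi] x
    by (simp add: mult.commute max_def borel_measurable_Mpi)
  show ?thesis unfolding Bop_def right_diff_distrib by (intro Bochner_Integration.integral_diff i f)
qed

lemma norm_Bop: "L2 f \<Longrightarrow> norm_L2 (Bop f) \<le> pi\<^sup>2 * norm_L2 f"
  using norm_L2_le_sup[of "Bop f" "pi * (sqrt pi * norm_L2 f)"] Bop_bound[of f] Bop_L2[of f]
  by (simp add: L2_def power2_eq_square mult_ac) (simp add: mult.assoc[symmetric])?

text \<open>In the description of \<open>opA_iff\<close> the constants a n equal u n + Bop (f n),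
  which converges in L2. For constant functions this is convergence of numbers, and both conditions
  on a pass to the limit because \<open>Bop\<close> and the integral are continuous on L2.\<close>

lemma opA_closed:
  assumes A: "\<And>n::nat. opA \<beta> (u n) (f n)" and L: "L2 v" "L2 g"
    and u: "(\<lambda>n. abs_l2 (u n)) \<longlonglongrightarrow> abs_l2 v" and f: "(\<lambda>n. abs_l2 (f n)) \<longlonglongrightarrow> abs_l2 g"
  shows "opA \<beta> v g"
proof -
  have Lu: "L2 (u n)" and Lf: "L2 (f n)" for n using A opA_iff by blast+
  obtain a where a: "\<And>n. eqae (u n) (\<lambda>x. a n - Bop (f n) x)" "\<And>n. (LINT s|Mpi. f n s) = of_real \<beta> * a n"
    using A unfolding opA_iff by metis
  have "(\<lambda>n. abs_l2 (Bop (f n))) \<longlonglongrightarrow> abs_l2 (Bop g)"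
  proof (rule LIM_zero_cancel, rule Lim_null_comparison)
    show "(\<lambda>n. pi\<^sup>2 * norm (abs_l2 (f n) - abs_l2 g)) \<longlonglongrightarrow> 0"
      using f by (intro tendsto_mult_right_zero tendsto_norm_zero LIM_zero)
    have "norm (abs_l2 (Bop (f n)) - abs_l2 (Bop g)) \<le> pi\<^sup>2 * norm (abs_l2 (f n) - abs_l2 g)" for n
    proof -
      have d: "L2 (\<lambda>s. f n s - g s)" by (intro L2_diff Lf L)
      have "abs_l2 (Bop (f n)) - abs_l2 (Bop g) = abs_l2 (\<lambda>x. Bop (f n) x - Bop g x)"
        by (intro abs_l2_diff[symmetric] Bop_L2 Lf L)
      also have "\<dots> = abs_l2 (Bop (\<lambda>s. f n s - g s))"
        using Bop_diff[OF Lf L(2)] by (subst abs_l2_eq_iff) (auto intro!: L2_diff Bop_L2 Lf L d AE_I2 simp: eqae_def)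
      finally show ?thesis using norm_Bop[OF d] d by (simp add: norm_abs_l2 Bop_L2 abs_l2_diff[symmetric] Lf L)
    qed
    then show "eventually (\<lambda>n. norm (abs_l2 (Bop (f n)) - abs_l2 (Bop g)) \<le> pi\<^sup>2 * norm (abs_l2 (f n) - abs_l2 g)) sequentially"
      by simp
  qed
  from tendsto_add[OF u this] have lim: "(\<lambda>n. abs_l2 (u n) + abs_l2 (Bop (f n))) \<longlonglongrightarrow> abs_l2 v + abs_l2 (Bop g)" .
  have ca: "abs_l2 (u n) + abs_l2 (Bop (f n)) = abs_l2 (\<lambda>x. a n)" for n
  proof -
    have "abs_l2 (u n) = abs_l2 (\<lambda>x. a n - Bop (f n) x)"
      using a(1) by (subst abs_l2_eq_iff[OF Lu L2_diff[OF L2_const Bop_L2[OF Lf]]])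
    then show ?thesis by (simp add: abs_l2_diff Bop_L2 Lf)
  qed
  have nc: "norm (abs_l2 (\<lambda>x. c) - abs_l2 (\<lambda>x. d)) = sqrt pi * cmod (c - d)" for c d
    by (simp add: abs_l2_diff[symmetric] norm_abs_l2 norm_L2_def real_sqrt_mult)
  have "Cauchy (\<lambda>n. abs_l2 (\<lambda>x. a n))" using lim unfolding ca by (rule LIMSEQ_imp_Cauchy)
  then have "Cauchy a"
  proof (intro metric_CauchyI)
    fix e :: real assume "Cauchy (\<lambda>n. abs_l2 (\<lambda>x. a n))" "e > 0"
    then obtain M where "\<And>m n. m \<ge> M \<Longrightarrow> n \<ge> M \<Longrightarrow> norm (abs_l2 (\<lambda>x. a m) - abs_l2 (\<lambda>x. a n)) < sqrt pi * e"
      using CauchyD[of _ "sqrt pi * e"] by (metis mult_pos_pos pi_gt_zero real_sqrt_gt_zero)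
    then show "\<exists>M. \<forall>m\<ge>M. \<forall>n\<ge>M. dist (a m) (a n) < e" unfolding nc by (auto simp: dist_norm)
  qed
  then obtain b where b: "a \<longlonglongrightarrow> b" by (auto simp: Cauchy_convergent_iff convergent_def)
  have "(\<lambda>n. abs_l2 (\<lambda>x. a n)) \<longlonglongrightarrow> abs_l2 (\<lambda>x. b)"
  proof (rule LIM_zero_cancel, rule tendsto_norm_zero_cancel)
    show "(\<lambda>n. norm (abs_l2 (\<lambda>x. a n) - abs_l2 (\<lambda>x. b))) \<longlonglongrightarrow> 0"
      unfolding nc using b by (intro tendsto_mult_right_zero tendsto_norm_zero LIM_zero)
  qed
  then have "abs_l2 v + abs_l2 (Bop g) = abs_l2 (\<lambda>x. b)" using lim unfolding ca by (rule LIMSEQ_unique[rotated])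
  then have "abs_l2 v = abs_l2 (\<lambda>x. b - Bop g x)" using L by (simp add: abs_l2_diff Bop_L2 algebra_simps)
  then have 1: "eqae v (\<lambda>x. b - Bop g x)" using L by (subst (asm) abs_l2_eq_iff) (auto intro: L2_diff Bop_L2)
  have "(\<lambda>n. LINT s|Mpi. f n s) \<longlonglongrightarrow> (LINT s|Mpi. g s)"
  proof (rule LIM_zero_cancel, rule Lim_null_comparison)
    show "(\<lambda>n. sqrt pi * norm (abs_l2 (f n) - abs_l2 g)) \<longlonglongrightarrow> 0"
      using f by (intro tendsto_mult_right_zero tendsto_norm_zero LIM_zero)
    have "cmod ((LINT s|Mpi. f n s) - (LINT s|Mpi. g s)) \<le> sqrt pi * norm (abs_l2 (f n) - abs_l2 g)" for n
    proof -
      have "(LINT s|Mpi. f n s) - (LINT s|Mpi. g s) = (LINT s|Mpi. f n s - g s)"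
        by (intro Bochner_Integration.integral_diff[symmetric] L2_integrable Lf L)
      moreover have "cmod (LINT s|Mpi. f n s - g s) \<le> sqrt pi * norm (abs_l2 (\<lambda>s. f n s - g s))"
        by (rule order_trans[OF integral_norm_bound L1_le_L2[OF L2_diff[OF Lf L(2)]]])
      ultimately show ?thesis by (simp add: abs_l2_diff Lf L)
    qed
    then show "eventually (\<lambda>n. norm ((LINT s|Mpi. f n s) - (LINT s|Mpi. g s)) \<le> sqrt pi * norm (abs_l2 (f n) - abs_l2 g)) sequentially"
      by simp
  qed
  moreover have "(\<lambda>n. LINT s|Mpi. f n s) \<longlonglongrightarrow> of_real \<beta> * b" unfolding a(2) by (intro tendsto_intros b)
  ultimately have "(LINT s|Mpi. g s) = of_real \<beta> * b" by (rule LIMSEQ_unique)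
  then show ?thesis unfolding opA_iff using L 1 by blast
qed

section \<open>The generator\<close>

definition eps :: "nat \<Rightarrow> real" where "eps n = 1 / real (Suc n)"

lemma eps_pos [simp]: "eps n > 0" "0 \<le> eps n" "eps n \<noteq> 0"
  by (simp_all add: eps_def)

lemma eps_seq: "eps \<longlonglongrightarrow> 0"
  unfolding eps_def using LIMSEQ_inverse_real_of_nat by (simp add: inverse_eq_divide)

lemma TS_eps: "(\<lambda>n. TS \<beta> (eps n) x) \<longlonglongrightarrow> x"
proof (rule filterlim_compose[OF C0_sg.cont0[OF C0_sg_TS]])
  show "filterlim eps (at_right 0) sequentially"
    unfolding filterlim_at using eps_seq by simp
qed

lemma conv_heat2_const: "t > 0 \<Longrightarrow> conv (heat2 t) (\<lambda>_. a) z = 0"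
proof -
  assume t: "t > 0"
  have "conv (heat1 t) (\<lambda>_. a) z = 0" for z
  proof -
    have "(conv (heat t) (\<lambda>_. a) has_vector_derivative conv (heat1 t) (\<lambda>_. a) z) (at z)"
      by (rule conv_has_derivative[OF heat_fast[OF t] heat1_fast[OF t] heat_deriv[OF t] egrow_const])
    moreover have "(conv (heat t) (\<lambda>_. a) has_vector_derivative 0) (at z)"
    proof -
      have "conv (heat t) (\<lambda>_. a) = (\<lambda>_. a)" by (simp add: fun_eq_iff conv_heat_const[OF t])
      then show ?thesis by simp
    qed
    ultimately show ?thesis by (rule vector_derivative_unique_at)
  qed
  then have c: "conv (heat1 t) (\<lambda>_. a) = (\<lambda>_. 0)" by blast
  have "(conv (heat1 t) (\<lambda>_. a) has_vector_derivative conv (heat2 t) (\<lambda>_. a) z) (at z)"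
    by (rule conv_has_derivative[OF heat1_fast[OF t] heat2_fast[OF t] heat1_deriv[OF t] egrow_const])
  then show ?thesis unfolding c by (rule vector_derivative_unique_at) simp
qed

lemma gen_unique: "C0_sg.gen (TS \<beta>) x y \<Longrightarrow> C0_sg.gen (TS \<beta>) x z \<Longrightarrow> y = z"
  unfolding C0_sg.gen_def[OF C0_sg_TS] by (rule tendsto_unique[OF trivial_limit_at_right_real])

text \<open>Each inclusion is shown for the regularised function S \<epsilon> f, which belongs to
  both domains, and then \<epsilon> tends to 0. The inclusion into A uses that A is closed, the
  converse that the generator is closed.\<close>

lemma generated_by_S: "generated_by_minus_A \<beta> (S \<beta>)"
  unfolding generated_by_minus_A_def
proof (intro conjI allI iffI C0_semigroup_S)
  fix f g
  interpret TS: C0_sg "TS \<beta>" by (rule C0_sg_TS)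
  assume "sg_generator (S \<beta>) f g"
  then have f: "L2 f" and g: "L2 g" and G: "TS.gen (abs_l2 f) (abs_l2 g)"
    using sg_generator_iff[OF C0_semigroup_S, of f g \<beta>] by (auto simp: sg_generator_def)
  have e: "eps n > 0" for n by simp
  have D: "abs_l2 (D2 \<beta> (eps n) f) = TS \<beta> (eps n) (abs_l2 g)" for n
  proof (rule gen_unique[OF S_gen[OF f e]])
    show "TS.gen (abs_l2 (S \<beta> (eps n) f)) (TS \<beta> (eps n) (abs_l2 g))"
      using TS.gen_orbit[OF G, of "eps n"] e[of n] by (simp add: TS_abs f less_imp_le)
  qed
  show "opA \<beta> f (\<lambda>x. - g x)"
  proof (rule opA_closed[OF S_opA[OF f e]])
    show "(\<lambda>n. abs_l2 (S \<beta> (eps n) f)) \<longlonglongrightarrow> abs_l2 f" using TS_eps[of \<beta> "abs_l2 f"] by (simp add: TS_abs f)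
    have "(\<lambda>n. - TS \<beta> (eps n) (abs_l2 g)) \<longlonglongrightarrow> - abs_l2 g" by (intro tendsto_minus TS_eps)
    then show "(\<lambda>n. abs_l2 (\<lambda>x. - D2 \<beta> (eps n) f x)) \<longlonglongrightarrow> abs_l2 (\<lambda>x. - g x)"
      by (simp add: abs_l2_uminus D2_L2 f g D)
  qed (simp_all add: f g L2_uminus)
next
  fix f g
  interpret TS: C0_sg "TS \<beta>" by (rule C0_sg_TS)
  assume "opA \<beta> f (\<lambda>x. - g x)"
  then obtain a where f: "L2 f" and mg: "L2 (\<lambda>x. - g x)" and a: "eqae f (\<lambda>x. a - Bop (\<lambda>x. - g x) x)"
    "(LINT s|Mpi. - g s) = of_real \<beta> * a" unfolding opA_iff by blast
  have g: "L2 g" using L2_uminus[OF mg] by simp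
  have e: "eps n > 0" for n by simp
  define w where "w x = a - Bop (\<lambda>x. - g x) x" for x
  have w: "L2 w" unfolding w_def[abs_def] by (intro L2_diff L2_const Bop_L2 mg)
  have fw: "abs_l2 f = abs_l2 w" using a(1) f w by (simp add: abs_l2_eq_iff w_def[abs_def])
  let ?H = "ext \<beta> (\<lambda>x. - g x)"
  have H: "egrow (gr \<beta> + 1) ?H" by (rule ext_egrow[OF mg])
  have ew: "ext \<beta> w = (\<lambda>y. a + (- 1) * J (J ?H) y)" by (rule ext_domain[OF mg a(2)]) (simp add: w_def)
  \<comment> \<open>The second derivative of the kernel cancels the two primitives in the extension
    of w and annihilates the constant, so regularising commutes with A.\<close>
  have D: "D2 \<beta> t w = (\<lambda>x. - S \<beta> t (\<lambda>x. - g x) x)" if t: "t > 0" for t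
  proof
    fix x
    have "D2 \<beta> t w x = conv (heat2 t) (\<lambda>_. a) (x - pi) + (- 1) * conv (heat2 t) (J (J ?H)) (x - pi)"
      unfolding D2_def ew by (rule conv_lincomb[OF heat2_fast[OF t] egrow_const J_egrow[OF J_egrow[OF H]]])
    also have "conv (heat2 t) (J (J ?H)) (x - pi) = conv (heat1 t) (J ?H) (x - pi)"
      by (rule conv_deriv_J[OF heat1_fast[OF t] heat2_fast[OF t] heat1_deriv[OF t] J_egrow[OF H]])
    also have "\<dots> = conv (heat t) ?H (x - pi)"
      by (rule conv_deriv_J[OF heat_fast[OF t] heat1_fast[OF t] heat_deriv[OF t] H])
    finally show "D2 \<beta> t w x = - S \<beta> t (\<lambda>x. - g x) x" using t by (simp add: conv_heat2_const S_def)
  qed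
  have "TS.gen (abs_l2 w) (abs_l2 g)"
  proof (rule TS.gen_closed[OF S_gen[OF w e]])
    show "(\<lambda>n. abs_l2 (S \<beta> (eps n) w)) \<longlonglongrightarrow> abs_l2 w" using TS_eps[of \<beta> "abs_l2 w"] by (simp add: TS_abs w)
    have "(\<lambda>n. - TS \<beta> (eps n) (abs_l2 (\<lambda>x. - g x))) \<longlonglongrightarrow> - abs_l2 (\<lambda>x. - g x)" by (intro tendsto_minus TS_eps)
    moreover have "abs_l2 (D2 \<beta> (eps n) w) = - TS \<beta> (eps n) (abs_l2 (\<lambda>x. - g x))" for n
      using D[OF e, of n] mg by (simp add: abs_l2_uminus TS_abs S_L2)
    moreover have "- abs_l2 (\<lambda>x. - g x) = abs_l2 g" using g by (simp add: abs_l2_uminus)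
    ultimately show "(\<lambda>n. abs_l2 (D2 \<beta> (eps n) w)) \<longlonglongrightarrow> abs_l2 g" by simp
  qed
  then show "sg_generator (S \<beta>) f g"
    using sg_generator_iff[OF C0_semigroup_S f g, of \<beta>] fw by simp
qed

lemma gen_iff_opA: "L2 f \<Longrightarrow> L2 g \<Longrightarrow> C0_sg.gen (TS \<beta>) (abs_l2 f) (abs_l2 g) \<longleftrightarrow> opA \<beta> f (\<lambda>x. - g x)"
  using generated_by_S[of \<beta>] sg_generator_iff[OF C0_semigroup_S, of f g \<beta>]
  by (simp add: generated_by_minus_A_def)

text \<open>\<open>expA\<close> may be any semigroup generated by -A, so its values are pinned down
  only almost everywhere. The density that \<open>C0_sg_unique\<close> asks for is provided by the
  regularisations S \<epsilon> x.\<close>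

lemma expA_eq_S:
  assumes t: "t \<ge> 0" and f: "L2 f" shows "eqae (expA \<beta> t f) (S \<beta> t f)"
proof -
  define T where "T = expA \<beta>"
  have T: "generated_by_minus_A \<beta> T" unfolding T_def expA_def by (rule someI[of _ "S \<beta>"]) (rule generated_by_S)
  then have sgT: "C0_semigroup T" by (simp add: generated_by_minus_A_def)
  have "TS \<beta> t (abs_l2 f) = lift_sg T t (abs_l2 f)"
  proof (rule C0_sg_unique[OF C0_sg_TS C0_sg_lift[OF sgT] _ _ t])
    fix x y assume "C0_sg.gen (TS \<beta>) x y"
    then have "sg_generator (S \<beta>) (rep_l2 x) (rep_l2 y)"
      using sg_generator_iff[OF C0_semigroup_S L2_rep L2_rep, of \<beta> x y] by simp
    then have "sg_generator T (rep_l2 x) (rep_l2 y)"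
      using T generated_by_S[of \<beta>] by (simp add: generated_by_minus_A_def)
    then show "C0_sg.gen (lift_sg T) x y"
      using sg_generator_iff[OF sgT L2_rep L2_rep, of x y] by simp
  next
    fix x :: l2 and e :: real assume e: "e > 0"
    have "eventually (\<lambda>n. norm (TS \<beta> (eps n) x - x) < e) sequentially"
      using TS_eps[of \<beta> x] e unfolding tendsto_iff dist_norm by blast
    then obtain n where n: "norm (TS \<beta> (eps n) x - x) < e" by (auto simp: eventually_sequentially)
    have "C0_sg.gen (TS \<beta>) (abs_l2 (S \<beta> (eps n) (rep_l2 x))) (abs_l2 (D2 \<beta> (eps n) (rep_l2 x)))"
      by (rule S_gen) auto
    then show "\<exists>x' y. C0_sg.gen (TS \<beta>) x' y \<and> norm (x - x') < e"
      using n by (auto simp: lift_sg_def norm_minus_commute intro!: exI)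
  qed
  then have "abs_l2 (T t f) = abs_l2 (S \<beta> t f)" using t f by (simp add: TS_abs lift_sg_abs[OF sgT])
  then show ?thesis unfolding T_def[symmetric] using sg_L2[OF sgT t f] S_L2[OF f t] by (simp add: abs_l2_eq_iff)
qed

lemma nonneg_cong: "eqae f g \<Longrightarrow> nonneg_fn f \<longleftrightarrow> nonneg_fn g"
  unfolding eqae_def nonneg_fn_def by (rule iffI; erule (1) AE_mp[OF _ AE_mp]) (auto intro!: AE_I2)

lemma positive_expA_iff: "positive_sg (expA \<beta>) \<longleftrightarrow> positive_sg (S \<beta>)"
  unfolding positive_sg_def using nonneg_cong[OF expA_eq_S] by blast

lemma ind_ev_expA_iff: "ind_ev_strongly_pos (expA \<beta>) \<longleftrightarrow> ind_ev_strongly_pos (S \<beta>)"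
proof -
  have *: "(AE x in Mpi. Im (expA \<beta> t f x) = 0 \<and> Re (expA \<beta> t f x) \<ge> c) \<longleftrightarrow> (AE x in Mpi. Im (S \<beta> t f x) = 0 \<and> Re (S \<beta> t f x) \<ge> c)"
    if "t \<ge> 0" "L2 f" for t f c
  proof -
    have e: "AE x in Mpi. expA \<beta> t f x = S \<beta> t f x" using expA_eq_S[OF that] by (simp add: eqae_def)
    show ?thesis
    proof
      assume "AE x in Mpi. Im (expA \<beta> t f x) = 0 \<and> Re (expA \<beta> t f x) \<ge> c"
      with e show "AE x in Mpi. Im (S \<beta> t f x) = 0 \<and> Re (S \<beta> t f x) \<ge> c" by eventually_elim simp
    next
      assume "AE x in Mpi. Im (S \<beta> t f x) = 0 \<and> Re (S \<beta> t f x) \<ge> c"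
      with e show "AE x in Mpi. Im (expA \<beta> t f x) = 0 \<and> Re (expA \<beta> t f x) \<ge> c" by eventually_elim simp
    qed
  qed
  have **: "(\<exists>t0>0. \<forall>t\<ge>t0. \<exists>c>0. AE x in Mpi. Im (expA \<beta> t f x) = 0 \<and> Re (expA \<beta> t f x) \<ge> c) \<longleftrightarrow>
     (\<exists>t0>0. \<forall>t\<ge>t0. \<exists>c>0. AE x in Mpi. Im (S \<beta> t f x) = 0 \<and> Re (S \<beta> t f x) \<ge> c)" if "L2 f" for f
    using *[OF _ that] by (intro ex_cong1 conj_cong refl all_cong) (meson less_imp_le order_trans)
  show ?thesis unfolding ind_ev_strongly_pos_def using ** by blast
qed

section \<open>Order properties\<close>

lemma V_complex_of_real: "V (\<lambda>s. complex_of_real (g s)) x = complex_of_real (LINT s|Mpi. (if s < x then g s else 0))"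
proof -
  have "V (\<lambda>s. complex_of_real (g s)) x = (LINT s|Mpi. complex_of_real (if s < x then g s else 0))"
    unfolding V_def by (rule Bochner_Integration.integral_cong) auto
  then show ?thesis by (simp only: integral_complex_of_real)
qed

lemma qB_real:
  assumes "\<And>x. Im (f x) = 0"
  shows "(\<forall>s. Im (pB \<beta> f n s) = 0) \<and> (\<forall>s. Im (qB \<beta> f n s) = 0) \<and> Im (cB \<beta> f n) = 0"
proof (induction n)
  case (Suc n)
  have "qB \<beta> f n = (\<lambda>s. complex_of_real (Re (qB \<beta> f n s)))"
    using Suc by (simp add: fun_eq_iff complex_eq_iff)
  then have "Im (V (qB \<beta> f n) s) = 0" for s by (metis V_complex_of_real Im_complex_of_real)
  then show ?case using Suc by (simp add: B_simps)
qed (simp add: B_simps assms)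

text \<open>In the recursion q becomes p - 2 \<beta> (c + V q), a sum of nonnegative terms when
  \<beta> \<le> 0.\<close>

lemma qB_nonneg:
  assumes "\<beta> \<le> 0" "\<And>x. Im (f x) = 0" "\<And>x. Re (f x) \<ge> 0"
  shows "(\<forall>s. Re (pB \<beta> f n s) \<ge> 0) \<and> (\<forall>s. Re (qB \<beta> f n s) \<ge> 0) \<and> Re (cB \<beta> f n) \<ge> 0"
proof (induction n)
  case (Suc n)
  have "qB \<beta> f n = (\<lambda>s. complex_of_real (Re (qB \<beta> f n s)))"
    using qB_real[of f \<beta> n] assms(2) by (simp add: fun_eq_iff complex_eq_iff)
  then have "V (qB \<beta> f n) x = complex_of_real (LINT s|Mpi. (if s < x then Re (qB \<beta> f n s) else 0))" for x
    by (metis V_complex_of_real)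
  moreover have "(LINT s|Mpi. (if s < x then Re (qB \<beta> f n s) else 0)) \<ge> 0" for x
    using Suc by (intro integral_nonneg_AE AE_I2) auto
  ultimately have V: "Re (V (qB \<beta> f n) x) \<ge> 0" for x by simp
  have "\<beta> * (Re (cB \<beta> f n) + Re (V (qB \<beta> f n) x)) \<le> 0" for x
    using Suc V assms(1) by (intro mult_nonpos_nonneg) auto
  moreover have "0 \<le> Re (pB \<beta> f n s)" for s using Suc by blast
  ultimately have "2 * (\<beta> * (Re (cB \<beta> f n) + Re (V (qB \<beta> f n) s))) \<le> Re (pB \<beta> f n s)" for s
    by (meson mult_nonneg_nonpos order_trans zero_le_numeral)
  with V show ?case using Suc by (simp add: B_simps mult.assoc)
qed (simp add: B_simps assms)

lemma S_real:
  assumes "\<And>x. Im (f x) = 0" shows "Im (S \<beta> t f x) = 0"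
proof -
  have "ext \<beta> f = (\<lambda>y. complex_of_real (Re (ext \<beta> f y)))"
    using qB_real[of f \<beta>] assms by (simp add: fun_eq_iff complex_eq_iff ext_def)
  then have "conv (heat t) (ext \<beta> f) z = (LINT y|lborel. complex_of_real (heat t (z - y) * Re (ext \<beta> f y)))" for z
    unfolding conv_def by (metis of_real_mult)
  then show ?thesis using assms by (simp add: S_def del: of_real_mult)
qed

lemma S_nonneg:
  assumes "\<beta> \<le> 0" "t \<ge> 0" "\<And>x. Im (f x) = 0" "\<And>x. Re (f x) \<ge> 0" shows "Re (S \<beta> t f x) \<ge> 0"
proof (cases "t = 0")
  case False
  have "ext \<beta> f = (\<lambda>y. complex_of_real (Re (ext \<beta> f y)))"
    using qB_real[of f \<beta>] assms by (simp add: fun_eq_iff complex_eq_iff ext_def)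
  then have "conv (heat t) (ext \<beta> f) z = (LINT y|lborel. complex_of_real (heat t (z - y) * Re (ext \<beta> f y)))" for z
    unfolding conv_def by (metis of_real_mult)
  moreover have "(LINT y|lborel. heat t (z - y) * Re (ext \<beta> f y)) \<ge> 0" for z
    using qB_nonneg[of \<beta> f] assms heat_pos[of t] False
    by (intro integral_nonneg_AE AE_I2 mult_nonneg_nonneg) (auto simp: ext_def less_imp_le)
  ultimately show ?thesis using False by (simp add: S_def del: of_real_mult)
qed (simp add: S_def assms)

text \<open>The recursion behind \<open>ext\<close> is pointwise, so sign and reality are followed
  for a representative that has them everywhere.\<close>

lemma nonneg_representative:
  assumes f: "L2 f" "nonneg_fn f"
  obtains g where "L2 g" "eqae f g" "\<And>x. Im (g x) = 0" "\<And>x. Re (g x) \<ge> 0"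
proof
  let ?g = "\<lambda>x. complex_of_real (max 0 (Re (f x)))"
  show e: "eqae f ?g" using f(2) unfolding eqae_def nonneg_fn_def by eventually_elim (simp add: complex_eq_iff)
  have [measurable]: "f \<in> borel_measurable Mpi" using f(1) by (rule L2_measurable)
  show "L2 ?g" by (rule L2_cong_AE[OF f(1) _ e]) measurable
qed auto

theorem positive_S: "\<beta> \<le> 0 \<Longrightarrow> positive_sg (S \<beta>)"
  unfolding positive_sg_def
proof (intro allI impI, elim conjE)
  fix t :: real and f assume \<beta>: "\<beta> \<le> 0" and t: "t \<ge> 0" and f: "L2 f" "nonneg_fn f"
  obtain g where g: "L2 g" "eqae f g" "\<And>x. Im (g x) = 0" "\<And>x. Re (g x) \<ge> 0"
    using nonneg_representative[OF f] by blast
  have "eqae (S \<beta> t f) (S \<beta> t g)" by (rule sg_cong[OF C0_semigroup_S t f(1) g(1,2)])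
  moreover have "nonneg_fn (S \<beta> t g)"
    unfolding nonneg_fn_def using S_nonneg[OF \<beta> t g(3,4)] S_real[OF g(3)] by simp
  ultimately show "nonneg_fn (S \<beta> t f)" using nonneg_cong by blast
qed

section \<open>Pairings with real weights and Green's identity\<close>

definition ip :: "fn \<Rightarrow> (real \<Rightarrow> real) \<Rightarrow> real" where
  "ip f \<theta> = (LINT x|Mpi. Re (f x) * \<theta> x)"

lemma inner_abs_ip:
  assumes "L2 f" "L2 (\<lambda>x. complex_of_real (\<theta> x))"
  shows "inner (abs_l2 f) (abs_l2 (\<lambda>x. complex_of_real (\<theta> x))) = ip f \<theta>"
  using integral_Re[OF L2_integrable_mult[OF assms]] by (simp add: inner_abs_l2 assms inner_L2_def ip_def)

lemma L2_real_continuous: "continuous_on {0..pi} \<theta> \<Longrightarrow> L2 (\<lambda>x. complex_of_real (\<theta> x))"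
  by (intro L2_continuous continuous_intros)

lemma ip_integrable:
  assumes "L2 f" "L2 (\<lambda>x. complex_of_real (\<theta> x))" shows "integrable Mpi (\<lambda>x. Re (f x) * \<theta> x)"
  using integrable_Re[OF L2_integrable_mult[OF assms]] by simp

lemma integral_Mpi_FTC_pi:
  fixes F :: "real \<Rightarrow> real"
  assumes "continuous_on {0..pi} f" "\<And>x. x \<in> {0..pi} \<Longrightarrow> (F has_vector_derivative f x) (at x within {0..pi})"
  shows "(LINT x|Mpi. f x) = F pi - F 0"
  using integral_Mpi_FTC[of 0 pi f F] assms integral_Mpi_full[of f] by simp

lemma S_has_derivative:
  assumes f: "L2 f" and t: "t > 0"
  shows "((\<lambda>t. TS \<beta> t (abs_l2 f)) has_vector_derivative abs_l2 (D2 \<beta> t f)) (at t)"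
proof -
  interpret TS: C0_sg "TS \<beta>" by (rule C0_sg_TS)
  \<comment> \<open>f itself need not lie in the domain; the orbit is restarted at time t / 2, where
    it does.\<close>
  define r where "r = t / 2"
  have r: "r > 0" "r < t" using t by (auto simp: r_def)
  note G = S_gen[OF f r(1), of \<beta>]
  have eq: "TS \<beta> (t - r) (abs_l2 (D2 \<beta> r f)) = abs_l2 (D2 \<beta> t f)"
  proof (rule gen_unique[OF _ S_gen[OF f t]])
    show "TS.gen (abs_l2 (S \<beta> t f)) (TS \<beta> (t - r) (abs_l2 (D2 \<beta> r f)))"
      using TS.gen_orbit[OF G, of "t - r"] TS.add[of "t - r" r "abs_l2 f"] r t f by (simp add: TS_abs)
  qed
  have "((\<lambda>s. TS \<beta> s (abs_l2 (S \<beta> r f))) has_vector_derivative TS \<beta> (t - r) (abs_l2 (D2 \<beta> r f))) (at (t - r))"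
    using r by (intro TS.orbit_has_derivative[OF G]) simp
  moreover have "((\<lambda>s. s - r) has_vector_derivative 1) (at t)"
    by (auto intro!: derivative_eq_intros simp: has_real_derivative_iff_has_vector_derivative[symmetric])
  ultimately have "((\<lambda>s. TS \<beta> (s - r) (abs_l2 (S \<beta> r f))) has_vector_derivative abs_l2 (D2 \<beta> t f)) (at t)"
    using vector_diff_chain_at[of "\<lambda>s. s - r" 1 t] by (fastforce simp: o_def eq)
  then show ?thesis
  proof (rule has_vector_derivative_transform_within_open)
    show "TS \<beta> (s - r) (abs_l2 (S \<beta> r f)) = TS \<beta> s (abs_l2 f)" if "s \<in> {r<..}" for s
      using TS.add[of "s - r" r "abs_l2 f"] r f that by (simp add: TS_abs)
  qed (use r in auto)
qed

lemma S_deriv_ip: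
  assumes f: "L2 f" and \<theta>: "L2 (\<lambda>x. complex_of_real (\<theta> x))" and t: "t > 0"
  shows "((\<lambda>t. ip (S \<beta> t f) \<theta>) has_real_derivative ip (D2 \<beta> t f) \<theta>) (at t)"
proof -
  let ?\<theta> = "abs_l2 (\<lambda>x. complex_of_real (\<theta> x))"
  have "((\<lambda>s. inner (TS \<beta> s (abs_l2 f)) ?\<theta>) has_vector_derivative inner (abs_l2 (D2 \<beta> t f)) ?\<theta>) (at t)"
    by (rule bounded_linear.has_vector_derivative[OF bounded_linear_inner_left S_has_derivative[OF f t]])
  then have "((\<lambda>s. inner (TS \<beta> s (abs_l2 f)) ?\<theta>) has_vector_derivative ip (D2 \<beta> t f) \<theta>) (at t)"
    by (simp add: inner_abs_ip D2_L2 f t \<theta>)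
  then have "((\<lambda>s. ip (S \<beta> s f) \<theta>) has_vector_derivative ip (D2 \<beta> t f) \<theta>) (at t)"
  proof (rule has_vector_derivative_transform_within_open)
    show "inner (TS \<beta> s (abs_l2 f)) ?\<theta> = ip (S \<beta> s f) \<theta>" if "s \<in> {0<..}" for s
      using that by (simp add: TS_abs f inner_abs_ip S_L2 \<theta>)
  qed (use t in auto)
  then show ?thesis by (simp add: has_real_derivative_iff_has_vector_derivative)
qed

lemma S_ip_continuous:
  assumes f: "L2 f" and \<theta>: "L2 (\<lambda>x. complex_of_real (\<theta> x))"
  shows "continuous_on {0..} (\<lambda>t. ip (S \<beta> t f) \<theta>)"
proof -
  have "continuous_on {0..} (\<lambda>t. inner (TS \<beta> t (abs_l2 f)) (abs_l2 (\<lambda>x. complex_of_real (\<theta> x))))"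
    by (intro continuous_intros C0_sg.continuous_orbit[OF C0_sg_TS])
  then show ?thesis by (rule continuous_on_eq) (simp add: TS_abs f inner_abs_ip S_L2 \<theta>)
qed

text \<open>Green's second identity with the boundary conditions of the orbit inserted. The adjoint
  conditions can be read off: \<theta>'(0) = 0 and \<theta>'(pi) = - \<beta> \<theta>(0) remove both
  boundary terms.\<close>

lemma D2_Green:
  fixes \<theta> \<theta>' \<theta>'' :: "real \<Rightarrow> real"
  assumes f: "L2 f" and t: "t > 0"
    and d1: "\<And>x. (\<theta> has_real_derivative \<theta>' x) (at x)" and d2: "\<And>x. (\<theta>' has_real_derivative \<theta>'' x) (at x)"
    and c: "continuous_on {0..pi} \<theta>''"
  shows "ip (D2 \<beta> t f) \<theta> = ip (S \<beta> t f) \<theta>'' + Re (S \<beta> t f 0) * \<theta>' 0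
    - Re (S \<beta> t f pi) * (\<beta> * \<theta> 0 + \<theta>' pi)"
proof -
  let ?u = "\<lambda>x. Re (S \<beta> t f x)" and ?u1 = "\<lambda>x. Re (D1 \<beta> t f x)" and ?u2 = "\<lambda>x. Re (D2 \<beta> t f x)"
  note S = S_derivs[OF f t, where \<beta>=\<beta>]
  have u1: "(?u has_vector_derivative ?u1 x) (at x within {0..pi})" for x
    using bounded_linear.has_vector_derivative[OF bounded_linear_Re S(1)] .
  have u2: "(?u1 has_vector_derivative ?u2 x) (at x within {0..pi})" for x
    using bounded_linear.has_vector_derivative[OF bounded_linear_Re S(2)] .
  have c2: "continuous_on {0..pi} ?u2" "continuous_on {0..pi} ?u" using S(3) S_continuous[OF f t] by (auto intro!: continuous_intros)
  have c0: "continuous_on {0..pi} \<theta>" "continuous_on {0..pi} \<theta>'"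
    using d1 d2 by (meson DERIV_isCont continuous_at_imp_continuous_on)+
  have "(LINT x|Mpi. ?u2 x * \<theta> x - ?u x * \<theta>'' x) = (?u1 pi * \<theta> pi - ?u pi * \<theta>' pi) - (?u1 0 * \<theta> 0 - ?u 0 * \<theta>' 0)"
  proof (rule integral_Mpi_FTC_pi)
    show "continuous_on {0..pi} (\<lambda>x. ?u2 x * \<theta> x - ?u x * \<theta>'' x)" by (intro continuous_intros c c2 c0)
    fix x assume "x \<in> {0..pi}"
    show "((\<lambda>x. ?u1 x * \<theta> x - ?u x * \<theta>' x) has_vector_derivative ?u2 x * \<theta> x - ?u x * \<theta>'' x) (at x within {0..pi})"
      using DERIV_diff[OF DERIV_mult[OF u2[unfolded has_real_derivative_iff_has_vector_derivative[symmetric]] has_field_derivative_at_within[OF d1]]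
          DERIV_mult[OF u1[unfolded has_real_derivative_iff_has_vector_derivative[symmetric]] has_field_derivative_at_within[OF d2]], of x]
      unfolding has_real_derivative_iff_has_vector_derivative[symmetric]
      by (simp add: algebra_simps)
  qed
  also have "(LINT x|Mpi. ?u2 x * \<theta> x - ?u x * \<theta>'' x) = ip (D2 \<beta> t f) \<theta> - ip (S \<beta> t f) \<theta>''"
    unfolding ip_def using t f c c0
    by (intro Bochner_Integration.integral_diff ip_integrable D2_L2 S_L2 L2_real_continuous) auto
  finally show ?thesis using S(5,6) by (simp add: algebra_simps)
qed

text \<open>Truncating the real part at c from below keeps continuity, so the inequality becomes an
  almost-everywhere equality of continuous functions.\<close>

lemma continuous_ge_if_AE:
  assumes w: "continuous_on {0..pi} w" and ae: "AE x in Mpi. Re (w x) \<ge> c" and x: "x \<in> {0..pi}"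
  shows "Re (w x) \<ge> c"
proof -
  have "w x = Complex (max c (Re (w x))) (Im (w x))"
  proof (rule continuous_AE_eq_Mpi[OF w _ _ x])
    have "continuous_on {0..pi} (\<lambda>x. complex_of_real (max c (Re (w x))) + \<i> * complex_of_real (Im (w x)))"
      by (intro continuous_intros w)
    then show "continuous_on {0..pi} (\<lambda>x. Complex (max c (Re (w x))) (Im (w x)))" by (simp add: Complex_eq)
    show "AE x in Mpi. w x = Complex (max c (Re (w x))) (Im (w x))"
      using ae by eventually_elim (simp add: complex_eq_iff)
  qed
  then have "Re (w x) = max c (Re (w x))" by (metis complex.sel(1))
  then show ?thesis by simp
qed

lemma gen_C2:
  fixes w w' w'' :: "real \<Rightarrow> real"
  assumes d1: "\<And>x. (w has_real_derivative w' x) (at x)" and d2: "\<And>x. (w' has_real_derivative w'' x) (at x)"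
    and c: "continuous_on {0..pi} w''" and bc: "w' pi = 0" "w' 0 = \<beta> * w pi"
  shows "C0_sg.gen (TS \<beta>) (abs_l2 (\<lambda>x. complex_of_real (w x))) (abs_l2 (\<lambda>x. complex_of_real (w'' x)))"
proof -
  have "continuous_on {0..pi} w" using d1 by (meson DERIV_isCont continuous_at_imp_continuous_on)
  moreover have "opA \<beta> (\<lambda>x. complex_of_real (w x)) (\<lambda>x. - complex_of_real (w'' x))"
  proof (rule opA_C2(1))
    show "((\<lambda>x. complex_of_real (w x)) has_vector_derivative complex_of_real (w' x)) (at x within {0..pi})" for x
      using d1 by (intro bounded_linear.has_vector_derivative[OF bounded_linear_of_real])
        (simp add: has_real_derivative_iff_has_vector_derivative has_vector_derivative_at_within)
    show "((\<lambda>x. complex_of_real (w' x)) has_vector_derivative complex_of_real (w'' x)) (at x within {0..pi})" for x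
      using d2 by (intro bounded_linear.has_vector_derivative[OF bounded_linear_of_real])
        (simp add: has_real_derivative_iff_has_vector_derivative has_vector_derivative_at_within)
    show "continuous_on {0..pi} (\<lambda>x. complex_of_real (w'' x))" by (intro continuous_intros c)
  qed (simp_all add: bc)
  ultimately show ?thesis by (simp add: gen_iff_opA L2_real_continuous c)
qed

lemma S_eigenfunction:
  fixes w w' :: "real \<Rightarrow> real"
  assumes d1: "\<And>x. (w has_real_derivative w' x) (at x)" and d2: "\<And>x. (w' has_real_derivative c * w x) (at x)"
    and bc: "w' pi = 0" "w' 0 = \<beta> * w pi" and t: "t > 0" and x: "x \<in> {0..pi}"
  shows "S \<beta> t (\<lambda>x. complex_of_real (w x)) x = complex_of_real (exp (c * t) * w x)"
proof -
  have cw: "continuous_on {0..pi} w" using d1 by (meson DERIV_isCont continuous_at_imp_continuous_on)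
  then have L: "L2 (\<lambda>x. complex_of_real (w x))" by (rule L2_real_continuous)
  have "C0_sg.gen (TS \<beta>) (abs_l2 (\<lambda>x. complex_of_real (w x))) (abs_l2 (\<lambda>x. complex_of_real (c * w x)))"
    by (rule gen_C2[OF d1 d2 _ bc]) (intro continuous_intros cw)
  moreover have "abs_l2 (\<lambda>x. complex_of_real (r * w x)) = r *\<^sub>R abs_l2 (\<lambda>x. complex_of_real (w x))" for r
    using abs_l2_scaleR[OF L, of r] by simp
  ultimately have "TS \<beta> t (abs_l2 (\<lambda>x. complex_of_real (w x))) = abs_l2 (\<lambda>x. complex_of_real (exp (c * t) * w x))"
    using C0_sg.eigenvector_orbit[OF C0_sg_TS, of \<beta> _ c t] t by simp
  moreover have cw': "continuous_on {0..pi} (\<lambda>x. complex_of_real (exp (c * t) * w x))" by (intro continuous_intros cw)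
  ultimately have "eqae (S \<beta> t (\<lambda>x. complex_of_real (w x))) (\<lambda>x. complex_of_real (exp (c * t) * w x))"
    using t L by (simp add: TS_abs abs_l2_eq_iff S_L2 L2_continuous del: of_real_mult)
  then show ?thesis
    unfolding eqae_def by (rule continuous_AE_eq_Mpi[OF S_continuous[OF L t] cw' _ x])
qed

section \<open>Negative results: failure of eventual positivity and of positivity\<close>

lemma eqae_0_continuous:
  assumes "continuous_on {0..pi} f" "eqae f (\<lambda>x. 0)" "x \<in> {0..pi}" shows "f x = 0"
  using continuous_AE_eq_Mpi[of f "\<lambda>_. 0" x] assms by (simp add: eqae_def)

lemma ind_ev_strongly_posD:
  assumes "ind_ev_strongly_pos (S \<beta>)" "continuous_on {0..pi} w" "\<And>x. x \<in> {0..pi} \<Longrightarrow> w x \<ge> (0::real)" "x0 \<in> {0..pi}" "w x0 \<noteq> 0"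
  obtains t0 where "t0 > 0" "\<And>t x. t \<ge> t0 \<Longrightarrow> x \<in> {0..pi} \<Longrightarrow> Re (S \<beta> t (\<lambda>x. complex_of_real (w x)) x) > 0"
proof -
  let ?f = "\<lambda>x. complex_of_real (w x)"
  have c: "continuous_on {0..pi} ?f" by (intro continuous_intros assms)
  have L: "L2 ?f" by (rule L2_continuous[OF c])
  have "nonneg_fn ?f" unfolding nonneg_fn_def using assms(3) by (intro AE_I2) auto
  moreover have "\<not> eqae ?f (\<lambda>x. 0)" using eqae_0_continuous[OF c, of x0] assms(4,5) by auto
  ultimately obtain t0 where t0: "t0 > 0" "\<And>t. t \<ge> t0 \<Longrightarrow> \<exists>c>0. AE x in Mpi. Im (S \<beta> t ?f x) = 0 \<and> Re (S \<beta> t ?f x) \<ge> c"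
    using assms(1) L unfolding ind_ev_strongly_pos_def by blast
  show thesis
  proof (rule that[OF t0(1)])
    fix t x assume t: "t \<ge> t0" and x: "x \<in> {0..pi}"
    from t0(2)[OF t] obtain c where c: "c > 0" "AE x in Mpi. Im (S \<beta> t ?f x) = 0 \<and> Re (S \<beta> t ?f x) \<ge> c" by blast
    from c(2) have "AE x in Mpi. Re (S \<beta> t ?f x) \<ge> c" by eventually_elim simp
    then have "Re (S \<beta> t ?f x) \<ge> c"
      using t t0(1) by (intro continuous_ge_if_AE[OF S_continuous[OF L] _ x]) auto
    then show "Re (S \<beta> t ?f x) > 0" using c(1) by simp
  qed
qed

theorem not_ind_ev_half: "\<not> ind_ev_strongly_pos (S (1/2))"
proof
  assume *: "ind_ev_strongly_pos (S (1/2))"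
  obtain t0 where t0: "t0 > 0" "\<And>t x. t \<ge> t0 \<Longrightarrow> x \<in> {0..pi} \<Longrightarrow> Re (S (1/2) t (\<lambda>x. complex_of_real (sin (x / 2))) x) > 0"
    by (rule ind_ev_strongly_posD[OF *, of "\<lambda>x. sin (x / 2)" pi]) (auto intro!: continuous_intros sin_ge_zero)
  have "S (1/2) t0 (\<lambda>x. complex_of_real (sin (x / 2))) 0 = complex_of_real (exp ((-1/4) * t0) * sin (0 / 2))"
    by (rule S_eigenfunction[of _ "\<lambda>x. cos (x / 2) / 2"]) (use t0 in \<open>auto intro!: derivative_eq_intros\<close>)
  then show False using t0(2)[of t0 0] by simp
qed

lemma integral_Mpi_pos:
  assumes "integrable Mpi f" "\<And>x. x \<in> space Mpi \<Longrightarrow> f x > (0::real)"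
  shows "(LINT x|Mpi. f x) > 0"
proof -
  have "emeasure Mpi (space Mpi) \<noteq> 0" by (simp add: emeasure_Mpi del: space_Mpi)
  moreover have "AE x in Mpi. f x > 0" using assms(2) by (intro AE_I2)
  ultimately show ?thesis using Mpi.integral_less_AE_space[of "\<lambda>_. 0" f] assms(1) by (simp del: space_Mpi)
qed

lemma ip_mono:
  assumes "L2 f" "L2 (\<lambda>x. complex_of_real (\<theta> x))" "L2 (\<lambda>x. complex_of_real (\<eta> x))"
    and "\<And>x. x \<in> {0..pi} \<Longrightarrow> Re (f x) \<ge> 0" "\<And>x. x \<in> {0..pi} \<Longrightarrow> \<theta> x \<le> \<eta> x"
  shows "ip f \<theta> \<le> ip f \<eta>"
  unfolding ip_def by (intro integral_mono ip_integrable assms mult_left_mono) (auto intro!: assms)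

lemma ip_lincomb:
  assumes "L2 f" "L2 (\<lambda>x. complex_of_real (\<theta> x))" "L2 (\<lambda>x. complex_of_real (\<eta> x))"
  shows "ip f (\<lambda>x. a * \<theta> x + b * \<eta> x) = a * ip f \<theta> + b * ip f \<eta>"
proof -
  have "ip f (\<lambda>x. a * \<theta> x + b * \<eta> x) = (LINT x|Mpi. a * (Re (f x) * \<theta> x) + b * (Re (f x) * \<eta> x))"
    unfolding ip_def by (simp add: algebra_simps)
  also have "\<dots> = a * ip f \<theta> + b * ip f \<eta>"
    unfolding ip_def using ip_integrable[OF assms(1,2)] ip_integrable[OF assms(1,3)] by simp
  finally show ?thesis .
qed

text \<open>For \<open>\<beta> > 1/2\<close> an orbit that stays positive has bounded integral, but its moment against \<open>\<theta>\<close> below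
  grows exponentially: \<open>\<theta>\<close> satisfies the adjoint boundary conditions and \<open>\<theta>'' + \<theta> / 4 = sin (x / 2)\<close>.\<close>

theorem not_ind_ev_large:
  assumes \<beta>: "\<beta> > 1/2" shows "\<not> ind_ev_strongly_pos (S \<beta>)"
proof
  assume *: "ind_ev_strongly_pos (S \<beta>)"
  let ?f = "\<lambda>x. complex_of_real 1"
  obtain t0 where t0: "t0 > 0" "\<And>t x. t \<ge> t0 \<Longrightarrow> x \<in> {0..pi} \<Longrightarrow> Re (S \<beta> t ?f x) > 0"
    by (rule ind_ev_strongly_posD[OF *, of "\<lambda>x. 1" 0]) auto
  have f: "L2 ?f" by simp
  \<comment> \<open>Solves the adjoint condition \<beta> \<theta>(0) + \<theta>'(pi) = - \<beta>
    \<kappa> + (pi + \<kappa>) / 2 = 0. Positivity of \<kappa> is where \<beta> > 1/2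
    enters.\<close>
  define \<kappa> where "\<kappa> = (pi / 2) / (\<beta> - 1 / 2)"
  have \<kappa>: "\<kappa> > 0" "\<kappa> * (\<beta> - 1 / 2) = pi / 2"
    using \<beta> nonzero_eq_divide_eq[of "\<beta> - 1 / 2" \<kappa> "pi / 2"] by (auto simp: \<kappa>_def)
  define \<theta> where "\<theta> x = 2 * sin (x / 2) - (x + \<kappa>) * cos (x / 2)" for x :: real
  define n where "n t = ip (S \<beta> t ?f) (\<lambda>x. sin (x / 2))" for t
  define z where "z t = ip (S \<beta> t ?f) \<theta>" for t
  define s where "s t = ip (S \<beta> t ?f) (\<lambda>x. 1)" for t
  have Ln: "L2 (\<lambda>x. complex_of_real (sin (x / 2)))" and Lz: "L2 (\<lambda>x. complex_of_real (\<theta> x))" and Ls: "L2 (\<lambda>x. complex_of_real 1)"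
    unfolding \<theta>_def by (auto intro!: L2_real_continuous continuous_intros simp del: of_real_diff of_real_mult)
  \<comment> \<open>For the weight sin (x / 2) the boundary term at pi vanishes, and the value of
    the orbit at 0 enters with the positive factor 1/2.\<close>
  have dn: "(n has_real_derivative - n t / 4 + Re (S \<beta> t ?f 0) / 2) (at t)" if t: "t > 0" for t
  proof -
    have "ip (D2 \<beta> t ?f) (\<lambda>x. sin (x / 2)) = ip (S \<beta> t ?f) (\<lambda>x. (- 1 / 4) * sin (x / 2) + 0 * sin (x / 2)) + Re (S \<beta> t ?f 0) * (cos (0 / 2) / 2) - Re (S \<beta> t ?f pi) * (\<beta> * sin (0 / 2) + cos (pi / 2) / 2)"
      by (rule D2_Green[OF f t]) (auto intro!: derivative_eq_intros continuous_intros)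
    moreover have "ip (S \<beta> t ?f) (\<lambda>x. (- 1 / 4) * sin (x / 2) + 0 * sin (x / 2)) = (- 1 / 4) * n t + 0 * n t"
      unfolding n_def using t by (intro ip_lincomb S_L2 f Ln) simp
    ultimately show ?thesis using S_deriv_ip[OF f Ln t, of \<beta>] unfolding n_def[symmetric] by simp
  qed
  have dz: "(z has_real_derivative - z t / 4 + n t) (at t)" if t: "t > 0" for t
  proof -
    have "ip (D2 \<beta> t ?f) \<theta> = ip (S \<beta> t ?f) (\<lambda>x. (- 1 / 4) * \<theta> x + 1 * sin (x / 2)) + Re (S \<beta> t ?f 0) * ((0 + \<kappa>) / 2 * sin (0 / 2)) - Re (S \<beta> t ?f pi) * (\<beta> * \<theta> 0 + (pi + \<kappa>) / 2 * sin (pi / 2))"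
    proof (rule D2_Green[OF f t])
      show "(\<theta> has_real_derivative (x + \<kappa>) / 2 * sin (x / 2)) (at x)" for x
        unfolding \<theta>_def by (auto intro!: derivative_eq_intros simp: field_simps)
      show "((\<lambda>x. (x + \<kappa>) / 2 * sin (x / 2)) has_real_derivative (- 1 / 4) * \<theta> x + 1 * sin (x / 2)) (at x)" for x
        unfolding \<theta>_def by (auto intro!: derivative_eq_intros simp: field_simps)
      show "continuous_on {0..pi} (\<lambda>x. (- 1 / 4) * \<theta> x + 1 * sin (x / 2))" unfolding \<theta>_def by (intro continuous_intros) auto
    qed
    moreover have "\<beta> * \<theta> 0 + (pi + \<kappa>) / 2 * sin (pi / 2) = 0" using \<kappa>(2) by (simp add: \<theta>_def field_simps)
    moreover have "ip (S \<beta> t ?f) (\<lambda>x. (- 1 / 4) * \<theta> x + 1 * sin (x / 2)) = (- 1 / 4) * z t + 1 * n t"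
      unfolding n_def z_def using t by (intro ip_lincomb S_L2 f Ln Lz) simp
    ultimately show ?thesis using S_deriv_ip[OF f Lz t, of \<beta>] unfolding z_def[symmetric] by simp
  qed
  have ds: "(s has_real_derivative - (\<beta> * Re (S \<beta> t ?f pi))) (at t)" if t: "t > 0" for t
  proof -
    have "ip (D2 \<beta> t ?f) (\<lambda>x. 1) = ip (S \<beta> t ?f) (\<lambda>x. 0) + Re (S \<beta> t ?f 0) * 0 - Re (S \<beta> t ?f pi) * (\<beta> * 1 + 0)"
      by (rule D2_Green[OF f t]) (auto intro!: derivative_eq_intros)
    moreover have "ip (S \<beta> t ?f) (\<lambda>x. 0) = 0" by (simp add: ip_def)
    ultimately show ?thesis using S_deriv_ip[OF f Ls t, of \<beta>] unfolding s_def[symmetric] by (simp add: mult.commute)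
  qed
  \<comment> \<open>Multiplying by exp (t / 4) removes the damping: a is nondecreasing while the
    orbit is nonnegative at 0, and b' = a.\<close>
  define a where "a t = exp (t / 4) * n t" for t
  define b where "b t = exp (t / 4) * z t" for t
  have da: "(a has_real_derivative exp (t / 4) * Re (S \<beta> t ?f 0) / 2) (at t)" if "t > 0" for t
    unfolding a_def using dn[OF that] by (auto intro!: derivative_eq_intros simp: field_simps)
  have db: "(b has_real_derivative a t) (at t)" if "t > 0" for t
    unfolding a_def b_def using dz[OF that] by (auto intro!: derivative_eq_intros simp: field_simps)
  have nneg: "Re (S \<beta> t ?f x) \<ge> 0" if "t \<ge> t0" "x \<in> {0..pi}" for t x using t0(2)[OF that] by simp
  have n0: "n t0 > 0"
  proof -
    have i: "integrable Mpi (\<lambda>x. Re (S \<beta> t0 ?f x) * sin (x / 2))"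
      using t0(1) by (intro ip_integrable S_L2 f Ln) simp
    have pos: "Re (S \<beta> t0 ?f x) * sin (x / 2) > 0" if "x \<in> space Mpi" for x
      using that t0 by (intro mult_pos_pos sin_gt_zero t0(2)) auto
    show ?thesis unfolding n_def ip_def by (rule integral_Mpi_pos[OF i pos])
  qed
  have a_ge: "a t \<ge> a t0" if "t \<ge> t0" for t
    using that by (rule DERIV_nonneg_imp_nondecreasing) (use da t0(1) nneg in \<open>fastforce intro: mult_nonneg_nonneg\<close>)
  have a0: "a t0 > 0" using n0 by (simp add: a_def)
  have b_ge: "b t \<ge> b t0 + a t0 * (t - t0)" if "t \<ge> t0" for t
  proof -
    have "b t0 - a t0 * t0 \<le> b t - a t0 * t"
    proof (rule DERIV_nonneg_imp_nondecreasing[OF that])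
      fix x assume x: "t0 \<le> x" "x \<le> t"
      have "((\<lambda>t. b t - a t0 * t) has_real_derivative a x - a t0) (at x)"
        using db[of x] x t0(1) by (auto intro!: derivative_eq_intros)
      then show "\<exists>y. ((\<lambda>t. b t - a t0 * t) has_real_derivative y) (at x) \<and> y \<ge> 0" using a_ge[of x] x by auto
    qed
    then show ?thesis by (simp add: algebra_simps)
  qed
  \<comment> \<open>\<theta> is 2 sin (x / 2) minus a term that is nonnegative on [0, pi]. The
    resulting b \<le> 2 a turns b' = a into b' \<ge> b / 2, so that linear growth of b improves to
    exponential growth.\<close>
  have zn: "z t \<le> 2 * n t" if t: "t \<ge> t0" for t
  proof -
    have "z t \<le> ip (S \<beta> t ?f) (\<lambda>x. 2 * sin (x / 2) + 0 * 1)"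
      unfolding z_def
    proof (rule ip_mono)
      show "L2 (\<lambda>x. complex_of_real (2 * sin (x / 2) + 0 * 1))" by (rule L2_real_continuous) (intro continuous_intros, simp)
      show "\<theta> x \<le> 2 * sin (x / 2) + 0 * 1" if "x \<in> {0..pi}" for x
        using that \<kappa>(1) cos_ge_zero[of "x / 2"] by (simp add: \<theta>_def)
    qed (use t t0(1) nneg f Lz in \<open>auto intro!: S_L2\<close>)
    also have "\<dots> = 2 * n t + 0 * s t" unfolding n_def s_def using t t0(1) by (intro ip_lincomb S_L2 f Ln Ls) simp
    finally show ?thesis by simp
  qed
  have ns: "n t \<le> s t" if t: "t \<ge> t0" for t
    unfolding n_def s_def by (rule ip_mono) (use t t0(1) nneg f Ln in \<open>auto intro!: S_L2\<close>)
  have s_le: "s t \<le> s t0" if "t \<ge> t0" for t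
    using that
  proof (rule DERIV_nonpos_imp_nonincreasing)
    fix x assume x: "t0 \<le> x" "x \<le> t"
    then have "- (\<beta> * Re (S \<beta> x ?f pi)) \<le> 0" using nneg[of x pi] \<beta> by simp
    then show "\<exists>y. (s has_real_derivative y) (at x) \<and> y \<le> 0" using ds[of x] x t0(1) by auto
  qed
  define t1 where "t1 = t0 + (1 + \<bar>b t0\<bar>) / a t0"
  have t1: "t1 \<ge> t0" using a0 by (simp add: t1_def)
  have b1: "b t1 \<ge> 1" using b_ge[OF t1] a0 by (simp add: t1_def)
  have b_exp: "b t \<ge> exp ((t - t1) / 2)" if "t \<ge> t1" for t
  proof -
    have "exp (- t1 / 2) * b t1 \<le> exp (- t / 2) * b t"
    proof (rule DERIV_nonneg_imp_nondecreasing[OF that])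
      fix x assume x: "t1 \<le> x" "x \<le> t"
      have "((\<lambda>t. exp (- t / 2) * b t) has_real_derivative exp (- x / 2) * (a x - b x / 2)) (at x)"
        using db[of x] x t1 t0(1) by (auto intro!: derivative_eq_intros simp: field_simps)
      moreover have "b x \<le> 2 * a x" using zn[of x] x t1 by (simp add: a_def b_def)
      ultimately show "\<exists>y. ((\<lambda>t. exp (- t / 2) * b t) has_real_derivative y) (at x) \<and> y \<ge> 0" by force
    qed
    moreover have "exp (- t1 / 2) * 1 \<le> exp (- t1 / 2) * b t1" using b1 by (intro mult_left_mono) auto
    ultimately have "exp (- t1 / 2) \<le> exp (- t / 2) * b t" by linarith
    then have "exp (t / 2) * exp (- t1 / 2) \<le> exp (t / 2) * (exp (- t / 2) * b t)" by (rule mult_left_mono) simp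
    then show ?thesis by (simp add: exp_add[symmetric] mult.assoc[symmetric] diff_divide_distrib)
  qed
  \<comment> \<open>For t \<ge> t1 the moment z(t) is at least exp (t / 4 - t1 / 2) and at most 2
    s(t0). At t2 the exponent is at least 2 |s(t0)|, so exp x \<ge> 1 + x already gives a
    contradiction.\<close>
  define t2 where "t2 = max t1 (2 * t1 + 8 * \<bar>s t0\<bar>)"
  have t2: "t2 \<ge> t1" "t2 \<ge> 2 * t1 + 8 * \<bar>s t0\<bar>" by (auto simp: t2_def)
  have "exp (t2 / 4) * exp (t2 / 4 - t1 / 2) \<le> exp (t2 / 4) * z t2"
    using b_exp[OF t2(1)] by (simp add: b_def exp_add[symmetric] diff_divide_distrib)
  then have "exp (t2 / 4 - t1 / 2) \<le> z t2" by (simp add: mult_le_cancel_left_pos)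
  moreover have "1 + (t2 / 4 - t1 / 2) \<le> exp (t2 / 4 - t1 / 2)" by (rule exp_ge_add_one_self)
  moreover have "z t2 \<le> 2 * s t0" using zn[of t2] ns[of t2] s_le[of t2] t1 t2 by simp
  ultimately show False using t2(2) by linarith
qed

text \<open>If \<open>m\<^sup>2 g - g'' \<ge> 0\<close> with \<open>m\<^sup>2\<close> above the growth bound, then positivity of the semigroup
  would force \<open>g \<ge> 0\<close>, since \<open>exp (- m\<^sup>2 s) \<langle>S\<^sub>s g, \<theta>\<rangle>\<close> is then nonincreasing with limit \<open>0\<close>.\<close>

lemma resolvent_nonneg:
  fixes g g' g'' :: "real \<Rightarrow> real"
  assumes pos: "positive_sg (S \<beta>)"
    and w: "\<And>t x. t \<ge> 0 \<Longrightarrow> norm (TS \<beta> t x) \<le> M * exp (w * t) * norm x" and mw: "w < c"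
    and d1: "\<And>x. (g has_real_derivative g' x) (at x)" and d2: "\<And>x. (g' has_real_derivative g'' x) (at x)"
    and cont: "continuous_on {0..pi} g''" and bc: "g' pi = 0" "g' 0 = \<beta> * g pi"
    and h: "\<And>x. x \<in> {0..pi} \<Longrightarrow> c * g x - g'' x \<ge> 0" and x: "x \<in> {0..pi}"
  shows "g x \<ge> 0"
proof -
  interpret TS: C0_sg "TS \<beta>" by (rule C0_sg_TS)
  \<comment> \<open>The negative part of g: it is a nonnegative weight, and its pairing with g is
    minus its squared norm, so a nonnegative pairing forces it to vanish.\<close>
  define \<theta> where "\<theta> x = max 0 (- g x)" for x
  have cg: "continuous_on {0..pi} g" using d1 by (meson DERIV_isCont continuous_at_imp_continuous_on)
  have c\<theta>: "continuous_on {0..pi} \<theta>" unfolding \<theta>_def by (intro continuous_intros cg)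
  define G where "G = abs_l2 (\<lambda>x. complex_of_real (g x))"
  define G2 where "G2 = abs_l2 (\<lambda>x. complex_of_real (g'' x))"
  define \<Theta> where "\<Theta> = abs_l2 (\<lambda>x. complex_of_real (\<theta> x))"
  define hh where "hh = (\<lambda>x. complex_of_real (c * g x - g'' x))"
  have L: "L2 (\<lambda>x. complex_of_real (g x))" "L2 (\<lambda>x. complex_of_real (g'' x))" "L2 (\<lambda>x. complex_of_real (\<theta> x))"
    by (intro L2_real_continuous cg cont c\<theta>)+
  have Lh: "L2 hh" unfolding hh_def by (intro L2_real_continuous continuous_intros cg cont)
  have H: "abs_l2 hh = c *\<^sub>R G - G2"
  proof -
    have "abs_l2 (\<lambda>x. complex_of_real c * complex_of_real (g x)) = c *\<^sub>R G" unfolding G_def by (rule abs_l2_scaleR[OF L(1)])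
    then show ?thesis using abs_l2_diff[OF L2_mult_const[OF L(1), of "complex_of_real c"] L(2)]
      by (simp add: hh_def G2_def)
  qed
  have gen: "TS.gen G G2" unfolding G_def G2_def by (rule gen_C2[OF d1 d2 cont bc])
  have H0: "inner (TS \<beta> s (c *\<^sub>R G - G2)) \<Theta> \<ge> 0" if s: "s \<ge> 0" for s
  proof -
    have "nonneg_fn hh" unfolding nonneg_fn_def hh_def using h by (intro AE_I2) auto
    then have "nonneg_fn (S \<beta> s hh)" using pos Lh s unfolding positive_sg_def by blast
    then have "ip (S \<beta> s hh) \<theta> \<ge> 0"
      unfolding ip_def nonneg_fn_def \<theta>_def
      by (intro integral_nonneg_AE) (erule eventually_mono, simp)
    then show ?thesis using s Lh L(3) by (simp add: H[symmetric] TS_abs \<Theta>_def inner_abs_ip S_L2)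
  qed
  have mono: "exp (- c * s) * inner (TS \<beta> s G) \<Theta> \<le> inner G \<Theta>" if s: "s \<ge> 0" for s
  proof -
    let ?P = "\<lambda>s. exp (- c * s) * inner (TS \<beta> s G) \<Theta>"
    have "?P s \<le> ?P 0" using s
    proof (rule DERIV_nonpos_imp_decreasing_open)
      fix r :: real assume r: "0 < r"
      have "((\<lambda>r. inner (TS \<beta> r G) \<Theta>) has_vector_derivative inner (TS \<beta> r G2) \<Theta>) (at r)"
        by (rule bounded_linear.has_vector_derivative[OF bounded_linear_inner_left TS.orbit_has_derivative[OF gen r]])
      then have "((\<lambda>r. inner (TS \<beta> r G) \<Theta>) has_real_derivative inner (TS \<beta> r G2) \<Theta>) (at r)"
        by (simp add: has_real_derivative_iff_has_vector_derivative)
      then have "(?P has_real_derivative - (exp (- c * r) * inner (TS \<beta> r (c *\<^sub>R G - G2)) \<Theta>)) (at r)"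
        using r by (auto intro!: derivative_eq_intros simp: TS.diff TS.scale inner_diff_left algebra_simps)
      then show "\<exists>y. (?P has_real_derivative y) (at r) \<and> y \<le> 0" using H0[of r] r by force
    next
      show "continuous_on {0..s} ?P"
        by (intro continuous_intros continuous_on_subset[OF TS.continuous_orbit]) auto
    qed
    then show ?thesis by (simp add: TS.zero)
  qed
  have "inner G \<Theta> \<ge> 0"
  proof (rule tendsto_upperbound)
    have "filterlim (\<lambda>s. (c - w) * s) at_top at_top"
      using mw by (intro filterlim_tendsto_pos_mult_at_top[OF tendsto_const] filterlim_ident) simp
    then have "((\<lambda>s. exp (- ((c - w) * s))) \<longlongrightarrow> 0) at_top"
      by (intro filterlim_compose[OF exp_at_bot] filterlim_compose[OF filterlim_uminus_at_bot_at_top])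
    then show "((\<lambda>s. - (M * exp (- ((c - w) * s)) * norm G * norm \<Theta>)) \<longlongrightarrow> 0) at_top"
      using tendsto_minus[OF tendsto_mult_left_zero[OF tendsto_mult_left_zero[OF tendsto_mult_right_zero]]] by fastforce
    show "eventually (\<lambda>s. - (M * exp (- ((c - w) * s)) * norm G * norm \<Theta>) \<le> inner G \<Theta>) at_top"
      using eventually_ge_at_top[of 0]
    proof eventually_elim
      case (elim s)
      have "\<bar>inner (TS \<beta> s G) \<Theta>\<bar> \<le> M * exp (w * s) * norm G * norm \<Theta>"
        using Cauchy_Schwarz_ineq2[of "TS \<beta> s G" \<Theta>] mult_right_mono[OF w[OF elim, of G], of "norm \<Theta>"] by simp
      then have "- (M * exp (w * s) * norm G * norm \<Theta>) \<le> inner (TS \<beta> s G) \<Theta>" by linarith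
      then have "exp (- c * s) * - (M * exp (w * s) * norm G * norm \<Theta>) \<le> exp (- c * s) * inner (TS \<beta> s G) \<Theta>"
        by (rule mult_left_mono) simp
      also have "exp (- c * s) * - (M * exp (w * s) * norm G * norm \<Theta>) = - (M * (exp (- c * s) * exp (w * s)) * norm G * norm \<Theta>)"
        by simp
      also have "exp (- c * s) * exp (w * s) = exp (- ((c - w) * s))" by (simp add: exp_add[symmetric] algebra_simps)
      finally show ?case using mono[OF elim] by linarith
    qed
  qed simp_all
  then have "ip (\<lambda>x. complex_of_real (g x)) \<theta> \<ge> 0" by (simp add: G_def \<Theta>_def inner_abs_ip L)
  also have "ip (\<lambda>x. complex_of_real (g x)) \<theta> = - (LINT x|Mpi. (\<theta> x)\<^sup>2)"
  proof -
    have "Re (complex_of_real (g x)) * \<theta> x = - (\<theta> x)\<^sup>2" for x by (simp add: \<theta>_def max_def power2_eq_square)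
    then show ?thesis unfolding ip_def by simp
  qed
  finally have le: "(LINT x|Mpi. (\<theta> x)\<^sup>2) \<le> 0" by simp
  have i: "integrable Mpi (\<lambda>x. (\<theta> x)\<^sup>2)" by (intro integrable_Mpi_continuous continuous_intros c\<theta>)
  have "(LINT x|Mpi. (\<theta> x)\<^sup>2) = 0" using le by (intro antisym Bochner_Integration.integral_nonneg) auto
  then have "AE x in Mpi. (\<theta> x)\<^sup>2 = 0" using integral_nonneg_eq_0_iff_AE[OF i] by simp
  then have "eqae (\<lambda>x. complex_of_real (\<theta> x)) (\<lambda>x. 0)" unfolding eqae_def by simp
  moreover have "continuous_on {0..pi} (\<lambda>x. complex_of_real (\<theta> x))" by (intro continuous_intros c\<theta>)
  ultimately have "\<theta> x = 0" using eqae_0_continuous x by fastforce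
  then show ?thesis by (simp add: \<theta>_def max_def split: if_splits)
qed

text \<open>For \<beta> > 0 the condition u'(0) = \<beta> u(pi) makes mass near pi act as a sink at
  0. The main part k of g is concentrated near pi, and the correction that restores the boundary
  condition pushes the value at 0 below zero.\<close>

theorem not_positive_S:
  assumes \<beta>: "\<beta> > 0" shows "\<not> positive_sg (S \<beta>)"
proof
  assume pos: "positive_sg (S \<beta>)"
  obtain M w where w: "w \<ge> 0" "\<And>t x. t \<ge> 0 \<Longrightarrow> norm (TS \<beta> t x) \<le> M * exp (w * t) * norm x"
    using C0_sg.growth[OF C0_sg_TS[of \<beta>]] by blast
  \<comment> \<open>n \<ge> w gives w < m^2, and n \<ge> (1 + \<beta>) / \<beta> gives m + \<beta> <
    \<beta> m^2 \<le> \<beta> exp (2 n), which makes k(0) = exp (- 2 n) smaller than d.\<close>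
  define n where "n = w + (1 + \<beta>) / \<beta>"
  define m where "m = n + 1"
  have n: "n > 0" "n \<ge> (1 + \<beta>) / \<beta>" using w(1) \<beta> by (auto simp: n_def add_nonneg_pos)
  have m: "m > 0" "m \<ge> 1" using n by (auto simp: m_def)
  have mw: "w < m\<^sup>2"
  proof -
    have "w < m" using \<beta> by (simp add: m_def n_def add_pos_pos)
    also have "m * 1 \<le> m * m" using m by (intro mult_left_mono) auto
    finally show ?thesis by (simp add: power2_eq_square)
  qed
  define sh where "sh = sinh (m * pi)"
  have sh: "sh \<ge> 1"
  proof -
    have "1 * 2 \<le> m * pi" using m pi_ge_two by (intro mult_mono) auto
    then have "3 \<le> exp (m * pi)" using exp_ge_add_one_self[of "m * pi"] by linarith
    moreover have "exp (- (m * pi)) \<le> 1" using m by simp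
    moreover have "sh = (exp (m * pi) - exp (- (m * pi))) / 2" by (simp add: sh_def sinh_field_def)
    moreover have "1 \<le> (a - b) / 2" if "3 \<le> a" "b \<le> 1" for a b :: real using that by simp
    ultimately show ?thesis by (simp only:)
  qed
  \<comment> \<open>Solves the boundary condition at 0 for g: as k'(0) = 0 and k(pi) = 1, one has
    g'(0) = d m and g(pi) = 1 - d / sh.\<close>
  define d where "d = \<beta> / (m + \<beta> / sh)"
  have dpos: "m + \<beta> / sh > 0" using m \<beta> sh by (intro add_pos_nonneg) auto
  have d: "d > 0" "d * m = \<beta> * (1 - d / sh)"
  proof -
    show "d > 0" using \<beta> dpos by (simp add: d_def)
    have "d * (m + \<beta> / sh) = \<beta>" using dpos by (simp add: d_def)
    then show "d * m = \<beta> * (1 - d / sh)" by (simp add: algebra_simps)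
  qed
  \<comment> \<open>Equal to 1 at pi and tiny at 0, with vanishing derivative at both ends and k''
    \<le> m^2 k. The cosh term subtracted in g solves v'' = m^2 v with v'(pi) = 0, so it corrects
    the condition at 0 without affecting the sign of m^2 g - g''.\<close>
  define k where "k x = exp (- n * (1 + cos x))" for x :: real
  have dk: "(k has_real_derivative n * sin x * k x) (at x)" for x
    unfolding k_def by (auto intro!: derivative_eq_intros)
  define g where "g x = k x - d * cosh (m * (pi - x)) / sh" for x
  define g' where "g' x = n * sin x * k x + d * m * sinh (m * (pi - x)) / sh" for x
  define g'' where "g'' x = (n * cos x + (n * sin x)\<^sup>2) * k x - m\<^sup>2 * (d * cosh (m * (pi - x)) / sh)" for x
  have "g 0 \<ge> 0"
  proof (rule resolvent_nonneg[OF pos w(2) mw, where g=g and g'=g' and g''=g'' and x=0])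
    show "(g has_real_derivative g' x) (at x)" for x
      unfolding g_def g'_def using sh by (auto intro!: derivative_eq_intros dk simp: field_simps)
    show "(g' has_real_derivative g'' x) (at x)" for x
      unfolding g'_def g''_def using sh by (auto intro!: derivative_eq_intros dk simp: field_simps power2_eq_square)
    show "continuous_on {0..pi} g''" unfolding g''_def k_def using sh by (intro continuous_intros) auto
    show "g' pi = 0" by (simp add: g'_def)
    show "g' 0 = \<beta> * g pi"
    proof -
      have "g' 0 = d * m * (sh / sh)" by (simp add: g'_def sh_def)
      then show ?thesis using d(2) sh by (simp add: g_def k_def)
    qed
    show "m\<^sup>2 * g x - g'' x \<ge> 0" for x
    proof -
      have "n * cos x \<le> n * 1" using n by (intro mult_left_mono) auto
      moreover have "(n * sin x)\<^sup>2 \<le> n\<^sup>2 * 1"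
        unfolding power_mult_distrib by (intro mult_left_mono) (auto simp: sin_squared_eq)
      moreover have "m\<^sup>2 = n\<^sup>2 + 2 * n + 1" by (simp add: m_def power2_eq_square algebra_simps)
      ultimately have "n * cos x + (n * sin x)\<^sup>2 \<le> m\<^sup>2" using n(1) by linarith
      moreover have "m\<^sup>2 * g x - g'' x = (m\<^sup>2 - (n * cos x + (n * sin x)\<^sup>2)) * k x"
        unfolding g_def g''_def by (simp add: algebra_simps)
      ultimately show ?thesis by (simp add: k_def)
    qed
  qed auto
  moreover have "g 0 < 0"
  proof -
    have "d * 1 \<le> d * (cosh (m * pi) / sh)"
    proof (rule mult_left_mono)
      show "1 \<le> cosh (m * pi) / sh" using sh sinh_le_cosh_real[of "m * pi"] by (simp add: sh_def[symmetric] pos_le_divide_eq)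
    qed (use d(1) in simp)
    moreover have "k 0 < d"
    proof -
      have me: "m \<le> exp n" unfolding m_def using exp_ge_add_one_self[of n] by linarith
      have "\<beta> / sh \<le> \<beta> / 1" using \<beta> sh by (intro divide_left_mono) auto
      then have "m + \<beta> / sh \<le> m + \<beta>" by simp
      also have "\<dots> < \<beta> * m\<^sup>2"
      proof -
        have "(1 + \<beta>) \<le> n * \<beta>" using n(2) \<beta> by (simp add: pos_divide_le_eq)
        then have "1 + \<beta> < \<beta> * m" using \<beta> by (simp add: m_def algebra_simps)
        then have "(1 + \<beta>) * m < \<beta> * m * m" using m by (intro mult_strict_right_mono) auto
        moreover have "\<beta> * 1 \<le> \<beta> * m" using \<beta> m by (intro mult_left_mono) auto
        ultimately show ?thesis by (simp add: power2_eq_square algebra_simps)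
      qed
      also have "\<beta> * m\<^sup>2 \<le> \<beta> * (exp n)\<^sup>2" using \<beta> m me by (intro mult_left_mono power_mono) auto
      also have "(exp n)\<^sup>2 = exp (2 * n)" by (simp add: exp_double)
      finally have "exp (- (2 * n)) * (m + \<beta> / sh) < exp (- (2 * n)) * (\<beta> * exp (2 * n))"
        by (rule mult_strict_left_mono) simp
      also have "\<dots> = \<beta>" by (simp add: exp_minus)
      finally have "exp (- (2 * n)) < d" using dpos by (simp add: d_def pos_less_divide_eq)
      then show ?thesis by (simp add: k_def mult.commute)
    qed
    ultimately show ?thesis by (simp add: g_def)
  qed
  ultimately show False by simp
qed

section \<open>Spectral gap and eventual positivity\<close>

text \<open>Jacobi's completion of the square: \<tau> solves the Riccati equation \<tau>' = 9/16 +
  \<tau>^2, so nonnegativity of the integral of (v' + \<tau> v)^2 is the claim up to boundary values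
  of \<tau> v^2, which vanish. Any constant below the sharp value 1 keeps such a tangent finite on
  [0, pi]; 9/16 is large enough for the balance in \<open>form_coercive\<close>.\<close>

lemma Poincare_Dirichlet:
  fixes v v' :: "real \<Rightarrow> real"
  assumes d: "\<And>x. x \<in> {0..pi} \<Longrightarrow> (v has_real_derivative v' x) (at x within {0..pi})"
    and c: "continuous_on {0..pi} v'" and v0: "v 0 = 0" "v pi = 0"
  shows "(9 / 16) * (LINT x|Mpi. (v x)\<^sup>2) \<le> (LINT x|Mpi. (v' x)\<^sup>2)"
proof -
  define \<tau> where "\<tau> x = 3 / 4 * tan (3 / 4 * (x - pi / 2))" for x :: real
  have cv: "continuous_on {0..pi} v" using d by (meson DERIV_continuous_on)
  have d\<tau>: "(\<tau> has_real_derivative 9 / 16 + (\<tau> x)\<^sup>2) (at x within {0..pi})" if x: "x \<in> {0..pi}" for x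
  proof -
    have nz: "cos (3 / 4 * (x - pi / 2)) \<noteq> 0"
      using x pi_ge_two by (intro less_imp_neq[THEN not_sym] cos_gt_zero_pi) auto
    have "(\<tau> has_real_derivative 3 / 4 * (inverse ((cos (3 / 4 * (x - pi / 2)))\<^sup>2) * (3 / 4))) (at x within {0..pi})"
      unfolding \<tau>_def
      by (rule DERIV_cmult, rule DERIV_chain'[where f="\<lambda>x. 3 / 4 * (x - pi / 2)" and g=tan])
        (use nz in \<open>auto intro!: derivative_eq_intros\<close>)
    moreover have "inverse ((cos (3 / 4 * (x - pi / 2)))\<^sup>2) = 1 + (tan (3 / 4 * (x - pi / 2)))\<^sup>2"
      using tan_sec[OF nz] by (simp add: power_inverse)
    moreover have "3 / 4 * ((1 + (tan (3 / 4 * (x - pi / 2)))\<^sup>2) * (3 / 4)) = 9 / 16 + (\<tau> x)\<^sup>2"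
      by (simp add: \<tau>_def power_mult_distrib power2_eq_square)
    ultimately show ?thesis by (simp only:)
  qed
  have c\<tau>: "continuous_on {0..pi} \<tau>" using d\<tau> by (meson DERIV_continuous_on)
  have "(LINT x|Mpi. (9 / 16 + (\<tau> x)\<^sup>2) * (v x)\<^sup>2 + \<tau> x * (2 * v x * v' x)) = \<tau> pi * (v pi)\<^sup>2 - \<tau> 0 * (v 0)\<^sup>2"
  proof (rule integral_Mpi_FTC_pi)
    show "continuous_on {0..pi} (\<lambda>x. (9 / 16 + (\<tau> x)\<^sup>2) * (v x)\<^sup>2 + \<tau> x * (2 * v x * v' x))"
      by (intro continuous_intros c\<tau> cv c)
    fix x assume x: "x \<in> {0..pi}"
    show "((\<lambda>x. \<tau> x * (v x)\<^sup>2) has_vector_derivative (9 / 16 + (\<tau> x)\<^sup>2) * (v x)\<^sup>2 + \<tau> x * (2 * v x * v' x)) (at x within {0..pi})"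
      unfolding has_real_derivative_iff_has_vector_derivative[symmetric]
      by (auto intro!: derivative_eq_intros d\<tau>[OF x] d[OF x] simp: algebra_simps)
  qed
  then have 0: "(LINT x|Mpi. (9 / 16 + (\<tau> x)\<^sup>2) * (v x)\<^sup>2 + \<tau> x * (2 * v x * v' x)) = 0" by (simp add: v0)
  have "0 \<le> (LINT x|Mpi. (v' x + \<tau> x * v x)\<^sup>2)" by (intro Bochner_Integration.integral_nonneg) simp
  also have "\<dots> = (LINT x|Mpi. (v' x)\<^sup>2 - 9 / 16 * (v x)\<^sup>2 + ((9 / 16 + (\<tau> x)\<^sup>2) * (v x)\<^sup>2 + \<tau> x * (2 * v x * v' x)))"
    by (intro Bochner_Integration.integral_cong) (auto simp: power2_eq_square algebra_simps)
  also have "\<dots> = (LINT x|Mpi. (v' x)\<^sup>2 - 9 / 16 * (v x)\<^sup>2) + (LINT x|Mpi. (9 / 16 + (\<tau> x)\<^sup>2) * (v x)\<^sup>2 + \<tau> x * (2 * v x * v' x))"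
    by (intro Bochner_Integration.integral_add integrable_Mpi_continuous continuous_intros c\<tau> cv c)
  also have "(LINT x|Mpi. (v' x)\<^sup>2 - 9 / 16 * (v x)\<^sup>2) = (LINT x|Mpi. (v' x)\<^sup>2) - (LINT x|Mpi. 9 / 16 * (v x)\<^sup>2)"
    by (intro Bochner_Integration.integral_diff integrable_Mpi_continuous continuous_intros cv c)
  finally show ?thesis using 0 by simp
qed

text \<open>The constraint says that \<open>w\<close> is orthogonal to the adjoint ground state \<open>cos (\<mu> x)\<close>.
  Writing \<open>w = p cos (\<mu> (\<pi> - x)) + q cos (\<mu> x) + v\<close> with \<open>v\<close> vanishing at both ends, the form minus
  \<open>\<mu>\<^sup>2 \<parallel>w\<parallel>\<^sup>2\<close> becomes \<open>- \<beta> sin\<^sup>2 (\<mu> \<pi>) p q + \<parallel>v'\<parallel>\<^sup>2 - \<mu>\<^sup>2 \<parallel>v\<parallel>\<^sup>2\<close>, and the constraint makes \<open>- p q\<close> positive up to \<open>v\<close>.\<close>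

lemma form_coercive:
  fixes w w' :: "real \<Rightarrow> real"
  assumes \<mu>: "0 < \<mu>" "\<mu> < 1 / 2" and \<beta>: "\<beta> = \<mu> * sin (\<mu> * pi)"
    and dw: "\<And>x. x \<in> {0..pi} \<Longrightarrow> (w has_real_derivative w' x) (at x within {0..pi})"
    and cw': "continuous_on {0..pi} w'" and orth: "(LINT x|Mpi. w x * cos (\<mu> * x)) = 0"
  shows "(\<mu>\<^sup>2 + \<beta> * (sin (\<mu> * pi))\<^sup>2 / (36 * pi\<^sup>2)) * (LINT x|Mpi. (w x)\<^sup>2) \<le> (LINT x|Mpi. (w' x)\<^sup>2) + \<beta> * w 0 * w pi"
proof -
  define s where "s = sin (\<mu> * pi)"
  define C where "C = cos (\<mu> * pi)"
  have \<mu>pi: "\<mu> * pi < pi / 2" "\<mu> * pi > 0" using \<mu> by auto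
  have s: "0 < s" "s \<le> 1" "s\<^sup>2 = 1 - C\<^sup>2"
    using \<mu>pi sin_gt_zero[of "\<mu> * pi"] by (auto simp: s_def C_def sin_squared_eq)
  define b where "b = \<beta> * s\<^sup>2"
  have b: "0 < b" "b \<le> 1 / 2"
  proof -
    show "0 < b" unfolding b_def \<beta> s_def[symmetric] using \<mu>(1) s(1) by (intro mult_pos_pos zero_less_power)
    have "\<mu> * s \<le> 1 / 2 * 1" using \<mu> s by (intro mult_mono) auto
    moreover have "s\<^sup>2 \<le> 1" using s by (simp add: power_le_one)
    ultimately have "b \<le> (1 / 2) * 1" unfolding b_def \<beta> s_def[symmetric] by (intro mult_mono) auto
    then show "b \<le> 1 / 2" by simp
  qed
  define \<phi> where "\<phi> x = cos (\<mu> * (pi - x))" for x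
  define \<psi> where "\<psi> x = cos (\<mu> * x)" for x
  \<comment> \<open>p and q solve the two linear equations that match the boundary values of w; the
    determinant is 1 - C^2 = s^2 up to sign.\<close>
  define p where "p = (w pi - C * w 0) / s\<^sup>2"
  define q where "q = (w 0 - C * w pi) / s\<^sup>2"
  define e where "e x = p * \<phi> x + q * \<psi> x" for x
  define e' where "e' x = p * (\<mu> * sin (\<mu> * (pi - x))) - q * (\<mu> * sin (\<mu> * x))" for x
  define v where "v x = w x - e x" for x
  define v' where "v' x = w' x - e' x" for x
  have s2: "s\<^sup>2 \<noteq> 0" using s(1) by simp
  have wb: "w 0 = p * C + q" "w pi = p + q * C"
  proof -
    have ps: "p * s\<^sup>2 = w pi - C * w 0" "q * s\<^sup>2 = w 0 - C * w pi" using s2 by (simp_all add: p_def q_def)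
    have "(p * C + q) * s\<^sup>2 = (p * s\<^sup>2) * C + q * s\<^sup>2" by (simp add: algebra_simps)
    also have "\<dots> = w 0 * (1 - C\<^sup>2)" unfolding ps by (simp add: power2_eq_square algebra_simps)
    finally have 1: "(p * C + q) * s\<^sup>2 = w 0 * s\<^sup>2" by (simp only: s(3))
    have "(p + q * C) * s\<^sup>2 = p * s\<^sup>2 + (q * s\<^sup>2) * C" by (simp add: algebra_simps)
    also have "\<dots> = w pi * (1 - C\<^sup>2)" unfolding ps by (simp add: power2_eq_square algebra_simps)
    finally have 2: "(p + q * C) * s\<^sup>2 = w pi * s\<^sup>2" by (simp only: s(3))
    from 1 2 show "w 0 = p * C + q" "w pi = p + q * C" using s2 by simp_all
  qed
  have c\<phi>: "continuous_on {0..pi} \<phi>" "continuous_on {0..pi} \<psi>" unfolding \<phi>_def \<psi>_def by (intro continuous_intros)+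
  have cw: "continuous_on {0..pi} w" using dw by (meson DERIV_continuous_on)
  have ce: "continuous_on {0..pi} e" "continuous_on {0..pi} e'" unfolding e_def e'_def by (intro continuous_intros c\<phi>)+
  have cv: "continuous_on {0..pi} v" "continuous_on {0..pi} v'" unfolding v_def v'_def by (intro continuous_intros cw cw' ce)+
  note cont = c\<phi> cw cw' ce cv
  note [intro] = integrable_Mpi_continuous
  have de: "(e has_real_derivative e' x) (at x within A)" for x A
    unfolding e_def e'_def \<phi>_def \<psi>_def by (auto intro!: derivative_eq_intros)
  have de': "(e' has_real_derivative - \<mu>\<^sup>2 * e x) (at x within A)" for x A
    unfolding e_def e'_def \<phi>_def \<psi>_def by (auto intro!: derivative_eq_intros simp: power2_eq_square algebra_simps)
  have dv: "(v has_real_derivative v' x) (at x within {0..pi})" if "x \<in> {0..pi}" for x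
    unfolding v_def v'_def by (intro DERIV_diff dw de that)
  have v0: "v 0 = 0" "v pi = 0" using wb by (simp_all add: v_def e_def \<phi>_def \<psi>_def C_def)
  define N where "N = (LINT x|Mpi. (v x)\<^sup>2)"
  define m where "m = (LINT x|Mpi. \<phi> x * \<psi> x)"
  define n where "n = (LINT x|Mpi. (\<psi> x)\<^sup>2)"
  define \<omega> where "\<omega> = (LINT x|Mpi. v x * \<psi> x)"
  have N0: "N \<ge> 0" unfolding N_def by (intro Bochner_Integration.integral_nonneg) simp
  have main: "(LINT x|Mpi. (w' x)\<^sup>2) - \<mu>\<^sup>2 * (LINT x|Mpi. (w x)\<^sup>2) + \<beta> * w 0 * w pi
      = (LINT x|Mpi. (v' x)\<^sup>2) - \<mu>\<^sup>2 * N - b * (p * q)"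
  proof -
    \<comment> \<open>The integrand is the difference of w'^2 - \<mu>^2 w^2 and v'^2 - \<mu>^2 v^2
      and also, by e'' = - \<mu>^2 e, the derivative of 2 w e' - e e'. The two forms thus differ by
      boundary terms only.\<close>
    have "(LINT x|Mpi. 2 * (w' x * e' x + w x * (- \<mu>\<^sup>2 * e x)) - (e' x * e' x + e x * (- \<mu>\<^sup>2 * e x)))
        = (2 * (w pi * e' pi) - e pi * e' pi) - (2 * (w 0 * e' 0) - e 0 * e' 0)"
    proof (rule integral_Mpi_FTC_pi)
      show "continuous_on {0..pi} (\<lambda>x. 2 * (w' x * e' x + w x * (- \<mu>\<^sup>2 * e x)) - (e' x * e' x + e x * (- \<mu>\<^sup>2 * e x)))"
        by (intro continuous_intros cont)
      fix x assume x: "x \<in> {0..pi}"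
      show "((\<lambda>x. 2 * (w x * e' x) - e x * e' x) has_vector_derivative
         2 * (w' x * e' x + w x * (- \<mu>\<^sup>2 * e x)) - (e' x * e' x + e x * (- \<mu>\<^sup>2 * e x))) (at x within {0..pi})"
        unfolding has_real_derivative_iff_has_vector_derivative[symmetric]
        by (rule DERIV_cong[OF DERIV_diff[OF DERIV_cmult[OF DERIV_mult[OF dw[OF x] de']] DERIV_mult[OF de de']]]) simp
    qed
    also have "(2 * (w pi * e' pi) - e pi * e' pi) - (2 * (w 0 * e' 0) - e 0 * e' 0) = w pi * e' pi - w 0 * e' 0"
      using v0 by (simp add: v_def)
    also have "\<dots> = - \<beta> * (q * w pi + p * w 0)"
      by (simp add: e'_def \<beta> algebra_simps)
    finally have 1: "(LINT x|Mpi. 2 * (w' x * e' x + w x * (- \<mu>\<^sup>2 * e x)) - (e' x * e' x + e x * (- \<mu>\<^sup>2 * e x))) = - \<beta> * (q * w pi + p * w 0)" .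
    have "(LINT x|Mpi. 2 * (w' x * e' x + w x * (- \<mu>\<^sup>2 * e x)) - (e' x * e' x + e x * (- \<mu>\<^sup>2 * e x)))
        = (LINT x|Mpi. ((w' x)\<^sup>2 - \<mu>\<^sup>2 * (w x)\<^sup>2) - ((v' x)\<^sup>2 - \<mu>\<^sup>2 * (v x)\<^sup>2))"
      by (intro Bochner_Integration.integral_cong) (auto simp: v_def v'_def power2_eq_square algebra_simps)
    also have "\<dots> = (LINT x|Mpi. (w' x)\<^sup>2 - \<mu>\<^sup>2 * (w x)\<^sup>2) - (LINT x|Mpi. (v' x)\<^sup>2 - \<mu>\<^sup>2 * (v x)\<^sup>2)"
      by (intro Bochner_Integration.integral_diff integrable_Mpi_continuous continuous_intros cont)
    also have "(LINT x|Mpi. (w' x)\<^sup>2 - \<mu>\<^sup>2 * (w x)\<^sup>2) = (LINT x|Mpi. (w' x)\<^sup>2) - (LINT x|Mpi. \<mu>\<^sup>2 * (w x)\<^sup>2)"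
      by (intro Bochner_Integration.integral_diff integrable_Mpi_continuous continuous_intros cont)
    also have "(LINT x|Mpi. (v' x)\<^sup>2 - \<mu>\<^sup>2 * (v x)\<^sup>2) = (LINT x|Mpi. (v' x)\<^sup>2) - (LINT x|Mpi. \<mu>\<^sup>2 * (v x)\<^sup>2)"
      by (intro Bochner_Integration.integral_diff integrable_Mpi_continuous continuous_intros cont)
    finally have 2: "(LINT x|Mpi. (w' x)\<^sup>2) - \<mu>\<^sup>2 * (LINT x|Mpi. (w x)\<^sup>2) - ((LINT x|Mpi. (v' x)\<^sup>2) - \<mu>\<^sup>2 * N) = - \<beta> * (q * w pi + p * w 0)"
      using 1 by (simp add: N_def)
    have "\<beta> * w 0 * w pi - \<beta> * (q * w pi + p * w 0) = - (b * (p * q))"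
      unfolding b_def s(3) wb by (simp add: power2_eq_square algebra_simps)
    with 2 show ?thesis by linarith
  qed
  have P: "(9 / 16) * N \<le> (LINT x|Mpi. (v' x)\<^sup>2)" unfolding N_def by (rule Poincare_Dirichlet[OF dv cv(2) v0])
  have con: "p * m + q * n + \<omega> = 0"
  proof -
    have "0 = (LINT x|Mpi. p * (\<phi> x * \<psi> x) + q * (\<psi> x)\<^sup>2 + v x * \<psi> x)"
      unfolding orth[symmetric] by (intro Bochner_Integration.integral_cong) (auto simp: v_def e_def \<psi>_def power2_eq_square algebra_simps)
    also have "\<dots> = (LINT x|Mpi. p * (\<phi> x * \<psi> x) + q * (\<psi> x)\<^sup>2) + \<omega>"
      unfolding \<omega>_def by (intro Bochner_Integration.integral_add integrable_Mpi_continuous continuous_intros cont)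
    also have "(LINT x|Mpi. p * (\<phi> x * \<psi> x) + q * (\<psi> x)\<^sup>2) = (LINT x|Mpi. p * (\<phi> x * \<psi> x)) + (LINT x|Mpi. q * (\<psi> x)\<^sup>2)"
      by (intro Bochner_Integration.integral_add integrable_Mpi_continuous continuous_intros cont)
    finally show ?thesis by (simp add: m_def n_def)
  qed
  have n\<phi>: "(LINT x|Mpi. (\<phi> x)\<^sup>2) = n"
    using integral_Mpi_reflect[of "\<lambda>x. (\<psi> x)\<^sup>2"] by (simp add: n_def \<phi>_def \<psi>_def)
  \<comment> \<open>Both cosines decrease in \<mu>, so for \<mu> < 1/2 their product is at least its
    value at \<mu> = 1/2, which is sin x / 2 with integral 1.\<close>
  have m1: "1 \<le> m"
  proof -
    have "(LINT x|Mpi. sin x / 2) = - cos pi / 2 - (- cos 0 / 2)"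
      by (rule integral_Mpi_FTC_pi) (auto intro!: continuous_intros derivative_eq_intros
          simp: has_real_derivative_iff_has_vector_derivative[symmetric])
    then have "1 = (LINT x|Mpi. sin x / 2)" by simp
    also have "\<dots> \<le> m" unfolding m_def
    proof (intro integral_mono integrable_Mpi_continuous continuous_intros cont)
      fix x assume "x \<in> space Mpi"
      then have x: "0 < x" "x < pi" by auto
      have le: "\<mu> * y \<le> 1 / 2 * y" if "0 \<le> y" for y using \<mu> that by (intro mult_right_mono) auto
      have "cos (1 / 2 * x) \<le> cos (\<mu> * x)" "cos (1 / 2 * (pi - x)) \<le> cos (\<mu> * (pi - x))"
        using x \<mu> le[of x] le[of "pi - x"] by (intro cos_monotone_0_pi_le; simp)+
      moreover have "0 \<le> cos (1 / 2 * x)" "0 \<le> cos (1 / 2 * (pi - x))" using x by (intro cos_ge_zero; simp)+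
      ultimately have "cos (1 / 2 * (pi - x)) * cos (1 / 2 * x) \<le> \<phi> x * \<psi> x"
        unfolding \<phi>_def \<psi>_def by (intro mult_mono) auto
      moreover have "cos (1 / 2 * (pi - x)) = sin (x / 2)" by (simp add: diff_divide_distrib cos_diff)
      moreover have "sin x = 2 * sin (x / 2) * cos (x / 2)" using sin_double[of "x / 2"] by simp
      ultimately show "sin x / 2 \<le> \<phi> x * \<psi> x" by simp
    qed auto
    finally show ?thesis .
  qed
  have mn: "m \<le> n"
  proof -
    have "2 * m = (LINT x|Mpi. 2 * (\<phi> x * \<psi> x))" by (simp add: m_def)
    also have "\<dots> \<le> (LINT x|Mpi. (\<phi> x)\<^sup>2 + (\<psi> x)\<^sup>2)"
    proof (intro integral_mono integrable_Mpi_continuous continuous_intros cont)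
      show "2 * (\<phi> x * \<psi> x) \<le> (\<phi> x)\<^sup>2 + (\<psi> x)\<^sup>2" for x
        using sum_squares_bound[of "\<phi> x" "\<psi> x"] by (simp add: mult.assoc)
    qed
    also have "\<dots> = (LINT x|Mpi. (\<phi> x)\<^sup>2) + n"
      unfolding n_def by (intro Bochner_Integration.integral_add integrable_Mpi_continuous continuous_intros cont)
    finally show ?thesis by (simp add: n\<phi>)
  qed
  have npi: "n \<le> pi"
  proof -
    have "n \<le> (LINT x|Mpi. 1)" unfolding n_def
      by (intro integral_mono integrable_Mpi_continuous continuous_intros cont) (auto simp: \<psi>_def abs_square_le_1)
    then show ?thesis by simp
  qed
  have n0: "n > 0" using m1 mn by simp
  have \<omega>N: "\<omega>\<^sup>2 \<le> n * N"
  proof -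
    have "0 \<le> (LINT x|Mpi. (n * v x - \<omega> * \<psi> x)\<^sup>2)" by (intro Bochner_Integration.integral_nonneg) simp
    also have "\<dots> = (LINT x|Mpi. n\<^sup>2 * (v x)\<^sup>2 - 2 * n * \<omega> * (v x * \<psi> x) + \<omega>\<^sup>2 * (\<psi> x)\<^sup>2)"
      by (intro Bochner_Integration.integral_cong) (auto simp: power2_eq_square algebra_simps)
    also have "\<dots> = (LINT x|Mpi. n\<^sup>2 * (v x)\<^sup>2 - 2 * n * \<omega> * (v x * \<psi> x)) + (LINT x|Mpi. \<omega>\<^sup>2 * (\<psi> x)\<^sup>2)"
      by (intro Bochner_Integration.integral_add integrable_Mpi_continuous continuous_intros cont)
    also have "(LINT x|Mpi. n\<^sup>2 * (v x)\<^sup>2 - 2 * n * \<omega> * (v x * \<psi> x)) = (LINT x|Mpi. n\<^sup>2 * (v x)\<^sup>2) - (LINT x|Mpi. 2 * n * \<omega> * (v x * \<psi> x))"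
      by (intro Bochner_Integration.integral_diff integrable_Mpi_continuous continuous_intros cont)
    finally have "0 \<le> n\<^sup>2 * N - 2 * n * \<omega> * \<omega> + \<omega>\<^sup>2 * n" by (simp add: N_def \<omega>_def n_def)
    also have "\<dots> = n * (n * N - \<omega>\<^sup>2)" by (simp add: power2_eq_square algebra_simps)
    finally show ?thesis using n0 by (simp add: zero_le_mult_iff)
  qed
  \<comment> \<open>The constraint eliminates q through n q^2 \<le> 2 n p^2 + 2 N, so the factor 3
    from squaring a sum of three terms becomes 9.\<close>
  have w2: "(LINT x|Mpi. (w x)\<^sup>2) \<le> 9 * (n * p\<^sup>2 + N)"
  proof -
    have "(LINT x|Mpi. (w x)\<^sup>2) \<le> (LINT x|Mpi. 3 * p\<^sup>2 * (\<phi> x)\<^sup>2 + 3 * q\<^sup>2 * (\<psi> x)\<^sup>2 + 3 * (v x)\<^sup>2)"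
    proof (intro integral_mono integrable_Mpi_continuous continuous_intros cont)
      fix x
      have "0 \<le> (p * \<phi> x - q * \<psi> x)\<^sup>2 + (p * \<phi> x - v x)\<^sup>2 + (q * \<psi> x - v x)\<^sup>2" by simp
      then show "(w x)\<^sup>2 \<le> 3 * p\<^sup>2 * (\<phi> x)\<^sup>2 + 3 * q\<^sup>2 * (\<psi> x)\<^sup>2 + 3 * (v x)\<^sup>2"
        unfolding v_def e_def by (simp add: power2_eq_square algebra_simps)
    qed
    also have "\<dots> = (LINT x|Mpi. 3 * p\<^sup>2 * (\<phi> x)\<^sup>2 + 3 * q\<^sup>2 * (\<psi> x)\<^sup>2) + (LINT x|Mpi. 3 * (v x)\<^sup>2)"
      by (intro Bochner_Integration.integral_add integrable_Mpi_continuous continuous_intros cont)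
    also have "(LINT x|Mpi. 3 * p\<^sup>2 * (\<phi> x)\<^sup>2 + 3 * q\<^sup>2 * (\<psi> x)\<^sup>2) = (LINT x|Mpi. 3 * p\<^sup>2 * (\<phi> x)\<^sup>2) + (LINT x|Mpi. 3 * q\<^sup>2 * (\<psi> x)\<^sup>2)"
      by (intro Bochner_Integration.integral_add integrable_Mpi_continuous continuous_intros cont)
    finally have "(LINT x|Mpi. (w x)\<^sup>2) \<le> 3 * (n * p\<^sup>2) + 3 * (n * q\<^sup>2) + 3 * N"
      by (simp add: n\<phi> n_def[symmetric] N_def[symmetric] mult_ac)
    moreover have "n * q\<^sup>2 \<le> 2 * (n * p\<^sup>2) + 2 * N"
    proof -
      have "n * q = - (p * m + \<omega>)" using con by (simp add: algebra_simps)
      then have "(n * q)\<^sup>2 = (p * m + \<omega>)\<^sup>2" by (simp only: power2_minus)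
      also have "\<dots> \<le> 2 * (p * m)\<^sup>2 + 2 * \<omega>\<^sup>2" using sum_squares_bound[of "p * m" \<omega>] by (simp add: power2_sum)
      also have "(p * m)\<^sup>2 \<le> p\<^sup>2 * n\<^sup>2" unfolding power_mult_distrib using m1 mn by (intro mult_left_mono power_mono) auto
      finally have "n * (n * q\<^sup>2) \<le> n * (2 * (n * p\<^sup>2) + 2 * N)" using \<omega>N by (simp add: power2_eq_square algebra_simps)
      then show ?thesis using n0 by simp
    qed
    ultimately show ?thesis by simp
  qed
  \<comment> \<open>Multiplying the constraint by p gives n (- p q) = p^2 m + p \<omega>. Young's
    inequality with weights 3/4 and 1/3 keeps p^2 / 4 of the first term and costs at most n N /
    3.\<close>
  have pq: "- (p * q) \<ge> p\<^sup>2 / (4 * n) - N / 3"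
  proof -
    have "n * (- (p * q)) = p\<^sup>2 * m + p * \<omega>"
    proof -
      have "p * (p * m + q * n + \<omega>) = 0" using con by simp
      then show ?thesis by (simp add: power2_eq_square algebra_simps)
    qed
    moreover have "p\<^sup>2 * 1 \<le> p\<^sup>2 * m" using m1 by (intro mult_left_mono) auto
    moreover have "p * \<omega> \<ge> - (3 / 4 * p\<^sup>2) - \<omega>\<^sup>2 / 3"
      using zero_le_power2[of "3 / 2 * p + \<omega>"] by (simp add: power2_eq_square algebra_simps)
    ultimately have "n * (- (p * q)) \<ge> p\<^sup>2 / 4 - n * N / 3" using \<omega>N by linarith
    then have "n * (- (p * q)) \<ge> n * (p\<^sup>2 / (4 * n) - N / 3)" using n0 by (simp add: right_diff_distrib)
    then show ?thesis using n0 by (simp only: mult_le_cancel_left_pos)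
  qed
  have bpq: "- (b * (p * q)) \<ge> b * (p\<^sup>2 / (4 * n)) - b * (N / 3)"
    using mult_left_mono[OF pq, of b] b by (simp add: right_diff_distrib)
  have "b * (N / 3) \<le> 1 / 2 * (N / 3)" using b N0 by (intro mult_right_mono) auto
  moreover have "\<mu>\<^sup>2 * N \<le> 1 / 4 * N"
    using \<mu> N0 power_mono[of \<mu> "1 / 2" 2] by (intro mult_right_mono) (auto simp: power2_eq_square)
  \<comment> \<open>The coefficient of N is what remains of 9/16 after subtracting \<mu>^2 \<le> 1/4
    and b / 3 \<le> 1/6: 9/16 - 1/4 - 1/6 = 7/48.\<close>
  ultimately have lower: "b * (p\<^sup>2 / (4 * n)) + 7 / 48 * N \<le> (LINT x|Mpi. (v' x)\<^sup>2) - \<mu>\<^sup>2 * N - b * (p * q)"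
    using P bpq by linarith
  \<comment> \<open>36 pi^2 is the 9 from the bound on w times 4 pi^2, and 4 pi^2 dominates 4 n^2
    because n \<le> pi.\<close>
  have "b / (36 * pi\<^sup>2) * (LINT x|Mpi. (w x)\<^sup>2) \<le> b / (36 * pi\<^sup>2) * (9 * (n * p\<^sup>2 + N))"
    using b w2 by (intro mult_left_mono) auto
  also have "\<dots> = b / (4 * pi\<^sup>2) * (n * p\<^sup>2) + b / (4 * pi\<^sup>2) * N" by (simp add: field_simps)
  also have "\<dots> \<le> b * (p\<^sup>2 / (4 * n)) + 7 / 48 * N"
  proof (rule add_mono)
    have "n * n \<le> pi * pi" using npi n0 by (intro mult_mono) auto
    then have "b * p\<^sup>2 * (n * n) \<le> b * p\<^sup>2 * (pi * pi)" using b by (intro mult_left_mono) auto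
    then show "b / (4 * pi\<^sup>2) * (n * p\<^sup>2) \<le> b * (p\<^sup>2 / (4 * n))"
      using n0 by (simp add: field_simps power2_eq_square)
    have "2 * 2 \<le> pi * pi" using pi_ge_two by (intro mult_mono) auto
    then have "b / (4 * pi\<^sup>2) \<le> (1 / 2) / (4 * 4)" using b by (intro frac_le mult_mono) (auto simp: power2_eq_square)
    then have "b / (4 * pi\<^sup>2) \<le> 7 / 48" by (rule order_trans) simp
    then show "b / (4 * pi\<^sup>2) * N \<le> 7 / 48 * N" by (rule mult_right_mono) (rule N0)
  qed
  finally have "b / (36 * pi\<^sup>2) * (LINT x|Mpi. (w x)\<^sup>2) \<le> (LINT x|Mpi. (w' x)\<^sup>2) - \<mu>\<^sup>2 * (LINT x|Mpi. (w x)\<^sup>2) + \<beta> * w 0 * w pi"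
    using lower unfolding main by linarith
  then show ?thesis by (simp add: b_def s_def distrib_right)
qed

text \<open>Smoothing from L2 to the supremum norm in one unit of time; it turns the L2 decay of
  \<open>S_energy_decay\<close> into uniform decay up to the endpoints.\<close>

lemma S_sup_bound:
  "\<exists>C\<ge>0. \<forall>f x. L2 f \<longrightarrow> x \<in> {0..pi} \<longrightarrow> cmod (S \<beta> 1 f x) \<le> C * norm_L2 f"
proof -
  let ?c = "gr \<beta>"
  have c: "?c \<ge> 0" by (rule gr_nonneg)
  obtain C where C: "C \<ge> 0" "\<And>z y. \<bar>heat 1 (z - y)\<bar> \<le> C * exp (?c * \<bar>z\<bar>) * exp (- ?c * \<bar>y\<bar>)"
    using fast_bound[OF heat_fast c, of 1] by auto
  define K where "K = sqrt (4 * C * exp (?c * pi))"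
  have "cmod (S \<beta> 1 f x) \<le> K * norm_L2 f" if f: "L2 f" and x: "x \<in> {0..pi}" for f x
  proof -
    let ?H = "ext \<beta> f" and ?z = "x - pi"
    have w: "integrable lborel (\<lambda>y. exp (- ?c * \<bar>y\<bar>) * (cmod (?H y))\<^sup>2)" by (rule ext_weighted_L2[OF f])
    have le: "heat 1 (?z - y) * (cmod (?H y))\<^sup>2 \<le> C * exp (?c * \<bar>?z\<bar>) * (exp (- ?c * \<bar>y\<bar>) * (cmod (?H y))\<^sup>2)" for y
      using mult_right_mono[OF order_trans[OF abs_ge_self C(2)], of "(cmod (?H y))\<^sup>2" ?z y] by (simp add: mult.assoc)
    have i: "integrable lborel (\<lambda>y. heat 1 (?z - y) * (cmod (?H y))\<^sup>2)" by (rule heat_ext_integrable[OF f]) simp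
    have "(cmod (S \<beta> 1 f x))\<^sup>2 \<le> (LINT y|lborel. heat 1 (?z - y) * (cmod (?H y))\<^sup>2)"
      using conv_heat_Jensen[OF _ ext_egrow[OF f] i] by (simp add: S_def)
    also have "\<dots> \<le> (LINT y|lborel. C * exp (?c * \<bar>?z\<bar>) * (exp (- ?c * \<bar>y\<bar>) * (cmod (?H y))\<^sup>2))"
      by (intro integral_mono i Bochner_Integration.integrable_mult_right w le)
    also have "\<dots> = C * exp (?c * \<bar>?z\<bar>) * (LINT y|lborel. exp (- ?c * \<bar>y\<bar>) * (cmod (?H y))\<^sup>2)" by simp
    also have "\<dots> \<le> C * exp (?c * pi) * (4 * (norm_L2 f)\<^sup>2)"
      using x c C(1) ext_weighted_L2(2)[OF f, of \<beta>]
      by (intro mult_mono) (auto intro!: mult_left_mono Bochner_Integration.integral_nonneg)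
    also have "\<dots> = (K * norm_L2 f)\<^sup>2" using C(1) by (simp add: K_def power_mult_distrib)
    finally show ?thesis by (rule power2_le_imp_le) (simp add: K_def C(1))
  qed
  moreover have "K \<ge> 0" by (simp add: K_def C(1))
  ultimately show ?thesis by blast
qed

lemma norm_sq_real:
  assumes "L2 f" "\<And>x. Im (f x) = 0" shows "(norm (abs_l2 f))\<^sup>2 = (LINT x|Mpi. (Re (f x))\<^sup>2)"
  using assms by (simp add: norm_abs_l2 norm_L2_def cmod_power2)

text \<open>The weight cos (\<mu> x) satisfies the adjoint boundary conditions, so the orbit stays
  orthogonal to it and \<open>form_coercive\<close> applies at every positive time. Then exp (2
  \<kappa> t) times the squared norm is nonincreasing.\<close>

lemma S_energy_decay:
  assumes \<mu>: "0 < \<mu>" "\<mu> < 1 / 2" and \<beta>: "\<beta> = \<mu> * sin (\<mu> * pi)"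
    and \<kappa>: "\<kappa> = \<mu>\<^sup>2 + \<beta> * (sin (\<mu> * pi))\<^sup>2 / (36 * pi\<^sup>2)"
    and f: "L2 f" "\<And>x. Im (f x) = 0" and orth: "ip f (\<lambda>x. cos (\<mu> * x)) = 0" and t: "t \<ge> 0"
  shows "norm_L2 (S \<beta> t f) \<le> exp (- \<kappa> * t) * norm_L2 f"
proof -
  interpret TS: C0_sg "TS \<beta>" by (rule C0_sg_TS)
  let ?\<psi> = "\<lambda>x. cos (\<mu> * x)" and ?F = "abs_l2 f"
  have L\<psi>: "L2 (\<lambda>x. complex_of_real (?\<psi> x))" by (intro L2_real_continuous continuous_intros)
  have orth_t: "ip (S \<beta> r f) ?\<psi> = 0" if r: "r > 0" for r
  proof -
    have "exp (\<mu>\<^sup>2 * r) * ip (S \<beta> r f) ?\<psi> = exp (\<mu>\<^sup>2 * 0) * ip (S \<beta> 0 f) ?\<psi>"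
    proof (rule vector_derivative_zero_imp_const[where f="\<lambda>r. exp (\<mu>\<^sup>2 * r) * ip (S \<beta> r f) ?\<psi>"])
      show "continuous_on {0..r} (\<lambda>r. exp (\<mu>\<^sup>2 * r) * ip (S \<beta> r f) ?\<psi>)"
        by (intro continuous_intros continuous_on_subset[OF S_ip_continuous[OF f(1) L\<psi>]]) auto
      fix x :: real assume x: "0 < x"
      have "ip (D2 \<beta> x f) ?\<psi> = ip (S \<beta> x f) (\<lambda>y. - \<mu>\<^sup>2 * ?\<psi> y + 0 * ?\<psi> y) + Re (S \<beta> x f 0) * (- \<mu> * sin (\<mu> * 0)) - Re (S \<beta> x f pi) * (\<beta> * cos (\<mu> * 0) + - \<mu> * sin (\<mu> * pi))"
        by (rule D2_Green[OF f(1) x]) (auto intro!: derivative_eq_intros continuous_intros simp: power2_eq_square)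
      also have "ip (S \<beta> x f) (\<lambda>y. - \<mu>\<^sup>2 * ?\<psi> y + 0 * ?\<psi> y) = - \<mu>\<^sup>2 * ip (S \<beta> x f) ?\<psi> + 0 * ip (S \<beta> x f) ?\<psi>"
        using x by (intro ip_lincomb S_L2 f L\<psi>) simp
      finally have "((\<lambda>r. ip (S \<beta> r f) ?\<psi>) has_real_derivative - \<mu>\<^sup>2 * ip (S \<beta> x f) ?\<psi>) (at x)"
        using S_deriv_ip[OF f(1) L\<psi> x, of \<beta>] \<beta> by simp
      then show "((\<lambda>r. exp (\<mu>\<^sup>2 * r) * ip (S \<beta> r f) ?\<psi>) has_vector_derivative 0) (at x)"
        unfolding has_real_derivative_iff_has_vector_derivative[symmetric]
        by (auto intro!: derivative_eq_intros)
    qed (use r in simp)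
    then show ?thesis using orth by (simp add: S_def[abs_def])
  qed
  let ?E = "\<lambda>r. exp (2 * \<kappa> * r) * (norm (TS \<beta> r ?F))\<^sup>2"
  have "?E t \<le> ?E 0" using t
  proof (rule DERIV_nonpos_imp_decreasing_open)
    show "continuous_on {0..t} ?E"
      by (intro continuous_intros continuous_on_subset[OF TS.continuous_orbit]) auto
    fix r :: real assume r: "0 < r"
    let ?u = "\<lambda>x. Re (S \<beta> r f x)" and ?u1 = "\<lambda>x. Re (D1 \<beta> r f x)" and ?u2 = "\<lambda>x. Re (D2 \<beta> r f x)"
    note D = S_derivs[OF f(1) r, where \<beta>=\<beta>]
    have u1: "(?u has_real_derivative ?u1 x) (at x within {0..pi})" for x
      unfolding has_real_derivative_iff_has_vector_derivative
      using bounded_linear.has_vector_derivative[OF bounded_linear_Re D(1)] .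
    have u2: "(?u1 has_real_derivative ?u2 x) (at x within {0..pi})" for x
      unfolding has_real_derivative_iff_has_vector_derivative
      using bounded_linear.has_vector_derivative[OF bounded_linear_Re D(2)] .
    have c: "continuous_on {0..pi} ?u" "continuous_on {0..pi} ?u1" "continuous_on {0..pi} ?u2"
      using D(3,4) S_continuous[OF f(1) r] by (auto intro!: continuous_intros)
    have Ls: "L2 (S \<beta> r f)" "L2 (D2 \<beta> r f)" using r by (auto intro: S_L2 D2_L2 f)
    have "inner (TS \<beta> r ?F) (abs_l2 (D2 \<beta> r f)) = (LINT x|Mpi. ?u x * ?u2 x)"
      using integral_Re[OF L2_integrable_cnj[OF Ls]] S_real[of f \<beta> r] f r
      by (simp add: TS_abs inner_abs_l2 Ls inner_L2_def)
    also have "\<dots> = (LINT x|Mpi. (?u1 x * ?u1 x + ?u x * ?u2 x) - ?u1 x * ?u1 x)" by simp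
    also have "\<dots> = (LINT x|Mpi. ?u1 x * ?u1 x + ?u x * ?u2 x) - (LINT x|Mpi. ?u1 x * ?u1 x)"
      by (intro Bochner_Integration.integral_diff integrable_Mpi_continuous continuous_intros c)
    also have "(LINT x|Mpi. ?u1 x * ?u1 x + ?u x * ?u2 x) = ?u pi * ?u1 pi - ?u 0 * ?u1 0"
    proof (rule integral_Mpi_FTC_pi)
      show "((\<lambda>x. ?u x * ?u1 x) has_vector_derivative ?u1 x * ?u1 x + ?u x * ?u2 x) (at x within {0..pi})" for x
        using DERIV_mult[OF u1 u2, of x] by (simp add: has_real_derivative_iff_has_vector_derivative algebra_simps)
    qed (intro continuous_intros c)
    finally have I: "inner (TS \<beta> r ?F) (abs_l2 (D2 \<beta> r f)) = - ((LINT x|Mpi. (?u1 x)\<^sup>2) + \<beta> * ?u 0 * ?u pi)"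
      using D(5,6) by (simp add: power2_eq_square)
    have "\<kappa> * (LINT x|Mpi. (?u x)\<^sup>2) \<le> (LINT x|Mpi. (?u1 x)\<^sup>2) + \<beta> * ?u 0 * ?u pi"
      unfolding \<kappa> using orth_t[OF r] by (intro form_coercive[OF \<mu> \<beta> u1 c(2)]) (simp add: ip_def)
    moreover have "(LINT x|Mpi. (?u x)\<^sup>2) = (norm (TS \<beta> r ?F))\<^sup>2"
      using norm_sq_real[OF Ls(1)] S_real[of f \<beta> r] f r by (simp add: TS_abs)
    ultimately have le: "\<kappa> * (norm (TS \<beta> r ?F))\<^sup>2 + inner (TS \<beta> r ?F) (abs_l2 (D2 \<beta> r f)) \<le> 0" using I by simp
    have "((\<lambda>r. inner (TS \<beta> r ?F) (TS \<beta> r ?F)) has_vector_derivative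
        inner (TS \<beta> r ?F) (abs_l2 (D2 \<beta> r f)) + inner (abs_l2 (D2 \<beta> r f)) (TS \<beta> r ?F)) (at r)"
      by (rule bounded_bilinear.has_vector_derivative[OF bounded_bilinear_inner S_has_derivative[OF f(1) r] S_has_derivative[OF f(1) r]])
    then have "((\<lambda>r. (norm (TS \<beta> r ?F))\<^sup>2) has_real_derivative 2 * inner (TS \<beta> r ?F) (abs_l2 (D2 \<beta> r f))) (at r)"
      by (simp add: has_real_derivative_iff_has_vector_derivative power2_norm_eq_inner inner_commute)
    then have "(?E has_real_derivative 2 * exp (2 * \<kappa> * r) * (\<kappa> * (norm (TS \<beta> r ?F))\<^sup>2 + inner (TS \<beta> r ?F) (abs_l2 (D2 \<beta> r f)))) (at r)"
      by (rule DERIV_cong[OF DERIV_mult[OF DERIV_fun_exp[OF DERIV_cmult_Id]]]) (simp add: algebra_simps)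
    then show "\<exists>y. (?E has_real_derivative y) (at r) \<and> y \<le> 0"
      by (intro exI conjI) (assumption, rule mult_nonneg_nonpos[OF _ le], simp)
  qed
  then have "(exp (\<kappa> * t) * norm (TS \<beta> t ?F))\<^sup>2 \<le> (norm ?F)\<^sup>2"
    by (simp add: TS.zero power_mult_distrib exp_double[symmetric] mult.assoc)
  then have "exp (\<kappa> * t) * norm (TS \<beta> t ?F) \<le> norm ?F" by (rule power2_le_imp_le) simp
  then have "exp (- \<kappa> * t) * (exp (\<kappa> * t) * norm (TS \<beta> t ?F)) \<le> exp (- \<kappa> * t) * norm ?F" by (rule mult_left_mono) simp
  then have "norm (TS \<beta> t ?F) \<le> exp (- \<kappa> * t) * norm ?F" by (simp add: mult.assoc[symmetric] exp_add[symmetric])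
  then show ?thesis using t f by (simp add: TS_abs norm_abs_l2 S_L2)
qed

text \<open>f is split into p times the eigenfunction cos (\<mu> (pi - x)) and a remainder h
  orthogonal to cos (\<mu> x); p is positive because f is nonnegative and nonzero while cos (\<mu>
  x) is positive. The leading term decays like exp (- \<mu>^2 t), the remainder faster by a factor
  exp (- \<delta> t).\<close>

lemma ind_ev_S_real:
  assumes \<mu>: "0 < \<mu>" "\<mu> < 1 / 2" and \<beta>: "\<beta> = \<mu> * sin (\<mu> * pi)"
    and f: "L2 f" "\<And>x. Im (f x) = 0" "\<And>x. Re (f x) \<ge> 0" "\<not> eqae f (\<lambda>x. 0)"
  shows "\<exists>t0>0. \<forall>t\<ge>t0. \<exists>c>0. \<forall>x\<in>{0..pi}. Re (S \<beta> t f x) \<ge> c"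
proof -
  define \<delta> where "\<delta> = \<beta> * (sin (\<mu> * pi))\<^sup>2 / (36 * pi\<^sup>2)"
  define \<kappa> where "\<kappa> = \<mu>\<^sup>2 + \<beta> * (sin (\<mu> * pi))\<^sup>2 / (36 * pi\<^sup>2)"
  have \<mu>pi: "0 < \<mu> * pi" "\<mu> * pi < pi / 2" using \<mu> by auto
  have sin0: "sin (\<mu> * pi) > 0" using \<mu>pi by (intro sin_gt_zero) auto
  have \<beta>0: "\<beta> > 0" unfolding \<beta> using \<mu>(1) sin0 by simp
  have \<delta>: "\<delta> > 0" unfolding \<delta>_def using \<beta>0 sin0 by simp
  let ?\<psi> = "\<lambda>x. cos (\<mu> * x)" and ?\<phi> = "\<lambda>x. cos (\<mu> * (pi - x))"
  have \<psi>0: "?\<psi> x > 0" "?\<phi> x \<ge> cos (\<mu> * pi)" if "x \<in> {0..pi}" for x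
  proof -
    have "\<mu> * x \<le> \<mu> * pi" "\<mu> * (pi - x) \<le> \<mu> * pi" "0 \<le> \<mu> * x" "0 \<le> \<mu> * (pi - x)"
      using \<mu> that by (auto intro!: mult_left_mono)
    then have "- (pi / 2) < \<mu> * x" "\<mu> * x < pi / 2" "\<mu> * pi \<le> pi" using \<mu>pi by linarith+
    then show "?\<psi> x > 0" "?\<phi> x \<ge> cos (\<mu> * pi)"
      using \<open>\<mu> * (pi - x) \<le> \<mu> * pi\<close> \<open>0 \<le> \<mu> * (pi - x)\<close> by (auto intro: cos_gt_zero_pi cos_monotone_0_pi_le)
  qed
  have c0: "cos (\<mu> * pi) > 0" using \<psi>0[of pi] by simp
  have L: "L2 (\<lambda>x. complex_of_real (?\<psi> x))" "L2 (\<lambda>x. complex_of_real (?\<phi> x))"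
    by (intro L2_real_continuous continuous_intros)+
  define m where "m = ip (\<lambda>x. complex_of_real (?\<phi> x)) ?\<psi>"
  have m: "m > 0" unfolding m_def ip_def
  proof (rule integral_Mpi_pos)
    fix x assume "x \<in> space Mpi"
    then have "x \<in> {0..pi}" by auto
    then show "Re (complex_of_real (?\<phi> x)) * ?\<psi> x > 0" using \<psi>0[of x] c0 by simp
  qed (rule ip_integrable[OF L(2,1)])
  have ipf: "ip f ?\<psi> > 0"
  proof -
    have i: "integrable Mpi (\<lambda>x. Re (f x) * ?\<psi> x)" by (rule ip_integrable[OF f(1) L(1)])
    have nn: "AE x in Mpi. Re (f x) * ?\<psi> x \<ge> 0"
      using f(3) \<psi>0(1) by (intro AE_I2 mult_nonneg_nonneg) (auto simp: less_imp_le)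
    have "ip f ?\<psi> \<noteq> 0"
    proof
      assume "ip f ?\<psi> = 0"
      then have "AE x in Mpi. Re (f x) * ?\<psi> x = 0"
        unfolding ip_def using integral_nonneg_eq_0_iff_AE[OF i nn] by simp
      moreover have "AE x in Mpi. ?\<psi> x > 0" using \<psi>0(1) by (intro AE_I2) auto
      ultimately have "AE x in Mpi. f x = 0"
        by eventually_elim (auto simp: complex_eq_iff f(2))
      then show False using f(4) by (simp add: eqae_def)
    qed
    moreover have "ip f ?\<psi> \<ge> 0" unfolding ip_def by (rule integral_nonneg_AE[OF nn])
    ultimately show ?thesis by simp
  qed
  define p where "p = ip f ?\<psi> / m"
  have p: "p > 0" using ipf m by (simp add: p_def)
  define h where "h = (\<lambda>x. f x + complex_of_real (- p) * complex_of_real (?\<phi> x))"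
  have h: "L2 h" "\<And>x. Im (h x) = 0" unfolding h_def by (rule L2_add[OF f(1) L2_mult_const[OF L(2)]]) (simp add: f(2))
  have orth: "ip h ?\<psi> = 0"
  proof -
    have "ip h ?\<psi> = (LINT x|Mpi. Re (f x) * ?\<psi> x - p * (Re (complex_of_real (?\<phi> x)) * ?\<psi> x))"
      unfolding ip_def h_def by (intro Bochner_Integration.integral_cong) (auto simp: algebra_simps)
    also have "\<dots> = ip f ?\<psi> - p * m"
      using ip_integrable[OF f(1) L(1)] ip_integrable[OF L(2,1)] by (simp add: ip_def m_def)
    finally show ?thesis using m by (simp add: p_def)
  qed
  have S_eq: "Re (S \<beta> t f x) = Re (S \<beta> t h x) + p * (exp (- \<mu>\<^sup>2 * t) * ?\<phi> x)" if t: "t > 0" and x: "x \<in> {0..pi}" for t x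
  proof -
    have "S \<beta> t (\<lambda>x. complex_of_real (?\<phi> x)) x = complex_of_real (exp (- \<mu>\<^sup>2 * t) * ?\<phi> x)"
    proof (rule S_eigenfunction[OF _ _ _ _ t x])
      show "(?\<phi> has_real_derivative \<mu> * sin (\<mu> * (pi - x))) (at x)" for x
        by (auto intro!: derivative_eq_intros)
      show "((\<lambda>x. \<mu> * sin (\<mu> * (pi - x))) has_real_derivative - \<mu>\<^sup>2 * ?\<phi> x) (at x)" for x
        by (auto intro!: derivative_eq_intros simp: power2_eq_square)
    qed (simp_all add: \<beta>)
    moreover have "S \<beta> t h x = S \<beta> t f x + complex_of_real (- p) * S \<beta> t (\<lambda>x. complex_of_real (?\<phi> x)) x"
      unfolding h_def using t by (intro S_lincomb f L) simp
    ultimately show ?thesis by simp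
  qed
  obtain C where C: "C \<ge> 0" "\<And>g x. L2 g \<Longrightarrow> x \<in> {0..pi} \<Longrightarrow> cmod (S \<beta> 1 g x) \<le> C * norm_L2 g"
    using S_sup_bound[of \<beta>] by blast
  define K where "K = C * (exp \<kappa> * norm_L2 h)"
  have h_le: "cmod (S \<beta> t h x) \<le> K * exp (- \<kappa> * t)" if t: "t \<ge> 1" and x: "x \<in> {0..pi}" for t x
  proof -
    have "S \<beta> t h x = S \<beta> 1 (S \<beta> (t - 1) h) x" using S_add[OF h(1), of 1 "t - 1" \<beta> x] t by simp
    then have "cmod (S \<beta> t h x) \<le> C * norm_L2 (S \<beta> (t - 1) h)" using C(2)[OF S_L2[OF h(1)] x, of "t - 1"] t by simp
    also have "\<dots> \<le> C * (exp (- \<kappa> * (t - 1)) * norm_L2 h)"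
      using t by (intro mult_left_mono C(1) S_energy_decay[OF \<mu> \<beta> \<kappa>_def h orth]) simp
    also have "exp (- \<kappa> * (t - 1)) = exp \<kappa> * exp (- \<kappa> * t)" by (simp add: exp_add[symmetric] algebra_simps)
    finally show ?thesis by (simp add: K_def mult_ac)
  qed
  have K: "K \<ge> 0" unfolding K_def using C(1) by simp
  \<comment> \<open>Half of the lower bound for the leading term, whose minimum over x is attained
    at 0; the other half is left for the remainder.\<close>
  define a where "a = p * cos (\<mu> * pi) / 2"
  have a: "a > 0" using p c0 by (simp add: a_def)
  \<comment> \<open>From here on K \<le> a \<delta> t \<le> a exp (\<delta> t), and the 1 makes
    \<open>h_le\<close> applicable. K and a depend on f, so the waiting time obtained is an
    individual one.\<close>
  define t0 where "t0 = 1 + K / (a * \<delta>)"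
  have t0: "t0 \<ge> 1" using K a \<delta> by (simp add: t0_def)
  have "Re (S \<beta> t f x) \<ge> a * exp (- \<mu>\<^sup>2 * t)" if t: "t \<ge> t0" and x: "x \<in> {0..pi}" for t x
  proof -
    have "K / (a * \<delta>) \<le> t" using t by (simp add: t0_def)
    then have "K \<le> t * (a * \<delta>)" using a \<delta> by (simp add: pos_divide_le_eq)
    also have "\<dots> = a * (\<delta> * t)" by simp
    also have "\<delta> * t \<le> exp (\<delta> * t)" using exp_ge_add_one_self[of "\<delta> * t"] by linarith
    finally have "K \<le> a * exp (\<delta> * t)" using a by simp
    then have "K * exp (- \<kappa> * t) \<le> (a * exp (\<delta> * t)) * exp (- \<kappa> * t)" by (rule mult_right_mono) simp
    also have "\<dots> = a * exp (- \<mu>\<^sup>2 * t)" by (simp add: exp_add[symmetric] \<kappa>_def \<delta>_def algebra_simps)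
    finally have "cmod (S \<beta> t h x) \<le> a * exp (- \<mu>\<^sup>2 * t)" using h_le[of t x] t t0 x by simp
    then have 1: "- (a * exp (- \<mu>\<^sup>2 * t)) \<le> Re (S \<beta> t h x)" using abs_Re_le_cmod[of "S \<beta> t h x"] by linarith
    have "p * (exp (- \<mu>\<^sup>2 * t) * cos (\<mu> * pi)) \<le> p * (exp (- \<mu>\<^sup>2 * t) * ?\<phi> x)"
      using p \<psi>0(2)[OF x] by (intro mult_left_mono) auto
    then have 2: "2 * (a * exp (- \<mu>\<^sup>2 * t)) \<le> p * (exp (- \<mu>\<^sup>2 * t) * ?\<phi> x)" by (simp add: a_def mult_ac)
    from 1 2 show ?thesis using S_eq[of t x] t t0 x by linarith
  qed
  then have "\<forall>t\<ge>t0. \<exists>c>0. \<forall>x\<in>{0..pi}. Re (S \<beta> t f x) \<ge> c"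
    using a by (meson exp_gt_zero mult_pos_pos)
  then show ?thesis using t0 by (intro exI[of _ t0]) auto
qed

theorem ind_ev_S:
  assumes \<beta>: "0 < \<beta>" "\<beta> < 1 / 2" shows "ind_ev_strongly_pos (S \<beta>)"
  unfolding ind_ev_strongly_pos_def
proof (intro allI impI, elim conjE)
  fix f assume f: "L2 f" "nonneg_fn f" "\<not> eqae f (\<lambda>x. 0)"
  \<comment> \<open>\<mu> sin (\<mu> pi) takes the values 0 and 1/2 at the ends of [0, 1/2]; the
    strict bounds on \<beta> then keep \<mu> in the interior.\<close>
  have "\<exists>\<mu>\<ge>0. \<mu> \<le> 1 / 2 \<and> \<mu> * sin (\<mu> * pi) = \<beta>"
    using \<beta> by (intro IVT') (auto intro!: continuous_intros)
  then obtain \<mu> where \<mu>: "0 \<le> \<mu>" "\<mu> \<le> 1 / 2" "\<beta> = \<mu> * sin (\<mu> * pi)" by blast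
  have "\<mu> \<noteq> 1 / 2"
  proof
    assume "\<mu> = 1 / 2"
    with \<mu>(3) have "\<beta> = 1 / 2 * sin (1 / 2 * pi)" by (simp only:)
    then show False using \<beta> by simp
  qed
  moreover have "\<mu> \<noteq> 0" using \<mu>(3) \<beta> by auto
  ultimately have \<mu>': "0 < \<mu>" "\<mu> < 1 / 2" using \<mu> by auto
  obtain g where g: "L2 g" "eqae f g" "\<And>x. Im (g x) = 0" "\<And>x. Re (g x) \<ge> 0"
    using nonneg_representative[OF f(1,2)] by blast
  have "\<not> eqae g (\<lambda>x. 0)" using f(3) g(2) eqae_trans by blast
  then obtain t0 where t0: "t0 > 0" "\<And>t. t \<ge> t0 \<Longrightarrow> \<exists>c>0. \<forall>x\<in>{0..pi}. Re (S \<beta> t g x) \<ge> c"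
    using ind_ev_S_real[OF \<mu>' \<mu>(3) g(1,3,4)] by blast
  have "\<exists>c>0. AE x in Mpi. Im (S \<beta> t f x) = 0 \<and> Re (S \<beta> t f x) \<ge> c" if t: "t \<ge> t0" for t
  proof -
    from t0(2)[OF t] obtain c where c: "c > 0" "\<And>x. x \<in> {0..pi} \<Longrightarrow> Re (S \<beta> t g x) \<ge> c" by blast
    have "AE x in Mpi. S \<beta> t f x = S \<beta> t g x"
      using sg_cong[OF C0_semigroup_S _ f(1) g(1,2), of t \<beta>] t t0(1) by (simp add: eqae_def)
    moreover have "AE x in Mpi. Im (S \<beta> t g x) = 0 \<and> Re (S \<beta> t g x) \<ge> c"
      using c(2) S_real[OF g(3)] by (intro AE_I2) auto
    ultimately have "AE x in Mpi. Im (S \<beta> t f x) = 0 \<and> Re (S \<beta> t f x) \<ge> c" by eventually_elim simp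
    then show ?thesis using c(1) by blast
  qed
  then show "\<exists>t0>0. \<forall>t\<ge>t0. \<exists>c>0. AE x in Mpi. Im (S \<beta> t f x) = 0 \<and> Re (S \<beta> t f x) \<ge> c"
    using t0(1) by blast
qed

theorem theorem6p10:
  fixes \<beta> :: real
  shows "(ind_ev_strongly_pos (expA \<beta>) \<and> \<not> positive_sg (expA \<beta>)) \<longleftrightarrow> \<beta> \<in> {0<..<1/2}"
proof -
  consider "\<beta> \<le> 0" | "0 < \<beta>" "\<beta> < 1 / 2" | "\<beta> = 1 / 2" | "\<beta> > 1 / 2" by linarith
  then show ?thesis
    unfolding positive_expA_iff ind_ev_expA_iff
  proof cases
    case 3
    show "(ind_ev_strongly_pos (S \<beta>) \<and> \<not> positive_sg (S \<beta>)) \<longleftrightarrow> \<beta> \<in> {0<..<1 / 2}"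
      unfolding 3 using not_ind_ev_half by simp
  qed (auto simp: positive_S not_positive_S ind_ev_S not_ind_ev_large)
qed

end
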